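(* Let $(R,m)$ be a local Gorenstein ring with infinite residue field and let $I$ be an unmixed $R$-ideal of positive codimension. Let $X,Y$ be two variables over $R$. Then $I$ is licci if and only if the ideals $(I,X)$ and $(I,Y)$ are in the same linkage class in $R[X,Y]_{(m,X,Y)}$.
   Context: All rings are commutative and Noetherian. A proper ideal is unmixed if all its associated primes have the same height. A complete intersection is a proper ideal generated by a regular sequence. Two proper ideals $I,J$ of a local Gorenstein ring are directly linked if there is a complete intersection $(\underline{\alpha})\subseteq I\cap J$ with $I=(\underline{\alpha}):J$ and $J=(\underline{\alpha}):I$. The equivalence relation on unmixed ideals generated by direct linkage is called linkage (CI-liaison); its classes are linkage classes. An ideal is licci if it lies in the linkage class of a complete intersection. *)

theory Defs
  imports "HOL-Algebra.Ring_Divisibility" "HOL-Algebra.UnivPoly" "HOL-Library.Extended_Nat"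
begin

section \<open>Local Gorenstein rings\<close>

definition local_ring :: "('a, 'b) ring_scheme \<Rightarrow> 'a set \<Rightarrow> bool" where
  "local_ring R m \<longleftrightarrow> cring R \<and> noetherian_ring R \<and> {M. maximalideal M R} = {m}"

definition prime_height :: "('a, 'b) ring_scheme \<Rightarrow> 'a set \<Rightarrow> enat" where
  "prime_height R P = Sup {enat n | n. \<exists>C :: nat \<Rightarrow> 'a set.
     (\<forall>i\<le>n. primeideal (C i) R) \<and> (\<forall>i<n. C i \<subset> C (Suc i)) \<and> C n = P}"

definition ideal_height :: "('a, 'b) ring_scheme \<Rightarrow> 'a set \<Rightarrow> enat" where
  "ideal_height R I = Inf {prime_height R P | P. primeideal P R \<and> I \<subseteq> P}"

definition krull_dim :: "('a, 'b) ring_scheme \<Rightarrow> enat" where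
  "krull_dim R = Sup {prime_height R P | P. primeideal P R}"

text \<open>The empty sequence is regular in a nonzero ring; it generates the zero ideal.\<close>

definition regular_sequence :: "('a, 'b) ring_scheme \<Rightarrow> 'a list \<Rightarrow> bool" where
  "regular_sequence R xs \<longleftrightarrow>
     set xs \<subseteq> carrier R \<and> genideal R (set xs) \<noteq> carrier R \<and>
     (\<forall>i<length xs. \<forall>r\<in>carrier R.
        r \<otimes>\<^bsub>R\<^esub> xs ! i \<in> genideal R (set (take i xs)) \<longrightarrow> r \<in> genideal R (set (take i xs)))"

definition depth :: "('a, 'b) ring_scheme \<Rightarrow> 'a set \<Rightarrow> enat" where
  "depth R m = Sup {enat (length xs) | xs. regular_sequence R xs \<and> set xs \<subseteq> m}"

definition cohen_macaulay_local :: "('a, 'b) ring_scheme \<Rightarrow> 'a set \<Rightarrow> bool" where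
  "cohen_macaulay_local R m \<longleftrightarrow> local_ring R m \<and> depth R m = krull_dim R"

definition parameter_ideal :: "('a, 'b) ring_scheme \<Rightarrow> 'a set \<Rightarrow> 'a set \<Rightarrow> bool" where
  "parameter_ideal R m Q \<longleftrightarrow>
     (\<exists>xs. set xs \<subseteq> m \<and> enat (length xs) = krull_dim R \<and> Q = genideal R (set xs) \<and>
           (\<forall>P. primeideal P R \<and> Q \<subseteq> P \<longrightarrow> P = m))"

definition irreducible_ideal :: "('a, 'b) ring_scheme \<Rightarrow> 'a set \<Rightarrow> bool" where
  "irreducible_ideal R Q \<longleftrightarrow> ideal Q R \<and> Q \<noteq> carrier R \<and>
     (\<forall>J K. ideal J R \<and> ideal K R \<and> Q = J \<inter> K \<longrightarrow> Q = J \<or> Q = K)"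

text \<open>Of the standard equivalent definitions (Matsumura, \<^emph>\<open>Commutative Ring Theory\<close>, Theorem 18.1)
  this is the ideal-theoretic one of Groebner and Northcott--Rees: a Cohen--Macaulay local ring all
  of whose parameter ideals are irreducible. Finite injective dimension would require quantifying
  over modules on arbitrary carrier types.\<close>

definition gorenstein_local :: "('a, 'b) ring_scheme \<Rightarrow> 'a set \<Rightarrow> bool" where
  "gorenstein_local R m \<longleftrightarrow>
     cohen_macaulay_local R m \<and> (\<forall>Q. parameter_ideal R m Q \<longrightarrow> irreducible_ideal R Q)"

section \<open>Linkage\<close>

definition colon_ideal :: "('a, 'b) ring_scheme \<Rightarrow> 'a set \<Rightarrow> 'a set \<Rightarrow> 'a set" where
  "colon_ideal R A J = {r \<in> carrier R. \<forall>j\<in>J. r \<otimes>\<^bsub>R\<^esub> j \<in> A}"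

text \<open>The associated primes of \<open>I\<close> are those of the module \<open>R/I\<close>, i.e. the primes that are
  annihilators of the class of some \<open>a\<close>.\<close>

definition associated_primes :: "('a, 'b) ring_scheme \<Rightarrow> 'a set \<Rightarrow> 'a set set" where
  "associated_primes R I = {P. primeideal P R \<and> (\<exists>a\<in>carrier R. P = colon_ideal R I {a})}"

definition unmixed_ideal :: "('a, 'b) ring_scheme \<Rightarrow> 'a set \<Rightarrow> bool" where
  "unmixed_ideal R I \<longleftrightarrow> ideal I R \<and> I \<noteq> carrier R \<and>
     (\<forall>P\<in>associated_primes R I. \<forall>Q\<in>associated_primes R I. prime_height R P = prime_height R Q)"

definition complete_intersection :: "('a, 'b) ring_scheme \<Rightarrow> 'a set \<Rightarrow> bool" where
  "complete_intersection R A \<longleftrightarrow> (\<exists>xs. regular_sequence R xs \<and> A = genideal R (set xs))"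

definition directly_linked :: "('a, 'b) ring_scheme \<Rightarrow> 'a set \<Rightarrow> 'a set \<Rightarrow> bool" where
  "directly_linked R I J \<longleftrightarrow>
     ideal I R \<and> I \<noteq> carrier R \<and> ideal J R \<and> J \<noteq> carrier R \<and>
     (\<exists>A. complete_intersection R A \<and> A \<subseteq> I \<inter> J \<and> I = colon_ideal R A J \<and> J = colon_ideal R A I)"

definition linkage :: "('a, 'b) ring_scheme \<Rightarrow> ('a set \<times> 'a set) set" where
  "linkage R = {(I, J). unmixed_ideal R I \<and> unmixed_ideal R J \<and>
     equivclp (\<lambda>I J. unmixed_ideal R I \<and> unmixed_ideal R J \<and> directly_linked R I J) I J}"

lemma equiv_linkage: "equiv {I. unmixed_ideal R I} (linkage R)"
  by (auto simp: linkage_def intro!: equivI refl_onI symI transI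
      intro: equivclp_sym equivclp_trans)

definition linkage_classes :: "('a, 'b) ring_scheme \<Rightarrow> 'a set set set" where
  "linkage_classes R = {I. unmixed_ideal R I} // linkage R"

definition same_linkage_class :: "('a, 'b) ring_scheme \<Rightarrow> 'a set \<Rightarrow> 'a set \<Rightarrow> bool" where
  "same_linkage_class R I J \<longleftrightarrow> (\<exists>L\<in>linkage_classes R. I \<in> L \<and> J \<in> L)"

definition licci :: "('a, 'b) ring_scheme \<Rightarrow> 'a set \<Rightarrow> bool" where
  "licci R I \<longleftrightarrow> (\<exists>A. complete_intersection R A \<and> same_linkage_class R I A)"

section \<open>Localization\<close>

definition fraction_rel :: "('a, 'b) ring_scheme \<Rightarrow> 'a set \<Rightarrow> (('a \<times> 'a) \<times> ('a \<times> 'a)) set" where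
  "fraction_rel A W = {((a, s), (b, t)). a \<in> carrier A \<and> s \<in> W \<and> b \<in> carrier A \<and> t \<in> W \<and>
     (\<exists>u\<in>W. u \<otimes>\<^bsub>A\<^esub> (t \<otimes>\<^bsub>A\<^esub> a) = u \<otimes>\<^bsub>A\<^esub> (s \<otimes>\<^bsub>A\<^esub> b))}"

text \<open>The fraction \<open>a/s\<close>.\<close>

definition fraction :: "('a, 'b) ring_scheme \<Rightarrow> 'a set \<Rightarrow> 'a \<Rightarrow> 'a \<Rightarrow> ('a \<times> 'a) set" where
  "fraction A W a s = fraction_rel A W `` {(a, s)}"

definition localization :: "('a, 'b) ring_scheme \<Rightarrow> 'a set \<Rightarrow> ('a \<times> 'a) set ring" where
  "localization A W =
     \<lparr>carrier = (carrier A \<times> W) // fraction_rel A W,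
      Group.monoid.mult = (\<lambda>x y. \<Union>(a, s)\<in>x. \<Union>(b, t)\<in>y. fraction A W (a \<otimes>\<^bsub>A\<^esub> b) (s \<otimes>\<^bsub>A\<^esub> t)),
      one = fraction A W \<one>\<^bsub>A\<^esub> \<one>\<^bsub>A\<^esub>,
      zero = fraction A W \<zero>\<^bsub>A\<^esub> \<one>\<^bsub>A\<^esub>,
      add = (\<lambda>x y. \<Union>(a, s)\<in>x. \<Union>(b, t)\<in>y.
               fraction A W ((t \<otimes>\<^bsub>A\<^esub> a) \<oplus>\<^bsub>A\<^esub> (s \<otimes>\<^bsub>A\<^esub> b)) (s \<otimes>\<^bsub>A\<^esub> t))\<rparr>"

locale mult_subset = cring A for A (structure) +
  fixes W
  assumes W_carrier: "W \<subseteq> carrier A"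
    and W_one: "\<one> \<in> W"
    and W_mult: "\<lbrakk>s \<in> W; t \<in> W\<rbrakk> \<Longrightarrow> s \<otimes> t \<in> W"
begin

lemma W_closed [simp, intro]: "s \<in> W \<Longrightarrow> s \<in> carrier A"
  using W_carrier by blast

lemma equiv_fraction_rel: "equiv (carrier A \<times> W) (fraction_rel A W)"
proof (rule equivI)
  show "fraction_rel A W \<subseteq> (carrier A \<times> W) \<times> (carrier A \<times> W)"
    by (auto simp: fraction_rel_def)
  show "refl_on (carrier A \<times> W) (fraction_rel A W)"
    using W_one by (auto simp: fraction_rel_def refl_on_def)
  show "sym (fraction_rel A W)"
    by (rule symI) (auto simp: fraction_rel_def, metis)
  show "trans (fraction_rel A W)"
  proof (rule transI, clarify)
    fix a s b t c r
    assume 1: "((a, s), (b, t)) \<in> fraction_rel A W" and 2: "((b, t), (c, r)) \<in> fraction_rel A W"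
    from 1 obtain u where u: "u \<in> W" "u \<otimes> (t \<otimes> a) = u \<otimes> (s \<otimes> b)"
      and mem: "a \<in> carrier A" "s \<in> W" "b \<in> carrier A" "t \<in> W"
      by (auto simp: fraction_rel_def)
    from 2 obtain v where v: "v \<in> W" "v \<otimes> (r \<otimes> b) = v \<otimes> (t \<otimes> c)"
      and mem': "c \<in> carrier A" "r \<in> W"
      by (auto simp: fraction_rel_def)
    have "(u \<otimes> v \<otimes> t) \<otimes> (r \<otimes> a) = v \<otimes> r \<otimes> (u \<otimes> (t \<otimes> a))"
      using u(1) v(1) mem mem' by (simp add: m_ac)
    also have "\<dots> = u \<otimes> s \<otimes> (v \<otimes> (r \<otimes> b))"
      unfolding u(2) using u(1) v(1) mem mem' by (simp add: m_ac)
    also have "\<dots> = (u \<otimes> v \<otimes> t) \<otimes> (s \<otimes> c)"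
      unfolding v(2) using u(1) v(1) mem mem' by (simp add: m_ac)
    finally show "((a, s), (c, r)) \<in> fraction_rel A W"
      using u(1) v(1) mem mem' W_mult unfolding fraction_rel_def by blast
  qed
qed

lemma fraction_eq_iff:
  assumes "a \<in> carrier A" "s \<in> W" "b \<in> carrier A" "t \<in> W"
  shows "fraction A W a s = fraction A W b t \<longleftrightarrow> (\<exists>u\<in>W. u \<otimes> (t \<otimes> a) = u \<otimes> (s \<otimes> b))"
  unfolding fraction_def
  using assms eq_equiv_class_iff[OF equiv_fraction_rel, of "(a, s)" "(b, t)"]
  by (auto simp: fraction_rel_def)

lemma mem_fractionD:
  assumes "p \<in> fraction A W a s"
  obtains b t u where "p = (b, t)" "b \<in> carrier A" "t \<in> W" "u \<in> W"
    "u \<otimes> (t \<otimes> a) = u \<otimes> (s \<otimes> b)"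
  using assms by (auto simp: fraction_def fraction_rel_def)

lemma fraction_self: "\<lbrakk>a \<in> carrier A; s \<in> W\<rbrakk> \<Longrightarrow> (a, s) \<in> fraction A W a s"
  unfolding fraction_def by (rule equiv_class_self[OF equiv_fraction_rel]) simp

lemma carrier_localization:
  "carrier (localization A W) = {fraction A W a s | a s. a \<in> carrier A \<and> s \<in> W}"
  by (auto simp: localization_def fraction_def quotient_def)

lemma localization_mult:
  assumes "a \<in> carrier A" "s \<in> W" "b \<in> carrier A" "t \<in> W"
  shows "fraction A W a s \<otimes>\<^bsub>localization A W\<^esub> fraction A W b t = fraction A W (a \<otimes> b) (s \<otimes> t)"
proof -
  have "fraction A W (fst p \<otimes> fst q) (snd p \<otimes> snd q) = fraction A W (a \<otimes> b) (s \<otimes> t)"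
    if p: "p \<in> fraction A W a s" and q: "q \<in> fraction A W b t" for p q
  proof -
    obtain a' s' u where p': "p = (a', s')" "a' \<in> carrier A" "s' \<in> W" "u \<in> W"
      "u \<otimes> (s' \<otimes> a) = u \<otimes> (s \<otimes> a')" using p by (rule mem_fractionD)
    obtain b' t' v where q': "q = (b', t')" "b' \<in> carrier A" "t' \<in> W" "v \<in> W"
      "v \<otimes> (t' \<otimes> b) = v \<otimes> (t \<otimes> b')" using q by (rule mem_fractionD)
    have "(u \<otimes> v) \<otimes> ((s \<otimes> t) \<otimes> (a' \<otimes> b')) = (u \<otimes> (s \<otimes> a')) \<otimes> (v \<otimes> (t \<otimes> b'))"
      using assms p'(2-4) q'(2-4) by (simp add: m_ac)
    also have "\<dots> = (u \<otimes> v) \<otimes> ((s' \<otimes> t') \<otimes> (a \<otimes> b))"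
      unfolding p'(5)[symmetric] q'(5)[symmetric]
      using assms p'(2-4) q'(2-4) by (simp add: m_ac)
    finally show ?thesis
      using assms p'(2-4) q'(2-4) W_mult[OF p'(4) q'(4)] unfolding p'(1) q'(1)
      by (auto simp: fraction_eq_iff W_mult)
  qed
  moreover have "(a, s) \<in> fraction A W a s" "(b, t) \<in> fraction A W b t"
    using assms by (auto intro: fraction_self)
  ultimately show ?thesis
    by (simp add: localization_def case_prod_unfold) blast
qed

lemma localization_add:
  assumes "a \<in> carrier A" "s \<in> W" "b \<in> carrier A" "t \<in> W"
  shows "fraction A W a s \<oplus>\<^bsub>localization A W\<^esub> fraction A W b t = fraction A W (t \<otimes> a \<oplus> s \<otimes> b) (s \<otimes> t)"
proof -
  have "fraction A W (snd q \<otimes> fst p \<oplus> snd p \<otimes> fst q) (snd p \<otimes> snd q)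
      = fraction A W (t \<otimes> a \<oplus> s \<otimes> b) (s \<otimes> t)"
    if p: "p \<in> fraction A W a s" and q: "q \<in> fraction A W b t" for p q
  proof -
    obtain a' s' u where p': "p = (a', s')" "a' \<in> carrier A" "s' \<in> W" "u \<in> W"
      "u \<otimes> (s' \<otimes> a) = u \<otimes> (s \<otimes> a')" using p by (rule mem_fractionD)
    obtain b' t' v where q': "q = (b', t')" "b' \<in> carrier A" "t' \<in> W" "v \<in> W"
      "v \<otimes> (t' \<otimes> b) = v \<otimes> (t \<otimes> b')" using q by (rule mem_fractionD)
    have "(u \<otimes> v) \<otimes> ((s \<otimes> t) \<otimes> (t' \<otimes> a' \<oplus> s' \<otimes> b'))
        = (v \<otimes> t \<otimes> t') \<otimes> (u \<otimes> (s \<otimes> a')) \<oplus> (u \<otimes> s \<otimes> s') \<otimes> (v \<otimes> (t \<otimes> b'))"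
      using assms p'(2-4) q'(2-4) by (simp add: m_ac r_distr)
    also have "\<dots> = (u \<otimes> v) \<otimes> ((s' \<otimes> t') \<otimes> (t \<otimes> a \<oplus> s \<otimes> b))"
      unfolding p'(5)[symmetric] q'(5)[symmetric]
      using assms p'(2-4) q'(2-4) by (simp add: m_ac r_distr)
    finally show ?thesis
      using assms p'(2-4) q'(2-4) W_mult[OF p'(4) q'(4)] unfolding p'(1) q'(1)
      by (auto simp: fraction_eq_iff W_mult)
  qed
  moreover have "(a, s) \<in> fraction A W a s" "(b, t) \<in> fraction A W b t"
    using assms by (auto intro: fraction_self)
  ultimately show ?thesis
    by (simp add: localization_def case_prod_unfold) blast
qed

lemma cring_localization: "cring (localization A W)"
proof -
  let ?L = "localization A W"
  have one: "\<one>\<^bsub>?L\<^esub> = fraction A W \<one> \<one>" and zero: "\<zero>\<^bsub>?L\<^esub> = fraction A W \<zero> \<one>"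
    by (simp_all add: localization_def)
  have eqI: "fraction A W a s = fraction A W b t"
    if "a \<in> carrier A" "s \<in> W" "b \<in> carrier A" "t \<in> W" "t \<otimes> a = s \<otimes> b" for a s b t
    using that W_one fraction_eq_iff by auto
  note simps = localization_mult localization_add one zero W_one W_mult
  show ?thesis
  proof (intro cringI abelian_groupI comm_monoidI)
    fix x y z
    assume x: "x \<in> carrier ?L" and y: "y \<in> carrier ?L" and z: "z \<in> carrier ?L"
    from x obtain a s where x': "x = fraction A W a s" "a \<in> carrier A" "s \<in> W"
      by (auto simp: carrier_localization)
    from y obtain b t where y': "y = fraction A W b t" "b \<in> carrier A" "t \<in> W"
      by (auto simp: carrier_localization)
    from z obtain c r where z': "z = fraction A W c r" "c \<in> carrier A" "r \<in> W"
      by (auto simp: carrier_localization)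
    show "x \<oplus>\<^bsub>?L\<^esub> y \<oplus>\<^bsub>?L\<^esub> z = x \<oplus>\<^bsub>?L\<^esub> (y \<oplus>\<^bsub>?L\<^esub> z)"
      using x' y' z' by (simp add: simps) (rule eqI; simp add: simps r_distr m_ac a_ac)
    show "x \<otimes>\<^bsub>?L\<^esub> y \<otimes>\<^bsub>?L\<^esub> z = x \<otimes>\<^bsub>?L\<^esub> (y \<otimes>\<^bsub>?L\<^esub> z)"
      using x' y' z' by (simp add: simps m_assoc)
    show "(x \<oplus>\<^bsub>?L\<^esub> y) \<otimes>\<^bsub>?L\<^esub> z = x \<otimes>\<^bsub>?L\<^esub> z \<oplus>\<^bsub>?L\<^esub> y \<otimes>\<^bsub>?L\<^esub> z"
      using x' y' z' by (simp add: simps) (rule eqI; simp add: simps r_distr l_distr m_ac)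
  next
    fix x y
    assume x: "x \<in> carrier ?L" and y: "y \<in> carrier ?L"
    from x obtain a s where x': "x = fraction A W a s" "a \<in> carrier A" "s \<in> W"
      by (auto simp: carrier_localization)
    from y obtain b t where y': "y = fraction A W b t" "b \<in> carrier A" "t \<in> W"
      by (auto simp: carrier_localization)
    show "x \<oplus>\<^bsub>?L\<^esub> y \<in> carrier ?L"
      unfolding x'(1) y'(1) localization_add[OF x'(2,3) y'(2,3)] carrier_localization
      using x' y' W_mult by blast
    show "x \<otimes>\<^bsub>?L\<^esub> y \<in> carrier ?L"
      unfolding x'(1) y'(1) localization_mult[OF x'(2,3) y'(2,3)] carrier_localization
      using x' y' W_mult by blast
    show "x \<oplus>\<^bsub>?L\<^esub> y = y \<oplus>\<^bsub>?L\<^esub> x"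
      using x' y' by (simp add: simps m_comm a_comm)
    show "x \<otimes>\<^bsub>?L\<^esub> y = y \<otimes>\<^bsub>?L\<^esub> x"
      using x' y' by (simp add: simps m_comm)
  next
    fix x
    assume x: "x \<in> carrier ?L"
    then obtain a s where x': "x = fraction A W a s" "a \<in> carrier A" "s \<in> W"
      by (auto simp: carrier_localization)
    show "\<zero>\<^bsub>?L\<^esub> \<oplus>\<^bsub>?L\<^esub> x = x" "\<one>\<^bsub>?L\<^esub> \<otimes>\<^bsub>?L\<^esub> x = x"
      using x' by (simp_all add: simps)
    show "\<exists>y\<in>carrier ?L. y \<oplus>\<^bsub>?L\<^esub> x = \<zero>\<^bsub>?L\<^esub>"
    proof (rule bexI[of _ "fraction A W (\<ominus> a) s"])
      show "fraction A W (\<ominus> a) s \<oplus>\<^bsub>?L\<^esub> x = \<zero>\<^bsub>?L\<^esub>"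
        using x' by (simp add: simps) (rule eqI; simp add: simps r_minus l_neg)
      show "fraction A W (\<ominus> a) s \<in> carrier ?L"
        unfolding carrier_localization using x' by blast
    qed
  qed (use W_one in \<open>auto simp: carrier_localization one zero\<close>)
qed

end

section \<open>The ring $R[X,Y]_{(m,X,Y)}$\<close>

text \<open>$R[X,Y]$ is realised as $(R[X])[Y]$; \<open>monom P a n\<close> is $a T^n$, with $T$ the variable of \<open>P\<close>.\<close>

definition poly2 :: "('a, 'b) ring_scheme \<Rightarrow> (nat \<Rightarrow> 'a, nat \<Rightarrow> nat \<Rightarrow> 'a) up_ring" where
  "poly2 R = UP (UP R)"

definition poly2_const :: "('a, 'b) ring_scheme \<Rightarrow> 'a \<Rightarrow> nat \<Rightarrow> nat \<Rightarrow> 'a" where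
  "poly2_const R r = monom (UP (UP R)) (monom (UP R) r 0) 0"

definition poly2_X :: "('a, 'b) ring_scheme \<Rightarrow> nat \<Rightarrow> nat \<Rightarrow> 'a" where
  "poly2_X R = monom (UP (UP R)) (monom (UP R) \<one>\<^bsub>R\<^esub> 1) 0"

definition poly2_Y :: "('a, 'b) ring_scheme \<Rightarrow> nat \<Rightarrow> nat \<Rightarrow> 'a" where
  "poly2_Y R = monom (UP (UP R)) \<one>\<^bsub>UP R\<^esub> 1"

text \<open>The ideal $(m,X,Y)$ of $R[X,Y]$, and the complement at which to localize.\<close>

definition poly2_ideal :: "('a, 'b) ring_scheme \<Rightarrow> 'a set \<Rightarrow> (nat \<Rightarrow> nat \<Rightarrow> 'a) set" where
  "poly2_ideal R m = genideal (poly2 R) (poly2_const R ` m \<union> {poly2_X R, poly2_Y R})"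

definition poly2_denoms :: "('a, 'b) ring_scheme \<Rightarrow> 'a set \<Rightarrow> (nat \<Rightarrow> nat \<Rightarrow> 'a) set" where
  "poly2_denoms R m = carrier (poly2 R) - poly2_ideal R m"

definition local_poly2 :: "('a, 'b) ring_scheme \<Rightarrow> 'a set \<Rightarrow>
    ((nat \<Rightarrow> nat \<Rightarrow> 'a) \<times> (nat \<Rightarrow> nat \<Rightarrow> 'a)) set ring" where
  "local_poly2 R m = localization (poly2 R) (poly2_denoms R m)"

definition to_local_poly2 :: "('a, 'b) ring_scheme \<Rightarrow> 'a set \<Rightarrow> (nat \<Rightarrow> nat \<Rightarrow> 'a) \<Rightarrow>
    ((nat \<Rightarrow> nat \<Rightarrow> 'a) \<times> (nat \<Rightarrow> nat \<Rightarrow> 'a)) set" where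
  "to_local_poly2 R m f = fraction (poly2 R) (poly2_denoms R m) f \<one>\<^bsub>poly2 R\<^esub>"

text \<open>The ideal $(I,f)$ of $R[X,Y]_{(m,X,Y)}$, for \<open>I\<close> an ideal of \<open>R\<close> and $f \in R[X,Y]$.\<close>

definition extend_by :: "('a, 'b) ring_scheme \<Rightarrow> 'a set \<Rightarrow> 'a set \<Rightarrow> (nat \<Rightarrow> nat \<Rightarrow> 'a) \<Rightarrow>
    ((nat \<Rightarrow> nat \<Rightarrow> 'a) \<times> (nat \<Rightarrow> nat \<Rightarrow> 'a)) set set" where
  "extend_by R m I f =
     genideal (local_poly2 R m) (to_local_poly2 R m ` (poly2_const R ` I \<union> {f}))"

end

theory Submission
  imports Defs
begin

text \<open>Admit the unit ideal as a link, so that every complete intersection is linked to it and a proper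
  ideal is licci iff a chain of links leads from it to the unit ideal. Let $T = R[X]_{(m,X)}$ and
  $S = R[X,Y]_{(m,X,Y)}$.

  If $I$ is licci, a link $J \sim J'$ by $\alpha$ in the chain from $I$ to a complete intersection
  $A$ yields the link $(J,X) \sim (J',X)$ by $(\alpha,X)$, and likewise for $Y$; moreover $(A,X)$ and
  $(A,Y)$ are linked by $(A,XY)$.

  Conversely, choose infinitely many elements of $R$ with pairwise distinct residues. A chain of
  links in $S$ from $(I,X)$ to $(I,Y)$ specializes at $Y = c$, for all but finitely many of these
  elements $c$, to a chain in $T$ from $(I,X)$ to the unit ideal. It remains to show, by induction on
  $n$ and for all $\rho \in m$: if $n$ links lead from $(J,X-\rho)$ to the unit ideal of $T$, then $n$
  links lead from $J$ to the unit ideal of $R$. Write the first element of the regular sequence of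
  the first link as $g = (X-\rho)\zeta + j$ with $j \in J$. The chain lifts from $T = S/(Y)$ to $S$ with
  $g + Y(X-\rho)$ in place of $g$: ideals linked to the unit ideal satisfy an Ext-vanishing property
  that makes links liftable. At $Y = c - \zeta$ the first element becomes $c(X-\rho) + j$, which for a
  unit $c$ is an associate of some $X-\sigma$ with $(J,X-\sigma) = (J,X-\rho)$. Reducing modulo $X-\sigma$
  turns the first link into a link $J \sim J'$ in $R$, and $n-1$ links lead from $(J',X-\sigma)$ to the
  unit ideal of $T$.\<close>


section \<open>Ideals and regular sequences modulo an ideal\<close>

text \<open>The obstacle is that the sequence of a link of (J, X - \<rho>) need not contain an
  associate of X - \<rho>, so the link cannot simply be reduced modulo X - \<rho>. In g = (X -
  \<rho>)\<zeta> + j the coefficient \<zeta> may be a nonunit and may involve X. Adding Y(X -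
  \<rho>) turns it into \<zeta> + Y, and Y = c - \<zeta> makes it the constant unit c. The price is
  a point of specialization that is in general neither constant nor in the maximal ideal: evaluation
  there is defined on the polynomial ring only, and behaves well for all but finitely many c,
  because a finite chain involves finitely many colon ideals and denominators.

  The deformation must not lengthen the chain, so all later links have to move along with the first.
  This is lifting: colons must commute with reduction modulo Y, and the obstruction is an Ext group
  over the complete intersection. Its vanishing is clear for a complete intersection and passes
  along a chain, because it does not depend on the choice of a maximal regular sequence inside an
  ideal. That independence rests on generic combinations of two regular elements, a second use of
  the infinite residue field.\<close>

context cring
begin

lemma eq_diffI: "\<lbrakk>x \<ominus> y = \<zero>; x \<in> carrier R; y \<in> carrier R\<rbrakk> \<Longrightarrow> x = y"
  by (simp add: r_right_minus_eq)

text \<open>Ring identities are verified by separating positive and negative terms. The two sides of the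
  rearranged identity agree as polynomials with natural coefficients, where rewriting with
  distributivity, associativity and commutativity is complete.\<close>

definition is_difference :: "'a \<Rightarrow> 'a \<Rightarrow> 'a \<Rightarrow> bool" where
  "is_difference x p n \<longleftrightarrow> p \<in> carrier R \<and> n \<in> carrier R \<and> x = p \<ominus> n"

lemma is_difference_add:
  assumes "is_difference x p n" "is_difference y q k" shows "is_difference (x \<oplus> y) (p \<oplus> q) (n \<oplus> k)"
  using assms by (auto simp: is_difference_def minus_eq minus_add a_ac)

lemma is_difference_uminus: "is_difference x p n \<Longrightarrow> is_difference (\<ominus> x) n p"
  by (auto simp: is_difference_def minus_eq minus_add a_ac)

lemma is_difference_minus:
  assumes "is_difference x p n" "is_difference y q k" shows "is_difference (x \<ominus> y) (p \<oplus> k) (n \<oplus> q)"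
  unfolding minus_eq[of x y] using assms(1) is_difference_uminus[OF assms(2)] by (rule is_difference_add)

lemma is_difference_mult:
  assumes "is_difference x p n" "is_difference y q k"
  shows "is_difference (x \<otimes> y) (p \<otimes> q \<oplus> n \<otimes> k) (p \<otimes> k \<oplus> n \<otimes> q)"
  using assms
  by (auto simp: is_difference_def minus_eq minus_add l_distr r_distr l_minus r_minus minus_minus a_ac)

lemma is_difference_atom: "x \<in> carrier R \<Longrightarrow> is_difference x x \<zero>"
  by (simp add: is_difference_def minus_eq)

lemmas ring_split = is_difference_add is_difference_uminus is_difference_minus
  is_difference_mult is_difference_atom

lemma ring_identity:
  assumes "is_difference x p n" "is_difference y q k" "p \<oplus> k = q \<oplus> n" shows "x = y"
proof -
  have c: "p \<in> carrier R" "n \<in> carrier R" "q \<in> carrier R" "k \<in> carrier R"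
    using assms(1,2) by (auto simp: is_difference_def)
  have "p \<ominus> n = ((p \<oplus> k) \<oplus> \<ominus> k) \<ominus> n" using c by (simp add: a_assoc r_neg)
  also have "\<dots> = ((q \<oplus> \<ominus> k) \<oplus> n) \<oplus> \<ominus> n" unfolding assms(3) using c by (simp add: minus_eq a_ac)
  also have "\<dots> = q \<ominus> k" using c by (simp add: a_assoc r_neg minus_eq)
  finally show ?thesis using assms(1,2) by (simp add: is_difference_def)
qed

lemmas ring_norm = l_distr r_distr m_ac a_ac

lemma Units_right_cancel:
  assumes "x \<otimes> u = y \<otimes> u" "u \<in> Units R" "x \<in> carrier R" "y \<in> carrier R" shows "x = y"
proof -
  have "(x \<otimes> u) \<otimes> inv u = (y \<otimes> u) \<otimes> inv u" by (simp only: assms(1))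
  then show ?thesis using assms(2-4) by (simp add: m_assoc Units_closed)
qed

section \<open>Closure properties of ideals, elementwise\<close>

lemma ideal_add: "\<lbrakk>ideal N R; x \<in> N; y \<in> N\<rbrakk> \<Longrightarrow> x \<oplus> y \<in> N"
  by (simp add: additive_subgroup.a_closed ideal.axioms(1))

lemma ideal_mult: "\<lbrakk>ideal N R; x \<in> N; r \<in> carrier R\<rbrakk> \<Longrightarrow> r \<otimes> x \<in> N"
  by (simp add: ideal.I_l_closed)

lemma ideal_mult_right: "\<lbrakk>ideal N R; x \<in> N; r \<in> carrier R\<rbrakk> \<Longrightarrow> x \<otimes> r \<in> N"
  by (simp add: ideal.I_r_closed)

lemma ideal_carrier: "\<lbrakk>ideal N R; x \<in> N\<rbrakk> \<Longrightarrow> x \<in> carrier R"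
  by (rule ideal.Icarr)

lemma ideal_subset_carrier: "ideal N R \<Longrightarrow> N \<subseteq> carrier R"
  by (auto intro: ideal.Icarr)

lemma ideal_zero: "ideal N R \<Longrightarrow> \<zero> \<in> N"
  by (simp add: additive_subgroup.zero_closed ideal.axioms(1))

lemma ideal_minus: "\<lbrakk>ideal N R; x \<in> N; y \<in> N\<rbrakk> \<Longrightarrow> x \<ominus> y \<in> N"
  by (simp add: a_minus_def additive_subgroup.a_closed additive_subgroup.a_inv_closed ideal.axioms(1))

lemma ideal_lincomb:
  "\<lbrakk>ideal N R; x \<in> N; y \<in> N; r \<in> carrier R; s \<in> carrier R; z = r \<otimes> x \<oplus> s \<otimes> y\<rbrakk> \<Longrightarrow> z \<in> N"
  by (simp add: ideal_add ideal_mult)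

lemma ideal_add_cancel:
  assumes "ideal N R" "x \<oplus> y \<in> N" "x \<in> N" "y \<in> carrier R" shows "y \<in> N"
proof -
  have x: "x \<in> carrier R" and "y \<in> carrier R" using assms ideal_carrier by auto
  have "\<zero> \<oplus> y = (x \<oplus> y) \<ominus> x" using assms(4) x by algebra
  then show ?thesis using ideal_minus[OF assms(1-3)] assms by simp
qed

lemma ideal_diff_iff:
  assumes "ideal N R" "x \<ominus> y \<in> N" "x \<in> carrier R" "y \<in> carrier R" shows "x \<in> N \<longleftrightarrow> y \<in> N"
proof
  have e: "\<zero> \<oplus> x = (x \<ominus> y) \<oplus> y" "\<zero> \<oplus> y = x \<ominus> (x \<ominus> y)" using assms(3,4) by algebra+
  show "y \<in> N \<Longrightarrow> x \<in> N" using e(1) ideal_add[OF assms(1,2), of y] assms(3) by (metis l_zero)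
  show "x \<in> N \<Longrightarrow> y \<in> N" using e(2) ideal_minus[OF assms(1) _ assms(2), of x] assms(4) by (metis l_zero)
qed

text \<open>Negation is multiplication by \<open>\<ominus> \<one>\<close>, so closure under addition
  and scalars already gives an additive subgroup.\<close>

lemma ideal_closedI:
  assumes "N \<subseteq> carrier R" "\<zero> \<in> N" "\<And>x y. \<lbrakk>x \<in> N; y \<in> N\<rbrakk> \<Longrightarrow> x \<oplus> y \<in> N"
    "\<And>r x. \<lbrakk>r \<in> carrier R; x \<in> N\<rbrakk> \<Longrightarrow> r \<otimes> x \<in> N"
  shows "ideal N R"
proof (rule idealI)
  show "subgroup N (add_monoid R)"
  proof
    fix x assume x: "x \<in> N"
    have "\<ominus> x = (\<ominus> \<one>) \<otimes> x" using assms(1) x by (simp add: l_minus subsetD)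
    then show "inv\<^bsub>add_monoid R\<^esub> x \<in> N" using assms(4)[OF _ x, of "\<ominus> \<one>"] by (simp add: a_inv_def)
  qed (use assms in auto)
next
  fix x r assume "x \<in> N" "r \<in> carrier R"
  then show "r \<otimes> x \<in> N" "x \<otimes> r \<in> N" using assms(1) assms(4)[of r x] m_comm[of x r] by auto
qed (rule ring_axioms)

lemma ideal_eq_carrier_iff: "ideal N R \<Longrightarrow> N = carrier R \<longleftrightarrow> \<one> \<in> N"
  using ideal.one_imp_carrier by fastforce

lemma ideal_unit: "\<lbrakk>ideal N R; u \<in> Units R; u \<in> N\<rbrakk> \<Longrightarrow> N = carrier R"
  using ideal_mult[of N u "inv u"] by (simp add: ideal_eq_carrier_iff Units_l_inv)

lemma ideal_unit_mult_iff:
  assumes "ideal N R" "u \<in> Units R" "x \<in> carrier R" shows "u \<otimes> x \<in> N \<longleftrightarrow> x \<in> N"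
proof
  assume "u \<otimes> x \<in> N"
  then have "inv u \<otimes> (u \<otimes> x) \<in> N" using assms by (simp add: ideal_mult)
  then show "x \<in> N" using assms by (simp add: m_assoc[symmetric] Units_closed)
qed (use assms in \<open>auto intro: ideal_mult\<close>)

text \<open>The ideal N + aR. With the base ideal \<open>N\<close> kept explicit, arguments about
  R/N take place in \<open>R\<close> itself, so successive quotients need no change of ring or
  type.\<close>

definition adj :: "'a set \<Rightarrow> 'a \<Rightarrow> 'a set" where
  "adj N a = {n \<oplus> r \<otimes> a | n r. n \<in> N \<and> r \<in> carrier R}"

lemma adjI: "\<lbrakk>n \<in> N; r \<in> carrier R; x = n \<oplus> r \<otimes> a\<rbrakk> \<Longrightarrow> x \<in> adj N a"
  by (auto simp: adj_def)

lemma adjE: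
  assumes "x \<in> adj N a" "ideal N R"
  obtains n r where "n \<in> N" "n \<in> carrier R" "r \<in> carrier R" "x = n \<oplus> r \<otimes> a"
  using assms by (auto simp: adj_def dest: ideal_carrier)

lemma ideal_adj: assumes N: "ideal N R" and a: "a \<in> carrier R" shows "ideal (adj N a) R"
proof (rule ideal_closedI)
  show "adj N a \<subseteq> carrier R" using assms by (auto simp: adj_def ideal_carrier)
  show "\<zero> \<in> adj N a" using a by (intro adjI[of \<zero> _ \<zero>]) (auto simp: ideal_zero[OF N])
next
  fix x y assume x: "x \<in> adj N a" and y: "y \<in> adj N a"
  from x obtain n r where 1: "n \<in> N" "n \<in> carrier R" "r \<in> carrier R" "x = n \<oplus> r \<otimes> a"
    using N by (rule adjE)
  from y obtain n' r' where 2: "n' \<in> N" "n' \<in> carrier R" "r' \<in> carrier R" "y = n' \<oplus> r' \<otimes> a"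
    using N by (rule adjE)
  show "x \<oplus> y \<in> adj N a"
  proof (rule adjI)
    show "n \<oplus> n' \<in> N" using 1 2 ideal_add N by auto
    show "x \<oplus> y = n \<oplus> n' \<oplus> (r \<oplus> r') \<otimes> a"
      unfolding 1(4) 2(4) by (rule ring_identity, (rule ring_split | simp add: ring_norm 1(2,3) 2(2,3) a)+)
  qed (use 1 2 in auto)
next
  fix r x assume r: "r \<in> carrier R" and x: "x \<in> adj N a"
  from x obtain n s where 1: "n \<in> N" "n \<in> carrier R" "s \<in> carrier R" "x = n \<oplus> s \<otimes> a"
    using N by (rule adjE)
  show "r \<otimes> x \<in> adj N a"
  proof (rule adjI)
    show "r \<otimes> n \<in> N" using 1 r ideal_mult N by auto
    show "r \<otimes> x = r \<otimes> n \<oplus> (r \<otimes> s) \<otimes> a" unfolding 1(4) using 1(2,3) r a by algebra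
  qed (use 1 r in auto)
qed

lemma adj_incl: "\<lbrakk>ideal N R; a \<in> carrier R; x \<in> N\<rbrakk> \<Longrightarrow> x \<in> adj N a"
  by (rule adjI[of x N \<zero>]) (auto dest: ideal_carrier)

lemma adj_self: "\<lbrakk>ideal N R; a \<in> carrier R\<rbrakk> \<Longrightarrow> a \<in> adj N a"
  by (rule adjI[of \<zero> N \<one>]) (auto simp: ideal_zero)

lemma adj_mult_self: "\<lbrakk>ideal N R; a \<in> carrier R; r \<in> carrier R\<rbrakk> \<Longrightarrow> r \<otimes> a \<in> adj N a"
  by (rule adjI[of \<zero> N r]) (auto simp: ideal_zero)

lemma adj_subset: "\<lbrakk>ideal I R; N \<subseteq> I; a \<in> I\<rbrakk> \<Longrightarrow> adj N a \<subseteq> I"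
  by (auto simp: adj_def intro!: ideal_add ideal_mult)

lemma adj_mono: "N \<subseteq> M \<Longrightarrow> adj N a \<subseteq> adj M a"
  by (auto simp: adj_def)

lemma adj_absorb: "\<lbrakk>ideal N R; a \<in> N\<rbrakk> \<Longrightarrow> adj N a = N"
  using adj_subset[of N N a] adj_incl[of N a] ideal_carrier by blast

lemma adj_commute:
  assumes "ideal N R" "a \<in> carrier R" "b \<in> carrier R" shows "adj (adj N a) b = adj (adj N b) a"
proof -
  have "adj (adj N a) b \<subseteq> adj (adj N b) a" if "a \<in> carrier R" "b \<in> carrier R" for a b
  proof (intro adj_subset ideal_adj assms that)
    show "a \<in> adj (adj N b) a" by (intro adj_self ideal_adj assms that)
    show "b \<in> adj (adj N b) a" by (intro adj_incl adj_self ideal_adj assms that)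
    show "N \<subseteq> adj (adj N b) a" using that by (auto intro!: adj_incl ideal_adj assms)
  qed
  then show ?thesis using assms by blast
qed

lemma adj_unit_mult:
  assumes "ideal N R" "u \<in> Units R" "a \<in> carrier R" shows "adj N (u \<otimes> a) = adj N a"
proof
  have ua: "u \<otimes> a \<in> carrier R" using assms by (simp add: Units_closed)
  show "adj N (u \<otimes> a) \<subseteq> adj N a"
    using assms ua by (intro adj_subset ideal_adj) (auto intro: adj_incl adj_mult_self Units_closed)
  have "a = inv u \<otimes> (u \<otimes> a)" using assms by (simp add: m_assoc[symmetric] Units_closed)
  then have "a \<in> adj N (u \<otimes> a)" using assms ua adj_mult_self[of N "u \<otimes> a" "inv u"] by simp
  then show "adj N a \<subseteq> adj N (u \<otimes> a)"
    using assms ua by (intro adj_subset ideal_adj) (auto intro: adj_incl)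
qed

text \<open>Generators are added from left to right, the order in which a regular sequence is
  tested.\<close>

definition adjl :: "'a set \<Rightarrow> 'a list \<Rightarrow> 'a set" where
  "adjl N xs = foldl adj N xs"

lemma adjl_Nil [simp]: "adjl N [] = N"
  and adjl_Cons [simp]: "adjl N (x # xs) = adjl (adj N x) xs"
  and adjl_append [simp]: "adjl N (xs @ ys) = adjl (adjl N xs) ys"
  by (simp_all add: adjl_def)

lemma ideal_adjl: "\<lbrakk>ideal N R; set xs \<subseteq> carrier R\<rbrakk> \<Longrightarrow> ideal (adjl N xs) R"
  by (induction xs arbitrary: N) (auto simp: ideal_adj)

lemma adjl_incl: "\<lbrakk>ideal N R; set xs \<subseteq> carrier R\<rbrakk> \<Longrightarrow> N \<subseteq> adjl N xs"
proof (induction xs arbitrary: N)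
  case (Cons x xs)
  then have "N \<subseteq> adj N x" by (auto intro: adj_incl)
  also have "\<dots> \<subseteq> adjl (adj N x) xs" using Cons by (auto simp: ideal_adj)
  finally show ?case by simp
qed simp

lemma adjl_set: "\<lbrakk>ideal N R; set xs \<subseteq> carrier R\<rbrakk> \<Longrightarrow> set xs \<subseteq> adjl N xs"
proof (induction xs arbitrary: N)
  case (Cons x xs)
  then have "x \<in> adj N x" by (auto intro: adj_self)
  moreover have "adj N x \<subseteq> adjl (adj N x) xs" using Cons by (intro adjl_incl ideal_adj) auto
  ultimately show ?case using Cons by (auto simp: ideal_adj)
qed simp

lemma adjl_subset: "\<lbrakk>ideal I R; N \<subseteq> I; set xs \<subseteq> I\<rbrakk> \<Longrightarrow> adjl N xs \<subseteq> I"
  by (induction xs arbitrary: N) (auto simp: adj_subset)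

lemma adjl_adj:
  "\<lbrakk>ideal N R; set xs \<subseteq> carrier R; y \<in> carrier R\<rbrakk> \<Longrightarrow> adjl (adj N y) xs = adj (adjl N xs) y"
proof (induction xs arbitrary: N)
  case (Cons x xs)
  have "adjl (adj N y) (x # xs) = adjl (adj (adj N x) y) xs"
    using Cons.prems by (simp add: adj_commute)
  then show ?case using Cons by (simp add: ideal_adj)
qed simp

lemma adjl_zero_eq_genideal:
  assumes "set xs \<subseteq> carrier R" shows "adjl {\<zero>} xs = Idl (set xs)"
proof
  show "adjl {\<zero>} xs \<subseteq> Idl (set xs)"
    using assms genideal_ideal genideal_self by (intro adjl_subset) (auto simp: ideal_zero)
  show "Idl (set xs) \<subseteq> adjl {\<zero>} xs"
    using assms by (intro genideal_minimal ideal_adjl adjl_set zeroideal)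
qed

text \<open>\<open>x\<close> is a nonzerodivisor on R/N. If \<open>N\<close> is the unit ideal,
  every element is regular; with this convention localization and specialization preserve regularity
  even when an ideal becomes the unit ideal.\<close>

definition reg :: "'a set \<Rightarrow> 'a \<Rightarrow> bool" where
  "reg N x \<longleftrightarrow> x \<in> carrier R \<and> (\<forall>r\<in>carrier R. r \<otimes> x \<in> N \<longrightarrow> r \<in> N)"

lemma regI: "\<lbrakk>x \<in> carrier R; \<And>r. \<lbrakk>r \<in> carrier R; r \<otimes> x \<in> N\<rbrakk> \<Longrightarrow> r \<in> N\<rbrakk> \<Longrightarrow> reg N x"
  by (simp add: reg_def)

lemma regD: "\<lbrakk>reg N x; r \<in> carrier R; r \<otimes> x \<in> N\<rbrakk> \<Longrightarrow> r \<in> N"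
  by (simp add: reg_def)

lemma regD': "\<lbrakk>reg N x; r \<in> carrier R; x \<otimes> r \<in> N\<rbrakk> \<Longrightarrow> r \<in> N"
  by (auto simp: reg_def m_comm)

lemma reg_closed: "reg N x \<Longrightarrow> x \<in> carrier R"
  by (simp add: reg_def)

lemma reg_unit_mult:
  assumes "reg N x" "u \<in> Units R" "ideal N R" shows "reg N (u \<otimes> x)"
proof (rule regI)
  fix r assume r: "r \<in> carrier R" "r \<otimes> (u \<otimes> x) \<in> N"
  then have "(u \<otimes> r) \<otimes> x \<in> N" using assms by (simp add: m_ac Units_closed reg_closed)
  then have "u \<otimes> r \<in> N" using assms(1) r assms(2) by (auto intro: regD)
  then show "r \<in> N" using assms r by (simp add: ideal_unit_mult_iff)
qed (use assms in \<open>auto simp: Units_closed reg_closed\<close>)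

lemma reg_pow: assumes "reg N x" shows "reg N (x [^] (n::nat))"
proof (induction n)
  case 0 show ?case by (auto simp: reg_def)
next
  case (Suc n)
  show ?case
  proof (rule regI)
    fix r assume r: "r \<in> carrier R" "r \<otimes> (x [^] Suc n) \<in> N"
    then have "(r \<otimes> x [^] n) \<otimes> x \<in> N" using assms by (simp add: m_assoc reg_closed)
    then have "r \<otimes> x [^] n \<in> N" using assms r by (auto intro: regD simp: reg_closed)
    then show "r \<in> N" using Suc r by (auto intro: regD)
  qed (use assms in \<open>auto simp: reg_closed\<close>)
qed

text \<open>A weakly regular sequence on R/N; properness of the resulting ideal is carried
  separately, see \<open>regular_sequence_iff\<close>.\<close>

primrec regm :: "'a set \<Rightarrow> 'a list \<Rightarrow> bool" where
  "regm N [] \<longleftrightarrow> True"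
| "regm N (x # xs) \<longleftrightarrow> reg N x \<and> regm (adj N x) xs"

lemma regm_append [simp]: "regm N (xs @ ys) \<longleftrightarrow> regm N xs \<and> regm (adjl N xs) ys"
  by (induction xs arbitrary: N) auto

lemma regm_closed: "regm N xs \<Longrightarrow> set xs \<subseteq> carrier R"
  by (induction xs arbitrary: N) (auto simp: reg_closed)

lemma regm_nth:
  "set xs \<subseteq> carrier R \<Longrightarrow> regm N xs \<longleftrightarrow> (\<forall>i<length xs. reg (adjl N (take i xs)) (xs ! i))"
proof (induction xs rule: rev_induct)
  case (snoc x xs)
  then show ?case by (auto simp: less_Suc_eq nth_append)
qed simp

lemma regular_sequence_iff:
  "regular_sequence R xs \<longleftrightarrow> regm {\<zero>} xs \<and> adjl {\<zero>} xs \<noteq> carrier R"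
proof (cases "set xs \<subseteq> carrier R")
  case True
  have "adjl {\<zero>} (take i xs) = Idl (set (take i xs))" for i
    using True set_take_subset[of i xs] by (intro adjl_zero_eq_genideal) blast
  then show ?thesis
    using True nth_mem[of _ xs]
    by (auto simp: regular_sequence_def regm_nth adjl_zero_eq_genideal reg_def)
qed (auto simp: regular_sequence_def dest: regm_closed)

section \<open>Colon ideals\<close>

lemma ideal_colon: assumes "ideal A R" "J \<subseteq> carrier R" shows "ideal (colon_ideal R A J) R"
proof (rule ideal_closedI)
  show "\<zero> \<in> colon_ideal R A J"
    using assms by (auto simp: colon_ideal_def ideal_zero subset_iff)
next
  fix x y assume xy: "x \<in> colon_ideal R A J" "y \<in> colon_ideal R A J"
  then show "x \<oplus> y \<in> colon_ideal R A J"
    using assms by (auto simp: colon_ideal_def l_distr subset_iff intro!: ideal_add)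
next
  fix r x assume "r \<in> carrier R" "x \<in> colon_ideal R A J"
  then show "r \<otimes> x \<in> colon_ideal R A J"
    using assms ideal_mult[OF assms(1)] by (auto simp: colon_ideal_def m_assoc subset_iff)
qed (auto simp: colon_ideal_def)

lemma colon_incl: "\<lbrakk>ideal A R; J \<subseteq> carrier R\<rbrakk> \<Longrightarrow> A \<subseteq> colon_ideal R A J"
  unfolding colon_ideal_def using ideal_mult_right ideal_carrier by blast

lemma colon_carrier: assumes "ideal A R" shows "colon_ideal R A (carrier R) = A"
proof
  show "colon_ideal R A (carrier R) \<subseteq> A" by (auto simp: colon_ideal_def) (metis one_closed r_one)
qed (rule colon_incl[OF assms subset_refl])

lemma colon_subset: "\<lbrakk>ideal A R; J \<subseteq> A\<rbrakk> \<Longrightarrow> colon_ideal R A J = carrier R"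
  unfolding colon_ideal_def using ideal_mult by blast

text \<open>For a fixed \<open>r\<close> the elements that \<open>r\<close> multiplies into
  \<open>A\<close> form an ideal, so testing generators is enough. With finite generation, a colon
  by an ideal becomes finitely many conditions.\<close>

lemma colon_genideal:
  assumes "ideal A R" "F \<subseteq> carrier R" shows "colon_ideal R A (Idl F) = colon_ideal R A F"
proof
  show "colon_ideal R A (Idl F) \<subseteq> colon_ideal R A F"
    using genideal_self[OF assms(2)] by (auto simp: colon_ideal_def)
  show "colon_ideal R A F \<subseteq> colon_ideal R A (Idl F)"
  proof
    fix r assume r: "r \<in> colon_ideal R A F"
    have "ideal (colon_ideal R A {r}) R"
      using assms r by (intro ideal_colon) (auto simp: colon_ideal_def)
    moreover have "F \<subseteq> colon_ideal R A {r}"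
      using r assms(2) by (auto simp: colon_ideal_def m_comm subset_iff)
    ultimately have "Idl F \<subseteq> colon_ideal R A {r}" by (rule genideal_minimal)
    then show "r \<in> colon_ideal R A (Idl F)"
      using r by (auto simp: colon_ideal_def m_comm subset_iff)
  qed
qed

end

section \<open>Noetherian rings: chain conditions, Nakayama's lemma, pencils\<close>

locale noetherian_cring = cring R + noetherian_ring R for R (structure)
begin

lemma ideal_list_generators:
  assumes "ideal I R" obtains xs where "set xs \<subseteq> carrier R" "I = Idl (set xs)"
  using finetely_gen[OF assms] finite_list by metis

lemma ideal_ascending_chain:
  assumes J: "\<And>n::nat. ideal (J n) R" and mono: "\<And>n. J n \<subseteq> J (Suc n)"
  obtains n where "\<And>k. n \<le> k \<Longrightarrow> J k = J n"
proof -
  have inc: "J i \<subseteq> J j" if "i \<le> j" for i j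
    using mono that by (rule lift_Suc_mono_le)
  have "\<Union>(range J) \<in> range J"
  proof (rule ideal_chain_is_trivial)
    show "subset.chain {I. ideal I R} (range J)"
      unfolding subset.chain_def using J inc nat_le_linear by blast
  qed simp
  then obtain n where n: "\<Union>(range J) = J n" by blast
  have "J k = J n" if "n \<le> k" for k using n inc[OF that] by blast
  then show ?thesis by (rule that)
qed

text \<open>Zorn's lemma applies because a nonempty chain of ideals in a Noetherian ring contains
  its union. This is the form in which Noetherian induction is used.\<close>

lemma maximal_ideal_in:
  assumes "I \<in> S" "\<And>J. J \<in> S \<Longrightarrow> ideal J R"
  shows "\<exists>M\<in>S. I \<subseteq> M \<and> (\<forall>J\<in>S. M \<subseteq> J \<longrightarrow> J = M)"
proof -
  define S' where "S' = {J \<in> S. I \<subseteq> J}"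
  have "\<exists>M\<in>S'. \<forall>X\<in>S'. M \<subseteq> X \<longrightarrow> X = M"
  proof (rule subset_Zorn)
    fix C assume C: "subset.chain S' C"
    show "\<exists>U\<in>S'. \<forall>X\<in>C. X \<subseteq> U"
    proof (cases "C = {}")
      case True then show ?thesis using assms(1) by (auto simp: S'_def)
    next
      case False
      have "subset.chain {I. ideal I R} C"
        using C assms(2) by (auto simp: subset.chain_def S'_def)
      then have "\<Union>C \<in> C" using False ideal_chain_is_trivial by blast
      then show ?thesis using C by (auto simp: subset.chain_def)
    qed
  qed
  then obtain M where M: "M \<in> S'" "\<forall>X\<in>S'. M \<subseteq> X \<longrightarrow> X = M" by blast
  have "X \<in> S'" if "X \<in> S" "M \<subseteq> X" for X using that M(1) by (auto simp: S'_def)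
  then show ?thesis using M by (intro bexI[of _ M]) (auto simp: S'_def)
qed

text \<open>Nakayama's lemma for the localization at a multiplicative set \<open>W\<close> with \<open>w - x r \<in> W\<close>
  for \<open>w \<in> W\<close>, phrased without denominators.\<close>

lemma nakayama_mult_subset:
  assumes D: "ideal D R" and A: "ideal A R" and x: "x \<in> carrier R"
    and W: "W \<subseteq> carrier R" "\<one> \<in> W" "\<And>v w. \<lbrakk>v \<in> W; w \<in> W\<rbrakk> \<Longrightarrow> v \<otimes> w \<in> W"
      "\<And>w r. \<lbrakk>w \<in> W; r \<in> carrier R\<rbrakk> \<Longrightarrow> w \<ominus> x \<otimes> r \<in> W"
    and sat: "\<And>w f. \<lbrakk>w \<in> W; f \<in> carrier R; w \<otimes> f \<in> A\<rbrakk> \<Longrightarrow> f \<in> A"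
    and step: "\<And>d. d \<in> D \<Longrightarrow> \<exists>w\<in>W. \<exists>a\<in>A. \<exists>e\<in>D. w \<otimes> d = a \<oplus> x \<otimes> e"
  shows "D \<subseteq> A"
proof -
  obtain ds where ds: "set ds \<subseteq> carrier R" "D = Idl (set ds)" using D by (rule ideal_list_generators)
  have dsD: "set ds \<subseteq> D" using ds genideal_self by blast
  \<comment> \<open>Generators of \<open>D\<close> are eliminated one at a time from the end of the
    list: up to factors from \<open>W\<close>, \<open>D\<close> lies in \<open>A\<close> plus the
    remaining generators.\<close>
  have main: "\<forall>f\<in>D. \<exists>w\<in>W. w \<otimes> f \<in> A" if "set es \<subseteq> D" "\<forall>f\<in>D. \<exists>w\<in>W. w \<otimes> f \<in> adjl A es" for es
    using that
  proof (induction es rule: rev_induct)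
    case (snoc d es)
    define M where "M = adjl A es"
    have dD: "d \<in> D" and esD: "set es \<subseteq> D" using snoc.prems by auto
    have dc: "d \<in> carrier R" and esc: "set es \<subseteq> carrier R"
      using dD esD D ideal_subset_carrier by auto
    have M: "ideal M R" "A \<subseteq> M" unfolding M_def using A esc by (auto intro: ideal_adjl dest: adjl_incl)
    have in_adj: "\<exists>w\<in>W. w \<otimes> f \<in> adj M d" if "f \<in> D" for f
      using snoc.prems(2) that by (auto simp: M_def)
    obtain w a e where 1: "w \<in> W" "a \<in> A" "e \<in> D" "w \<otimes> d = a \<oplus> x \<otimes> e" using step dD by blast
    obtain w' where 2: "w' \<in> W" "w' \<otimes> e \<in> adj M d" using in_adj 1 by blast
    obtain g r where 3: "g \<in> M" "g \<in> carrier R" "r \<in> carrier R" "w' \<otimes> e = g \<oplus> r \<otimes> d"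
      using 2(2) M(1) by (rule adjE)
    have c: "w \<in> carrier R" "w' \<in> carrier R" "e \<in> carrier R" "a \<in> carrier R"
      using 1 2 W(1) D A ideal_carrier by auto
    \<comment> \<open>The determinant trick for one generator: a multiple of \<open>e\<close> is g +
      rd, so w d = a + x e becomes a relation in which \<open>d\<close> has the coefficient w'w -
      xr, again an element of \<open>W\<close>.\<close>
    have "(w' \<otimes> w \<ominus> x \<otimes> r) \<otimes> d = w' \<otimes> (w \<otimes> d) \<ominus> x \<otimes> r \<otimes> d"
      by (rule ring_identity, (rule ring_split | simp add: ring_norm c x 3(3) dc)+)
    also have "\<dots> = w' \<otimes> a \<oplus> x \<otimes> (w' \<otimes> e) \<ominus> x \<otimes> r \<otimes> d"
      unfolding 1(4) by (rule ring_identity, (rule ring_split | simp add: ring_norm c x 3(3) dc)+)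
    also have "\<dots> = w' \<otimes> a \<oplus> x \<otimes> g"
      unfolding 3(4) by (rule ring_identity, (rule ring_split | simp add: ring_norm c x 3(2,3) dc)+)
    also have "\<dots> \<in> M" using M 1(2) 3(1) c x by (blast intro: ideal_add ideal_mult)
    finally have v: "(w' \<otimes> w \<ominus> x \<otimes> r) \<otimes> d \<in> M" .
    define v where "v = w' \<otimes> w \<ominus> x \<otimes> r"
    have vW: "v \<in> W" unfolding v_def using W 1 2 3 by blast
    then have vc: "v \<in> carrier R" using W by blast
    show ?case
    proof (rule snoc.IH[OF esD], rule ballI)
      fix f assume f: "f \<in> D"
      then obtain u where u: "u \<in> W" "u \<otimes> f \<in> adj M d" using in_adj by blast
      obtain h s where 4: "h \<in> M" "h \<in> carrier R" "s \<in> carrier R" "u \<otimes> f = h \<oplus> s \<otimes> d"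
        using u(2) M(1) by (rule adjE)
      have fc: "f \<in> carrier R" "u \<in> carrier R" using f u D ideal_carrier W by auto
      have "(v \<otimes> u) \<otimes> f = v \<otimes> (u \<otimes> f)" using fc vc by (simp add: m_assoc)
      also have "\<dots> = v \<otimes> h \<oplus> s \<otimes> (v \<otimes> d)" unfolding 4(4) by (rule ring_identity, (rule ring_split | simp add: ring_norm 4(2,3) vc dc)+)
      also have "\<dots> \<in> M" using M 4 v vc unfolding v_def by (blast intro: ideal_add ideal_mult)
      finally show "\<exists>w\<in>W. w \<otimes> f \<in> adjl A es" using W(3)[OF vW u(1)] unfolding M_def by blast
    qed
  qed simp
  have "f \<in> adjl A ds" if "f \<in> D" for f
    using that ds(2) genideal_minimal[OF ideal_adjl[OF A ds(1)] adjl_set[OF A ds(1)]] by blast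
  then have "\<forall>f\<in>D. \<exists>w\<in>W. w \<otimes> f \<in> adjl A ds"
    using W(2) D ideal_carrier by (metis l_one)
  from main[OF dsD this] show ?thesis using sat D ideal_carrier by blast
qed

text \<open>The case where \<open>W\<close> is the group of units; \<open>jac\<close> says that
  \<open>x\<close> lies in the Jacobson radical.\<close>

lemma nakayama:
  assumes D: "ideal D R" and A: "ideal A R" and x: "x \<in> carrier R"
    and jac: "\<And>r. r \<in> carrier R \<Longrightarrow> \<one> \<ominus> x \<otimes> r \<in> Units R"
    and step: "\<And>d. d \<in> D \<Longrightarrow> \<exists>a\<in>A. \<exists>e\<in>D. d = a \<oplus> x \<otimes> e"
  shows "D \<subseteq> A"
proof (rule nakayama_mult_subset[OF D A x])
  fix w r assume w: "w \<in> Units R" and r: "r \<in> carrier R"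
  have wc: "w \<in> carrier R" using w by (rule Units_closed)
  define i where "i = inv w"
  have i: "i \<in> carrier R" "w \<otimes> i = \<one>" unfolding i_def using w by simp_all
  have "w \<otimes> (\<one> \<ominus> x \<otimes> (i \<otimes> r)) = w \<ominus> x \<otimes> ((w \<otimes> i) \<otimes> r)"
    by (rule ring_identity, (rule ring_split | simp add: ring_norm i(1) wc x r)+)
  then have "w \<ominus> x \<otimes> r = w \<otimes> (\<one> \<ominus> x \<otimes> (inv w \<otimes> r))"
    using i r by (simp add: i_def)
  then show "w \<ominus> x \<otimes> r \<in> Units R" using jac[of "inv w \<otimes> r"] w r by simp
next
  fix d assume "d \<in> D"
  then show "\<exists>w\<in>Units R. \<exists>a\<in>A. \<exists>e\<in>D. w \<otimes> d = a \<oplus> x \<otimes> e"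
    using step[of d] D ideal_carrier[of D d] by (metis Units_one_closed l_one)
qed (use A in \<open>auto simp: ideal_unit_mult_iff Units_closed\<close>)

text \<open>Read modulo an ideal containing (a + db)w: if \<open>p\<close> acts on \<open>w\<close>
  like sq, then p(a + cb) acts like s(c - d)qb. A further factor of the pencil contributes c - d and
  one factor \<open>b\<close>.\<close>

lemma pencil_identity:
  assumes "p \<in> carrier R" "a \<in> carrier R" "b \<in> carrier R" "c \<in> carrier R" "d \<in> carrier R"
    "s \<in> carrier R" "q \<in> carrier R" "w \<in> carrier R"
  shows "p \<otimes> (a \<oplus> c \<otimes> b) \<otimes> w \<ominus> (s \<otimes> (c \<ominus> d)) \<otimes> (q \<otimes> b \<otimes> w)
    = (a \<oplus> c \<otimes> b) \<otimes> (p \<otimes> w \<ominus> s \<otimes> (q \<otimes> w)) \<oplus> (s \<otimes> q) \<otimes> ((a \<oplus> d \<otimes> b) \<otimes> w)"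
  by (rule ring_identity, (rule ring_split | simp add: ring_norm assms)+)

lemma pencil_identity':
  assumes "p \<in> carrier R" "l \<in> carrier R" "j \<in> carrier R" "r \<in> carrier R" "w \<in> carrier R"
  shows "p \<otimes> l \<otimes> (j \<oplus> r \<otimes> w) = l \<otimes> (p \<otimes> j) \<oplus> (r \<otimes> p) \<otimes> (l \<otimes> w)"
  by (rule ring_identity, (rule ring_split | simp add: ring_norm assms)+)

text \<open>Elements of \<open>B\<close> play the role of scalars: their differences are units, so eigenvectors of a
  pencil \<open>a + c b\<close> for distinct \<open>c \<in> B\<close> are independent and a Noetherian ring has room for only
  finitely many.\<close>

lemma finite_pencil_exceptions:
  assumes M: "ideal M R" and ab: "a \<in> carrier R" "b \<in> carrier R"
    and B: "B \<subseteq> carrier R" "\<And>c d. \<lbrakk>c \<in> B; d \<in> B; c \<noteq> d\<rbrakk> \<Longrightarrow> c \<ominus> d \<in> Units R"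
  shows "finite {c \<in> B. \<exists>v\<in>carrier R. (a \<oplus> c \<otimes> b) \<otimes> v \<in> M \<and> (\<forall>n::nat. b [^] n \<otimes> v \<notin> M)}"
proof (rule ccontr)
  assume "infinite {c \<in> B. \<exists>v\<in>carrier R. (a \<oplus> c \<otimes> b) \<otimes> v \<in> M \<and> (\<forall>n::nat. b [^] n \<otimes> v \<notin> M)}"
  then obtain c :: "nat \<Rightarrow> 'a" where c: "inj c" and
    cB: "range c \<subseteq> {c \<in> B. \<exists>v\<in>carrier R. (a \<oplus> c \<otimes> b) \<otimes> v \<in> M \<and> (\<forall>n::nat. b [^] n \<otimes> v \<notin> M)}"
    using infinite_countable_subset by blast
  have "\<forall>i. \<exists>v\<in>carrier R. (a \<oplus> c i \<otimes> b) \<otimes> v \<in> M \<and> (\<forall>n::nat. b [^] n \<otimes> v \<notin> M)"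
    using cB by blast
  then obtain v where v: "\<And>i. v i \<in> carrier R" "\<And>i. (a \<oplus> c i \<otimes> b) \<otimes> v i \<in> M"
    "\<And>i n::nat. b [^] n \<otimes> v i \<notin> M" by metis
  have cc: "c i \<in> carrier R" for i using cB B(1) by blast
  define l where "l i = a \<oplus> c i \<otimes> b" for i
  have lc: "l i \<in> carrier R" for i using ab cc by (simp add: l_def)
  define p where "p = rec_nat \<one> (\<lambda>k x. x \<otimes> l k)"
  have p0: "p 0 = \<one>" and pS: "p (Suc k) = p k \<otimes> l k" for k by (simp_all add: p_def)
  have pc: "p k \<in> carrier R" for k by (induction k) (simp_all add: p0 pS lc)
  define J where "J k = adjl M (map v [0..<k])" for k
  have JS: "J (Suc k) = adj (J k) (v k)" for k by (simp add: J_def)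
  have J: "ideal (J k) R" for k unfolding J_def using v M by (intro ideal_adjl) auto
  \<comment> \<open>The product of the first \<open>k\<close> factors kills, modulo
    \<open>M\<close>, the first \<open>k\<close> eigenvectors and hence \<open>J k\<close>.\<close>
  have kill: "p k \<otimes> u \<in> M" if "u \<in> J k" for k u
    using that
  proof (induction k arbitrary: u)
    case 0 then show ?case using M by (simp add: J_def p0 ideal_carrier)
  next
    case (Suc k)
    from Suc.prems obtain j r where u: "j \<in> J k" "j \<in> carrier R" "r \<in> carrier R" "u = j \<oplus> r \<otimes> v k"
      unfolding JS using J by (rule adjE)
    have "p (Suc k) \<otimes> u = l k \<otimes> (p k \<otimes> j) \<oplus> (r \<otimes> p k) \<otimes> (l k \<otimes> v k)"
      unfolding pS u(4) by (rule pencil_identity') (use pc lc u(2,3) v(1) in auto)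
    also have "\<dots> \<in> M" using Suc.IH[OF u(1)] v(2)[of k] u pc lc M
      unfolding l_def by (blast intro: ideal_add ideal_mult m_closed)
    finally show ?case .
  qed
  \<comment> \<open>On an eigenvector of index at least \<open>k\<close> the same product acts as a
    unit times a power of \<open>b\<close>, each factor contributing the unit
    \<open>c k \<ominus> c n\<close>.\<close>
  have expand: "\<exists>s\<in>Units R. p k \<otimes> v n \<ominus> s \<otimes> (b [^] k \<otimes> v n) \<in> M" if "k \<le> n" for k n
    using that
  proof (induction k)
    case 0
    have "p 0 \<otimes> v n \<ominus> \<one> \<otimes> (b [^] (0::nat) \<otimes> v n) = \<zero>" using v(1)[of n] by (simp add: p0 r_neg minus_eq)
    then show ?case using ideal_zero[OF M] by (intro bexI[of _ \<one>]) auto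
  next
    case (Suc k)
    then obtain s where s: "s \<in> Units R" "p k \<otimes> v n \<ominus> s \<otimes> (b [^] k \<otimes> v n) \<in> M" by auto
    have "c k \<noteq> c n" using c Suc.prems by (auto dest: injD)
    then have cu: "c k \<ominus> c n \<in> Units R" using B(2) cB by blast
    have comp: "p k \<otimes> l k \<otimes> v n \<ominus> (s \<otimes> (c k \<ominus> c n)) \<otimes> (b [^] k \<otimes> b \<otimes> v n)
      = l k \<otimes> (p k \<otimes> v n \<ominus> s \<otimes> (b [^] k \<otimes> v n)) \<oplus> (s \<otimes> b [^] k) \<otimes> (l n \<otimes> v n)"
      unfolding l_def by (rule pencil_identity) (use pc cc ab s(1) v(1) in \<open>auto simp: Units_closed\<close>)
    have "p (Suc k) \<otimes> v n \<ominus> (s \<otimes> (c k \<ominus> c n)) \<otimes> (b [^] Suc k \<otimes> v n)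
      = l k \<otimes> (p k \<otimes> v n \<ominus> s \<otimes> (b [^] k \<otimes> v n)) \<oplus> (s \<otimes> b [^] k) \<otimes> (l n \<otimes> v n)"
      unfolding pS using comp by simp
    also have "\<dots> \<in> M" using s v(2)[of n] lc M ab
      unfolding l_def by (blast intro: ideal_add ideal_mult m_closed Units_closed nat_pow_closed)
    finally show ?case using s cu by blast
  qed
  obtain n where n: "\<And>k. n \<le> k \<Longrightarrow> J k = J n"
  proof (rule ideal_ascending_chain[of J])
    show "J k \<subseteq> J (Suc k)" for k unfolding JS using J v(1) by (auto intro: adj_incl)
  qed (use J in auto)
  \<comment> \<open>Once the chain is stationary, \<open>v n\<close> lies in \<open>J n\<close>, so
    both descriptions of \<open>p n \<otimes> v n\<close> apply; together they let a power of
    \<open>b\<close> kill \<open>v n\<close>.\<close>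
  have "v n \<in> J (Suc n)" unfolding JS using J v(1) by (auto intro: adj_self)
  then have "p n \<otimes> v n \<in> M" using n[of "Suc n"] kill by simp
  moreover obtain s where s: "s \<in> Units R" "p n \<otimes> v n \<ominus> s \<otimes> (b [^] n \<otimes> v n) \<in> M"
    using expand[of n n] by auto
  ultimately have "s \<otimes> (b [^] n \<otimes> v n) \<in> M"
    using ideal_diff_iff[OF M s(2)] pc v(1) ab s(1) by (simp add: Units_closed)
  then have "b [^] n \<otimes> v n \<in> M" using M s v ab by (simp add: ideal_unit_mult_iff)
  then show False using v(3) by blast
qed

end

section \<open>Local rings and permutation of regular sequences\<close>

locale local_noetherian = noetherian_cring +
  fixes m
  assumes m_ideal: "ideal m R" and one_notin_m: "\<one> \<notin> m"
    and Units_if_notin_m: "\<lbrakk>x \<in> carrier R; x \<notin> m\<rbrakk> \<Longrightarrow> x \<in> Units R"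
begin

lemma m_carrier: "x \<in> m \<Longrightarrow> x \<in> carrier R"
  using m_ideal by (rule ideal_carrier)

lemma Units_iff_notin_m: "x \<in> carrier R \<Longrightarrow> x \<in> Units R \<longleftrightarrow> x \<notin> m"
  using Units_if_notin_m ideal_unit[OF m_ideal] one_notin_m by blast

lemma proper_ideal_subset_m: "\<lbrakk>ideal I R; I \<noteq> carrier R\<rbrakk> \<Longrightarrow> I \<subseteq> m"
  using Units_if_notin_m ideal_unit ideal_carrier by blast

lemma one_minus_m_Units: assumes "x \<in> m" "r \<in> carrier R" shows "\<one> \<ominus> x \<otimes> r \<in> Units R"
proof (rule Units_if_notin_m)
  show "\<one> \<ominus> x \<otimes> r \<notin> m"
  proof
    assume "\<one> \<ominus> x \<otimes> r \<in> m"
    moreover have "x \<otimes> r \<in> m" using assms by (simp add: ideal_mult_right[OF m_ideal])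
    ultimately have "\<one> \<in> m" using ideal_diff_iff[OF m_ideal, of \<one> "x \<otimes> r"] assms m_carrier by blast
    then show False using one_notin_m by blast
  qed
qed (use assms m_carrier in auto)

lemma nakayama_m:
  "\<lbrakk>ideal D R; ideal A R; x \<in> m; \<And>d. d \<in> D \<Longrightarrow> \<exists>a\<in>A. \<exists>e\<in>D. d = a \<oplus> x \<otimes> e\<rbrakk> \<Longrightarrow> D \<subseteq> A"
  by (rule nakayama[of D A x]) (auto simp: m_carrier one_minus_m_Units)

text \<open>If dy lies in \<open>N\<close>, then d = n + ga, and \<open>g\<close> again multiplies
  \<open>y\<close> into \<open>N\<close>. So N : y is contained in N + a(N : y), and Nakayama's
  lemma for \<open>a\<close> in \<open>m\<close> gives N : y = N. The second claim is then a
  division argument.\<close>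

lemma reg_swap:
  assumes N: "ideal N R" and a: "a \<in> m" and ra: "reg N a" and ry: "reg (adj N a) y"
  shows "reg N y" and "reg (adj N y) a"
proof -
  have ac: "a \<in> carrier R" and yc: "y \<in> carrier R" using ra ry by (auto simp: reg_def)
  have "colon_ideal R N {y} \<subseteq> N"
  proof (rule nakayama_m[OF _ N a])
    show "ideal (colon_ideal R N {y}) R" using N yc by (intro ideal_colon) auto
    fix d assume "d \<in> colon_ideal R N {y}"
    then have d: "d \<in> carrier R" "d \<otimes> y \<in> N" by (auto simp: colon_ideal_def)
    then have "d \<in> adj N a" using regD[OF ry d(1)] adj_incl[OF N ac] by blast
    then obtain n g where 1: "n \<in> N" "n \<in> carrier R" "g \<in> carrier R" "d = n \<oplus> g \<otimes> a"
      using N by (rule adjE)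
    have "(g \<otimes> y) \<otimes> a = \<one> \<otimes> (d \<otimes> y) \<oplus> (\<ominus> y) \<otimes> n"
      unfolding 1(4) by (rule ring_identity, (rule ring_split | simp add: ring_norm 1 ac yc)+)
    then have "(g \<otimes> y) \<otimes> a \<in> N" using N d 1 yc by (simp add: ideal_add[OF N] ideal_mult[OF N])
    then have "g \<in> colon_ideal R N {y}"
      using ra 1(3) yc regD[OF ra, of "g \<otimes> y"] by (auto simp: colon_ideal_def)
    then show "\<exists>n\<in>N. \<exists>e\<in>colon_ideal R N {y}. d = n \<oplus> a \<otimes> e"
      using 1 ac by (auto simp: m_comm)
  qed
  then show "reg N y" using yc by (auto simp: reg_def colon_ideal_def)
  show "reg (adj N y) a"
  proof (rule regI)
    fix f assume f: "f \<in> carrier R" "f \<otimes> a \<in> adj N y"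
    then obtain n g where 1: "n \<in> N" "n \<in> carrier R" "g \<in> carrier R" "f \<otimes> a = n \<oplus> g \<otimes> y"
      using N adjE by metis
    have "g \<otimes> y = (\<ominus> n) \<oplus> f \<otimes> a"
      unfolding 1(4) using 1(2,3) yc by algebra
    then have "g \<otimes> y \<in> adj N a"
      using 1(1,2) f N by (intro adjI[of "\<ominus> n"]) (auto simp: additive_subgroup.a_inv_closed ideal.axioms(1))
    then have "g \<in> adj N a" using regD[OF ry 1(3)] by blast
    then obtain n' h where 2: "n' \<in> N" "n' \<in> carrier R" "h \<in> carrier R" "g = n' \<oplus> h \<otimes> a"
      using N by (rule adjE)
    have "(f \<ominus> h \<otimes> y) \<otimes> a = f \<otimes> a \<ominus> h \<otimes> y \<otimes> a" using f 2 yc ac by algebra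
    also have "\<dots> = \<one> \<otimes> n \<oplus> y \<otimes> n'"
      unfolding 1(4) 2(4) by (rule ring_identity, (rule ring_split | simp add: ring_norm 1(2) 2(2,3) yc ac)+)
    finally have "(f \<ominus> h \<otimes> y) \<otimes> a \<in> N" using N 1 2 yc by (simp add: ideal_add[OF N] ideal_mult[OF N])
    then have "f \<ominus> h \<otimes> y \<in> N" using f 2 yc by (simp add: regD[OF ra])
    moreover have "f = (f \<ominus> h \<otimes> y) \<oplus> h \<otimes> y"
      by (rule ring_identity, (rule ring_split | simp add: ring_norm f 2 yc)+)
    ultimately show "f \<in> adj N y" using 2 by (intro adjI[of "f \<ominus> h \<otimes> y"])
  qed (rule ac)
qed

text \<open>Iterates \<open>reg_swap\<close>. Once in front, \<open>y\<close> becomes part of the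
  base ideal, which sets up inductions that shorten a sequence.\<close>

lemma regm_last_to_front:
  assumes "ideal N R" "set xs \<subseteq> m" "regm N xs" "reg (adjl N xs) y"
  shows "reg N y \<and> regm (adj N y) xs"
  using assms
proof (induction xs arbitrary: N)
  case (Cons x xs)
  have c: "x \<in> carrier R" "y \<in> carrier R" using Cons.prems by (auto simp: reg_def)
  have "reg (adj N x) y \<and> regm (adj (adj N x) y) xs"
    using Cons.prems c by (intro Cons.IH) (auto simp: ideal_adj)
  then show ?case
    using reg_swap[of N x y] Cons.prems c adj_commute[of N x y] by auto
qed simp

text \<open>Used for sequences lifted from the quotient by \<open>y\<close>: they are regular before
  \<open>y\<close> is divided out, and \<open>y\<close> stays regular after them.\<close>

lemma regm_front_to_last:
  assumes "ideal N R" "y \<in> m" "reg N y" "regm (adj N y) xs"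
  shows "regm N xs \<and> reg (adjl N xs) y"
  using assms
proof (induction xs arbitrary: N)
  case (Cons x xs)
  have c: "x \<in> carrier R" "y \<in> carrier R" using Cons.prems by (auto simp: reg_def)
  have sw: "reg N x" "reg (adj N x) y" using reg_swap[of N y x] Cons.prems by auto
  have "regm (adj N x) xs \<and> reg (adjl (adj N x) xs) y"
    using Cons.prems c sw adj_commute[of N x y] by (intro Cons.IH) (auto simp: ideal_adj)
  then show ?case using sw by auto
qed simp

end

text \<open>\<open>B\<close> has pairwise distinct residues and plays the role of an infinite field
  of scalars. Stated through units, the condition can be transported along ring homomorphisms into
  local rings.\<close>

locale local_noetherian_infinite = local_noetherian +
  fixes B
  assumes infinite_B: "infinite B" and B_carrier: "B \<subseteq> carrier R"
    and B_diff: "\<lbrakk>c \<in> B; d \<in> B; c \<noteq> d\<rbrakk> \<Longrightarrow> c \<ominus> d \<in> Units R"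
begin

lemma exists_in_B: "\<lbrakk>finite F; finite G\<rbrakk> \<Longrightarrow> \<exists>c\<in>B. c \<notin> F \<and> c \<notin> G"
  using infinite_B by (metis Un_iff finite_Un finite_subset subsetI)

text \<open>Modulo \<open>M\<close>, \<open>a\<close> acts on \<open>v\<close> as -cb, so if a power
  of \<open>b\<close> kills \<open>v\<close>, the same power of \<open>a\<close> does.\<close>

lemma pencil_pow:
  assumes M: "ideal M R" and c: "a \<in> carrier R" "b \<in> carrier R" "c \<in> carrier R"
    and "v \<in> carrier R" "(a \<oplus> c \<otimes> b) \<otimes> v \<in> M" "b [^] (n::nat) \<otimes> v \<in> M"
  shows "a [^] n \<otimes> v \<in> M"
  using assms(5-7)
proof (induction n arbitrary: v)
  case (Suc n)
  define p where "p = a [^] n"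
  have pc: "p \<in> carrier R" using c by (simp add: p_def)
  note v = Suc.prems(1)
  have "(a \<oplus> c \<otimes> b) \<otimes> (b \<otimes> v) = b \<otimes> ((a \<oplus> c \<otimes> b) \<otimes> v)"
    by (rule ring_identity, (rule ring_split | simp add: ring_norm c v)+)
  then have "(a \<oplus> c \<otimes> b) \<otimes> (b \<otimes> v) \<in> M" using Suc.prems c M by (simp add: ideal_mult)
  then have 1: "p \<otimes> (b \<otimes> v) \<in> M" unfolding p_def using Suc.prems c
    by (intro Suc.IH) (auto simp: m_assoc)
  have "a [^] Suc n \<otimes> v = p \<otimes> ((a \<oplus> c \<otimes> b) \<otimes> v) \<oplus> (\<ominus> c) \<otimes> (p \<otimes> (b \<otimes> v))"
    unfolding nat_pow_Suc p_def[symmetric] by (rule ring_identity, (rule ring_split | simp add: ring_norm c v pc)+)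
  then show ?case using ideal_lincomb[OF M Suc.prems(2) 1] c pc by simp
qed simp

text \<open>A vector outside \<open>M\<close> is killed by no power of the regular element
  \<open>b\<close>, so each bad \<open>c\<close> is exceptional for the pencil.\<close>

lemma finite_not_reg_snd:
  assumes "ideal M R" "a \<in> carrier R" "reg M b"
  shows "finite {c \<in> B. \<not> reg M (a \<oplus> c \<otimes> b)}"
proof (rule finite_subset)
  have b: "b \<in> carrier R" using assms by (simp add: reg_def)
  show "finite {c \<in> B. \<exists>v\<in>carrier R. (a \<oplus> c \<otimes> b) \<otimes> v \<in> M \<and> (\<forall>n::nat. b [^] n \<otimes> v \<notin> M)}"
    using assms b B_carrier B_diff by (intro finite_pencil_exceptions) auto
  show "{c \<in> B. \<not> reg M (a \<oplus> c \<otimes> b)} \<subseteq>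
    {c \<in> B. \<exists>v\<in>carrier R. (a \<oplus> c \<otimes> b) \<otimes> v \<in> M \<and> (\<forall>n::nat. b [^] n \<otimes> v \<notin> M)}"
  proof clarify
    fix c assume c: "c \<in> B" "\<not> reg M (a \<oplus> c \<otimes> b)"
    then obtain v where v: "v \<in> carrier R" "v \<otimes> (a \<oplus> c \<otimes> b) \<in> M" "v \<notin> M"
      using assms b B_carrier by (auto simp: reg_def)
    have "b [^] n \<otimes> v \<notin> M" for n :: nat
      using regD'[OF reg_pow[OF assms(3), of n] v(1)] v by blast
    then show "\<exists>v\<in>carrier R. (a \<oplus> c \<otimes> b) \<otimes> v \<in> M \<and> (\<forall>n::nat. b [^] n \<otimes> v \<notin> M)"
      using v c assms b subsetD[OF B_carrier c(1)] m_comm[of v "a \<oplus> c \<otimes> b"] by (intro bexI[of _ v]) auto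
  qed
qed

text \<open>Here \<open>a\<close> is the regular element; \<open>pencil_pow\<close> turns a power of
  \<open>b\<close> that kills a vector into a power of \<open>a\<close> that kills it.\<close>

lemma finite_not_reg_fst:
  assumes "ideal M R" "b \<in> carrier R" "reg M a"
  shows "finite {c \<in> B. \<not> reg M (a \<oplus> c \<otimes> b)}"
proof (rule finite_subset)
  have a: "a \<in> carrier R" using assms by (simp add: reg_def)
  show "finite {c \<in> B. \<exists>v\<in>carrier R. (a \<oplus> c \<otimes> b) \<otimes> v \<in> M \<and> (\<forall>n::nat. b [^] n \<otimes> v \<notin> M)}"
    using assms a B_carrier B_diff by (intro finite_pencil_exceptions) auto
  show "{c \<in> B. \<not> reg M (a \<oplus> c \<otimes> b)} \<subseteq>
    {c \<in> B. \<exists>v\<in>carrier R. (a \<oplus> c \<otimes> b) \<otimes> v \<in> M \<and> (\<forall>n::nat. b [^] n \<otimes> v \<notin> M)}"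
  proof clarify
    fix c assume c: "c \<in> B" "\<not> reg M (a \<oplus> c \<otimes> b)"
    then have cc: "c \<in> carrier R" using B_carrier by blast
    then obtain v where v: "v \<in> carrier R" "(a \<oplus> c \<otimes> b) \<otimes> v \<in> M" "v \<notin> M"
      using assms a c m_comm[of _ "a \<oplus> c \<otimes> b"] by (auto simp: reg_def)
    have "b [^] n \<otimes> v \<notin> M" for n :: nat
      using regD'[OF reg_pow[OF assms(3), of n] v(1)] v pencil_pow[OF assms(1) a assms(2) cc v(1,2), of n]
      by blast
    then show "\<exists>v\<in>carrier R. (a \<oplus> c \<otimes> b) \<otimes> v \<in> M \<and> (\<forall>n::nat. b [^] n \<otimes> v \<notin> M)"
      using v by blast
  qed
qed

text \<open>Divide by \<open>z\<close> once: if fy lies in M + (z^(n+1)), then f = m2 + hz, and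
  regularity of \<open>z\<close> leaves hy in M + (z^n), to which the induction hypothesis
  applies.\<close>

lemma reg_adj_pow:
  assumes M: "ideal M R" and z: "reg M z" and y: "reg (adj M z) y"
  shows "reg (adj M (z [^] (n::nat))) y"
proof (induction n)
  have c: "z \<in> carrier R" "y \<in> carrier R" using z y by (auto simp: reg_def)
  case 0
  have "r \<in> adj M \<one>" if "r \<in> carrier R" for r
    using that M by (intro adjI[of \<zero> _ r]) (auto simp: ideal_zero)
  then show ?case using c by (auto simp: reg_def)
next
  case (Suc n)
  have c: "z \<in> carrier R" "y \<in> carrier R" using z y by (auto simp: reg_def)
  define p where "p = z [^] n"
  have pc: "p \<in> carrier R" using c by (simp add: p_def)
  show ?case
  proof (rule regI)
    fix f assume f: "f \<in> carrier R" "f \<otimes> y \<in> adj M (z [^] Suc n)"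
    then obtain m1 g where 1: "m1 \<in> M" "m1 \<in> carrier R" "g \<in> carrier R" "f \<otimes> y = m1 \<oplus> g \<otimes> (p \<otimes> z)"
      unfolding nat_pow_Suc p_def[symmetric] using M adjE by metis
    have "f \<otimes> y \<in> adj M z"
      unfolding 1(4) using 1 c pc by (intro adjI[of m1 _ "g \<otimes> p"]) (auto simp: m_assoc)
    then have "f \<in> adj M z" using regD[OF y f(1)] by blast
    then obtain m2 h where 2: "m2 \<in> M" "m2 \<in> carrier R" "h \<in> carrier R" "f = m2 \<oplus> h \<otimes> z"
      using M by (rule adjE)
    have "(h \<otimes> y \<ominus> g \<otimes> p) \<otimes> z = f \<otimes> y \<ominus> y \<otimes> m2 \<ominus> g \<otimes> (p \<otimes> z)"
      unfolding 2(4) by (rule ring_identity, (rule ring_split | simp add: ring_norm 1(2,3) 2(2,3) c pc)+)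
    also have "\<dots> = \<one> \<otimes> m1 \<oplus> (\<ominus> y) \<otimes> m2"
      unfolding 1(4) by (rule ring_identity, (rule ring_split | simp add: ring_norm 1(2,3) 2(2,3) c pc)+)
    finally have "(h \<otimes> y \<ominus> g \<otimes> p) \<otimes> z \<in> M" using 1 2 c by (simp add: ideal_add[OF M] ideal_mult[OF M])
    then have 3: "h \<otimes> y \<ominus> g \<otimes> p \<in> M" using 1 2 c pc by (simp add: regD[OF z])
    moreover have "h \<otimes> y = (h \<otimes> y \<ominus> g \<otimes> p) \<oplus> g \<otimes> p"
      by (rule ring_identity, (rule ring_split | simp add: ring_norm 1(2,3) 2(2,3) c pc)+)
    ultimately have "h \<otimes> y \<in> adj M p" using 1 by (intro adjI[of "h \<otimes> y \<ominus> g \<otimes> p"])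
    then have "h \<in> adj M p" using regD[OF Suc 2(3)] unfolding p_def by blast
    then obtain m3 k where 4: "m3 \<in> M" "m3 \<in> carrier R" "k \<in> carrier R" "h = m3 \<oplus> k \<otimes> p"
      using M by (rule adjE)
    have "f = (m2 \<oplus> z \<otimes> m3) \<oplus> k \<otimes> (p \<otimes> z)"
      unfolding 2(4) 4(4) by (rule ring_identity, (rule ring_split | simp add: ring_norm 2(2,3) 4(2,3) c pc)+)
    then show "f \<in> adj M (z [^] Suc n)"
      unfolding nat_pow_Suc p_def[symmetric]
      using 2 4 c by (intro adjI[of "m2 \<oplus> z \<otimes> m3"]) (simp_all add: ideal_add[OF M] ideal_mult[OF M])
  qed (use c in simp)
qed

text \<open>Generic combinations over \<open>B\<close> take the place of prime avoidance. The last
  elements \<open>a\<close> and \<open>b\<close> are combined to one \<open>y\<close> that is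
  regular after either shortened sequence. With \<open>y\<close> moved to the front, induction gives
  \<open>z\<close> regular after \<open>xs\<close> and \<open>y\<close>; then a generic y + tz is
  regular after \<open>xs\<close> and \<open>a\<close>.\<close>

lemma regm_extend:
  assumes "ideal N R" "set xs \<subseteq> m" "set ys \<subseteq> m" "regm N xs" "regm N ys" "length xs < length ys"
  shows "\<exists>z\<in>m. reg (adjl N xs) z"
  using assms
proof (induction xs arbitrary: N ys rule: rev_induct)
  case Nil
  then show ?case by (cases ys) auto
next
  case (snoc a xs)
  then obtain ys' b where ys: "ys = ys' @ [b]" by (cases ys rule: rev_cases) auto
  note N = snoc.prems(1)
  define M where "M = adjl N xs"
  have sub: "set xs \<subseteq> m" "set ys' \<subseteq> m" "a \<in> m" "b \<in> m" using snoc.prems ys by auto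
  have c: "set xs \<subseteq> carrier R" "set ys' \<subseteq> carrier R" "a \<in> carrier R" "b \<in> carrier R"
    using sub m_carrier by auto
  have M: "ideal M R" unfolding M_def using N c by (intro ideal_adjl)
  have M': "ideal (adjl N ys') R" using N c by (intro ideal_adjl)
  have r: "regm N xs" "reg M a" "regm N ys'" "reg (adjl N ys') b"
    using snoc.prems by (auto simp: M_def ys)
  obtain s where s: "s \<in> B" "reg M (a \<oplus> s \<otimes> b)" "reg (adjl N ys') (a \<oplus> s \<otimes> b)"
    using exists_in_B[OF finite_not_reg_fst[OF M c(4) r(2)] finite_not_reg_snd[OF M' c(3) r(4)]]
    by blast
  define y where "y = a \<oplus> s \<otimes> b"
  have sc: "s \<in> carrier R" using s(1) B_carrier by blast
  have y: "y \<in> m" "reg M y" "reg (adjl N ys') y"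
    using sub s sc by (auto simp: y_def intro: ideal_add[OF m_ideal] ideal_mult[OF m_ideal])
  have yc: "y \<in> carrier R" using y m_carrier by blast
  have f: "reg N y" "regm (adj N y) xs" "regm (adj N y) ys'"
    using regm_last_to_front[OF N sub(1) r(1), of y] regm_last_to_front[OF N sub(2) r(3), of y] y
    by (auto simp: M_def)
  obtain z where z: "z \<in> m" "reg (adjl (adj N y) xs) z"
    using snoc.IH[OF ideal_adj[OF N yc] sub(1,2) f(2,3)] snoc.prems(6) ys by auto
  then have "reg (adj M y) z" using adjl_adj[OF N c(1) yc] by (simp add: M_def)
  then have zM: "reg M z" "reg (adj M z) y" using reg_swap[OF M y(1,2)] by auto
  have zc: "z \<in> carrier R" using z m_carrier by blast
  have Ma: "ideal (adj M a) R" using M c by (intro ideal_adj)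
  have fin: "finite {c \<in> B. \<exists>v\<in>carrier R. (y \<oplus> c \<otimes> z) \<otimes> v \<in> adj M a \<and> (\<forall>n::nat. z [^] n \<otimes> v \<notin> adj M a)}"
    using Ma yc zc B_carrier B_diff by (intro finite_pencil_exceptions) auto
  obtain t where t: "t \<in> B" and t': "\<And>v. \<lbrakk>v \<in> carrier R; (y \<oplus> t \<otimes> z) \<otimes> v \<in> adj M a\<rbrakk> \<Longrightarrow>
      \<exists>n::nat. z [^] n \<otimes> v \<in> adj M a"
    using exists_in_B[OF fin fin] by blast
  have tc: "t \<in> carrier R" using t B_carrier by blast
  \<comment> \<open>A vector \<open>v\<close> killed by the generic combination modulo M + (a) is
    killed by some z^n and so by y^n. Eliminating \<open>v\<close> leaves a relation between y^n and
    z^n with coefficients \<open>u\<close> and \<open>u'\<close>, and this is trivial because z^n,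
    y^n is regular modulo \<open>M\<close>.\<close>
  have "reg (adj M a) (y \<oplus> t \<otimes> z)"
  proof (rule regI)
    fix v assume v: "v \<in> carrier R" "v \<otimes> (y \<oplus> t \<otimes> z) \<in> adj M a"
    then have v': "(y \<oplus> t \<otimes> z) \<otimes> v \<in> adj M a" using yc zc tc by (simp add: m_comm)
    then obtain n :: nat where n: "z [^] n \<otimes> v \<in> adj M a" using t' v by blast
    define zn where "zn = z [^] n"
    define yn where "yn = y [^] n"
    have zyc: "zn \<in> carrier R" "yn \<in> carrier R" using yc zc by (auto simp: zn_def yn_def)
    obtain m1 u where 1: "m1 \<in> M" "m1 \<in> carrier R" "u \<in> carrier R" "zn \<otimes> v = m1 \<oplus> u \<otimes> a"
      using n M adjE unfolding zn_def by metis
    have "yn \<otimes> v \<in> adj M a" unfolding yn_def by (rule pencil_pow[OF Ma yc zc tc v(1) v' n])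
    then obtain m2 u' where 2: "m2 \<in> M" "m2 \<in> carrier R" "u' \<in> carrier R" "yn \<otimes> v = m2 \<oplus> u' \<otimes> a"
      using M adjE by metis
    have "(yn \<otimes> u \<ominus> u' \<otimes> zn) \<otimes> a = yn \<otimes> (m1 \<oplus> u \<otimes> a) \<ominus> zn \<otimes> (m2 \<oplus> u' \<otimes> a) \<oplus> zn \<otimes> m2 \<ominus> yn \<otimes> m1"
      by (rule ring_identity, (rule ring_split | simp add: ring_norm 1(2,3) 2(2,3) c zyc)+)
    also have "\<dots> = zn \<otimes> m2 \<oplus> (\<ominus> yn) \<otimes> m1"
      unfolding 1(4)[symmetric] 2(4)[symmetric]
      by (rule ring_identity, (rule ring_split | simp add: ring_norm 1(2,3) 2(2,3) c zyc v)+)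
    finally have "(yn \<otimes> u \<ominus> u' \<otimes> zn) \<otimes> a \<in> M"
      using 1 2 zyc by (simp add: ideal_add[OF M] ideal_mult[OF M])
    then have 3: "yn \<otimes> u \<ominus> u' \<otimes> zn \<in> M" using 1 2 zyc by (simp add: regD[OF r(2)])
    moreover have "yn \<otimes> u = (yn \<otimes> u \<ominus> u' \<otimes> zn) \<oplus> u' \<otimes> zn"
      by (rule ring_identity, (rule ring_split | simp add: ring_norm 1(2,3) 2(2,3) zyc)+)
    ultimately have "yn \<otimes> u \<in> adj M zn" using 2 by (intro adjI[of "yn \<otimes> u \<ominus> u' \<otimes> zn"])
    moreover have "reg (adj M zn) yn"
      unfolding zn_def yn_def by (intro reg_pow reg_adj_pow M zM)
    ultimately have "u \<in> adj M zn" using regD'[OF _ 1(3)] by blast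
    then obtain m3 w where 4: "m3 \<in> M" "m3 \<in> carrier R" "w \<in> carrier R" "u = m3 \<oplus> w \<otimes> zn"
      using M by (rule adjE)
    have "(v \<ominus> w \<otimes> a) \<otimes> zn = zn \<otimes> v \<ominus> w \<otimes> a \<otimes> zn"
      by (rule ring_identity, (rule ring_split | simp add: ring_norm 4(2,3) zyc v c)+)
    also have "\<dots> = \<one> \<otimes> m1 \<oplus> a \<otimes> m3"
      unfolding 1(4) 4(4) by (rule ring_identity, (rule ring_split | simp add: ring_norm 1(2) 4(2,3) zyc c)+)
    finally have "(v \<ominus> w \<otimes> a) \<otimes> zn \<in> M" using 1 4 c by (simp add: ideal_add[OF M] ideal_mult[OF M])
    then have "v \<ominus> w \<otimes> a \<in> M"
      using regD[OF reg_pow[OF zM(1), of n], folded zn_def] v 4 c by simp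
    moreover have "v = (v \<ominus> w \<otimes> a) \<oplus> w \<otimes> a"
      by (rule ring_identity, (rule ring_split | simp add: ring_norm 4(2,3) v c)+)
    ultimately show "v \<in> adj M a" using 4 by (intro adjI[of "v \<ominus> w \<otimes> a"])
  qed (use yc zc tc in simp)
  moreover have "y \<oplus> t \<otimes> z \<in> m"
    using y z tc by (auto intro: ideal_add[OF m_ideal] ideal_mult[OF m_ideal])
  ultimately show ?case by (auto simp: M_def)
qed

end

section \<open>Homomorphisms into a quotient and linkage to the unit ideal\<close>

context cring
begin

text \<open>The homomorphisms \<open>K/N \<rightarrow> R/N\<close> of modules, given by representatives.\<close>

definition hom_mod :: "'a set \<Rightarrow> 'a set \<Rightarrow> ('a \<Rightarrow> 'a) \<Rightarrow> bool" where
  "hom_mod N K \<phi> \<longleftrightarrow>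
     (\<forall>k\<in>K. \<phi> k \<in> carrier R) \<and>
     (\<forall>k\<in>K. \<forall>l\<in>K. \<phi> (k \<oplus> l) \<ominus> (\<phi> k \<oplus> \<phi> l) \<in> N) \<and>
     (\<forall>r\<in>carrier R. \<forall>k\<in>K. \<phi> (r \<otimes> k) \<ominus> r \<otimes> \<phi> k \<in> N) \<and>
     (\<forall>k\<in>N. \<phi> k \<in> N)"

text \<open>Equivalently \<open>Ext\<^sup>1(R/K, R/N) = 0\<close> over \<open>R/N\<close>.\<close>

definition homs_are_mult :: "'a set \<Rightarrow> 'a set \<Rightarrow> bool" where
  "homs_are_mult N K \<longleftrightarrow> (\<forall>\<phi>. hom_mod N K \<phi> \<longrightarrow> (\<exists>e\<in>carrier R. \<forall>k\<in>K. \<phi> k \<ominus> e \<otimes> k \<in> N))"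

lemma hom_mod_cong:
  assumes h: "hom_mod N K \<phi>" and N: "ideal N R" and K: "ideal K R" "N \<subseteq> K"
    and xy: "x \<in> K" "y \<in> K" "x \<ominus> y \<in> N"
  shows "\<phi> x \<ominus> \<phi> y \<in> N"
proof -
  have c: "x \<in> carrier R" "y \<in> carrier R" using xy K ideal_carrier by auto
  define d where "d = x \<ominus> y"
  have d: "d \<in> N" "d \<in> K" "d \<in> carrier R" using xy K c by (auto simp: d_def)
  have x: "x = y \<oplus> d" unfolding d_def by (rule ring_identity, (rule ring_split | simp add: ring_norm c)+)
  define p where "p = \<phi> x" define q where "q = \<phi> y" define s where "s = \<phi> d"
  have pqs: "p \<in> carrier R" "q \<in> carrier R" "s \<in> carrier R"
    using h xy d by (auto simp: hom_mod_def p_def q_def s_def)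
  have "p \<ominus> (q \<oplus> s) \<in> N" using h xy d unfolding hom_mod_def p_def q_def s_def x by blast
  moreover have "s \<in> N" using h d by (auto simp: hom_mod_def s_def)
  moreover have "p \<ominus> q = (p \<ominus> (q \<oplus> s)) \<oplus> s" by (rule ring_identity, (rule ring_split | simp add: ring_norm pqs)+)
  ultimately show ?thesis using ideal_add[OF N] by (simp add: p_def q_def)
qed

text \<open>Multiplication by \<open>b\<close> identifies R/(N + aR) with the submodule generated by
  \<open>b\<close> in R/(N + abR).\<close>

lemma reg_mult_mem_adj_iff:
  assumes N: "ideal N R" and b: "reg N b" and a: "a \<in> carrier R" and z: "z \<in> carrier R"
  shows "b \<otimes> z \<in> adj N (a \<otimes> b) \<longleftrightarrow> z \<in> adj N a"
proof
  have bc: "b \<in> carrier R" using b by (rule reg_closed)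
  show "z \<in> adj N a" if z': "b \<otimes> z \<in> adj N (a \<otimes> b)"
  proof -
    obtain n r where 1: "n \<in> N" "n \<in> carrier R" "r \<in> carrier R" "b \<otimes> z = n \<oplus> r \<otimes> (a \<otimes> b)"
      using z' N by (rule adjE)
    have "b \<otimes> (z \<ominus> r \<otimes> a) = b \<otimes> z \<ominus> r \<otimes> (a \<otimes> b)"
      by (rule ring_identity, (rule ring_split | simp add: ring_norm a z bc 1(3))+)
    also have "\<dots> = n" unfolding 1(4) using 1(2,3) a bc by algebra
    finally have "z \<ominus> r \<otimes> a \<in> N" using 1 a z by (simp add: regD'[OF b])
    moreover have "z = (z \<ominus> r \<otimes> a) \<oplus> r \<otimes> a" by (rule ring_identity, (rule ring_split | simp add: ring_norm a z 1(3))+)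
    ultimately show ?thesis using 1(3) by (intro adjI)
  qed
  show "b \<otimes> z \<in> adj N (a \<otimes> b)" if z': "z \<in> adj N a"
  proof -
    obtain n r where 1: "n \<in> N" "n \<in> carrier R" "r \<in> carrier R" "z = n \<oplus> r \<otimes> a"
      using z' N by (rule adjE)
    have "b \<otimes> z = b \<otimes> n \<oplus> r \<otimes> (a \<otimes> b)"
      unfolding 1(4) by (rule ring_identity, (rule ring_split | simp add: ring_norm a bc 1(2,3))+)
    then show ?thesis using 1 bc by (intro adjI[of "b \<otimes> n"]) (auto simp: ideal_mult[OF N])
  qed
qed

text \<open>\<open>\<Phi>\<close> represents a homomorphism from \<open>L\<close> to R/(N + abR)
  with image in the submodule generated by \<open>b\<close>, a copy of R/(N + aR). Dividing by
  \<open>b\<close> gives a homomorphism which \<open>E\<close> recognizes as a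
  multiplication.\<close>

lemma homs_are_mult_divide:
  assumes N: "ideal N R" and b: "reg N b" and a: "a \<in> carrier R"
    and E: "homs_are_mult (adj N a) L" and L: "ideal L R"
    and i: "\<And>k. k \<in> L \<Longrightarrow> \<Phi> k \<in> adj N b"
    and ii: "\<And>k l. \<lbrakk>k \<in> L; l \<in> L\<rbrakk> \<Longrightarrow> \<Phi> (k \<oplus> l) \<ominus> (\<Phi> k \<oplus> \<Phi> l) \<in> adj N (a \<otimes> b)"
    and iii: "\<And>r k. \<lbrakk>r \<in> carrier R; k \<in> L\<rbrakk> \<Longrightarrow> \<Phi> (r \<otimes> k) \<ominus> r \<otimes> \<Phi> k \<in> adj N (a \<otimes> b)"
    and iv: "\<And>k. k \<in> adj N a \<Longrightarrow> \<Phi> k \<in> adj N (a \<otimes> b)" and aL: "adj N a \<subseteq> L"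
  shows "\<exists>e\<in>carrier R. \<forall>k\<in>L. \<Phi> k \<ominus> b \<otimes> (e \<otimes> k) \<in> adj N (a \<otimes> b)"
proof -
  have bc: "b \<in> carrier R" using b by (rule reg_closed)
  define M where "M = adj N (a \<otimes> b)"
  have M: "ideal M R" unfolding M_def using N a bc by (intro ideal_adj) auto
  have NM: "N \<subseteq> M" unfolding M_def using N a bc by (auto intro: adj_incl)
  have Nb: "ideal (adj N b) R" using N bc by (rule ideal_adj)
  have "\<exists>z. z \<in> carrier R \<and> \<Phi> k \<ominus> b \<otimes> z \<in> N" if k: "k \<in> L" for k
  proof -
    obtain n r where 1: "n \<in> N" "n \<in> carrier R" "r \<in> carrier R" "\<Phi> k = n \<oplus> r \<otimes> b"
      using i[OF k] N by (rule adjE)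
    have "\<Phi> k \<ominus> b \<otimes> r = n" unfolding 1(4) using 1(2,3) bc by algebra
    then show ?thesis using 1(1,3) by metis
  qed
  then obtain \<chi> where \<chi>: "\<And>k. k \<in> L \<Longrightarrow> \<chi> k \<in> carrier R" "\<And>k. k \<in> L \<Longrightarrow> \<Phi> k \<ominus> b \<otimes> \<chi> k \<in> N" by metis
  have \<Phi>c: "\<Phi> k \<in> carrier R" if "k \<in> L" for k using i[OF that] Nb ideal_carrier by blast
  have key: "z \<in> adj N a" if "b \<otimes> z \<in> M" "z \<in> carrier R" for z
    using reg_mult_mem_adj_iff[OF N b a that(2)] that(1) by (simp add: M_def)
  have "hom_mod (adj N a) L \<chi>"
    unfolding hom_mod_def
  proof (intro conjI ballI)
    fix k l assume k: "k \<in> L" and l: "l \<in> L"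
    have kl: "k \<oplus> l \<in> L" using L k l by (rule ideal_add)
    define p1 where "p1 = \<Phi> k" define p2 where "p2 = \<Phi> l" define p3 where "p3 = \<Phi> (k \<oplus> l)"
    define c1 where "c1 = \<chi> k" define c2 where "c2 = \<chi> l" define c3 where "c3 = \<chi> (k \<oplus> l)"
    have c: "p1 \<in> carrier R" "p2 \<in> carrier R" "p3 \<in> carrier R"
      "c1 \<in> carrier R" "c2 \<in> carrier R" "c3 \<in> carrier R"
      using k l kl \<Phi>c \<chi> by (auto simp: p1_def p2_def p3_def c1_def c2_def c3_def)
    have q: "p1 \<ominus> b \<otimes> c1 \<in> M" "p2 \<ominus> b \<otimes> c2 \<in> M" "p3 \<ominus> b \<otimes> c3 \<in> M" "p3 \<ominus> (p1 \<oplus> p2) \<in> M"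
      using k l kl \<chi>(2) NM ii[OF k l] by (auto simp: p1_def p2_def p3_def c1_def c2_def c3_def M_def)
    have "b \<otimes> (c3 \<ominus> (c1 \<oplus> c2)) = (p3 \<ominus> (p1 \<oplus> p2)) \<ominus> (p3 \<ominus> b \<otimes> c3) \<oplus> ((p1 \<ominus> b \<otimes> c1) \<oplus> (p2 \<ominus> b \<otimes> c2))"
      by (rule ring_identity, (rule ring_split | simp add: ring_norm c bc)+)
    also have "\<dots> \<in> M" using q by (simp add: ideal_add[OF M] ideal_minus[OF M])
    finally show "\<chi> (k \<oplus> l) \<ominus> (\<chi> k \<oplus> \<chi> l) \<in> adj N a"
      using c unfolding c1_def[symmetric] c2_def[symmetric] c3_def[symmetric] by (intro key) auto
  next
    fix r k assume r: "r \<in> carrier R" and k: "k \<in> L"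
    have rk: "r \<otimes> k \<in> L" using L k r by (rule ideal_mult)
    define p1 where "p1 = \<Phi> k" define p3 where "p3 = \<Phi> (r \<otimes> k)"
    define c1 where "c1 = \<chi> k" define c3 where "c3 = \<chi> (r \<otimes> k)"
    have c: "p1 \<in> carrier R" "p3 \<in> carrier R" "c1 \<in> carrier R" "c3 \<in> carrier R"
      using k rk \<Phi>c \<chi> by (auto simp: p1_def p3_def c1_def c3_def)
    have q: "p1 \<ominus> b \<otimes> c1 \<in> M" "p3 \<ominus> b \<otimes> c3 \<in> M" "p3 \<ominus> r \<otimes> p1 \<in> M"
      using k rk \<chi>(2) NM iii[OF r k] by (auto simp: p1_def p3_def c1_def c3_def M_def)
    have "b \<otimes> (c3 \<ominus> r \<otimes> c1) = (p3 \<ominus> r \<otimes> p1) \<ominus> (p3 \<ominus> b \<otimes> c3) \<oplus> r \<otimes> (p1 \<ominus> b \<otimes> c1)"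
      by (rule ring_identity, (rule ring_split | simp add: ring_norm c bc r)+)
    also have "\<dots> \<in> M" using q r by (simp add: ideal_add[OF M] ideal_minus[OF M] ideal_mult[OF M])
    finally show "\<chi> (r \<otimes> k) \<ominus> r \<otimes> \<chi> k \<in> adj N a"
      using c r unfolding c1_def[symmetric] c3_def[symmetric] by (intro key) auto
  next
    fix k assume k: "k \<in> adj N a"
    then have kL: "k \<in> L" using aL by blast
    define p1 where "p1 = \<Phi> k" define c1 where "c1 = \<chi> k"
    have c: "p1 \<in> carrier R" "c1 \<in> carrier R" using kL \<Phi>c \<chi> by (auto simp: p1_def c1_def)
    have q: "p1 \<ominus> b \<otimes> c1 \<in> M" "p1 \<in> M"
      using kL \<chi>(2) NM iv[OF k] by (auto simp: p1_def c1_def M_def)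
    have "b \<otimes> c1 = p1 \<ominus> (p1 \<ominus> b \<otimes> c1)" by (rule ring_identity, (rule ring_split | simp add: ring_norm c bc)+)
    also have "\<dots> \<in> M" using q by (simp add: ideal_minus[OF M])
    finally show "\<chi> k \<in> adj N a" using c unfolding c1_def[symmetric] by (intro key) auto
  qed (use \<chi> in auto)
  then obtain e where e: "e \<in> carrier R" "\<And>k. k \<in> L \<Longrightarrow> \<chi> k \<ominus> e \<otimes> k \<in> adj N a"
    using E unfolding homs_are_mult_def by blast
  have "\<Phi> k \<ominus> b \<otimes> (e \<otimes> k) \<in> M" if k: "k \<in> L" for k
  proof -
    define p1 where "p1 = \<Phi> k" define c1 where "c1 = \<chi> k"
    have c: "p1 \<in> carrier R" "c1 \<in> carrier R" "k \<in> carrier R" "e \<in> carrier R"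
      using k \<Phi>c \<chi> L ideal_carrier e by (auto simp: p1_def c1_def)
    have q: "p1 \<ominus> b \<otimes> c1 \<in> M" using k \<chi>(2) NM by (auto simp: p1_def c1_def)
    have "b \<otimes> (c1 \<ominus> e \<otimes> k) \<in> M"
      using reg_mult_mem_adj_iff[OF N b a, of "c1 \<ominus> e \<otimes> k"] c e(2)[OF k] by (simp add: M_def c1_def)
    moreover have "p1 \<ominus> b \<otimes> (e \<otimes> k) = (p1 \<ominus> b \<otimes> c1) \<oplus> b \<otimes> (c1 \<ominus> e \<otimes> k)"
      by (rule ring_identity, (rule ring_split | simp add: ring_norm c bc)+)
    ultimately show ?thesis using ideal_add[OF M q] by (simp add: p1_def)
  qed
  then show ?thesis using e(1) by (auto simp: M_def)
qed

text \<open>Given \<phi> modulo N + bR, consider a\<phi>(k) - \<phi>(a)k modulo N + abR. It vanishes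
  at \<open>a\<close> and is divisible by \<open>b\<close>, so it is multiplication by a multiple of
  \<open>b\<close>; dividing by \<open>a\<close> then exhibits \<phi> as a multiplication.\<close>

lemma homs_are_mult_exchange:
  assumes N: "ideal N R" and K: "ideal K R" "N \<subseteq> K" and ab: "a \<in> K" "b \<in> K" "reg N a" "reg N b"
    and E: "homs_are_mult (adj N a) K"
  shows "homs_are_mult (adj N b) K"
  unfolding homs_are_mult_def
proof (intro allI impI)
  fix \<phi> assume h: "hom_mod (adj N b) K \<phi>"
  have ac: "a \<in> carrier R" and bc: "b \<in> carrier R" using ab by (auto simp: reg_def)
  define Nb where "Nb = adj N b"
  have Nb: "ideal Nb R" "N \<subseteq> Nb" unfolding Nb_def using N bc by (auto intro: ideal_adj adj_incl)
  define M where "M = adj N (a \<otimes> b)"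
  have M: "ideal M R" "N \<subseteq> M" unfolding M_def using N ac bc by (auto intro: ideal_adj adj_incl)
  have aNb: "a \<otimes> z \<in> M \<longleftrightarrow> z \<in> Nb" if "z \<in> carrier R" for z
    using reg_mult_mem_adj_iff[OF N ab(3) bc that] by (simp add: M_def Nb_def m_comm ac bc)
  have bNa: "b \<otimes> z \<in> M \<longleftrightarrow> z \<in> adj N a" if "z \<in> carrier R" for z
    using reg_mult_mem_adj_iff[OF N ab(4) ac that] by (simp add: M_def)
  have \<phi>c: "\<phi> k \<in> carrier R" if "k \<in> K" for k using h that by (auto simp: hom_mod_def)
  have \<phi>add: "\<phi> (k \<oplus> l) \<ominus> (\<phi> k \<oplus> \<phi> l) \<in> Nb" if "k \<in> K" "l \<in> K" for k l
    using h that unfolding hom_mod_def Nb_def by blast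
  have \<phi>mult: "\<phi> (r \<otimes> k) \<ominus> r \<otimes> \<phi> k \<in> Nb" if "r \<in> carrier R" "k \<in> K" for r k
    using h that unfolding hom_mod_def Nb_def by blast
  have \<phi>kill: "\<phi> k \<in> Nb" if "k \<in> Nb" for k using h that unfolding hom_mod_def Nb_def by blast
  have Kc: "k \<in> carrier R" if "k \<in> K" for k using that K ideal_carrier by blast
  define u where "u = \<phi> a"
  have uc: "u \<in> carrier R" using \<phi>c ab by (simp add: u_def)
  define \<Phi> where "\<Phi> k = a \<otimes> \<phi> k \<ominus> u \<otimes> k" for k
  have \<Phi>c: "\<Phi> k \<in> carrier R" if "k \<in> K" for k using that \<phi>c Kc ac uc by (simp add: \<Phi>_def)
  \<comment> \<open>Both a\<phi>(k) and k\<phi>(a) represent \<phi>(ak) modulo N + bR.\<close>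
  have \<Phi>_b: "\<Phi> k \<in> Nb" if k: "k \<in> K" for k
  proof -
    define f where "f = \<phi> k" define g where "g = \<phi> (a \<otimes> k)"
    have c: "f \<in> carrier R" "g \<in> carrier R" "k \<in> carrier R"
      using \<phi>c[OF k] \<phi>c[OF ideal_mult[OF K(1) k ac]] Kc[OF k] by (auto simp: f_def g_def)
    have "g \<ominus> a \<otimes> f \<in> Nb" using \<phi>mult[OF ac k] by (simp add: f_def g_def)
    moreover have "g \<ominus> k \<otimes> u \<in> Nb" using \<phi>mult[OF Kc[OF k] ab(1)] c ac by (simp add: u_def g_def m_comm)
    moreover have "a \<otimes> f \<ominus> u \<otimes> k = (g \<ominus> k \<otimes> u) \<ominus> (g \<ominus> a \<otimes> f)"
      by (rule ring_identity, (rule ring_split | simp add: ring_norm c ac uc)+)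
    ultimately show ?thesis using ideal_minus[OF Nb(1)] by (simp add: \<Phi>_def f_def)
  qed
  have \<Phi>_add: "\<Phi> (k \<oplus> l) \<ominus> (\<Phi> k \<oplus> \<Phi> l) \<in> M" if k: "k \<in> K" and l: "l \<in> K" for k l
  proof -
    define f1 where "f1 = \<phi> k" define f2 where "f2 = \<phi> l" define f3 where "f3 = \<phi> (k \<oplus> l)"
    have c: "f1 \<in> carrier R" "f2 \<in> carrier R" "f3 \<in> carrier R" "k \<in> carrier R" "l \<in> carrier R"
      using \<phi>c k l Kc ideal_add[OF K(1) k l] by (auto simp: f1_def f2_def f3_def)
    have "a \<otimes> (f3 \<ominus> (f1 \<oplus> f2)) \<in> M"
      using aNb[of "f3 \<ominus> (f1 \<oplus> f2)"] \<phi>add[OF k l] c by (simp add: f1_def f2_def f3_def)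
    moreover have "(a \<otimes> f3 \<ominus> u \<otimes> (k \<oplus> l)) \<ominus> ((a \<otimes> f1 \<ominus> u \<otimes> k) \<oplus> (a \<otimes> f2 \<ominus> u \<otimes> l)) = a \<otimes> (f3 \<ominus> (f1 \<oplus> f2))"
      by (rule ring_identity, (rule ring_split | simp add: ring_norm c ac uc)+)
    ultimately show ?thesis by (simp add: \<Phi>_def f1_def f2_def f3_def)
  qed
  have \<Phi>_mult: "\<Phi> (r \<otimes> k) \<ominus> r \<otimes> \<Phi> k \<in> M" if r: "r \<in> carrier R" and k: "k \<in> K" for r k
  proof -
    define f1 where "f1 = \<phi> k" define f3 where "f3 = \<phi> (r \<otimes> k)"
    have c: "f1 \<in> carrier R" "f3 \<in> carrier R" "k \<in> carrier R"
      using \<phi>c k r Kc ideal_mult[OF K(1) k r] by (auto simp: f1_def f3_def)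
    have "a \<otimes> (f3 \<ominus> r \<otimes> f1) \<in> M"
      using aNb[of "f3 \<ominus> r \<otimes> f1"] \<phi>mult[OF r k] c r by (simp add: f1_def f3_def)
    moreover have "(a \<otimes> f3 \<ominus> u \<otimes> (r \<otimes> k)) \<ominus> r \<otimes> (a \<otimes> f1 \<ominus> u \<otimes> k) = a \<otimes> (f3 \<ominus> r \<otimes> f1)"
      by (rule ring_identity, (rule ring_split | simp add: ring_norm c ac uc r)+)
    ultimately show ?thesis by (simp add: \<Phi>_def f1_def f3_def)
  qed
  have aK: "adj N a \<subseteq> K" using K ab by (intro adj_subset)
  have \<Phi>_kill: "\<Phi> k \<in> M" if k: "k \<in> adj N a" for k
  proof -
    obtain n r where 1: "n \<in> N" "n \<in> carrier R" "r \<in> carrier R" "k = n \<oplus> r \<otimes> a"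
      using k N by (rule adjE)
    have nK: "n \<in> K" and raK: "r \<otimes> a \<in> K" using 1 K ab by (auto intro: ideal_mult)
    define F1 where "F1 = \<Phi> n" define F2 where "F2 = \<Phi> (r \<otimes> a)" define F3 where "F3 = \<Phi> k"
    have c: "F1 \<in> carrier R" "F2 \<in> carrier R" "F3 \<in> carrier R"
      using \<Phi>c nK raK k aK by (auto simp: F1_def F2_def F3_def)
    have "\<phi> n \<in> Nb" using \<phi>kill 1(1) Nb(2) by blast
    then have "a \<otimes> \<phi> n \<in> M" using aNb[OF \<phi>c[OF nK]] by blast
    moreover have "u \<otimes> n \<in> M" using 1 M uc by (auto intro: ideal_mult)
    ultimately have F1: "F1 \<in> M" unfolding F1_def \<Phi>_def by (rule ideal_minus[OF M(1)])
    have "\<Phi> a = \<zero>" unfolding \<Phi>_def u_def[symmetric] using uc ac by algebra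
    then have "F2 \<in> M" using \<Phi>_mult[OF 1(3) ab(1)] c 1(3) by (simp add: F2_def minus_eq)
    moreover have "F3 \<ominus> (F1 \<oplus> F2) \<in> M" using \<Phi>_add[OF nK raK] 1(4) by (simp add: F1_def F2_def F3_def)
    moreover have "F3 = (F3 \<ominus> (F1 \<oplus> F2)) \<oplus> (F1 \<oplus> F2)" by (rule ring_identity, (rule ring_split | simp add: ring_norm c)+)
    ultimately show ?thesis using F1 ideal_add[OF M(1)] unfolding F3_def by metis
  qed
  have "\<exists>e\<in>carrier R. \<forall>k\<in>K. \<Phi> k \<ominus> b \<otimes> (e \<otimes> k) \<in> adj N (a \<otimes> b)"
    by (rule homs_are_mult_divide[OF N ab(4) ac E K(1)])
      (use \<Phi>_b \<Phi>_add \<Phi>_mult \<Phi>_kill aK in \<open>simp_all add: M_def Nb_def\<close>)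
  then obtain e where e: "e \<in> carrier R" "\<And>k. k \<in> K \<Longrightarrow> \<Phi> k \<ominus> b \<otimes> (e \<otimes> k) \<in> M"
    unfolding M_def by blast
  \<comment> \<open>At \<open>b\<close> the map \<phi> vanishes modulo N + bR. Hence u + eb is
    congruent modulo \<open>N\<close> to a multiple ga of \<open>a\<close>, and this
    \<open>g\<close> is the multiplier sought.\<close>
  define f where "f = \<phi> b"
  have f: "f \<in> carrier R" "f \<in> Nb" using \<phi>c[OF ab(2)] \<phi>kill adj_self[OF N bc] by (auto simp: f_def Nb_def)
  have "b \<otimes> (u \<oplus> e \<otimes> b) = a \<otimes> f \<ominus> ((a \<otimes> f \<ominus> u \<otimes> b) \<ominus> b \<otimes> (e \<otimes> b))"
    by (rule ring_identity, (rule ring_split | simp add: ring_norm f(1) uc e(1) ac bc)+)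
  also have "\<dots> \<in> M"
    using e(2)[OF ab(2)] aNb[OF f(1)] f(2) ideal_minus[OF M(1)] by (simp add: \<Phi>_def f_def)
  finally have "u \<oplus> e \<otimes> b \<in> adj N a" using bNa uc e(1) bc by simp
  then obtain n g where 1: "n \<in> N" "n \<in> carrier R" "g \<in> carrier R" "u \<oplus> e \<otimes> b = n \<oplus> g \<otimes> a"
    using N by (rule adjE)
  have "\<phi> k \<ominus> g \<otimes> k \<in> Nb" if k: "k \<in> K" for k
  proof -
    define p where "p = \<phi> k"
    have c: "p \<in> carrier R" "k \<in> carrier R" using \<phi>c k Kc by (auto simp: p_def)
    have "a \<otimes> (p \<ominus> g \<otimes> k) = ((a \<otimes> p \<ominus> u \<otimes> k) \<ominus> b \<otimes> (e \<otimes> k)) \<oplus> ((u \<oplus> e \<otimes> b) \<otimes> k \<ominus> g \<otimes> a \<otimes> k)"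
      by (rule ring_identity, (rule ring_split | simp add: ring_norm c uc e(1) ac bc 1(3))+)
    also have "(u \<oplus> e \<otimes> b) \<otimes> k \<ominus> g \<otimes> a \<otimes> k = k \<otimes> n"
      unfolding 1(4) by (rule ring_identity, (rule ring_split | simp add: ring_norm c ac 1(2,3))+)
    also have "((a \<otimes> p \<ominus> u \<otimes> k) \<ominus> b \<otimes> (e \<otimes> k)) \<oplus> k \<otimes> n \<in> M"
      using e(2)[OF k] 1(1) c M by (intro ideal_add[OF M(1)] ideal_mult[OF M(1)]) (auto simp: \<Phi>_def p_def)
    finally show ?thesis using aNb[of "p \<ominus> g \<otimes> k"] c 1(3) by (simp add: p_def)
  qed
  then show "\<exists>e\<in>carrier R. \<forall>k\<in>K. \<phi> k \<ominus> e \<otimes> k \<in> adj N b" using 1(3) by (auto simp: Nb_def)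
qed

text \<open>The relation \<open>b u \<equiv> a v\<close> modulo \<open>N\<close> is the isomorphism between \<open>(N + a : K)/(N + a)\<close> and
  \<open>(N + b : K)/(N + b)\<close>, both of which compute \<open>Ext\<^sup>1(R/K, R/N)\<close>.\<close>

lemma colon_adj_correspond:
  assumes N: "ideal N R" and a: "reg N a" and b: "reg N b"
    and u: "u \<in> carrier R" and v: "v \<in> carrier R" and uv: "b \<otimes> u \<ominus> a \<otimes> v \<in> N"
  shows "u \<in> adj N a \<Longrightarrow> v \<in> adj N b"
    and "\<lbrakk>K \<subseteq> carrier R; u \<in> colon_ideal R (adj N a) K\<rbrakk> \<Longrightarrow> v \<in> colon_ideal R (adj N b) K"
proof -
  have ac: "a \<in> carrier R" and bc: "b \<in> carrier R" using a b by (auto simp: reg_def)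
  have key: "r \<otimes> v \<in> adj N b" if r: "r \<in> carrier R" and ru: "r \<otimes> u \<in> adj N a" for r
  proof -
    obtain n s where 1: "n \<in> N" "n \<in> carrier R" "s \<in> carrier R" "r \<otimes> u = n \<oplus> s \<otimes> a"
      using ru N by (rule adjE)
    have "a \<otimes> (r \<otimes> v \<ominus> s \<otimes> b) = b \<otimes> (r \<otimes> u) \<ominus> r \<otimes> (b \<otimes> u \<ominus> a \<otimes> v) \<ominus> s \<otimes> a \<otimes> b"
      by (rule ring_identity, (rule ring_split | simp add: ring_norm u v ac bc r 1(3))+)
    also have "\<dots> = b \<otimes> n \<ominus> r \<otimes> (b \<otimes> u \<ominus> a \<otimes> v)"
      unfolding 1(4) by (rule ring_identity, (rule ring_split | simp add: ring_norm u v ac bc r 1(2,3))+)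
    also have "\<dots> \<in> N" using uv 1(1) bc r by (simp add: ideal_minus[OF N] ideal_mult[OF N])
    finally have "r \<otimes> v \<ominus> s \<otimes> b \<in> N" using r v 1(3) bc by (simp add: regD'[OF a])
    moreover have "r \<otimes> v = (r \<otimes> v \<ominus> s \<otimes> b) \<oplus> s \<otimes> b"
      by (rule ring_identity, (rule ring_split | simp add: ring_norm v bc r 1(3))+)
    ultimately show ?thesis using 1(3) by (intro adjI)
  qed
  show "u \<in> adj N a \<Longrightarrow> v \<in> adj N b" using key[of \<one>] u v by simp
  show "\<lbrakk>K \<subseteq> carrier R; u \<in> colon_ideal R (adj N a) K\<rbrakk> \<Longrightarrow> v \<in> colon_ideal R (adj N b) K"
    using key u v m_comm[of u] m_comm[of v] by (auto simp: colon_ideal_def subset_iff)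
qed

text \<open>Supplies the element corresponding to \<open>u\<close>: as \<open>b\<close> lies in
  \<open>K\<close>, the product bu is a multiple of \<open>a\<close> modulo
  \<open>N\<close>.\<close>

lemma colon_adj_partner:
  assumes N: "ideal N R" and "a \<in> carrier R" and K: "K \<subseteq> carrier R" "b \<in> K"
    and u: "u \<in> colon_ideal R (adj N a) K"
  shows "\<exists>v\<in>carrier R. b \<otimes> u \<ominus> a \<otimes> v \<in> N"
proof -
  have c: "u \<in> carrier R" "b \<in> carrier R" using u K by (auto simp: colon_ideal_def)
  have "b \<otimes> u \<in> adj N a" using u K c m_comm[of b u] by (auto simp: colon_ideal_def)
  then obtain n s where 1: "n \<in> N" "n \<in> carrier R" "s \<in> carrier R" "b \<otimes> u = n \<oplus> s \<otimes> a"
    using N by (rule adjE)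
  have "b \<otimes> u \<ominus> a \<otimes> s = n" unfolding 1(4) using 1(2,3) assms(2) by algebra
  then show ?thesis using 1(1,3) by metis
qed

text \<open>Transports \<phi> along the isomorphism of \<open>colon_adj_correspond\<close>. With
  v(u) the partner of \<open>u\<close>, the map sending \<open>u\<close> to a\<phi>(v(u)) is
  divisible by \<open>b\<close>, because a v(u) is congruent to bu modulo \<open>N\<close>; the
  multiplier found for \<open>Ka\<close> then serves for \<open>Kb\<close>.\<close>

lemma homs_are_mult_colon_exchange:
  assumes N: "ideal N R" and K: "ideal K R" and ab: "a \<in> K" "b \<in> K" "reg N a" "reg N b"
    and E: "homs_are_mult (adj N a) (colon_ideal R (adj N a) K)"
  shows "homs_are_mult (adj N b) (colon_ideal R (adj N b) K)"
  unfolding homs_are_mult_def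
proof (intro allI impI)
  define Ka where "Ka = colon_ideal R (adj N a) K"
  define Kb where "Kb = colon_ideal R (adj N b) K"
  fix \<phi> assume h: "hom_mod (adj N b) (colon_ideal R (adj N b) K) \<phi>"
  have ac: "a \<in> carrier R" and bc: "b \<in> carrier R" using ab by (auto simp: reg_def)
  have Kc: "K \<subseteq> carrier R" using K by (rule ideal_subset_carrier)
  define Nb where "Nb = adj N b"
  have Nb: "ideal Nb R" "N \<subseteq> Nb" unfolding Nb_def using N bc by (auto intro: ideal_adj adj_incl)
  have Na: "ideal (adj N a) R" using N ac by (rule ideal_adj)
  have Ka: "ideal Ka R" "adj N a \<subseteq> Ka" unfolding Ka_def using Na Kc by (auto intro: ideal_colon dest: colon_incl)
  have Kb: "ideal Kb R" "Nb \<subseteq> Kb"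
    unfolding Kb_def Nb_def[symmetric] using Nb(1) Kc by (auto intro: ideal_colon dest: colon_incl)
  note h = h[folded Kb_def Nb_def]
  define M where "M = adj N (a \<otimes> b)"
  have M: "ideal M R" "N \<subseteq> M" unfolding M_def using N ac bc by (auto intro: ideal_adj adj_incl)
  have aNb: "a \<otimes> z \<in> M \<longleftrightarrow> z \<in> Nb" if "z \<in> carrier R" for z
    using reg_mult_mem_adj_iff[OF N ab(3) bc that] by (simp add: M_def Nb_def m_comm ac bc)
  have \<phi>c: "\<phi> k \<in> carrier R" if "k \<in> Kb" for k using h that by (auto simp: hom_mod_def)
  have \<phi>add: "\<phi> (k \<oplus> l) \<ominus> (\<phi> k \<oplus> \<phi> l) \<in> Nb" if "k \<in> Kb" "l \<in> Kb" for k l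
    using h that unfolding hom_mod_def by blast
  have \<phi>mult: "\<phi> (r \<otimes> k) \<ominus> r \<otimes> \<phi> k \<in> Nb" if "r \<in> carrier R" "k \<in> Kb" for r k
    using h that unfolding hom_mod_def by blast
  have \<phi>kill: "\<phi> k \<in> Nb" if "k \<in> Nb" for k using h that unfolding hom_mod_def by blast
  have \<phi>cong: "\<phi> x \<ominus> \<phi> y \<in> Nb" if "x \<in> Kb" "y \<in> Kb" "x \<ominus> y \<in> N" for x y
    using hom_mod_cong[OF h Nb(1) Kb] that Nb(2) by blast
  have "\<exists>v. v \<in> carrier R \<and> b \<otimes> u \<ominus> a \<otimes> v \<in> N" if "u \<in> Ka" for u
    using colon_adj_partner[OF N ac Kc ab(2)] that unfolding Ka_def by blast
  then obtain v where v: "\<And>u. u \<in> Ka \<Longrightarrow> v u \<in> carrier R" "\<And>u. u \<in> Ka \<Longrightarrow> b \<otimes> u \<ominus> a \<otimes> v u \<in> N"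
    by metis
  have Kac: "u \<in> carrier R" if "u \<in> Ka" for u using that Ka ideal_carrier by blast
  have vKb: "v u \<in> Kb" if "u \<in> Ka" for u
    using colon_adj_correspond(2)[OF N ab(3,4) Kac[OF that] v[OF that] Kc] that
    unfolding Ka_def Kb_def by blast
  define \<Phi> where "\<Phi> u = a \<otimes> \<phi> (v u)" for u
  have vdiff: "x \<ominus> y \<in> N" if "a \<otimes> x \<ominus> a \<otimes> y \<in> N" "x \<in> carrier R" "y \<in> carrier R" for x y
  proof -
    have "a \<otimes> (x \<ominus> y) = a \<otimes> x \<ominus> a \<otimes> y" by (rule ring_identity, (rule ring_split | simp add: ring_norm that(2,3) ac)+)
    then show ?thesis using that by (simp add: regD'[OF ab(3)])
  qed
  have "\<exists>e\<in>carrier R. \<forall>u\<in>Ka. \<Phi> u \<ominus> b \<otimes> (e \<otimes> u) \<in> adj N (a \<otimes> b)"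
  proof (rule homs_are_mult_divide[OF N ab(4) ac])
    show "homs_are_mult (adj N a) Ka" using E by (simp add: Ka_def)
    fix u assume u: "u \<in> Ka"
    define w where "w = v u"
    have w: "w \<in> carrier R" "w \<in> Kb" "b \<otimes> u \<ominus> a \<otimes> w \<in> N" using v u vKb by (auto simp: w_def)
    note uc = Kac[OF u]
    have "a \<otimes> w = b \<otimes> u \<ominus> (b \<otimes> u \<ominus> a \<otimes> w)" by (rule ring_identity, (rule ring_split | simp add: ring_norm uc w ac bc)+)
    moreover have "b \<otimes> u \<in> Nb"
      unfolding Nb_def using adj_mult_self[OF N bc uc] uc bc by (simp add: m_comm)
    ultimately have "a \<otimes> w \<in> Nb" using ideal_minus[OF Nb(1)] w(3) Nb(2) by (metis subsetD)
    then have "\<phi> (a \<otimes> w) \<in> Nb" by (rule \<phi>kill)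
    then have "a \<otimes> \<phi> w \<in> Nb"
      using \<phi>mult[OF ac w(2)] ideal_diff_iff[OF Nb(1) \<phi>mult[OF ac w(2)]] \<phi>c[OF ideal_mult[OF Kb(1) w(2) ac]]
        \<phi>c[OF w(2)] ac by simp
    then show "\<Phi> u \<in> adj N b" by (simp add: \<Phi>_def w_def Nb_def)
  next
    fix k l assume k: "k \<in> Ka" and l: "l \<in> Ka"
    have kl: "k \<oplus> l \<in> Ka" using Ka k l by (intro ideal_add)
    define v1 where "v1 = v k" define v2 where "v2 = v l" define v3 where "v3 = v (k \<oplus> l)"
    have vs: "v1 \<in> Kb" "v2 \<in> Kb" "v3 \<in> Kb" "v1 \<in> carrier R" "v2 \<in> carrier R" "v3 \<in> carrier R"
      using vKb v k l kl by (auto simp: v1_def v2_def v3_def)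
    have n: "b \<otimes> k \<ominus> a \<otimes> v1 \<in> N" "b \<otimes> l \<ominus> a \<otimes> v2 \<in> N" "b \<otimes> (k \<oplus> l) \<ominus> a \<otimes> v3 \<in> N"
      using v k l kl by (auto simp: v1_def v2_def v3_def)
    note c = Kac[OF k] Kac[OF l]
    have v12: "v1 \<oplus> v2 \<in> Kb" using vs Kb by (intro ideal_add)
    have "a \<otimes> v3 \<ominus> a \<otimes> (v1 \<oplus> v2) = (b \<otimes> k \<ominus> a \<otimes> v1) \<oplus> (b \<otimes> l \<ominus> a \<otimes> v2) \<ominus> (b \<otimes> (k \<oplus> l) \<ominus> a \<otimes> v3)"
      by (rule ring_identity, (rule ring_split | simp add: ring_norm c vs ac bc)+)
    also have "\<dots> \<in> N" using n by (simp add: ideal_minus[OF N] ideal_add[OF N])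
    finally have "v3 \<ominus> (v1 \<oplus> v2) \<in> N" using vs by (simp add: vdiff)
    then have d1: "\<phi> v3 \<ominus> \<phi> (v1 \<oplus> v2) \<in> Nb" using \<phi>cong vs v12 by blast
    have d2: "\<phi> (v1 \<oplus> v2) \<ominus> (\<phi> v1 \<oplus> \<phi> v2) \<in> Nb" using \<phi>add vs by blast
    define f1 where "f1 = \<phi> v1" define f2 where "f2 = \<phi> v2" define f3 where "f3 = \<phi> v3"
    define f12 where "f12 = \<phi> (v1 \<oplus> v2)"
    have fc: "f1 \<in> carrier R" "f2 \<in> carrier R" "f3 \<in> carrier R" "f12 \<in> carrier R"
      using \<phi>c vs v12 by (auto simp: f1_def f2_def f3_def f12_def)
    have "f3 \<ominus> (f1 \<oplus> f2) = (f3 \<ominus> f12) \<oplus> (f12 \<ominus> (f1 \<oplus> f2))"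
      by (rule ring_identity, (rule ring_split | simp add: ring_norm fc)+)
    also have "\<dots> \<in> Nb" using d1 d2 by (simp add: f1_def f2_def f3_def f12_def ideal_add[OF Nb(1)])
    finally have "a \<otimes> (f3 \<ominus> (f1 \<oplus> f2)) \<in> M" using aNb fc by simp
    moreover have "a \<otimes> f3 \<ominus> (a \<otimes> f1 \<oplus> a \<otimes> f2) = a \<otimes> (f3 \<ominus> (f1 \<oplus> f2))"
      by (rule ring_identity, (rule ring_split | simp add: ring_norm fc ac)+)
    ultimately show "\<Phi> (k \<oplus> l) \<ominus> (\<Phi> k \<oplus> \<Phi> l) \<in> adj N (a \<otimes> b)"
      by (simp add: \<Phi>_def M_def f1_def f2_def f3_def v1_def v2_def v3_def)
  next
    fix r k assume r: "r \<in> carrier R" and k: "k \<in> Ka"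
    have rk: "r \<otimes> k \<in> Ka" using Ka k r by (intro ideal_mult)
    define v1 where "v1 = v k" define v3 where "v3 = v (r \<otimes> k)"
    have vs: "v1 \<in> Kb" "v3 \<in> Kb" "v1 \<in> carrier R" "v3 \<in> carrier R"
      using vKb v k rk by (auto simp: v1_def v3_def)
    have n: "b \<otimes> k \<ominus> a \<otimes> v1 \<in> N" "b \<otimes> (r \<otimes> k) \<ominus> a \<otimes> v3 \<in> N"
      using v k rk by (auto simp: v1_def v3_def)
    note c = Kac[OF k]
    have rv: "r \<otimes> v1 \<in> Kb" using vs r Kb by (intro ideal_mult)
    have "a \<otimes> v3 \<ominus> a \<otimes> (r \<otimes> v1) = r \<otimes> (b \<otimes> k \<ominus> a \<otimes> v1) \<ominus> (b \<otimes> (r \<otimes> k) \<ominus> a \<otimes> v3)"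
      by (rule ring_identity, (rule ring_split | simp add: ring_norm c r vs ac bc)+)
    also have "\<dots> \<in> N" using n r by (simp add: ideal_minus[OF N] ideal_mult[OF N])
    finally have "v3 \<ominus> r \<otimes> v1 \<in> N" using vs r by (simp add: vdiff)
    then have d1: "\<phi> v3 \<ominus> \<phi> (r \<otimes> v1) \<in> Nb" using \<phi>cong vs rv by blast
    have d2: "\<phi> (r \<otimes> v1) \<ominus> r \<otimes> \<phi> v1 \<in> Nb" using \<phi>mult vs r by blast
    define f1 where "f1 = \<phi> v1" define f3 where "f3 = \<phi> v3"
    define f12 where "f12 = \<phi> (r \<otimes> v1)"
    have fc: "f1 \<in> carrier R" "f3 \<in> carrier R" "f12 \<in> carrier R"
      using \<phi>c vs rv by (auto simp: f1_def f3_def f12_def)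
    have "f3 \<ominus> r \<otimes> f1 = (f3 \<ominus> f12) \<oplus> (f12 \<ominus> r \<otimes> f1)"
      by (rule ring_identity, (rule ring_split | simp add: ring_norm fc r)+)
    also have "\<dots> \<in> Nb" using d1 d2 by (simp add: f1_def f3_def f12_def ideal_add[OF Nb(1)])
    finally have "a \<otimes> (f3 \<ominus> r \<otimes> f1) \<in> M" using aNb fc r by simp
    moreover have "a \<otimes> f3 \<ominus> r \<otimes> (a \<otimes> f1) = a \<otimes> (f3 \<ominus> r \<otimes> f1)"
      by (rule ring_identity, (rule ring_split | simp add: ring_norm fc r ac)+)
    ultimately show "\<Phi> (r \<otimes> k) \<ominus> r \<otimes> \<Phi> k \<in> adj N (a \<otimes> b)"
      by (simp add: \<Phi>_def M_def f1_def f3_def v1_def v3_def)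
  next
    fix k assume k: "k \<in> adj N a"
    then have kKa: "k \<in> Ka" using Ka(2) by blast
    have "v k \<in> Nb"
      unfolding Nb_def using colon_adj_correspond(1)[OF N ab(3,4) Kac[OF kKa] v[OF kKa] k] .
    then have "\<phi> (v k) \<in> Nb" by (rule \<phi>kill)
    then show "\<Phi> k \<in> adj N (a \<otimes> b)"
      using aNb[OF \<phi>c[OF vKb[OF kKa]]] by (simp add: \<Phi>_def M_def)
  qed (use Ka in auto)
  then obtain e where e: "e \<in> carrier R" "\<And>u. u \<in> Ka \<Longrightarrow> \<Phi> u \<ominus> b \<otimes> (e \<otimes> u) \<in> M"
    unfolding M_def by blast
  \<comment> \<open>Each \<open>w\<close> in \<open>Kb\<close> is, modulo \<open>N\<close>, the
    partner of some \<open>u\<close>, by the correspondence in the opposite direction.\<close>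
  have "\<phi> w \<ominus> e \<otimes> w \<in> Nb" if w: "w \<in> Kb" for w
  proof -
    have wc: "w \<in> carrier R" using w Kb ideal_carrier by blast
    obtain u where u: "u \<in> carrier R" "a \<otimes> w \<ominus> b \<otimes> u \<in> N"
      using colon_adj_partner[OF N bc Kc ab(1)] w unfolding Kb_def by blast
    have uKa: "u \<in> Ka"
      using colon_adj_correspond(2)[OF N ab(4,3) wc u Kc] w unfolding Ka_def Kb_def by blast
    define x where "x = v u"
    have x: "x \<in> carrier R" "x \<in> Kb" "b \<otimes> u \<ominus> a \<otimes> x \<in> N" using v uKa vKb by (auto simp: x_def)
    have "a \<otimes> w \<ominus> a \<otimes> x = (a \<otimes> w \<ominus> b \<otimes> u) \<oplus> (b \<otimes> u \<ominus> a \<otimes> x)"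
      by (rule ring_identity, (rule ring_split | simp add: ring_norm wc x u ac bc)+)
    also have "\<dots> \<in> N" using u x by (simp add: ideal_add[OF N])
    finally have "w \<ominus> x \<in> N" using wc x by (simp add: vdiff)
    then have d: "\<phi> w \<ominus> \<phi> x \<in> Nb" using \<phi>cong w x by blast
    define f where "f = \<phi> w" define g where "g = \<phi> x"
    have fc: "f \<in> carrier R" "g \<in> carrier R" using \<phi>c w x by (auto simp: f_def g_def)
    have 1: "a \<otimes> (f \<ominus> g) \<in> M" using aNb d fc by (simp add: f_def g_def)
    have 2: "a \<otimes> g \<ominus> b \<otimes> (e \<otimes> u) \<in> M" using e(2)[OF uKa] by (simp add: \<Phi>_def g_def x_def)
    have 3: "a \<otimes> w \<ominus> b \<otimes> u \<in> M" using u(2) M(2) by blast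
    have "a \<otimes> (f \<ominus> e \<otimes> w) = a \<otimes> (f \<ominus> g) \<oplus> (a \<otimes> g \<ominus> b \<otimes> (e \<otimes> u)) \<ominus> e \<otimes> (a \<otimes> w \<ominus> b \<otimes> u)"
      by (rule ring_identity, (rule ring_split | simp add: ring_norm fc wc u(1) e(1) ac bc)+)
    also have "\<dots> \<in> M" using 1 2 3 e(1) by (simp add: ideal_add[OF M(1)] ideal_minus[OF M(1)] ideal_mult[OF M(1)])
    finally show ?thesis using aNb fc wc e(1) by (simp add: f_def)
  qed
  then show "\<exists>e\<in>carrier R. \<forall>k\<in>colon_ideal R (adj N b) K. \<phi> k \<ominus> e \<otimes> k \<in> adj N b"
    using e(1) by (auto simp: Kb_def Nb_def)
qed

text \<open>Both \<open>R/K\<close> and \<open>R/(N : K)\<close> are reflexive over \<open>R/N\<close> with vanishing \<open>Ext\<^sup>1\<close>: the part of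
  total reflexivity (G-dimension 0) that survives linkage without any duality theory.\<close>

definition ext_reflexive :: "'a set \<Rightarrow> 'a set \<Rightarrow> bool" where
  "ext_reflexive N K \<longleftrightarrow> homs_are_mult N K \<and> homs_are_mult N (colon_ideal R N K) \<and>
     colon_ideal R N (colon_ideal R N K) \<subseteq> K"

text \<open>For the double colon, \<open>u\<close> and its partner \<open>v\<close> are tested
  together: rv in N + bR forces ru in N + aR.\<close>

lemma ext_reflexive_exchange:
  assumes N: "ideal N R" and K: "ideal K R" "N \<subseteq> K" and ab: "a \<in> K" "b \<in> K" "reg N a" "reg N b"
    and E: "ext_reflexive (adj N a) K"
  shows "ext_reflexive (adj N b) K"
  unfolding ext_reflexive_def
proof (intro conjI subsetI)
  have ac: "a \<in> carrier R" and bc: "b \<in> carrier R" using ab by (auto simp: reg_def)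
  have Kc: "K \<subseteq> carrier R" using K by (intro ideal_subset_carrier)
  show "homs_are_mult (adj N b) K"
    using homs_are_mult_exchange[OF N K ab] E by (simp add: ext_reflexive_def)
  show "homs_are_mult (adj N b) (colon_ideal R (adj N b) K)"
    using homs_are_mult_colon_exchange[OF N K(1) ab] E by (simp add: ext_reflexive_def)
  fix r assume r: "r \<in> colon_ideal R (adj N b) (colon_ideal R (adj N b) K)"
  then have rc: "r \<in> carrier R" by (simp add: colon_ideal_def)
  have "r \<otimes> u \<in> adj N a" if u: "u \<in> colon_ideal R (adj N a) K" for u
  proof -
    have uc: "u \<in> carrier R" using u by (simp add: colon_ideal_def)
    obtain v where v: "v \<in> carrier R" "b \<otimes> u \<ominus> a \<otimes> v \<in> N"
      using colon_adj_partner[OF N ac Kc ab(2) u] by blast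
    have "v \<in> colon_ideal R (adj N b) K"
      using colon_adj_correspond(2)[OF N ab(3,4) uc v Kc u] .
    then have "r \<otimes> v \<in> adj N b" using r by (simp add: colon_ideal_def)
    moreover have "a \<otimes> (r \<otimes> v) \<ominus> b \<otimes> (r \<otimes> u) = (\<ominus> r) \<otimes> (b \<otimes> u \<ominus> a \<otimes> v)"
      by (rule ring_identity, (rule ring_split | simp add: ring_norm rc uc v(1) ac bc)+)
    then have "a \<otimes> (r \<otimes> v) \<ominus> b \<otimes> (r \<otimes> u) \<in> N" using v(2) rc by (simp add: ideal_mult[OF N])
    ultimately show ?thesis
      using colon_adj_correspond(1)[OF N ab(4,3), of "r \<otimes> v" "r \<otimes> u"] rc uc v(1) by simp
  qed
  then have "r \<in> colon_ideal R (adj N a) (colon_ideal R (adj N a) K)"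
    using rc by (simp add: colon_ideal_def[of R "adj N a" "colon_ideal R (adj N a) K"])
  then show "r \<in> K" using E by (auto simp: ext_reflexive_def)
qed

text \<open>If a colon by \<open>K\<close> exceeds its base, then \<open>K\<close> contains no
  element regular modulo that base: the regular sequence in \<open>K\<close> is maximal. Maximality
  survives exchanging the last element.\<close>

lemma colon_adj_neq_exchange:
  assumes N: "ideal N R" and K: "K \<subseteq> carrier R" and ab: "b \<in> K" "reg N a" "reg N b"
    and "colon_ideal R (adj N a) K \<noteq> adj N a"
  shows "colon_ideal R (adj N b) K \<noteq> adj N b"
proof -
  have ac: "a \<in> carrier R" and bc: "b \<in> carrier R" using ab by (auto simp: reg_def)
  have "adj N a \<subseteq> colon_ideal R (adj N a) K" using N ac K by (intro colon_incl ideal_adj)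
  then obtain u where u: "u \<in> colon_ideal R (adj N a) K" "u \<notin> adj N a" using assms(6) by blast
  have uc: "u \<in> carrier R" using u by (simp add: colon_ideal_def)
  obtain v where v: "v \<in> carrier R" "b \<otimes> u \<ominus> a \<otimes> v \<in> N"
    using colon_adj_partner[OF N ac K ab(1) u(1)] by blast
  have "a \<otimes> v \<ominus> b \<otimes> u = (\<ominus> \<one>) \<otimes> (b \<otimes> u \<ominus> a \<otimes> v)"
    by (rule ring_identity, (rule ring_split | simp add: ring_norm uc v(1) ac bc)+)
  then have "a \<otimes> v \<ominus> b \<otimes> u \<in> N" using v(2) ideal_mult[OF N v(2), of "\<ominus> \<one>"] by simp
  then have "v \<notin> adj N b"
    using colon_adj_correspond(1)[OF N ab(3,2) v(1) uc] u(2) by blast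
  moreover have "v \<in> colon_ideal R (adj N b) K"
    using colon_adj_correspond(2)[OF N ab(2,3) uc v K u(1)] .
  ultimately show ?thesis by blast
qed

text \<open>The sequence is kept as a list, because lifting and specialization act on it element by
  element. Either ideal may be the unit ideal, but the ideal of the sequence is proper.\<close>

definition linked_by :: "'a list \<Rightarrow> 'a set \<Rightarrow> 'a set \<Rightarrow> bool" where
  "linked_by xs K K' \<longleftrightarrow> regm {\<zero>} xs \<and> adjl {\<zero>} xs \<noteq> carrier R \<and> ideal K R \<and> ideal K' R \<and>
     set xs \<subseteq> K \<and> K = colon_ideal R (adjl {\<zero>} xs) K' \<and> K' = colon_ideal R (adjl {\<zero>} xs) K"

text \<open>Admitting the unit ideal as a link makes every complete intersection directly linked to it,
  so that a proper ideal is licci iff it is linked to the unit ideal.\<close>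

inductive linked_to_unit :: "nat \<Rightarrow> 'a set \<Rightarrow> bool" where
  unit: "linked_to_unit c (carrier R)"
| link: "\<lbrakk>linked_by xs K K'; linked_to_unit c K'\<rbrakk> \<Longrightarrow> linked_to_unit (Suc c) K"

lemma linked_by_colon:
  assumes "linked_by xs K K'"
  shows "K = colon_ideal R (adjl {\<zero>} xs) K'" and "K' = colon_ideal R (adjl {\<zero>} xs) K"
  using assms unfolding linked_by_def by blast+

lemma linked_byD:
  assumes "linked_by xs K K'"
  shows "regm {\<zero>} xs" "adjl {\<zero>} xs \<noteq> carrier R" "ideal K R" "ideal K' R" "set xs \<subseteq> K"
  using assms unfolding linked_by_def by blast+

lemma linked_by_ideal_adjl: "linked_by xs K K' \<Longrightarrow> ideal (adjl {\<zero>} xs) R"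
  using linked_byD(3,5)[of xs K K'] ideal_subset_carrier[of K] by (blast intro: ideal_adjl zeroideal)

lemma linked_by_adjl_subset: "linked_by xs K K' \<Longrightarrow> adjl {\<zero>} xs \<subseteq> K \<and> adjl {\<zero>} xs \<subseteq> K'"
  using linked_by_ideal_adjl[of xs K K'] colon_incl[of "adjl {\<zero>} xs"] linked_byD(3,4)[of xs K K']
    linked_by_colon[of xs K K'] ideal_subset_carrier by metis

text \<open>Homomorphisms on A/A are zero, and those on A : A = R are determined by their value at
  \<open>\<one>\<close>.\<close>

lemma ext_reflexive_self: assumes "ideal A R" shows "ext_reflexive A A"
  unfolding ext_reflexive_def homs_are_mult_def
proof (intro conjI allI impI)
  show "colon_ideal R A (colon_ideal R A A) \<subseteq> A"
    using assms by (simp add: colon_subset colon_carrier)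
  show "\<exists>e\<in>carrier R. \<forall>k\<in>A. \<phi> k \<ominus> e \<otimes> k \<in> A" if "hom_mod A A \<phi>" for \<phi>
    using that assms by (intro bexI[of _ \<zero>]) (auto simp: hom_mod_def ideal_carrier minus_eq)
  show "\<exists>e\<in>carrier R. \<forall>k\<in>colon_ideal R A A. \<phi> k \<ominus> e \<otimes> k \<in> A" if "hom_mod A (colon_ideal R A A) \<phi>" for \<phi>
  proof (intro bexI[of _ "\<phi> \<one>"] ballI)
    have h: "hom_mod A (carrier R) \<phi>" using that assms by (simp add: colon_subset)
    show "\<phi> \<one> \<in> carrier R" using h by (simp add: hom_mod_def)
    fix k assume "k \<in> colon_ideal R A A"
    then have k: "k \<in> carrier R" by (simp add: colon_ideal_def)
    have "\<phi> (k \<otimes> \<one>) \<ominus> k \<otimes> \<phi> \<one> \<in> A" using h k unfolding hom_mod_def by blast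
    then show "\<phi> k \<ominus> \<phi> \<one> \<otimes> k \<in> A" using k \<open>\<phi> \<one> \<in> carrier R\<close> by (simp add: m_comm)
  qed
qed

lemma ext_reflexive_colon:
  assumes "ext_reflexive A K'" "K = colon_ideal R A K'" "K' = colon_ideal R A K"
  shows "ext_reflexive A K"
  using assms unfolding ext_reflexive_def by (metis order_refl)

end

section \<open>Ext-reflexivity along a chain of links\<close>

context local_noetherian_infinite
begin

text \<open>A generic combination \<open>y\<close> of the two last elements is regular in both
  positions. By \<open>ext_reflexive_exchange\<close> it replaces each of them, is moved into the
  base, and the sequences become shorter. The inequalities express that both sequences are maximal
  in \<open>K\<close>, so neither is exhausted before the other.\<close>

lemma ext_reflexive_regular_sequence:
  assumes "ideal N R" "ideal K R" "N \<subseteq> K" "K \<subseteq> m" "set xs \<subseteq> K" "set ys \<subseteq> K"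
    "regm N xs" "regm N ys"
    "colon_ideal R (adjl N xs) K \<noteq> adjl N xs" "colon_ideal R (adjl N ys) K \<noteq> adjl N ys"
    "ext_reflexive (adjl N xs) K"
  shows "ext_reflexive (adjl N ys) K"
  using assms
proof (induction xs arbitrary: N ys rule: rev_induct)
  case Nil
  have no: False if "y \<in> K" "reg N y" for y
    using that Nil.prems(9) colon_incl[of N K] Nil.prems(1,2) ideal_subset_carrier[of K]
    by (auto simp: colon_ideal_def reg_def)
  then show ?case using Nil.prems by (cases ys) auto
next
  case (snoc a xs)
  note N = snoc.prems(1) and K = snoc.prems(2)
  have Kc: "K \<subseteq> carrier R" using K by (rule ideal_subset_carrier)
  have no: False if "y \<in> K" "reg N y" "colon_ideal R N K \<noteq> N" for y
    using that colon_incl[OF N Kc] by (auto simp: colon_ideal_def reg_def)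
  show ?case
  proof (cases ys rule: rev_cases)
    case Nil
    then have "colon_ideal R N K \<noteq> N" using snoc.prems by simp
    then show ?thesis using no snoc.prems by (cases xs) auto
  next
    case (snoc ys' b)
    note ys = this
    define M where "M = adjl N xs"
    define M' where "M' = adjl N ys'"
    note prems = snoc.prems
    have sub: "set xs \<subseteq> K" "set ys' \<subseteq> K" "a \<in> K" "b \<in> K" using prems ys by auto
    have subm: "set xs \<subseteq> m" "set ys' \<subseteq> m" using sub prems(4) by auto
    have c: "set xs \<subseteq> carrier R" "set ys' \<subseteq> carrier R" "a \<in> carrier R" "b \<in> carrier R"
      using sub Kc by auto
    have M: "ideal M R" "M \<subseteq> K" unfolding M_def using N c K prems(3) sub by (simp_all add: ideal_adjl adjl_subset)
    have M': "ideal M' R" "M' \<subseteq> K" unfolding M'_def using N c K prems(3) sub by (simp_all add: ideal_adjl adjl_subset)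
    have r: "regm N xs" "reg M a" "regm N ys'" "reg M' b"
      using prems by (auto simp: M_def M'_def ys)
    obtain s where s: "s \<in> B" "reg M (a \<oplus> s \<otimes> b)" "reg M' (a \<oplus> s \<otimes> b)"
      using exists_in_B[OF finite_not_reg_fst[OF M(1) c(4) r(2)] finite_not_reg_snd[OF M'(1) c(3) r(4)]]
      by blast
    define y where "y = a \<oplus> s \<otimes> b"
    have sc: "s \<in> carrier R" using s(1) B_carrier by blast
    have y: "y \<in> K" "reg M y" "reg M' y"
      using sub s sc by (auto simp: y_def intro: ideal_add[OF K] ideal_mult[OF K])
    have yc: "y \<in> carrier R" using y Kc by blast
    have f: "regm (adj N y) xs" "regm (adj N y) ys'"
      using regm_last_to_front[OF N subm(1) r(1), of y] regm_last_to_front[OF N subm(2) r(3), of y] y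
      by (auto simp: M_def M'_def)
    have eq: "adjl (adj N y) xs = adj M y" "adjl (adj N y) ys' = adj M' y"
      using adjl_adj[OF N c(1) yc] adjl_adj[OF N c(2) yc] by (auto simp: M_def M'_def)
    have "ext_reflexive (adj M y) K"
      using ext_reflexive_exchange[OF M(1) K M(2) sub(3) y(1) r(2) y(2)] prems by (simp add: M_def)
    moreover have "colon_ideal R (adj M y) K \<noteq> adj M y"
      using colon_adj_neq_exchange[OF M(1) Kc y(1) r(2) y(2)] prems by (simp add: M_def)
    moreover have "colon_ideal R (adj M' y) K \<noteq> adj M' y"
      using colon_adj_neq_exchange[OF M'(1) Kc y(1) r(4) y(3)] prems ys by (simp add: M'_def)
    ultimately have "ext_reflexive (adj M' y) K"
      using snoc.IH[OF ideal_adj[OF N yc] K adj_subset[OF K prems(3) y(1)] prems(4) sub(1,2) f]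
      by (simp add: eq)
    then show ?thesis
      using ext_reflexive_exchange[OF M'(1) K M'(2) y(1) sub(4) y(3) r(4)] ys by (simp add: M'_def)
  qed
qed

text \<open>\<open>K'\<close> belongs to two consecutive links. By induction it is reflexive over
  the sequence of the second one, by independence of the sequence also over \<open>xs\<close>, and
  the property is symmetric in \<open>K\<close> and \<open>K'\<close>.\<close>

lemma linked_to_unit_ext_reflexive:
  assumes "linked_to_unit c K'" "linked_by xs K K'" "K \<noteq> carrier R"
  shows "ext_reflexive (adjl {\<zero>} xs) K"
  using assms
proof (induction arbitrary: xs K rule: linked_to_unit.induct)
  case (unit c)
  then have "K = adjl {\<zero>} xs"
    using colon_carrier[OF linked_by_ideal_adjl[OF unit.prems(1)]] linked_by_colon(1)[OF unit.prems(1)]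
    by simp
  then show ?case using ext_reflexive_self linked_by_ideal_adjl[OF unit.prems(1)] by simp
next
  case (link ys K' K'' c)
  have xs: "linked_by xs K K'" by fact
  define X where "X = adjl {\<zero>} xs"
  define Y where "Y = adjl {\<zero>} ys"
  have X: "ideal X R" unfolding X_def by (rule linked_by_ideal_adjl[OF xs])
  have Y: "ideal Y R" unfolding Y_def by (rule linked_by_ideal_adjl[OF link.hyps(1)])
  have cX: "K = colon_ideal R X K'" "K' = colon_ideal R X K" using linked_by_colon[OF xs] by (simp_all only: X_def)
  have cY: "K' = colon_ideal R Y K''" "K'' = colon_ideal R Y K'"
    using linked_by_colon[OF link.hyps(1)] by (simp_all only: Y_def)
  have "ext_reflexive X K'"
  proof (cases "K' = carrier R")
    case True
    then have "K = X" using cX(1) colon_carrier[OF X] by metis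
    then show ?thesis using ext_reflexive_colon[OF ext_reflexive_self[OF X], of K'] cX by metis
  next
    case False
    have K': "ideal K' R" using linked_byD(4)[OF xs] .
    have Km: "K' \<subseteq> m" using K' False by (rule proper_ideal_subset_m)
    have "ext_reflexive Y K'" unfolding Y_def by (rule link.IH[OF link.hyps(1) False])
    moreover have "colon_ideal R Y K' \<noteq> Y" using cY False colon_subset[OF Y, of Y] by (metis order_refl)
    moreover have "colon_ideal R X K' \<noteq> X" using cX False colon_subset[OF X, of X] by (metis order_refl)
    moreover have "set xs \<subseteq> K'"
      using linked_by_adjl_subset[OF xs] adjl_set[OF zeroideal, of xs] ideal_subset_carrier[of K]
        linked_byD(3,5)[OF xs] by blast
    moreover have "{\<zero>} \<subseteq> K'" using K' ideal_zero by auto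
    ultimately show ?thesis
      using ext_reflexive_regular_sequence[OF zeroideal K' _ Km, of ys xs] linked_byD[OF xs] linked_byD[OF link.hyps(1)]
      unfolding X_def Y_def by blast
  qed
  then show ?case using ext_reflexive_colon[OF _ cX] unfolding X_def by blast
qed

end

section \<open>Lifting links along a regular element\<close>

context cring
begin

lemma adj_pow_antimono:
  assumes N: "ideal N R" and t: "t \<in> carrier R" and x: "x \<in> adj N (t [^] (i + j :: nat))"
  shows "x \<in> adj N (t [^] i)"
proof -
  obtain n r where 1: "n \<in> N" "n \<in> carrier R" "r \<in> carrier R" "x = n \<oplus> r \<otimes> t [^] (i + j)"
    using x N by (rule adjE)
  then have "x = n \<oplus> (r \<otimes> t [^] j) \<otimes> t [^] i"
    using t by (simp add: nat_pow_mult[symmetric] m_ac)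
  then show ?thesis using 1 t by (intro adjI) auto
qed

end

section \<open>Artin-Rees bounds for the powers of one element\<close>

context noetherian_cring
begin

lemma ideal_power_colon_stabilizes:
  assumes D: "ideal D R" and t: "t \<in> carrier R"
  obtains n :: nat where "\<And>j g. \<lbrakk>g \<in> carrier R; t [^] (n + j) \<otimes> g \<in> D\<rbrakk> \<Longrightarrow> t [^] n \<otimes> g \<in> D"
proof -
  define J where "J k = colon_ideal R D {t [^] (k::nat)}" for k
  obtain n where n: "\<And>k. n \<le> k \<Longrightarrow> J k = J n"
  proof (rule ideal_ascending_chain[of J])
    show "ideal (J k) R" for k unfolding J_def using D t by (intro ideal_colon) auto
    show "J k \<subseteq> J (Suc k)" for k
      using t ideal_mult_right[OF D _ t] by (auto simp: J_def colon_ideal_def simp flip: m_assoc)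
  qed blast
  show ?thesis
  proof (rule that)
    fix j g assume g: "g \<in> carrier R" "t [^] (n + j) \<otimes> g \<in> D"
    then have "g \<in> J (n + j)" using t by (simp add: J_def colon_ideal_def m_comm)
    then have "g \<in> J n" using n[of "n + j"] by simp
    then show "t [^] n \<otimes> g \<in> D" using g t by (simp add: J_def colon_ideal_def m_comm)
  qed
qed

text \<open>Write fk = x + g t^(n+j). Stability of the colons of N + kR by powers of
  \<open>t\<close> puts t^n g into N + kR; subtracting a suitable multiple of t^j from
  \<open>f\<close> then makes the product with \<open>k\<close> fall into \<open>N\<close>.\<close>

lemma artin_rees_colon_single:
  assumes N: "ideal N R" and t: "t \<in> carrier R" and k: "k \<in> carrier R"
  obtains n :: nat where "\<And>j f. \<lbrakk>f \<in> carrier R; f \<otimes> k \<in> adj N (t [^] (n + j))\<rbrakk> \<Longrightarrow>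
    f \<in> adj (colon_ideal R N {k}) (t [^] j)"
proof -
  have D: "ideal (adj N k) R" using N k by (rule ideal_adj)
  obtain n :: nat where n: "\<And>j g. \<lbrakk>g \<in> carrier R; t [^] (n + j) \<otimes> g \<in> adj N k\<rbrakk> \<Longrightarrow> t [^] n \<otimes> g \<in> adj N k"
    using ideal_power_colon_stabilizes[OF D t] by blast
  show ?thesis
  proof (rule that)
    fix j f assume f: "f \<in> carrier R" "f \<otimes> k \<in> adj N (t [^] (n + j))"
    define a where "a = t [^] n" define b where "b = t [^] j"
    have ab: "a \<in> carrier R" "b \<in> carrier R" "t [^] (n + j) = a \<otimes> b"
      using t by (auto simp: a_def b_def nat_pow_mult)
    obtain x g where 1: "x \<in> N" "x \<in> carrier R" "g \<in> carrier R" "f \<otimes> k = x \<oplus> g \<otimes> (a \<otimes> b)"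
      using f(2) N unfolding ab(3) by (rule adjE)
    have "(a \<otimes> b) \<otimes> g = f \<otimes> k \<ominus> x" unfolding 1(4) by (rule ring_identity, (rule ring_split | simp add: ring_norm 1(2,3) ab)+)
    moreover have "f \<otimes> k \<ominus> x \<in> adj N k"
      using adj_mult_self[OF N k f(1)] adj_incl[OF N k 1(1)] by (rule ideal_minus[OF D])
    ultimately have "a \<otimes> g \<in> adj N k" using n[of g j] 1(3) ab by (simp add: a_def)
    then obtain y u where 2: "y \<in> N" "y \<in> carrier R" "u \<in> carrier R" "a \<otimes> g = y \<oplus> u \<otimes> k"
      using N by (rule adjE)
    have "(f \<ominus> u \<otimes> b) \<otimes> k = f \<otimes> k \<ominus> b \<otimes> u \<otimes> k" by (rule ring_identity, (rule ring_split | simp add: ring_norm 2(3) ab f k)+)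
    also have "\<dots> = x \<oplus> b \<otimes> (a \<otimes> g) \<ominus> b \<otimes> u \<otimes> k"
      unfolding 1(4) by (rule ring_identity, (rule ring_split | simp add: ring_norm 1(2,3) 2(3) ab f k)+)
    also have "\<dots> = x \<oplus> b \<otimes> y" unfolding 2(4) by (rule ring_identity, (rule ring_split | simp add: ring_norm 1(2,3) 2(2,3) ab f k)+)
    also have "\<dots> \<in> N" using 1 2 ab by (simp add: ideal_add[OF N] ideal_mult[OF N])
    finally have "f \<ominus> u \<otimes> b \<in> colon_ideal R N {k}" using f 2(3) ab by (simp add: colon_ideal_def)
    moreover have "f = (f \<ominus> u \<otimes> b) \<oplus> u \<otimes> b" by (rule ring_identity, (rule ring_split | simp add: ring_norm f ab 2(3))+)
    ultimately show "f \<in> adj (colon_ideal R N {k}) (t [^] j)"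
      unfolding b_def[symmetric] using 2(3) by (intro adjI)
  qed
qed

text \<open>The two representations of \<open>f\<close> have remainders differing by an element that
  t^(n+j) multiplies into A + C. By stability t^n already does so, which leaves a correction
  divisible by t^j.\<close>

lemma artin_rees_Int:
  assumes A: "ideal A R" and C: "ideal C R" and t: "t \<in> carrier R"
  obtains n :: nat where "\<And>j f. \<lbrakk>f \<in> adj A (t [^] (n + j)); f \<in> adj C (t [^] (n + j))\<rbrakk> \<Longrightarrow>
    f \<in> adj (A \<inter> C) (t [^] j)"
proof -
  have D: "ideal (A <+>\<^bsub>R\<^esub> C) R" using A C by (rule add_ideals)
  obtain n :: nat where n: "\<And>j g. \<lbrakk>g \<in> carrier R; t [^] (n + j) \<otimes> g \<in> A <+>\<^bsub>R\<^esub> C\<rbrakk> \<Longrightarrow> t [^] n \<otimes> g \<in> A <+>\<^bsub>R\<^esub> C"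
    using ideal_power_colon_stabilizes[OF D t] by blast
  show ?thesis
  proof (rule that)
    fix j f assume f: "f \<in> adj A (t [^] (n + j))" "f \<in> adj C (t [^] (n + j))"
    define a where "a = t [^] n" define b where "b = t [^] j"
    have ab: "a \<in> carrier R" "b \<in> carrier R" "t [^] (n + j) = a \<otimes> b"
      using t by (auto simp: a_def b_def nat_pow_mult)
    obtain x g where 1: "x \<in> A" "x \<in> carrier R" "g \<in> carrier R" "f = x \<oplus> g \<otimes> (a \<otimes> b)"
      using f(1) A unfolding ab(3) by (rule adjE)
    obtain y h where 2: "y \<in> C" "y \<in> carrier R" "h \<in> carrier R" "f = y \<oplus> h \<otimes> (a \<otimes> b)"
      using f(2) C unfolding ab(3) by (rule adjE)
    have "(a \<otimes> b) \<otimes> (h \<ominus> g) = (y \<oplus> h \<otimes> (a \<otimes> b)) \<ominus> (x \<oplus> g \<otimes> (a \<otimes> b)) \<oplus> (x \<ominus> y)"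
      by (rule ring_identity, (rule ring_split | simp add: ring_norm 1(2,3) 2(2,3) ab)+)
    also have "\<dots> = x \<oplus> (\<ominus> y)"
      unfolding 1(4)[symmetric] 2(4)[symmetric] using 1 2 ab
      by (simp add: minus_eq r_neg)
    also have "\<dots> \<in> A <+>\<^bsub>R\<^esub> C"
      unfolding set_add_defs
      by (auto intro!: bexI[OF _ 1(1)] bexI[OF _ additive_subgroup.a_inv_closed[OF ideal.axioms(1)[OF C] 2(1)]])
    finally have D1: "(a \<otimes> b) \<otimes> (h \<ominus> g) \<in> A <+>\<^bsub>R\<^esub> C" .
    have eq1: "x \<ominus> y = (a \<otimes> b) \<otimes> (h \<ominus> g)"
      using \<open>(a \<otimes> b) \<otimes> (h \<ominus> g) = _\<close> \<open>_ = x \<oplus> (\<ominus> y)\<close> by (simp add: minus_eq)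
    have "a \<otimes> (h \<ominus> g) \<in> A <+>\<^bsub>R\<^esub> C"
      using n[of "h \<ominus> g" j] D1 1(3) 2(3) ab by (simp add: a_def)
    then obtain u v where 3: "u \<in> A" "v \<in> C" "a \<otimes> (h \<ominus> g) = u \<oplus> v"
      by (auto simp: set_add_defs)
    have uv: "u \<in> carrier R" "v \<in> carrier R" using 3 A C ideal_carrier by auto
    have "x \<ominus> y = b \<otimes> (a \<otimes> (h \<ominus> g))"
      unfolding eq1 by (rule ring_identity, (rule ring_split | simp add: ring_norm 1(3) 2(3) ab)+)
    then have xy: "x \<ominus> y = b \<otimes> (u \<oplus> v)" using 3 by simp
    define w where "w = x \<ominus> b \<otimes> u"
    have wA: "w \<in> A" unfolding w_def using 1 3 ab by (simp add: ideal_minus[OF A] ideal_mult[OF A])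
    have "w = (x \<ominus> y) \<oplus> (y \<ominus> b \<otimes> u)"
      unfolding w_def by (rule ring_identity, (rule ring_split | simp add: ring_norm 1(2) 2(2) ab uv)+)
    also have "\<dots> = y \<oplus> b \<otimes> v" unfolding xy by (rule ring_identity, (rule ring_split | simp add: ring_norm 1(2) 2(2) ab uv)+)
    also have "\<dots> \<in> C" using 2 3 ab by (simp add: ideal_add[OF C] ideal_mult[OF C])
    finally have wC: "w \<in> C" .
    have "f = w \<oplus> (u \<oplus> g \<otimes> a) \<otimes> b"
      unfolding 1(4) w_def by (rule ring_identity, (rule ring_split | simp add: ring_norm 1(2,3) ab uv)+)
    then show "f \<in> adj (A \<inter> C) (t [^] j)"
      unfolding b_def[symmetric] using wA wC uv 1(3) ab by (intro adjI) auto
  qed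
qed

text \<open>What lifting needs: approximate solutions of fK \<subseteq> N, modulo high powers of
  \<open>t\<close>, are close to true ones. This stands in for passing to the completion.\<close>

lemma artin_rees_colon:
  assumes N: "ideal N R" and t: "t \<in> carrier R" and K: "ideal K R"
  obtains n :: nat where "\<And>j f. \<lbrakk>f \<in> carrier R; \<And>k. k \<in> K \<Longrightarrow> f \<otimes> k \<in> adj N (t [^] (n + j))\<rbrakk> \<Longrightarrow>
    f \<in> adj (colon_ideal R N K) (t [^] j)"
proof -
  have fin: "\<exists>n::nat. \<forall>j. \<forall>f\<in>carrier R. (\<forall>k\<in>set ks. f \<otimes> k \<in> adj N (t [^] (n + j))) \<longrightarrow>
    f \<in> adj (colon_ideal R N (set ks)) (t [^] j)" if "set ks \<subseteq> carrier R" for ks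
    using that
  proof (induction ks)
    case Nil
    have "ideal (carrier R) R" by (rule oneideal)
    then show ?case using t by (auto simp: colon_ideal_def intro: adj_incl)
  next
    case (Cons k ks)
    then have c: "k \<in> carrier R" "set ks \<subseteq> carrier R" by auto
    have ic: "ideal (colon_ideal R N {k}) R" "ideal (colon_ideal R N (set ks)) R"
      using N c by (auto intro!: ideal_colon)
    obtain n1 :: nat where 1: "\<And>j f. \<lbrakk>f \<in> carrier R; \<forall>k\<in>set ks. f \<otimes> k \<in> adj N (t [^] (n1 + j))\<rbrakk> \<Longrightarrow>
      f \<in> adj (colon_ideal R N (set ks)) (t [^] j)" using Cons by auto
    obtain n2 :: nat where 2: "\<And>j f. \<lbrakk>f \<in> carrier R; f \<otimes> k \<in> adj N (t [^] (n2 + j))\<rbrakk> \<Longrightarrow>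
      f \<in> adj (colon_ideal R N {k}) (t [^] j)" using artin_rees_colon_single[OF N t c(1)] by blast
    obtain n3 :: nat where 3: "\<And>j f. \<lbrakk>f \<in> adj (colon_ideal R N {k}) (t [^] (n3 + j));
        f \<in> adj (colon_ideal R N (set ks)) (t [^] (n3 + j))\<rbrakk> \<Longrightarrow>
      f \<in> adj (colon_ideal R N {k} \<inter> colon_ideal R N (set ks)) (t [^] j)"
      using artin_rees_Int[OF ic t] by blast
    have eq: "colon_ideal R N {k} \<inter> colon_ideal R N (set ks) = colon_ideal R N (set (k # ks))"
      by (auto simp: colon_ideal_def)
    show ?case
    proof (intro exI[of _ "n1 + n2 + n3"] allI ballI impI)
      fix j f assume f: "f \<in> carrier R" "\<forall>l\<in>set (k # ks). f \<otimes> l \<in> adj N (t [^] (n1 + n2 + n3 + j))"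
      have e: "n1 + n2 + n3 + j = (n1 + (n3 + j)) + n2" "n1 + n2 + n3 + j = (n2 + (n3 + j)) + n1"
        by auto
      have "f \<in> adj (colon_ideal R N (set ks)) (t [^] (n3 + j))"
        using f(2) adj_pow_antimono[OF N t, of _ "n1 + (n3 + j)" n2] unfolding e(1) by (intro 1 f(1)) auto
      moreover have "f \<in> adj (colon_ideal R N {k}) (t [^] (n3 + j))"
        using f(2) adj_pow_antimono[OF N t, of _ "n2 + (n3 + j)" n1] unfolding e(2) by (intro 2 f(1)) auto
      ultimately show "f \<in> adj (colon_ideal R N (set (k # ks))) (t [^] j)" using 3 eq by metis
    qed
  qed
  obtain ks where ks: "set ks \<subseteq> carrier R" "K = Idl (set ks)" using K by (rule ideal_list_generators)
  have "set ks \<subseteq> K" using ks genideal_self by blast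
  then show ?thesis using fin[OF ks(1)] that colon_genideal[OF N ks(1)] ks(2) by (metis subsetD)
qed

end

lemma (in ring_hom_cring) hom_minus [simp]:
  "\<lbrakk>x \<in> carrier R; y \<in> carrier R\<rbrakk> \<Longrightarrow> h (x \<ominus>\<^bsub>R\<^esub> y) = h x \<ominus>\<^bsub>S\<^esub> h y"
  by (simp add: a_minus_def)

section \<open>Reduction modulo a regular element\<close>

locale surjective_hom = ring_hom_cring S T ev for S (structure) and T (structure) and ev +
  assumes surj: "ev ` carrier S = carrier T"
begin

lemma ideal_image: assumes N: "ideal N S" shows "ideal (ev ` N) T"
proof (rule S.ideal_closedI)
  show "ev ` N \<subseteq> carrier T" using N R.ideal_subset_carrier by auto
  show "\<zero>\<^bsub>T\<^esub> \<in> ev ` N" using R.ideal_zero[OF N] hom_zero by (metis imageI)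
next
  fix x y assume "x \<in> ev ` N" "y \<in> ev ` N"
  then obtain a b where "a \<in> N" "b \<in> N" "x = ev a" "y = ev b" by blast
  then show "x \<oplus>\<^bsub>T\<^esub> y \<in> ev ` N"
    using R.ideal_add[OF N] R.ideal_carrier[OF N] by (auto intro!: image_eqI[of _ ev "a \<oplus> b"])
next
  fix r x assume "r \<in> carrier T" "x \<in> ev ` N"
  then obtain a b where "a \<in> carrier S" "b \<in> N" "r = ev a" "x = ev b" using surj by blast
  then show "r \<otimes>\<^bsub>T\<^esub> x \<in> ev ` N"
    using R.ideal_mult[OF N] R.ideal_carrier[OF N] by (auto intro!: image_eqI[of _ ev "a \<otimes> b"])
qed

lemma image_adj: assumes N: "ideal N S" and y: "y \<in> carrier S"
  shows "ev ` R.adj N y = S.adj (ev ` N) (ev y)"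
proof
  show "ev ` R.adj N y \<subseteq> S.adj (ev ` N) (ev y)"
  proof
    fix x assume "x \<in> ev ` R.adj N y"
    then obtain n r where "n \<in> N" "r \<in> carrier S" "x = ev (n \<oplus> r \<otimes> y)"
      unfolding R.adj_def by blast
    then show "x \<in> S.adj (ev ` N) (ev y)"
      using R.ideal_carrier[OF N] y by (intro S.adjI[of "ev n" _ "ev r"]) auto
  qed
  show "S.adj (ev ` N) (ev y) \<subseteq> ev ` R.adj N y"
  proof
    fix x assume "x \<in> S.adj (ev ` N) (ev y)"
    then obtain n r where "n \<in> N" "r \<in> carrier S" "x = ev n \<oplus>\<^bsub>T\<^esub> ev r \<otimes>\<^bsub>T\<^esub> ev y"
      unfolding S.adj_def surj[symmetric] by auto
    moreover from this have "x = ev (n \<oplus> r \<otimes> y)" using R.ideal_carrier[OF N] y by simp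
    ultimately show "x \<in> ev ` R.adj N y" unfolding R.adj_def by blast
  qed
qed

lemma image_adjl:
  "\<lbrakk>ideal N S; set ys \<subseteq> carrier S\<rbrakk> \<Longrightarrow> ev ` R.adjl N ys = S.adjl (ev ` N) (map ev ys)"
  by (induction ys arbitrary: N) (auto simp: image_adj R.ideal_adj)

end

text \<open>\<open>T\<close> is the quotient of the local ring \<open>S\<close> by the regular
  element \<open>t\<close> of its maximal ideal, presented by the map \<open>ev\<close>.\<close>

locale lifting = S?: local_noetherian S n + T: local_noetherian_infinite T m B + surjective_hom S T ev
  for S (structure) and n and T (structure) and m B ev +
  fixes t
  assumes t_n: "t \<in> n" and t_reg: "S.reg {\<zero>} t" and ev_t: "ev t = \<zero>\<^bsub>T\<^esub>"
    and kernel: "\<lbrakk>s \<in> carrier S; ev s = \<zero>\<^bsub>T\<^esub>\<rbrakk> \<Longrightarrow> \<exists>r\<in>carrier S. s = t \<otimes> r"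
begin

lemma t_carrier: "t \<in> carrier S"
  using t_n by (rule S.m_carrier)

lemma kernel_diff:
  assumes "x \<in> carrier S" "y \<in> carrier S" "ev x = ev y"
  obtains r where "r \<in> carrier S" "x = y \<oplus> r \<otimes> t"
proof -
  have "ev (x \<ominus> y) = \<zero>\<^bsub>T\<^esub>" using assms by (simp add: T.minus_eq T.r_neg)
  then obtain r where r: "r \<in> carrier S" "x \<ominus> y = t \<otimes> r" using kernel assms by blast
  have "x = y \<oplus> (x \<ominus> y)" by (rule S.ring_identity, (rule S.ring_split | simp add: S.ring_norm assms)+)
  then have "x = y \<oplus> r \<otimes> t" using r t_carrier by (simp add: S.m_comm)
  then show ?thesis using r that by blast
qed

lemma ev_mem_image_iff:
  assumes N: "ideal N S" and s: "s \<in> carrier S"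
  shows "ev s \<in> ev ` N \<longleftrightarrow> s \<in> S.adj N t"
proof
  assume "ev s \<in> ev ` N"
  then obtain x where x: "x \<in> N" "ev s = ev x" by blast
  then obtain r where "r \<in> carrier S" "s = x \<oplus> r \<otimes> t"
    using kernel_diff[OF s S.ideal_carrier[OF N x(1)]] by blast
  then show "s \<in> S.adj N t" using x by (auto intro: S.adjI)
next
  assume "s \<in> S.adj N t"
  then obtain x r where 1: "x \<in> N" "x \<in> carrier S" "r \<in> carrier S" "s = x \<oplus> r \<otimes> t"
    using N by (rule S.adjE)
  then have "ev s = ev x" using t_carrier by (simp add: ev_t)
  then show "ev s \<in> ev ` N" using 1 by blast
qed

lemma reg_lift:
  assumes N: "ideal N S" and y: "y \<in> carrier S" and r: "T.reg (ev ` N) (ev y)"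
  shows "S.reg (S.adj N t) y"
proof (rule S.regI[OF y])
  fix s assume s: "s \<in> carrier S" "s \<otimes> y \<in> S.adj N t"
  then have "ev s \<otimes>\<^bsub>T\<^esub> ev y \<in> ev ` N" using ev_mem_image_iff[OF N, of "s \<otimes> y"] y by simp
  then have "ev s \<in> ev ` N" using T.regD[OF r] s by simp
  then show "s \<in> S.adj N t" using ev_mem_image_iff[OF N s(1)] by simp
qed

lemma regm_lift:
  "\<lbrakk>ideal N S; set ys \<subseteq> carrier S; T.regm (ev ` N) (map ev ys)\<rbrakk> \<Longrightarrow> S.regm (S.adj N t) ys"
proof (induction ys arbitrary: N)
  case (Cons y ys)
  then have "S.reg (S.adj N t) y" by (intro reg_lift) auto
  moreover have "S.regm (S.adj (S.adj N y) t) ys"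
    using Cons by (intro Cons.IH) (auto simp: S.ideal_adj image_adj)
  ultimately show ?case using S.adj_commute[of N t y] Cons.prems t_carrier by simp
qed simp

lemma image_zero: "ev ` {\<zero>} = {\<zero>\<^bsub>T\<^esub>}"
  by simp

context
  fixes K N :: "'a set"
  assumes N: "ideal N S" and K: "ideal K S" and NK: "N \<subseteq> K"
    and tN: "S.reg N t" and tK: "S.reg K t"
    and E: "T.homs_are_mult (ev ` N) (ev ` K)"
begin

lemma Kc: "k \<in> K \<Longrightarrow> k \<in> carrier S"
  using K by (rule S.ideal_carrier)

text \<open>Dividing fk by t^j modulo \<open>N\<close> defines a map on \<open>K\<close> that
  induces a homomorphism from the image of \<open>K\<close> to \<open>T\<close> modulo the image of
  \<open>N\<close>. By \<open>E\<close> it is multiplication by some element, and subtracting t^j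
  times a lift of that element from \<open>f\<close> gains one power of \<open>t\<close>.\<close>

lemma lift_colon_step:
  assumes f: "f \<in> carrier S" and fK: "\<And>k. k \<in> K \<Longrightarrow> f \<otimes> k \<in> S.adj N (t [^] (j::nat))"
  shows "\<exists>e\<in>carrier S. \<forall>k\<in>K. (f \<ominus> t [^] j \<otimes> e) \<otimes> k \<in> S.adj N (t [^] Suc j)"
proof -
  note t = t_carrier
  define a where "a = t [^] j"
  have a: "a \<in> carrier S" "S.reg N a" using t S.reg_pow[OF tN] by (auto simp: a_def)
  have "\<exists>z. z \<in> carrier S \<and> f \<otimes> k \<ominus> a \<otimes> z \<in> N" if k: "k \<in> K" for k
  proof -
    obtain x g where 1: "x \<in> N" "x \<in> carrier S" "g \<in> carrier S" "f \<otimes> k = x \<oplus> g \<otimes> a"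
      using fK[OF k] N unfolding a_def by (rule S.adjE)
    have "f \<otimes> k \<ominus> a \<otimes> g = x" unfolding 1(4) using 1(2,3) a(1) by algebra
    then show ?thesis using 1(1,3) by metis
  qed
  then obtain \<phi> where \<phi>: "\<And>k. k \<in> K \<Longrightarrow> \<phi> k \<in> carrier S" "\<And>k. k \<in> K \<Longrightarrow> f \<otimes> k \<ominus> a \<otimes> \<phi> k \<in> N"
    by metis
  have \<phi>add: "\<phi> (k \<oplus> l) \<ominus> (\<phi> k \<oplus> \<phi> l) \<in> N" if k: "k \<in> K" and l: "l \<in> K" for k l
  proof -
    have kl: "k \<oplus> l \<in> K" using K k l by (rule S.ideal_add)
    define p where "p = \<phi> k" define q where "q = \<phi> l" define r where "r = \<phi> (k \<oplus> l)"
    have c: "p \<in> carrier S" "q \<in> carrier S" "r \<in> carrier S" "k \<in> carrier S" "l \<in> carrier S"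
      using \<phi> k l kl Kc by (auto simp: p_def q_def r_def)
    have "f \<otimes> k \<ominus> a \<otimes> p \<in> N" "f \<otimes> l \<ominus> a \<otimes> q \<in> N" "f \<otimes> (k \<oplus> l) \<ominus> a \<otimes> r \<in> N"
      using \<phi> k l kl by (auto simp: p_def q_def r_def)
    then have "(f \<otimes> k \<ominus> a \<otimes> p) \<oplus> (f \<otimes> l \<ominus> a \<otimes> q) \<ominus> (f \<otimes> (k \<oplus> l) \<ominus> a \<otimes> r) \<in> N"
      by (simp add: S.ideal_add[OF N] S.ideal_minus[OF N])
    moreover have "(f \<otimes> k \<ominus> a \<otimes> p) \<oplus> (f \<otimes> l \<ominus> a \<otimes> q) \<ominus> (f \<otimes> (k \<oplus> l) \<ominus> a \<otimes> r) = a \<otimes> (r \<ominus> (p \<oplus> q))"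
      by (rule S.ring_identity, (rule S.ring_split | simp add: S.ring_norm c f a)+)
    ultimately show ?thesis using S.regD'[OF a(2)] c by (simp add: p_def q_def r_def)
  qed
  have \<phi>mult: "\<phi> (s \<otimes> k) \<ominus> s \<otimes> \<phi> k \<in> N" if s: "s \<in> carrier S" and k: "k \<in> K" for s k
  proof -
    have sk: "s \<otimes> k \<in> K" using K k s by (rule S.ideal_mult)
    define p where "p = \<phi> k" define r where "r = \<phi> (s \<otimes> k)"
    have c: "p \<in> carrier S" "r \<in> carrier S" "k \<in> carrier S"
      using \<phi> k sk Kc by (auto simp: p_def r_def)
    have "f \<otimes> k \<ominus> a \<otimes> p \<in> N" "f \<otimes> (s \<otimes> k) \<ominus> a \<otimes> r \<in> N"
      using \<phi> k sk by (auto simp: p_def r_def)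
    then have "s \<otimes> (f \<otimes> k \<ominus> a \<otimes> p) \<ominus> (f \<otimes> (s \<otimes> k) \<ominus> a \<otimes> r) \<in> N"
      using s by (simp add: S.ideal_mult[OF N] S.ideal_minus[OF N])
    moreover have "s \<otimes> (f \<otimes> k \<ominus> a \<otimes> p) \<ominus> (f \<otimes> (s \<otimes> k) \<ominus> a \<otimes> r) = a \<otimes> (r \<ominus> s \<otimes> p)"
      by (rule S.ring_identity, (rule S.ring_split | simp add: S.ring_norm c f a s)+)
    ultimately show ?thesis using S.regD'[OF a(2)] c s by (simp add: p_def r_def)
  qed
  have \<phi>N: "\<phi> k \<in> N" if k: "k \<in> N" for k
  proof -
    have kK: "k \<in> K" using k NK by blast
    define p where "p = \<phi> k"
    have c: "p \<in> carrier S" "k \<in> carrier S" using \<phi> kK Kc by (auto simp: p_def)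
    have "f \<otimes> k \<ominus> (f \<otimes> k \<ominus> a \<otimes> p) \<in> N"
      using \<phi>(2)[OF kK] k f by (simp add: S.ideal_mult[OF N] S.ideal_minus[OF N] p_def)
    moreover have "f \<otimes> k \<ominus> (f \<otimes> k \<ominus> a \<otimes> p) = a \<otimes> p" by (rule S.ring_identity, (rule S.ring_split | simp add: S.ring_norm c f a)+)
    ultimately show ?thesis using S.regD'[OF a(2)] c by (simp add: p_def)
  qed
  have Nt: "ideal (S.adj N t) S" "N \<subseteq> S.adj N t" using N t by (auto intro: S.ideal_adj S.adj_incl)
  \<comment> \<open>Regularity of \<open>t\<close> modulo \<open>K\<close> enters here: elements of
    \<open>K\<close> with equal images differ by \<open>t\<close> times an element of
    \<open>K\<close>.\<close>
  have cong: "\<phi> x \<ominus> \<phi> y \<in> S.adj N t" if x: "x \<in> K" and y: "y \<in> K" and xy: "ev x = ev y" for x y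
  proof -
    obtain r where r: "r \<in> carrier S" "x = y \<oplus> r \<otimes> t" using kernel_diff[OF Kc[OF x] Kc[OF y] xy] .
    have "r \<otimes> t = x \<ominus> y" unfolding r(2) using r(1) t Kc[OF y] by algebra
    then have "r \<otimes> t \<in> K" using S.ideal_minus[OF K x y] by simp
    then have rK: "r \<in> K" using S.regD[OF tK r(1)] by blast
    have rtK: "t \<otimes> r \<in> K" using K rK t by (rule S.ideal_mult)
    define p where "p = \<phi> x" define q where "q = \<phi> y" define u where "u = \<phi> (t \<otimes> r)" define v where "v = \<phi> r"
    have c: "p \<in> carrier S" "q \<in> carrier S" "u \<in> carrier S" "v \<in> carrier S"
      using \<phi> x y rtK rK by (auto simp: p_def q_def u_def v_def)
    have "p \<ominus> (q \<oplus> u) \<in> N" using \<phi>add[OF y rtK] r t by (simp add: p_def q_def u_def S.m_comm)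
    moreover have "u \<ominus> t \<otimes> v \<in> N" using \<phi>mult[OF t rK] by (simp add: u_def v_def)
    moreover have "t \<otimes> v \<in> S.adj N t" using S.adj_mult_self[OF N t c(4)] c t by (simp add: S.m_comm)
    ultimately have "(p \<ominus> (q \<oplus> u)) \<oplus> (u \<ominus> t \<otimes> v) \<oplus> t \<otimes> v \<in> S.adj N t"
      using Nt(2) by (simp add: S.ideal_add[OF Nt(1)] subset_iff)
    moreover have "(p \<ominus> (q \<oplus> u)) \<oplus> (u \<ominus> t \<otimes> v) \<oplus> t \<otimes> v = p \<ominus> q"
      by (rule S.ring_identity, (rule S.ring_split | simp add: S.ring_norm c t)+)
    ultimately show ?thesis by (simp add: p_def q_def)
  qed
  \<comment> \<open>A choice of preimages in \<open>K\<close>; by \<open>cong\<close> another choice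
    would change \<psi> only within the image of \<open>N\<close>.\<close>
  define g where "g = inv_into K ev"
  have g: "g x \<in> K" "ev (g x) = x" if "x \<in> ev ` K" for x
    using that by (auto simp: g_def inv_into_into f_inv_into_f)
  define \<psi> where "\<psi> x = ev (\<phi> (g x))" for x
  have \<psi>ev: "ev (\<phi> k) \<ominus>\<^bsub>T\<^esub> \<psi> (ev k) \<in> ev ` N" if k: "k \<in> K" for k
  proof -
    have gk: "g (ev k) \<in> K" "ev (g (ev k)) = ev k" using g k by auto
    have "\<phi> k \<ominus> \<phi> (g (ev k)) \<in> S.adj N t" using cong[OF k gk(1)] gk(2) by simp
    then have "ev (\<phi> k \<ominus> \<phi> (g (ev k))) \<in> ev ` N"
      using ev_mem_image_iff[OF N] \<phi>(1) k gk(1) by blast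
    then show ?thesis using \<phi>(1) k gk(1) by (simp add: \<psi>_def)
  qed
  have iN: "ideal (ev ` N) T" using N by (rule ideal_image)
  have iK: "ideal (ev ` K) T" using K by (rule ideal_image)
  have evN: "ev s \<in> ev ` N" if "s \<in> N" for s using that by blast
  have "T.hom_mod (ev ` N) (ev ` K) \<psi>"
    unfolding T.hom_mod_def
  proof (intro conjI ballI)
    fix x assume "x \<in> ev ` K" then show "\<psi> x \<in> carrier T" using g \<phi>(1) by (simp add: \<psi>_def)
  next
    fix x y assume xy: "x \<in> ev ` K" "y \<in> ev ` K"
    define k l where "k = g x" and "l = g y"
    have kl: "k \<in> K" "l \<in> K" "ev k = x" "ev l = y" using g xy by (auto simp: k_def l_def)
    have klK: "k \<oplus> l \<in> K" using K kl by (intro S.ideal_add)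
    have ekl: "ev (k \<oplus> l) = x \<oplus>\<^bsub>T\<^esub> y" using kl Kc by simp
    define P where "P = ev (\<phi> k)" define Q where "Q = ev (\<phi> l)" define U where "U = ev (\<phi> (k \<oplus> l))"
    define V where "V = \<psi> (x \<oplus>\<^bsub>T\<^esub> y)"
    have "x \<oplus>\<^bsub>T\<^esub> y \<in> ev ` K" using iK xy by (rule T.ideal_add)
    then have c: "P \<in> carrier T" "Q \<in> carrier T" "U \<in> carrier T" "V \<in> carrier T"
      using \<phi>(1) kl klK g by (auto simp: P_def Q_def U_def V_def \<psi>_def)
    have "U \<ominus>\<^bsub>T\<^esub> V \<in> ev ` N" using \<psi>ev[OF klK] by (simp add: U_def V_def ekl)
    moreover have "U \<ominus>\<^bsub>T\<^esub> (P \<oplus>\<^bsub>T\<^esub> Q) \<in> ev ` N"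
      using evN[OF \<phi>add[OF kl(1,2)]] \<phi>(1) kl klK by (simp add: P_def Q_def U_def)
    moreover have "V \<ominus>\<^bsub>T\<^esub> (P \<oplus>\<^bsub>T\<^esub> Q) = (U \<ominus>\<^bsub>T\<^esub> (P \<oplus>\<^bsub>T\<^esub> Q)) \<ominus>\<^bsub>T\<^esub> (U \<ominus>\<^bsub>T\<^esub> V)"
      by (rule T.ring_identity, (rule T.ring_split | simp add: T.ring_norm c)+)
    ultimately have "V \<ominus>\<^bsub>T\<^esub> (P \<oplus>\<^bsub>T\<^esub> Q) \<in> ev ` N" using T.ideal_minus[OF iN] by simp
    then show "\<psi> (x \<oplus>\<^bsub>T\<^esub> y) \<ominus>\<^bsub>T\<^esub> (\<psi> x \<oplus>\<^bsub>T\<^esub> \<psi> y) \<in> ev ` N"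
      by (simp add: V_def P_def Q_def \<psi>_def k_def l_def)
  next
    fix r x assume r: "r \<in> carrier T" and x: "x \<in> ev ` K"
    obtain s where s: "s \<in> carrier S" "r = ev s" using r surj by blast
    define k where "k = g x"
    have kl: "k \<in> K" "ev k = x" using g x by (auto simp: k_def)
    have klK: "s \<otimes> k \<in> K" using K kl s by (intro S.ideal_mult)
    have ekl: "ev (s \<otimes> k) = r \<otimes>\<^bsub>T\<^esub> x" using kl Kc s by simp
    define P where "P = ev (\<phi> k)" define U where "U = ev (\<phi> (s \<otimes> k))"
    define V where "V = \<psi> (r \<otimes>\<^bsub>T\<^esub> x)"
    have "r \<otimes>\<^bsub>T\<^esub> x \<in> ev ` K" using iK x r by (rule T.ideal_mult)
    then have c: "P \<in> carrier T" "U \<in> carrier T" "V \<in> carrier T"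
      using \<phi>(1) kl klK g by (auto simp: P_def U_def V_def \<psi>_def)
    have "U \<ominus>\<^bsub>T\<^esub> V \<in> ev ` N" using \<psi>ev[OF klK] by (simp add: U_def V_def ekl)
    moreover have "U \<ominus>\<^bsub>T\<^esub> r \<otimes>\<^bsub>T\<^esub> P \<in> ev ` N"
      using evN[OF \<phi>mult[OF s(1) kl(1)]] \<phi>(1) kl klK s by (simp add: P_def U_def)
    moreover have "V \<ominus>\<^bsub>T\<^esub> r \<otimes>\<^bsub>T\<^esub> P = (U \<ominus>\<^bsub>T\<^esub> r \<otimes>\<^bsub>T\<^esub> P) \<ominus>\<^bsub>T\<^esub> (U \<ominus>\<^bsub>T\<^esub> V)"
      by (rule T.ring_identity, (rule T.ring_split | simp add: T.ring_norm c r)+)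
    ultimately have "V \<ominus>\<^bsub>T\<^esub> r \<otimes>\<^bsub>T\<^esub> P \<in> ev ` N" using T.ideal_minus[OF iN] by simp
    then show "\<psi> (r \<otimes>\<^bsub>T\<^esub> x) \<ominus>\<^bsub>T\<^esub> r \<otimes>\<^bsub>T\<^esub> \<psi> x \<in> ev ` N"
      by (simp add: V_def P_def \<psi>_def k_def)
  next
    fix x assume "x \<in> ev ` N"
    then obtain z where z: "z \<in> N" "x = ev z" by blast
    have zK: "z \<in> K" using z NK by blast
    have "ev (\<phi> z) \<ominus>\<^bsub>T\<^esub> \<psi> (ev z) \<in> ev ` N" by (rule \<psi>ev[OF zK])
    moreover have "ev (\<phi> z) \<in> ev ` N" using \<phi>N[OF z(1)] by blast
    ultimately show "\<psi> x \<in> ev ` N"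
      using T.ideal_diff_iff[OF iN, of "ev (\<phi> z)" "\<psi> (ev z)"] \<phi>(1)[OF zK] \<phi>(1)[OF g(1)] zK z(2)
      by (simp add: \<psi>_def)
  qed
  from E[unfolded T.homs_are_mult_def, rule_format, OF this]
  obtain e' where e': "e' \<in> carrier T" "\<And>x. x \<in> ev ` K \<Longrightarrow> \<psi> x \<ominus>\<^bsub>T\<^esub> e' \<otimes>\<^bsub>T\<^esub> x \<in> ev ` N"
    by blast
  obtain e where e: "e \<in> carrier S" "e' = ev e" using e'(1) surj by blast
  have "(f \<ominus> a \<otimes> e) \<otimes> k \<in> S.adj N (a \<otimes> t)" if k: "k \<in> K" for k
  proof -
    define p where "p = \<phi> k"
    have c: "p \<in> carrier S" "k \<in> carrier S" using \<phi> k Kc by (auto simp: p_def)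
    define V where "V = \<psi> (ev k)"
    have Vc: "V \<in> carrier T" using \<phi>(1) g k by (simp add: V_def \<psi>_def)
    have "(ev p \<ominus>\<^bsub>T\<^esub> V) \<oplus>\<^bsub>T\<^esub> (V \<ominus>\<^bsub>T\<^esub> e' \<otimes>\<^bsub>T\<^esub> ev k) \<in> ev ` N"
      using \<psi>ev[OF k] e'(2)[of "ev k"] k by (intro T.ideal_add[OF iN]) (auto simp: V_def p_def)
    moreover have "(P \<ominus>\<^bsub>T\<^esub> V) \<oplus>\<^bsub>T\<^esub> (V \<ominus>\<^bsub>T\<^esub> e' \<otimes>\<^bsub>T\<^esub> Q) = P \<ominus>\<^bsub>T\<^esub> e' \<otimes>\<^bsub>T\<^esub> Q"
      if "P \<in> carrier T" "Q \<in> carrier T" for P Q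
      by (rule T.ring_identity, (rule T.ring_split | simp add: T.ring_norm that Vc e')+)
    ultimately have "ev p \<ominus>\<^bsub>T\<^esub> e' \<otimes>\<^bsub>T\<^esub> ev k \<in> ev ` N" using c by simp
    then have "ev (p \<ominus> e \<otimes> k) \<in> ev ` N" using c e by simp
    then have "p \<ominus> e \<otimes> k \<in> S.adj N t"
      using ev_mem_image_iff[OF N, of "p \<ominus> e \<otimes> k"] c e(1) by blast
    then obtain x r where 1: "x \<in> N" "x \<in> carrier S" "r \<in> carrier S" "p \<ominus> e \<otimes> k = x \<oplus> r \<otimes> t"
      using N by (rule S.adjE)
    have "(f \<ominus> a \<otimes> e) \<otimes> k = (f \<otimes> k \<ominus> a \<otimes> p) \<oplus> a \<otimes> (p \<ominus> e \<otimes> k)"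
      by (rule S.ring_identity, (rule S.ring_split | simp add: S.ring_norm c f a e)+)
    also have "\<dots> = ((f \<otimes> k \<ominus> a \<otimes> p) \<oplus> a \<otimes> x) \<oplus> r \<otimes> (a \<otimes> t)"
      unfolding 1(4) by (rule S.ring_identity, (rule S.ring_split | simp add: S.ring_norm c f a 1(2,3) t)+)
    finally show ?thesis
      using \<phi>(2)[OF k] 1 a(1)
      by (intro S.adjI[of "(f \<otimes> k \<ominus> a \<otimes> p) \<oplus> a \<otimes> x"])
        (simp_all add: S.ideal_add[OF N] S.ideal_mult[OF N] p_def)
  qed
  then show ?thesis using e(1) by (auto simp: a_def)
qed

text \<open>Corrections are accumulated until the exponent passes the Artin-Rees bound. The
  corrected element then lies in N : K up to a multiple of \<open>t\<close>, and it differs from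
  \<open>r\<close> by a multiple of \<open>t\<close>.\<close>

lemma lift_colon:
  assumes r: "r \<in> carrier S" and rK: "\<And>k. k \<in> K \<Longrightarrow> r \<otimes> k \<in> S.adj N t"
  shows "r \<in> S.adj (colon_ideal S N K) t"
proof -
  note t = t_carrier
  have iter: "\<exists>e\<in>carrier S. \<forall>k\<in>K. (r \<ominus> t \<otimes> e) \<otimes> k \<in> S.adj N (t [^] Suc j)" for j
  proof (induction j)
    case 0
    show ?case using rK r t by (intro bexI[of _ \<zero>]) (simp_all add: S.minus_eq)
  next
    case (Suc j)
    then obtain e where e: "e \<in> carrier S" "\<And>k. k \<in> K \<Longrightarrow> (r \<ominus> t \<otimes> e) \<otimes> k \<in> S.adj N (t [^] Suc j)"
      by blast
    obtain e' where e': "e' \<in> carrier S"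
      "\<And>k. k \<in> K \<Longrightarrow> ((r \<ominus> t \<otimes> e) \<ominus> t [^] Suc j \<otimes> e') \<otimes> k \<in> S.adj N (t [^] Suc (Suc j))"
      using lift_colon_step[OF _ e(2)] r t e(1) by auto
    define a where "a = t [^] j"
    have a: "a \<in> carrier S" using t by (simp add: a_def)
    have "(r \<ominus> t \<otimes> e) \<ominus> a \<otimes> t \<otimes> e' = r \<ominus> t \<otimes> (e \<oplus> a \<otimes> e')"
      by (rule S.ring_identity, (rule S.ring_split | simp add: S.ring_norm a e(1) e'(1) t r)+)
    then have "(r \<ominus> t \<otimes> (e \<oplus> a \<otimes> e')) \<otimes> k \<in> S.adj N (t [^] Suc (Suc j))" if "k \<in> K" for k
      using e'(2)[OF that] by (simp add: a_def)
    then show ?case using a e(1) e'(1) by (intro bexI[of _ "e \<oplus> a \<otimes> e'"]) auto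
  qed
  obtain i :: nat where i: "\<And>j f. \<lbrakk>f \<in> carrier S; \<And>k. k \<in> K \<Longrightarrow> f \<otimes> k \<in> S.adj N (t [^] (i + j))\<rbrakk> \<Longrightarrow>
    f \<in> S.adj (colon_ideal S N K) (t [^] j)" using S.artin_rees_colon[OF N t K] by blast
  obtain e where e: "e \<in> carrier S" "\<And>k. k \<in> K \<Longrightarrow> (r \<ominus> t \<otimes> e) \<otimes> k \<in> S.adj N (t [^] (i + 1))"
    using iter[of i] by auto
  have C: "ideal (colon_ideal S N K) S" using N Kc by (intro S.ideal_colon) auto
  have "r \<ominus> t \<otimes> e \<in> S.adj (colon_ideal S N K) (t [^] (1::nat))"
    using r t e by (intro i) auto
  then have "r \<ominus> t \<otimes> e \<in> S.adj (colon_ideal S N K) t" using t by (simp add: S.nat_pow_eone)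
  moreover have "t \<otimes> e \<in> S.adj (colon_ideal S N K) t"
    using S.adj_mult_self[OF C t e(1)] t e(1) by (simp add: S.m_comm)
  ultimately show ?thesis
    using S.ideal_diff_iff[OF S.ideal_adj[OF C t], of r "t \<otimes> e"] r t e(1) by simp
qed

end

text \<open>The new link is N : K, with \<open>N\<close> the ideal of the lifted sequence. Its image
  is \<open>K'\<close> by \<open>lift_colon\<close>, and Nakayama's lemma reduces the double colon
  to the one in \<open>T\<close>. Any preimages of the sequence inside \<open>K\<close> may serve as
  \<open>ys\<close>; this freedom is what lets the first element be deformed.\<close>

lemma lift_link:
  assumes xs: "T.linked_by (map ev ys) (ev ` K) K'" and c: "T.linked_to_unit c K'"
    and proper: "ev ` K \<noteq> carrier T"
    and K: "ideal K S" and tK: "S.reg K t" and ys: "set ys \<subseteq> K"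
  obtains K'' where "S.linked_by ys K K''" "S.reg K'' t" "ev ` K'' = K'"
proof -
  note t = t_carrier
  have ysc: "set ys \<subseteq> carrier S" using ys K S.ideal_subset_carrier by blast
  have Kc: "K \<subseteq> carrier S" using K by (rule S.ideal_subset_carrier)
  define N where "N = S.adjl {\<zero>} ys"
  have N: "ideal N S" unfolding N_def using ysc by (intro S.ideal_adjl S.zeroideal)
  have NK: "N \<subseteq> K" unfolding N_def using ys K S.ideal_zero by (intro S.adjl_subset) auto
  define A where "A = T.adjl {\<zero>\<^bsub>T\<^esub>} (map ev ys)"
  have evN: "ev ` N = A" unfolding N_def A_def using image_adjl[OF S.zeroideal ysc] image_zero by simp
  have "S.regm (S.adj {\<zero>} t) ys"
    using T.linked_byD(1)[OF xs] image_zero by (intro regm_lift S.zeroideal ysc) simp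
  then have r: "S.regm {\<zero>} ys" "S.reg N t"
    using S.regm_front_to_last[OF S.zeroideal t_n t_reg] by (auto simp: N_def)
  have E: "T.homs_are_mult (ev ` N) (ev ` K)"
    using T.linked_to_unit_ext_reflexive[OF c xs proper] by (simp add: T.ext_reflexive_def evN A_def)
  have KA: "ev ` K = colon_ideal T A K'" "K' = colon_ideal T A (ev ` K)"
    using T.linked_by_colon[OF xs] unfolding A_def by blast+
  define K'' where "K'' = colon_ideal S N K"
  have K'': "ideal K'' S" unfolding K''_def using N Kc by (rule S.ideal_colon)
  have K''c: "K'' \<subseteq> carrier S" using K'' by (rule S.ideal_subset_carrier)
  have tK'': "S.reg (colon_ideal S N L) t" if "L \<subseteq> carrier S" for L
  proof (rule S.regI[OF t])
    fix s assume s: "s \<in> carrier S" "s \<otimes> t \<in> colon_ideal S N L"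
    have "s \<otimes> l \<in> N" if "l \<in> L" for l
    proof -
      have l: "l \<in> carrier S" using that \<open>L \<subseteq> carrier S\<close> by blast
      have "(s \<otimes> l) \<otimes> t = (s \<otimes> t) \<otimes> l" using s l t by (simp add: S.m_ac)
      also have "\<dots> \<in> N" using s(2) that by (simp add: colon_ideal_def)
      finally show ?thesis using S.regD[OF r(2)] s l by simp
    qed
    then show "s \<in> colon_ideal S N L" using s by (simp add: colon_ideal_def)
  qed
  have img: "ev ` K'' = K'"
  proof
    show "ev ` K'' \<subseteq> K'"
    proof
      fix x assume "x \<in> ev ` K''"
      then obtain s where s: "s \<in> carrier S" "x = ev s" "\<And>k. k \<in> K \<Longrightarrow> s \<otimes> k \<in> N"
        by (auto simp: K''_def colon_ideal_def)
      have "ev s \<otimes>\<^bsub>T\<^esub> ev k \<in> A" if "k \<in> K" for k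
        using s(1) s(3)[OF that] Kc that unfolding evN[symmetric] by (auto simp flip: hom_mult)
      then have "ev s \<in> colon_ideal T A (ev ` K)" using s(1) by (simp add: colon_ideal_def)
      then show "x \<in> K'" using KA(2) s(2) by simp
    qed
    show "K' \<subseteq> ev ` K''"
    proof
      fix x assume "x \<in> K'"
      then have x: "x \<in> colon_ideal T A (ev ` K)" using KA(2) by metis
      then obtain s where s: "s \<in> carrier S" "x = ev s" using surj by (auto simp: colon_ideal_def)
      have "s \<otimes> k \<in> S.adj N t" if "k \<in> K" for k
      proof -
        have k: "k \<in> carrier S" using that Kc by blast
        have "ev (s \<otimes> k) \<in> ev ` N" using x s k that by (simp add: colon_ideal_def evN)
        then show ?thesis using ev_mem_image_iff[OF N, of "s \<otimes> k"] s k by blast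
      qed
      then have "s \<in> S.adj K'' t"
        unfolding K''_def using lift_colon[OF N K NK r(2) tK E s(1)] by blast
      then show "x \<in> ev ` K''" using ev_mem_image_iff[OF K'' s(1)] s(2) by simp
    qed
  qed
  define D where "D = colon_ideal S N K''"
  have D: "ideal D S" unfolding D_def using N K''c by (rule S.ideal_colon)
  have KD: "K \<subseteq> D"
    using Kc K''c by (auto simp: D_def K''_def colon_ideal_def S.m_comm subset_iff)
  have "D \<subseteq> K"
  proof (rule S.nakayama_m[OF D K t_n])
    fix d assume d: "d \<in> D"
    then have dc: "d \<in> carrier S" by (simp add: D_def colon_ideal_def)
    have "ev d \<otimes>\<^bsub>T\<^esub> ev k \<in> A" if "k \<in> K''" for k
      using d dc K''c that unfolding evN[symmetric] D_def by (auto simp: colon_ideal_def simp flip: hom_mult)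
    then have "ev d \<in> colon_ideal T A K'" using dc by (auto simp: colon_ideal_def img[symmetric])
    then have "ev d \<in> ev ` K" using KA(1) by simp
    then have "d \<in> S.adj K t" using ev_mem_image_iff[OF K dc] by simp
    then obtain k s where 1: "k \<in> K" "k \<in> carrier S" "s \<in> carrier S" "d = k \<oplus> s \<otimes> t"
      using K by (rule S.adjE)
    have "s \<otimes> t = d \<ominus> k" unfolding 1(4) using 1(2,3) t by algebra
    then have "s \<otimes> t \<in> D" using S.ideal_minus[OF D d] 1(1) KD by auto
    then have "s \<in> D" using S.regD[OF tK''[OF K''c] 1(3)] by (simp add: D_def)
    then show "\<exists>a\<in>K. \<exists>e\<in>D. d = a \<oplus> t \<otimes> e" using 1 t by (metis S.m_comm)
  qed
  then have "K = D" using KD by blast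
  moreover have "N \<noteq> carrier S"
    using T.linked_byD(2)[OF xs] evN surj unfolding A_def by blast
  ultimately have "S.linked_by ys K K''"
    unfolding S.linked_by_def using r(1) K K'' ys by (simp add: N_def D_def K''_def)
  then show ?thesis using that tK''[OF Kc] img by (simp add: K''_def)
qed

lemma lift_linked_to_unit:
  assumes "T.linked_to_unit c K'" "ideal K S" "S.reg K t" "ev ` K = K'"
  shows "S.linked_to_unit c K"
  using assms
proof (induction arbitrary: K rule: T.linked_to_unit.induct)
  \<comment> \<open>An ideal whose image is the unit ideal contains some 1 - ts, a unit because
    \<open>t\<close> lies in the maximal ideal.\<close>
  have unit: "S.linked_to_unit c K" if K: "ideal K S" and e: "ev ` K = carrier T" for c K
  proof -
    have "ev \<one> \<in> ev ` K" unfolding e by simp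
    then have "\<one> \<in> S.adj K t" using ev_mem_image_iff[OF K] by blast
    then obtain k s where 1: "k \<in> K" "k \<in> carrier S" "s \<in> carrier S" "\<one> = k \<oplus> s \<otimes> t"
      using K by (rule S.adjE)
    have "\<one> \<ominus> t \<otimes> s = k" unfolding 1(4) using 1(2,3) t_carrier by algebra
    then have "k \<in> Units S" using S.one_minus_m_Units[OF t_n 1(3)] by simp
    then have "K = carrier S" using S.ideal_unit[OF K] 1(1) by blast
    then show ?thesis using S.linked_to_unit.unit by blast
  qed
  {
    case (unit c)
    then show ?case using \<open>\<And>K c. \<lbrakk>ideal K S; ev ` K = carrier T\<rbrakk> \<Longrightarrow> S.linked_to_unit c K\<close> by blast
  next
    case (link xs L L' c)
    show ?case
    proof (cases "L = carrier T")
      case True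
      then show ?thesis using unit link.prems by blast
    next
      case False
      have "set xs \<subseteq> ev ` K" using T.linked_byD(5)[OF link.hyps(1)] link.prems by simp
      moreover define ys where "ys = map (inv_into K ev) xs"
      ultimately have ys: "set ys \<subseteq> K" "xs = map ev ys"
        by (auto simp: inv_into_into f_inv_into_f subset_iff intro!: map_idI[symmetric])
      obtain K'' where K'': "S.linked_by ys K K''" "S.reg K'' t" "ev ` K'' = L'"
        using lift_link[of ys K L' c] link ys False by metis
      have "S.linked_to_unit c K''" using link.IH[OF S.linked_byD(4)[OF K''(1)] K''(2,3)] .
      then show ?thesis using S.linked_to_unit.link K''(1) by blast
    qed
  }
qed

end

section \<open>Generic specialization of links\<close>

context cring
begin

lemma mult_interchange:
  "\<lbrakk>a \<in> carrier R; b \<in> carrier R; c \<in> carrier R; d \<in> carrier R\<rbrakk> \<Longrightarrow>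
    (a \<otimes> b) \<otimes> (c \<otimes> d) = (a \<otimes> c) \<otimes> (b \<otimes> d)"
  by (simp add: m_ac)

lemma associates_adjl_regm:
  assumes "list_all2 (\<lambda>x y. \<exists>u\<in>Units R. y = u \<otimes> x) xs ys" "ideal N R" "set xs \<subseteq> carrier R"
  shows "adjl N ys = adjl N xs" and "regm N xs \<Longrightarrow> regm N ys"
proof -
  have "adjl N ys = adjl N xs \<and> (regm N xs \<longrightarrow> regm N ys)"
    using assms
  proof (induction xs ys arbitrary: N rule: list_all2_induct)
    case (Cons x xs y ys)
    then obtain u where u: "u \<in> Units R" "y = u \<otimes> x" by blast
    then have "adj N y = adj N x" using Cons.prems by (simp add: adj_unit_mult)
    moreover have "reg N x \<longrightarrow> reg N y" using u reg_unit_mult Cons.prems by blast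
    moreover have "adjl (adj N x) ys = adjl (adj N x) xs \<and> (regm (adj N x) xs \<longrightarrow> regm (adj N x) ys)"
      using Cons.prems by (intro Cons.IH) (auto simp: ideal_adj)
    ultimately show ?case by simp
  qed simp
  then show "adjl N ys = adjl N xs" "regm N xs \<Longrightarrow> regm N ys" by auto
qed

end

text \<open>\<open>h\<close> is the composition of the quotient by \<open>Z\<close> with a localization, up to isomorphism.\<close>

locale fractional_hom = ring_hom_cring P Q h for P (structure) and Q (structure) and h +
  fixes Z
  assumes Z: "ideal Z P" and h_Z: "z \<in> Z \<Longrightarrow> h z = \<zero>\<^bsub>Q\<^esub>"
    and fraction: "s \<in> carrier Q \<Longrightarrow> \<exists>f\<in>carrier P. \<exists>w\<in>carrier P. h w \<in> Units Q \<and> s \<otimes>\<^bsub>Q\<^esub> h w = h f"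
    and h_eq_zero: "\<lbrakk>f \<in> carrier P; h f = \<zero>\<^bsub>Q\<^esub>\<rbrakk> \<Longrightarrow> \<exists>w\<in>carrier P. h w \<in> Units Q \<and> w \<otimes> f \<in> Z"
begin

definition contr :: "'c set \<Rightarrow> 'a set" where
  "contr K = {f \<in> carrier P. h f \<in> K}"

text \<open>For an ideal \<open>A\<close> this is the ideal of \<open>Q\<close> generated by its
  image, described with a single fraction per element.\<close>

definition ext :: "'a set \<Rightarrow> 'c set" where
  "ext A = {s \<in> carrier Q. \<exists>f\<in>A. \<exists>w\<in>carrier P. h w \<in> Units Q \<and> s \<otimes>\<^bsub>Q\<^esub> h w = h f}"

lemma ideal_contr: assumes K: "ideal K Q" shows "ideal (contr K) P"
  by (rule R.ideal_closedI)
    (auto simp: contr_def S.ideal_zero[OF K] S.ideal_add[OF K] S.ideal_mult[OF K])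

lemma Units_h_mult: "\<lbrakk>v \<in> carrier P; w \<in> carrier P; h v \<in> Units Q; h w \<in> Units Q\<rbrakk> \<Longrightarrow> h (v \<otimes> w) \<in> Units Q"
  by simp

lemma ext_memI:
  "\<lbrakk>s \<in> carrier Q; f \<in> A; w \<in> carrier P; h w \<in> Units Q; s \<otimes>\<^bsub>Q\<^esub> h w = h f\<rbrakk> \<Longrightarrow> s \<in> ext A"
  by (auto simp: ext_def)

lemma ext_memE:
  assumes "s \<in> ext A"
  obtains f w where "s \<in> carrier Q" "f \<in> A" "w \<in> carrier P" "h w \<in> Units Q" "s \<otimes>\<^bsub>Q\<^esub> h w = h f"
  using assms by (auto simp: ext_def)

lemma h_mem_ext: "\<lbrakk>f \<in> A; f \<in> carrier P\<rbrakk> \<Longrightarrow> h f \<in> ext A"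
  by (rule ext_memI[of _ f _ \<one>]) auto

lemma ext_mono: "A \<subseteq> C \<Longrightarrow> ext A \<subseteq> ext C"
  by (auto simp: ext_def)

lemma ideal_ext: assumes A: "ideal A P" shows "ideal (ext A) Q"
proof (rule S.ideal_closedI)
  show "ext A \<subseteq> carrier Q" by (auto simp: ext_def)
  show "\<zero>\<^bsub>Q\<^esub> \<in> ext A" using h_mem_ext[OF R.ideal_zero[OF A]] by simp
next
  fix x y assume "x \<in> ext A" "y \<in> ext A"
  then obtain f v g w where 1: "x \<in> carrier Q" "f \<in> A" "v \<in> carrier P" "h v \<in> Units Q" "x \<otimes>\<^bsub>Q\<^esub> h v = h f"
    and 2: "y \<in> carrier Q" "g \<in> A" "w \<in> carrier P" "h w \<in> Units Q" "y \<otimes>\<^bsub>Q\<^esub> h w = h g"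
    by (elim ext_memE) blast
  have c: "f \<in> carrier P" "g \<in> carrier P" using 1 2 R.ideal_carrier[OF A] by auto
  have "w \<otimes> f \<oplus> v \<otimes> g \<in> A" using 1 2 by (simp add: R.ideal_add[OF A] R.ideal_mult[OF A])
  moreover have "(x \<oplus>\<^bsub>Q\<^esub> y) \<otimes>\<^bsub>Q\<^esub> h (v \<otimes> w) = h (w \<otimes> f \<oplus> v \<otimes> g)"
  proof -
    define V W where "V = h v" and "W = h w"
    have VW: "V \<in> carrier Q" "W \<in> carrier Q" using 1 2 by (auto simp: V_def W_def)
    have "(x \<oplus>\<^bsub>Q\<^esub> y) \<otimes>\<^bsub>Q\<^esub> (V \<otimes>\<^bsub>Q\<^esub> W) = W \<otimes>\<^bsub>Q\<^esub> (x \<otimes>\<^bsub>Q\<^esub> V) \<oplus>\<^bsub>Q\<^esub> V \<otimes>\<^bsub>Q\<^esub> (y \<otimes>\<^bsub>Q\<^esub> W)"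
      using VW 1(1) 2(1) by algebra
    then show ?thesis using 1 2 c by (simp add: V_def W_def)
  qed
  ultimately show "x \<oplus>\<^bsub>Q\<^esub> y \<in> ext A"
    using 1 2 by (intro ext_memI[of _ "w \<otimes> f \<oplus> v \<otimes> g" _ "v \<otimes> w"] Units_h_mult) auto
next
  fix r x assume "r \<in> carrier Q" "x \<in> ext A"
  then obtain f v where 1: "x \<in> carrier Q" "f \<in> A" "v \<in> carrier P" "h v \<in> Units Q" "x \<otimes>\<^bsub>Q\<^esub> h v = h f"
    and r: "r \<in> carrier Q" by (elim ext_memE) blast
  obtain g w where 2: "g \<in> carrier P" "w \<in> carrier P" "h w \<in> Units Q" "r \<otimes>\<^bsub>Q\<^esub> h w = h g"
    using fraction[OF r] by blast
  have c: "f \<in> carrier P" using 1 R.ideal_carrier[OF A] by auto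
  have "(r \<otimes>\<^bsub>Q\<^esub> x) \<otimes>\<^bsub>Q\<^esub> h (v \<otimes> w) = (r \<otimes>\<^bsub>Q\<^esub> x) \<otimes>\<^bsub>Q\<^esub> (h w \<otimes>\<^bsub>Q\<^esub> h v)"
    using 1(3) 2(2) by (simp add: S.m_comm)
  also have "\<dots> = (r \<otimes>\<^bsub>Q\<^esub> h w) \<otimes>\<^bsub>Q\<^esub> (x \<otimes>\<^bsub>Q\<^esub> h v)"
    using r 1(1,3) 2(2) by (intro S.mult_interchange) auto
  also have "\<dots> = h (g \<otimes> f)" using 1 2 c by simp
  finally show "r \<otimes>\<^bsub>Q\<^esub> x \<in> ext A"
    using 1 2 r R.ideal_mult[OF A] by (intro ext_memI[of _ "g \<otimes> f" _ "v \<otimes> w"] Units_h_mult) auto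
qed

lemma ext_minimal: assumes J: "ideal J Q" and "\<And>f. f \<in> A \<Longrightarrow> h f \<in> J" shows "ext A \<subseteq> J"
proof
  fix s assume "s \<in> ext A"
  then obtain f w where 1: "s \<in> carrier Q" "f \<in> A" "w \<in> carrier P" "h w \<in> Units Q" "s \<otimes>\<^bsub>Q\<^esub> h w = h f"
    by (rule ext_memE)
  then have "h w \<otimes>\<^bsub>Q\<^esub> s \<in> J" using assms(2)[OF 1(2)] by (simp add: S.m_comm)
  then show "s \<in> J" using 1 by (simp add: S.ideal_unit_mult_iff[OF J])
qed

lemma ext_contr: assumes K: "ideal K Q" shows "ext (contr K) = K"
proof
  show "ext (contr K) \<subseteq> K" using K by (intro ext_minimal) (auto simp: contr_def)
  show "K \<subseteq> ext (contr K)"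
  proof
    fix s assume s: "s \<in> K"
    then have sc: "s \<in> carrier Q" using K S.ideal_carrier by blast
    then obtain f w where 1: "f \<in> carrier P" "w \<in> carrier P" "h w \<in> Units Q" "s \<otimes>\<^bsub>Q\<^esub> h w = h f"
      using fraction by blast
    have "h f \<in> K" unfolding 1(4)[symmetric] using s 1(2) by (simp add: S.ideal_mult_right[OF K])
    then show "s \<in> ext (contr K)" using 1 sc by (intro ext_memI[of _ f]) (auto simp: contr_def)
  qed
qed

text \<open>An equality in \<open>Q\<close> holds in \<open>P\<close> after multiplication by a
  denominator and up to an error in \<open>Z\<close>; later arguments consist in absorbing this
  error.\<close>

lemma h_mem_extD:
  assumes A: "ideal A P" and f: "f \<in> carrier P" and hf: "h f \<in> ext A"
  shows "\<exists>w\<in>carrier P. \<exists>z\<in>Z. h w \<in> Units Q \<and> w \<otimes> f \<ominus> z \<in> A"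
proof -
  obtain g v where 1: "g \<in> A" "v \<in> carrier P" "h v \<in> Units Q" "h f \<otimes>\<^bsub>Q\<^esub> h v = h g"
    using hf by (rule ext_memE)
  have g: "g \<in> carrier P" using 1 R.ideal_carrier[OF A] by auto
  have "h (f \<otimes> v \<ominus> g) = \<zero>\<^bsub>Q\<^esub>" using f g 1 by (simp add: S.minus_eq S.r_neg)
  then obtain w where w: "w \<in> carrier P" "h w \<in> Units Q" "w \<otimes> (f \<otimes> v \<ominus> g) \<in> Z"
    using h_eq_zero[of "f \<otimes> v \<ominus> g"] f g 1 by auto
  have "(v \<otimes> w) \<otimes> f \<ominus> w \<otimes> (f \<otimes> v \<ominus> g) = w \<otimes> g"
    by (rule R.ring_identity, (rule R.ring_split | simp add: R.ring_norm f g w(1) 1(2))+)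
  also have "\<dots> \<in> A" using 1 w by (simp add: R.ideal_mult[OF A])
  finally show ?thesis using w 1 by (intro bexI[of _ "v \<otimes> w"] bexI[of _ "w \<otimes> (f \<otimes> v \<ominus> g)"]) auto
qed

lemma ext_zero: "ext {\<zero>} = {\<zero>\<^bsub>Q\<^esub>}"
proof
  show "ext {\<zero>} \<subseteq> {\<zero>\<^bsub>Q\<^esub>}" by (intro ext_minimal S.zeroideal) auto
  show "{\<zero>\<^bsub>Q\<^esub>} \<subseteq> ext {\<zero>}" using S.ideal_zero[OF ideal_ext[OF R.zeroideal]] by blast
qed

lemma ext_carrier: "ext (carrier P) = carrier Q"
  using fraction by (auto simp: ext_def)

lemma ext_adj: assumes A: "ideal A P" and f: "f \<in> carrier P"
  shows "ext (R.adj A f) = S.adj (ext A) (h f)"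
proof
  have J: "ideal (S.adj (ext A) (h f)) Q" using f by (intro S.ideal_adj ideal_ext A) auto
  show "ext (R.adj A f) \<subseteq> S.adj (ext A) (h f)"
  proof (rule ext_minimal[OF J])
    fix g assume "g \<in> R.adj A f"
    then obtain n r where 1: "n \<in> A" "n \<in> carrier P" "r \<in> carrier P" "g = n \<oplus> r \<otimes> f"
      using A by (rule R.adjE)
    then show "h g \<in> S.adj (ext A) (h f)"
      using f h_mem_ext by (intro S.adjI[of "h n" _ "h r"]) auto
  qed
  show "S.adj (ext A) (h f) \<subseteq> ext (R.adj A f)"
    using A f R.ideal_carrier[OF A] h_mem_ext[OF R.adj_self[OF A f]]
    by (intro S.adj_subset ideal_ext R.ideal_adj ext_mono) (auto intro: R.adj_incl)
qed

lemma ext_adjl: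
  "\<lbrakk>ideal A P; set fs \<subseteq> carrier P\<rbrakk> \<Longrightarrow> ext (R.adjl A fs) = S.adjl (ext A) (map h fs)"
  by (induction fs arbitrary: A) (auto simp: ext_adj R.ideal_adj)

lemma contr_colon:
  assumes A: "ideal A Q" and K: "ideal K Q"
  shows "contr (colon_ideal Q A K) = colon_ideal P (contr A) (contr K)"
proof
  show "contr (colon_ideal Q A K) \<subseteq> colon_ideal P (contr A) (contr K)"
    by (auto simp: contr_def colon_ideal_def)
  show "colon_ideal P (contr A) (contr K) \<subseteq> contr (colon_ideal Q A K)"
  proof
    fix f assume f: "f \<in> colon_ideal P (contr A) (contr K)"
    then have fc: "f \<in> carrier P" by (simp add: colon_ideal_def)
    have "h f \<otimes>\<^bsub>Q\<^esub> k \<in> A" if k: "k \<in> K" for k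
    proof -
      have kc: "k \<in> carrier Q" using k K S.ideal_carrier by blast
      then obtain g w where 1: "g \<in> carrier P" "w \<in> carrier P" "h w \<in> Units Q" "k \<otimes>\<^bsub>Q\<^esub> h w = h g"
        using fraction by blast
      have "h g \<in> K" unfolding 1(4)[symmetric] using k 1(2) by (simp add: S.ideal_mult_right[OF K])
      then have "g \<in> contr K" using 1 by (simp add: contr_def)
      then have "f \<otimes> g \<in> contr A" using f by (simp add: colon_ideal_def)
      then have "h (f \<otimes> g) \<in> A" by (simp add: contr_def)
      also have "h (f \<otimes> g) = h w \<otimes>\<^bsub>Q\<^esub> (h f \<otimes>\<^bsub>Q\<^esub> k)"
        using fc kc 1 by (simp add: 1(4)[symmetric] S.m_ac)
      finally show ?thesis using 1 fc kc by (simp add: S.ideal_unit_mult_iff[OF A])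
    qed
    then show "f \<in> contr (colon_ideal Q A K)" using fc by (simp add: contr_def colon_ideal_def)
  qed
qed

lemma ext_colon_subset:
  assumes A: "ideal A P" and K: "K \<subseteq> carrier P"
  shows "ext (colon_ideal P A K) \<subseteq> colon_ideal Q (ext A) (ext K)"
proof
  fix s assume "s \<in> ext (colon_ideal P A K)"
  then obtain f w where 1: "s \<in> carrier Q" "f \<in> colon_ideal P A K" "w \<in> carrier P" "h w \<in> Units Q" "s \<otimes>\<^bsub>Q\<^esub> h w = h f"
    by (rule ext_memE)
  have "s \<otimes>\<^bsub>Q\<^esub> k \<in> ext A" if "k \<in> ext K" for k
  proof -
    obtain g v where 2: "k \<in> carrier Q" "g \<in> K" "v \<in> carrier P" "h v \<in> Units Q" "k \<otimes>\<^bsub>Q\<^esub> h v = h g"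
      using \<open>k \<in> ext K\<close> by (rule ext_memE)
    have c: "g \<in> carrier P" "f \<in> carrier P" using 1 2 K by (auto simp: colon_ideal_def)
    have "(s \<otimes>\<^bsub>Q\<^esub> k) \<otimes>\<^bsub>Q\<^esub> h (w \<otimes> v) = (s \<otimes>\<^bsub>Q\<^esub> h w) \<otimes>\<^bsub>Q\<^esub> (k \<otimes>\<^bsub>Q\<^esub> h v)"
      using 1(1,3) 2(1,3) by (simp add: S.mult_interchange)
    also have "\<dots> = h (f \<otimes> g)" using 1 2 c by simp
    finally show ?thesis
      using 1 2 c by (intro ext_memI[of _ "f \<otimes> g" _ "w \<otimes> v"] Units_h_mult) (auto simp: colon_ideal_def)
  qed
  then show "s \<in> colon_ideal Q (ext A) (ext K)" using 1 by (simp add: colon_ideal_def)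
qed

text \<open>Unit multiples change neither the ideal of a sequence nor its regularity, so the
  sequence may be taken from \<open>P\<close>, where it can be evaluated.\<close>

lemma linked_by_clear_denominators:
  assumes "S.linked_by xs K K'"
  obtains fs where "set fs \<subseteq> carrier P" "S.linked_by (map h fs) K K'"
    "list_all2 (\<lambda>x f. \<exists>u\<in>Units Q. h f = u \<otimes>\<^bsub>Q\<^esub> x) xs fs"
proof -
  note l = S.linked_byD[OF assms]
  have xs: "set xs \<subseteq> carrier Q" using l(3,5) S.ideal_subset_carrier by blast
  have "\<forall>x\<in>set xs. \<exists>f. f \<in> carrier P \<and> (\<exists>u\<in>Units Q. h f = u \<otimes>\<^bsub>Q\<^esub> x)"
  proof
    fix x assume "x \<in> set xs"
    then have x: "x \<in> carrier Q" using xs by blast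
    obtain f w where 1: "f \<in> carrier P" "w \<in> carrier P" "h w \<in> Units Q" "x \<otimes>\<^bsub>Q\<^esub> h w = h f"
      using fraction[OF x] by blast
    then show "\<exists>f. f \<in> carrier P \<and> (\<exists>u\<in>Units Q. h f = u \<otimes>\<^bsub>Q\<^esub> x)"
      using x by (intro exI[of _ f] conjI bexI[of _ "h w"]) (auto simp: S.m_comm)
  qed
  then obtain F where F: "\<And>x. x \<in> set xs \<Longrightarrow> F x \<in> carrier P"
    "\<And>x. x \<in> set xs \<Longrightarrow> \<exists>u\<in>Units Q. h (F x) = u \<otimes>\<^bsub>Q\<^esub> x"
    using bchoice[of "set xs"] by metis
  define fs where "fs = map F xs"
  have as: "list_all2 (\<lambda>x f. \<exists>u\<in>Units Q. h f = u \<otimes>\<^bsub>Q\<^esub> x) xs fs"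
    unfolding fs_def using F by (auto simp: list_all2_conv_all_nth)
  then have as': "list_all2 (\<lambda>x y. \<exists>u\<in>Units Q. y = u \<otimes>\<^bsub>Q\<^esub> x) xs (map h fs)"
    by (simp add: list_all2_map2)
  have "set (map h fs) \<subseteq> K"
  proof
    fix y assume "y \<in> set (map h fs)"
    then obtain x where "x \<in> set xs" "y = h (F x)" by (auto simp: fs_def)
    then obtain u where "u \<in> Units Q" "y = u \<otimes>\<^bsub>Q\<^esub> x" "x \<in> K" using F(2) l(5) by blast
    then show "y \<in> K" using S.ideal_mult[OF l(3)] by blast
  qed
  moreover note eq = S.associates_adjl_regm[OF as' S.zeroideal xs]
  ultimately have "S.linked_by (map h fs) K K'"
    using S.linked_by_colon[OF assms] l eq(2)[OF l(1)] unfolding S.linked_by_def eq(1) by blast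
  then show ?thesis using that[of fs] F(1) as unfolding fs_def by auto
qed

end

text \<open>In the applications \<open>P\<close> is a polynomial ring in \<open>t\<close>,
  \<open>S\<close> a localization of it, and \<open>e b\<close> the evaluation at t = b followed by
  a map to \<open>T\<close>. Evaluation is given on \<open>P\<close> only: an invertible denominator
  of \<open>S\<close> may become a nonunit of \<open>T\<close>, but by \<open>generic_unit\<close>
  only for finitely many \<open>b\<close>.\<close>

locale specialization = P: noetherian_cring P + \<iota>: fractional_hom P S \<iota> "{\<zero>}"
  for P (structure) and S (structure) and \<iota> +
  fixes T (structure) and e :: "'a \<Rightarrow> 'a \<Rightarrow> 'e" and t :: 'a and B :: "'a set"
  assumes T: "cring T" and t_carrier: "t \<in> carrier P"
    and infinite_B: "infinite B" and B_carrier: "B \<subseteq> carrier P"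
    and B_diff: "\<lbrakk>c \<in> B; d \<in> B; c \<noteq> d\<rbrakk> \<Longrightarrow> c \<ominus> d \<in> Units P"
    and e: "b \<in> B \<Longrightarrow> fractional_hom P T (e b) {r \<otimes> (t \<ominus> b) | r. r \<in> carrier P}"
    and generic_unit: "\<lbrakk>w \<in> carrier P; \<iota> w \<in> Units S\<rbrakk> \<Longrightarrow> finite {b \<in> B. e b w \<notin> Units T}"
begin

sublocale T: cring T by (rule T)

text \<open>All but finitely many elements of \<open>B\<close>, as a filter, so that exceptional
  sets are united by \<open>eventually_elim\<close>.\<close>

definition generic :: "'a filter" where
  "generic = inf cofinite (principal B)"

lemma eventually_generic: "eventually Q generic \<longleftrightarrow> finite {b \<in> B. \<not> Q b}"
  by (simp add: generic_def eventually_inf_principal eventually_cofinite)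

lemma generic_neq_bot: "generic \<noteq> bot"
proof
  assume "generic = bot"
  then have "eventually (\<lambda>_. False) generic" by simp
  then show False using infinite_B by (simp add: eventually_generic)
qed

lemma eventually_in_B: "eventually (\<lambda>b. b \<in> B) generic"
  by (simp add: eventually_generic)

lemma eventually_generic_unit: "\<lbrakk>w \<in> carrier P; \<iota> w \<in> Units S\<rbrakk> \<Longrightarrow> eventually (\<lambda>b. e b w \<in> Units T) generic"
  using generic_unit by (simp add: eventually_generic)

abbreviation exte :: "'a \<Rightarrow> 'a set \<Rightarrow> 'e set" where
  "exte b \<equiv> fractional_hom.ext P T (e b)"

text \<open>The ideal is contracted to \<open>P\<close>, where evaluation is defined, and then
  extended along it.\<close>

definition spec :: "'a \<Rightarrow> 'c set \<Rightarrow> 'e set" where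
  "spec b K = exte b (\<iota>.contr K)"

text \<open>\<open>t \<ominus> b\<close> belongs to the pencil with second coefficient
  \<open>\<ominus> \<one>\<close>, whose powers are units and kill no vector outside
  \<open>A\<close>.\<close>

lemma eventually_reg:
  assumes A: "ideal A P" shows "eventually (\<lambda>b. P.reg A (t \<ominus> b)) generic"
  unfolding eventually_generic
proof (rule finite_subset)
  show "finite {c \<in> B. \<exists>v\<in>carrier P. (t \<oplus> c \<otimes> \<ominus> \<one>) \<otimes> v \<in> A \<and> (\<forall>n::nat. (\<ominus> \<one>) [^] n \<otimes> v \<notin> A)}"
    using A t_carrier B_carrier B_diff by (intro P.finite_pencil_exceptions) auto
  show "{b \<in> B. \<not> P.reg A (t \<ominus> b)} \<subseteq>
    {c \<in> B. \<exists>v\<in>carrier P. (t \<oplus> c \<otimes> \<ominus> \<one>) \<otimes> v \<in> A \<and> (\<forall>n::nat. (\<ominus> \<one>) [^] n \<otimes> v \<notin> A)}"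
  proof clarify
    fix b assume b: "b \<in> B" "\<not> P.reg A (t \<ominus> b)"
    have bc: "b \<in> carrier P" using b B_carrier by blast
    note t = t_carrier
    obtain v where v: "v \<in> carrier P" "v \<otimes> (t \<ominus> b) \<in> A" "v \<notin> A"
      using b bc t_carrier by (auto simp: P.reg_def)
    have "(t \<oplus> b \<otimes> \<ominus> \<one>) \<otimes> v = v \<otimes> (t \<ominus> b)"
      by (rule P.ring_identity, (rule P.ring_split | simp add: P.ring_norm v(1) bc t_carrier)+)
    moreover have "(\<ominus> \<one>) [^] n \<in> Units P" for n :: nat
      using P.Units_pow_closed[OF P.Units_minus_one_closed] .
    ultimately show "\<exists>v\<in>carrier P. (t \<oplus> b \<otimes> \<ominus> \<one>) \<otimes> v \<in> A \<and> (\<forall>n::nat. (\<ominus> \<one>) [^] n \<otimes> v \<notin> A)"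
      using v by (intro bexI[of _ v]) (auto simp: P.ideal_unit_mult_iff[OF A])
  qed
qed

text \<open>Reduction modulo t - b commutes with the colon by \<open>k\<close> if t - b is regular
  modulo A + kP: the error r(t - b) in a relation then has \<open>r\<close> in A + kP, and a
  multiple of t - b subtracted from the solution absorbs it.\<close>

lemma eventually_colon_single:
  assumes A: "ideal A P" and k: "k \<in> carrier P"
  shows "eventually (\<lambda>b. colon_ideal T (exte b A) {e b k} \<subseteq> exte b (colon_ideal P A {k})) generic"
  using eventually_reg[OF P.ideal_adj[OF A k]] eventually_in_B
proof eventually_elim
  case (elim b)
  have bc: "b \<in> carrier P" using elim B_carrier by blast
  interpret e: fractional_hom P T "e b" "{r \<otimes> (t \<ominus> b) | r. r \<in> carrier P}" using elim by (intro e)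
  define s where "s = t \<ominus> b"
  have s: "s \<in> carrier P" using t_carrier bc by (simp add: s_def)
  note D = P.ideal_adj[OF A k]
  show ?case
  proof
    fix z assume "z \<in> colon_ideal T (exte b A) {e b k}"
    then have z: "z \<in> carrier T" "z \<otimes>\<^bsub>T\<^esub> e b k \<in> exte b A" by (auto simp: colon_ideal_def)
    obtain f w where 1: "f \<in> carrier P" "w \<in> carrier P" "e b w \<in> Units T" "z \<otimes>\<^bsub>T\<^esub> e b w = e b f"
      using e.fraction[OF z(1)] by blast
    have "e b (f \<otimes> k) = e b w \<otimes>\<^bsub>T\<^esub> (z \<otimes>\<^bsub>T\<^esub> e b k)" using 1 k z by (simp add: 1(4)[symmetric] T.m_ac)
    also have "\<dots> \<in> exte b A" using z 1 by (simp add: T.ideal_mult[OF e.ideal_ext[OF A]])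
    finally have "e b (f \<otimes> k) \<in> exte b A" .
    then obtain w' r where 2: "w' \<in> carrier P" "r \<in> carrier P" "e b w' \<in> Units T" "w' \<otimes> (f \<otimes> k) \<ominus> r \<otimes> s \<in> A"
      using e.h_mem_extD[OF A, of "f \<otimes> k"] 1 k unfolding s_def by auto
    define a where "a = w' \<otimes> (f \<otimes> k) \<ominus> r \<otimes> s"
    have a: "a \<in> A" "a \<in> carrier P" using 2 P.ideal_carrier[OF A] by (auto simp: a_def)
    have "r \<otimes> s = (w' \<otimes> f) \<otimes> k \<ominus> a"
      unfolding a_def by (rule P.ring_identity, (rule P.ring_split | simp add: P.ring_norm 1(1) 2(1,2) k s)+)
    moreover have "(w' \<otimes> f) \<otimes> k \<in> P.adj A k" using 1 2 by (intro P.adj_mult_self[OF A k]) auto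
    ultimately have "r \<otimes> s \<in> P.adj A k" using P.ideal_minus[OF D] P.adj_incl[OF A k a(1)] by simp
    then have "r \<in> P.adj A k" using elim(1) 2(2) P.regD unfolding s_def by blast
    then obtain a' u where 3: "a' \<in> A" "a' \<in> carrier P" "u \<in> carrier P" "r = a' \<oplus> u \<otimes> k"
      using A by (rule P.adjE)
    define g where "g = w' \<otimes> f \<ominus> u \<otimes> s"
    have g: "g \<in> carrier P" using 1 2 3 s by (simp add: g_def)
    have "g \<otimes> k = a \<oplus> s \<otimes> a'"
      unfolding g_def a_def 3(4) by (rule P.ring_identity, (rule P.ring_split | simp add: P.ring_norm 1(1) 2(1) 3(2,3) k s)+)
    also have "\<dots> \<in> A" using a 3 s by (simp add: P.ideal_add[OF A] P.ideal_mult[OF A])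
    finally have gA: "g \<in> colon_ideal P A {k}" using g by (simp add: colon_ideal_def)
    have "u \<otimes> s \<in> {r \<otimes> (t \<ominus> b) | r. r \<in> carrier P}" using 3 by (auto simp: s_def)
    then have "e b (u \<otimes> s) = \<zero>\<^bsub>T\<^esub>" by (rule e.h_Z)
    then have "e b g = e b w' \<otimes>\<^bsub>T\<^esub> e b f"
      unfolding g_def using 1 2 3 s by (simp add: T.minus_eq del: e.hom_mult) simp
    also have "\<dots> = z \<otimes>\<^bsub>T\<^esub> e b (w \<otimes> w')" using 1 2 z by (simp add: 1(4)[symmetric] T.m_ac)
    finally show "z \<in> exte b (colon_ideal P A {k})"
      using gA 1 2 z by (intro e.ext_memI[of _ g _ "w \<otimes> w'"] e.Units_h_mult) auto
  qed
qed

text \<open>The same mechanism with regularity modulo A + C: the multiplier of t - b splits into a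
  part in \<open>A\<close> and a part in \<open>C\<close>, and one of them corrects the
  representative.\<close>

lemma eventually_Int:
  assumes A: "ideal A P" and C: "ideal C P"
  shows "eventually (\<lambda>b. exte b A \<inter> exte b C \<subseteq> exte b (A \<inter> C)) generic"
  using eventually_reg[OF P.add_ideals[OF A C]] eventually_in_B
proof eventually_elim
  case (elim b)
  have bc: "b \<in> carrier P" using elim B_carrier by blast
  interpret e: fractional_hom P T "e b" "{r \<otimes> (t \<ominus> b) | r. r \<in> carrier P}" using elim by (intro e)
  define s where "s = t \<ominus> b"
  have s: "s \<in> carrier P" using t_carrier bc by (simp add: s_def)
  show ?case
  proof clarify
    fix z assume "z \<in> exte b A" "z \<in> exte b C"
    then obtain f v g w where 1: "z \<in> carrier T" "f \<in> A" "v \<in> carrier P" "e b v \<in> Units T" "z \<otimes>\<^bsub>T\<^esub> e b v = e b f"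
      and 2: "g \<in> C" "w \<in> carrier P" "e b w \<in> Units T" "z \<otimes>\<^bsub>T\<^esub> e b w = e b g"
      by (elim e.ext_memE) blast
    have c: "f \<in> carrier P" "g \<in> carrier P" using 1 2 P.ideal_carrier A C by auto
    have fz: "e b (w \<otimes> f) = z \<otimes>\<^bsub>T\<^esub> e b (v \<otimes> w)"
      using 1 2 c by (simp add: 1(5)[symmetric] T.m_ac)
    have gz: "e b (v \<otimes> g) = z \<otimes>\<^bsub>T\<^esub> e b (v \<otimes> w)"
      using 1 2 c by (simp add: 2(4)[symmetric] T.m_ac)
    have "e b (w \<otimes> f \<ominus> v \<otimes> g) = e b (w \<otimes> f) \<ominus>\<^bsub>T\<^esub> e b (v \<otimes> g)"
      using 1 2 c by (intro e.hom_minus) auto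
    also have "\<dots> = \<zero>\<^bsub>T\<^esub>" unfolding fz gz using 1 2 by (simp add: T.minus_eq T.r_neg)
    finally have "e b (w \<otimes> f \<ominus> v \<otimes> g) = \<zero>\<^bsub>T\<^esub>" .
    then obtain x q where 3: "x \<in> carrier P" "e b x \<in> Units T" "q \<in> carrier P" "x \<otimes> (w \<otimes> f \<ominus> v \<otimes> g) = q \<otimes> s"
      using e.h_eq_zero[of "w \<otimes> f \<ominus> v \<otimes> g"] 1 2 c unfolding s_def by auto
    have "q \<otimes> s = (x \<otimes> w) \<otimes> f \<oplus> (\<ominus> (x \<otimes> v)) \<otimes> g"
      unfolding 3(4)[symmetric] by (rule P.ring_identity, (rule P.ring_split | simp add: P.ring_norm 1(3) 2(2) 3(1) c)+)
    moreover have m: "(x \<otimes> w) \<otimes> f \<in> A" "(\<ominus> (x \<otimes> v)) \<otimes> g \<in> C"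
      using 1 2 3 by (simp_all add: P.ideal_mult[OF A] P.ideal_mult[OF C])
    ultimately have "q \<otimes> s \<in> A <+>\<^bsub>P\<^esub> C" unfolding set_add_defs by (auto intro!: bexI[OF _ m(1)] bexI[OF _ m(2)])
    then have "q \<in> A <+>\<^bsub>P\<^esub> C" using elim(1) 3(3) P.regD unfolding s_def by blast
    then obtain y y' where 4: "y \<in> A" "y' \<in> C" "q = y \<oplus> y'" by (auto simp: set_add_defs)
    have yc: "y \<in> carrier P" "y' \<in> carrier P" using 4 P.ideal_carrier A C by auto
    define k where "k = (x \<otimes> w) \<otimes> f \<ominus> y \<otimes> s"
    have "k \<in> A" unfolding k_def using m(1) 4(1) s by (simp add: P.ideal_minus[OF A] P.ideal_mult_right[OF A])
    moreover have "k = x \<otimes> (w \<otimes> f \<ominus> v \<otimes> g) \<oplus> (x \<otimes> v) \<otimes> g \<ominus> y \<otimes> s"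
      unfolding k_def by (rule P.ring_identity, (rule P.ring_split | simp add: P.ring_norm 1(3) 2(2) 3(1) c yc s)+)
    moreover have "q \<otimes> s \<oplus> (x \<otimes> v) \<otimes> g \<ominus> y \<otimes> s = (x \<otimes> v) \<otimes> g \<oplus> y' \<otimes> s"
      unfolding 4(3) by (rule P.ring_identity, (rule P.ring_split | simp add: P.ring_norm 2(2) 1(3) 3(1) c yc s)+)
    ultimately have kk: "k \<in> A" "k = (x \<otimes> v) \<otimes> g \<oplus> y' \<otimes> s" unfolding 3(4) by simp_all
    note kk(1) moreover note kk(2)
    then have "k \<in> C" using 1 2 3 4 s by (simp add: P.ideal_add[OF C] P.ideal_mult[OF C] P.ideal_mult_right[OF C])
    moreover have "e b k = z \<otimes>\<^bsub>T\<^esub> e b (x \<otimes> (v \<otimes> w))"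
    proof -
      have "y \<otimes> s \<in> {r \<otimes> (t \<ominus> b) | r. r \<in> carrier P}" using yc by (auto simp: s_def)
      then have "e b (y \<otimes> s) = \<zero>\<^bsub>T\<^esub>" by (rule e.h_Z)
      moreover have "e b k = e b (x \<otimes> (w \<otimes> f)) \<ominus>\<^bsub>T\<^esub> e b (y \<otimes> s)"
        unfolding k_def using 1 2 3 c yc s by (subst e.hom_minus) (auto simp: P.m_assoc)
      ultimately have "e b k = e b x \<otimes>\<^bsub>T\<^esub> e b (w \<otimes> f)" using 1 2 3 c by (simp add: T.minus_eq)
      also have "\<dots> = z \<otimes>\<^bsub>T\<^esub> e b (x \<otimes> (v \<otimes> w))" unfolding fz using 1 2 3 by (simp add: T.m_ac)
      finally show ?thesis .
    qed
    ultimately show "z \<in> exte b (A \<inter> C)"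
      using 1 2 3 by (intro e.ext_memI[of _ k _ "x \<otimes> (v \<otimes> w)"] e.Units_h_mult) auto
  qed
qed

lemma eventually_colon_set:
  assumes A: "ideal A P" and "set ks \<subseteq> carrier P"
  shows "eventually (\<lambda>b. colon_ideal T (exte b A) (e b ` set ks) \<subseteq> exte b (colon_ideal P A (set ks))) generic"
  using assms(2)
proof (induction ks)
  case Nil
  show ?case
    using eventually_in_B
  proof eventually_elim
    case (elim b)
    interpret e: fractional_hom P T "e b" "{r \<otimes> (t \<ominus> b) | r. r \<in> carrier P}" using elim by (intro e)
    show ?case by (simp add: colon_ideal_def e.ext_carrier)
  qed
next
  case (Cons k ks)
  then have k: "k \<in> carrier P" and ks: "set ks \<subseteq> carrier P" by auto
  have i: "ideal (colon_ideal P A {k}) P" "ideal (colon_ideal P A (set ks)) P"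
    using A k ks by (auto intro!: P.ideal_colon)
  show ?case
    using eventually_colon_single[OF A k] Cons.IH[OF ks] eventually_Int[OF i]
  proof eventually_elim
    case (elim b)
    have "colon_ideal T (exte b A) (e b ` set (k # ks)) \<subseteq>
      colon_ideal T (exte b A) {e b k} \<inter> colon_ideal T (exte b A) (e b ` set ks)"
      by (auto simp: colon_ideal_def)
    also have "\<dots> \<subseteq> exte b (colon_ideal P A {k} \<inter> colon_ideal P A (set ks))" using elim by blast
    also have "colon_ideal P A {k} \<inter> colon_ideal P A (set ks) = colon_ideal P A (set (k # ks))"
      by (auto simp: colon_ideal_def)
    finally show ?case .
  qed
qed

text \<open>The contracted ideal of \<open>K\<close> is finitely generated, so the colon is a finite
  intersection of colons by single elements and only finitely many exceptional sets are
  united.\<close>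

lemma eventually_spec_colon:
  assumes A: "ideal A S" and K: "ideal K S"
  shows "eventually (\<lambda>b. spec b (colon_ideal S A K) = colon_ideal T (spec b A) (spec b K)) generic"
proof -
  define A' where "A' = \<iota>.contr A"
  define K' where "K' = \<iota>.contr K"
  have A': "ideal A' P" and K': "ideal K' P" using A K by (auto simp: A'_def K'_def \<iota>.ideal_contr)
  obtain ks where ks: "set ks \<subseteq> carrier P" "K' = Idl (set ks)" using K' by (rule P.ideal_list_generators)
  have ksK: "set ks \<subseteq> K'" using ks P.genideal_self by blast
  have eq: "\<iota>.contr (colon_ideal S A K) = colon_ideal P A' (set ks)"
    using \<iota>.contr_colon[OF A K] P.colon_genideal[OF A' ks(1)] by (simp add: A'_def K'_def ks(2)[unfolded K'_def])
  have eq': "colon_ideal P A' (set ks) = colon_ideal P A' K'"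
    using P.colon_genideal[OF A' ks(1)] ks(2) by simp
  show ?thesis
    using eventually_colon_set[OF A' ks(1)] eventually_in_B
  proof eventually_elim
    case (elim b)
    interpret e: fractional_hom P T "e b" "{r \<otimes> (t \<ominus> b) | r. r \<in> carrier P}" using elim by (intro e)
    have "colon_ideal T (exte b A') (exte b K') \<subseteq> colon_ideal T (exte b A') (e b ` set ks)"
    proof -
      have "e b ` set ks \<subseteq> exte b K'" using ksK ks(1) e.h_mem_ext by blast
      then show ?thesis by (auto simp: colon_ideal_def)
    qed
    then have "colon_ideal T (exte b A') (exte b K') \<subseteq> exte b (colon_ideal P A' (set ks))" using elim by blast
    moreover have "exte b (colon_ideal P A' (set ks)) \<subseteq> colon_ideal T (exte b A') (exte b K')"
      unfolding eq' by (rule e.ext_colon_subset[OF A' P.ideal_subset_carrier[OF K']])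
    ultimately show ?case unfolding spec_def eq A'_def[symmetric] K'_def[symmetric] by blast
  qed
qed

text \<open>The contraction of the extension of \<open>A\<close> has finitely many generators, each
  multiplied into \<open>A\<close> by a denominator; generically these denominators evaluate to
  units.\<close>

lemma eventually_spec_ext:
  assumes A: "ideal A P" shows "eventually (\<lambda>b. spec b (\<iota>.ext A) = exte b A) generic"
proof -
  define C where "C = \<iota>.contr (\<iota>.ext A)"
  have C: "ideal C P" unfolding C_def by (intro \<iota>.ideal_contr \<iota>.ideal_ext A)
  obtain gs where gs: "set gs \<subseteq> carrier P" "C = Idl (set gs)" using C by (rule P.ideal_list_generators)
  have "\<exists>w\<in>carrier P. \<iota> w \<in> Units S \<and> w \<otimes> g \<in> A" if g: "g \<in> set gs" for g
  proof -
    have gc: "g \<in> carrier P" "\<iota> g \<in> \<iota>.ext A"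
      using gs g P.genideal_self[OF gs(1)] by (auto simp: C_def \<iota>.contr_def)
    then show ?thesis using \<iota>.h_mem_extD[OF A gc] by (auto simp: P.minus_eq)
  qed
  then obtain w where w: "\<And>g. g \<in> set gs \<Longrightarrow> w g \<in> carrier P" "\<And>g. g \<in> set gs \<Longrightarrow> \<iota> (w g) \<in> Units S"
    "\<And>g. g \<in> set gs \<Longrightarrow> w g \<otimes> g \<in> A" by metis
  have "eventually (\<lambda>b. \<forall>g\<in>set gs. e b (w g) \<in> Units T) generic"
    using w by (intro eventually_ball_finite ballI eventually_generic_unit) auto
  then show ?thesis
    using eventually_in_B
  proof eventually_elim
    case (elim b)
    interpret e: fractional_hom P T "e b" "{r \<otimes> (t \<ominus> b) | r. r \<in> carrier P}" using elim by (intro e)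
    have J: "ideal (e.contr (exte b A)) P" by (intro e.ideal_contr e.ideal_ext A)
    have "set gs \<subseteq> e.contr (exte b A)"
    proof
      fix g assume g: "g \<in> set gs"
      have "e b (w g \<otimes> g) \<in> exte b A" using w[OF g] P.ideal_carrier[OF A] by (intro e.h_mem_ext) auto
      then have "e b (w g) \<otimes>\<^bsub>T\<^esub> e b g \<in> exte b A" using w g gs by auto
      then have "e b g \<in> exte b A"
        using g gs elim by (subst (asm) T.ideal_unit_mult_iff[OF e.ideal_ext[OF A]]) auto
      then show "g \<in> e.contr (exte b A)" using g gs by (auto simp: e.contr_def)
    qed
    then have "C \<subseteq> e.contr (exte b A)" unfolding gs(2) by (rule P.genideal_minimal[OF J])
    then have "exte b C \<subseteq> exte b A"
      by (intro e.ext_minimal e.ideal_ext A) (auto simp: e.contr_def)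
    moreover have "A \<subseteq> C"
      using P.ideal_carrier[OF A] \<iota>.h_mem_ext by (auto simp: C_def \<iota>.contr_def)
    then have "exte b A \<subseteq> exte b C" by (rule e.ext_mono)
    ultimately show ?case by (simp add: spec_def C_def)
  qed
qed

text \<open>Regularity of \<open>f\<close> says that the colon by \<open>f\<close> stays inside the
  base, and \<open>eventually_colon_single\<close> preserves this.\<close>

lemma eventually_regm:
  "\<lbrakk>ideal A P; set fs \<subseteq> carrier P; \<iota>.S.regm (\<iota>.ext A) (map \<iota> fs)\<rbrakk> \<Longrightarrow>
    eventually (\<lambda>b. T.regm (exte b A) (map (e b) fs)) generic"
proof (induction fs arbitrary: A)
  case (Cons f fs)
  note A = Cons.prems(1)
  have f: "f \<in> carrier P" "set fs \<subseteq> carrier P" using Cons.prems by auto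
  define C where "C = \<iota>.contr (\<iota>.ext A)"
  have C: "ideal C P" unfolding C_def by (intro \<iota>.ideal_contr \<iota>.ideal_ext A)
  have reg: "\<iota>.S.reg (\<iota>.ext A) (\<iota> f)" using Cons.prems by simp
  have col: "colon_ideal P C {f} \<subseteq> C"
  proof
    fix g assume "g \<in> colon_ideal P C {f}"
    then have g: "g \<in> carrier P" "\<iota> g \<otimes>\<^bsub>S\<^esub> \<iota> f \<in> \<iota>.ext A"
      using f by (auto simp: C_def \<iota>.contr_def colon_ideal_def)
    then have "\<iota> g \<in> \<iota>.ext A" using \<iota>.S.regD[OF reg _ g(2)] by simp
    then show "g \<in> C" using g by (simp add: C_def \<iota>.contr_def)
  qed
  have "eventually (\<lambda>b. T.regm (exte b (P.adj A f)) (map (e b) fs)) generic"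
    using Cons.prems f by (intro Cons.IH) (auto simp: P.ideal_adj \<iota>.ext_adj)
  then show ?case
    using eventually_colon_single[OF C f(1)] eventually_spec_ext[OF A] eventually_in_B
  proof eventually_elim
    case (elim b)
    interpret e: fractional_hom P T "e b" "{r \<otimes> (t \<ominus> b) | r. r \<in> carrier P}" using elim by (intro e)
    have "exte b C = exte b A" using elim(3) by (simp add: spec_def C_def)
    then have "colon_ideal T (exte b A) {e b f} \<subseteq> exte b A" using elim(2) e.ext_mono[OF col] by simp
    then have "T.reg (exte b A) (e b f)" using f by (auto simp: T.reg_def colon_ideal_def)
    then show ?case using elim(1) A f by (simp add: e.ext_adj)
  qed
qed simp

lemma ideal_spec: "\<lbrakk>b \<in> B; ideal K S\<rbrakk> \<Longrightarrow> ideal (spec b K) T"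
  unfolding spec_def using e by (intro fractional_hom.ideal_ext \<iota>.ideal_contr)

lemma spec_carrier: assumes "b \<in> B" shows "spec b (carrier S) = carrier T"
proof -
  interpret e: fractional_hom P T "e b" "{r \<otimes> (t \<ominus> b) | r. r \<in> carrier P}" using assms by (intro e)
  have "\<iota>.contr (carrier S) = carrier P" by (auto simp: \<iota>.contr_def)
  then show ?thesis by (simp add: spec_def e.ext_carrier)
qed

text \<open>If the sequence specializes to the unit ideal, so does \<open>K\<close>, and the chain
  ends there. Since \<open>linked_to_unit\<close> holds for the unit ideal at every index, such a
  shortened chain still satisfies the same bound.\<close>

lemma eventually_linked_by:
  assumes l: "\<iota>.S.linked_by (map \<iota> fs) K K'" and fs: "set fs \<subseteq> carrier P"
  shows "eventually (\<lambda>b. spec b K = carrier T \<or> T.linked_by (map (e b) fs) (spec b K) (spec b K')) generic"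
proof -
  note D = \<iota>.S.linked_byD[OF l]
  define X where "X = \<iota>.S.adjl {\<zero>\<^bsub>S\<^esub>} (map \<iota> fs)"
  have X: "ideal X S" unfolding X_def by (rule \<iota>.S.linked_by_ideal_adjl[OF l])
  define A where "A = P.adjl {\<zero>} fs"
  have A: "ideal A P" unfolding A_def using fs by (intro P.ideal_adjl P.zeroideal)
  have XA: "X = \<iota>.ext A" unfolding X_def A_def \<iota>.ext_adjl[OF P.zeroideal fs] \<iota>.ext_zero ..
  have "\<iota>.S.regm (\<iota>.ext {\<zero>}) (map \<iota> fs)" using D(1) by (simp add: \<iota>.ext_zero)
  from eventually_regm[OF P.zeroideal fs this]
  show ?thesis
    using eventually_spec_ext[OF A] eventually_spec_colon[OF X D(3)] eventually_spec_colon[OF X D(4)]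
      eventually_in_B
  proof eventually_elim
    case (elim b)
    interpret e: fractional_hom P T "e b" "{r \<otimes> (t \<ominus> b) | r. r \<in> carrier P}" using elim by (intro e)
    have Xb: "spec b X = T.adjl {\<zero>\<^bsub>T\<^esub>} (map (e b) fs)"
      using elim(2) e.ext_adjl[OF P.zeroideal fs] e.ext_zero by (simp add: XA A_def)
    have iK: "ideal (spec b K) T" "ideal (spec b K') T" using elim D by (auto intro: ideal_spec)
    have c: "spec b K = colon_ideal T (spec b X) (spec b K')" "spec b K' = colon_ideal T (spec b X) (spec b K)"
      using elim(3,4) \<iota>.S.linked_by_colon[OF l, folded X_def] by metis+
    have sub: "set (map (e b) fs) \<subseteq> spec b K"
      using fs D(5) by (auto simp: spec_def \<iota>.contr_def intro!: e.h_mem_ext)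
    show ?case
    proof (cases "spec b X = carrier T")
      case True
      then show ?thesis using T.adjl_subset[OF iK(1), of "{\<zero>\<^bsub>T\<^esub>}" "map (e b) fs"] sub T.ideal_zero[OF iK(1)]
          T.ideal_subset_carrier[OF iK(1)] by (simp add: Xb)
    next
      case False
      have "T.regm {\<zero>\<^bsub>T\<^esub>} (map (e b) fs)" using elim(1) e.ext_zero by simp
      then show ?thesis
        using False iK sub c unfolding T.linked_by_def Xb by blast
    qed
  qed
qed

lemma eventually_linked_to_unit_link:
  assumes l: "\<iota>.S.linked_by xs K K'" and K': "eventually (\<lambda>b. T.linked_to_unit c (spec b K')) generic"
  shows "eventually (\<lambda>b. T.linked_to_unit (Suc c) (spec b K)) generic"
proof -
  obtain fs where fs: "set fs \<subseteq> carrier P" "\<iota>.S.linked_by (map \<iota> fs) K K'"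
    by (rule \<iota>.linked_by_clear_denominators[OF l])
  show ?thesis using eventually_linked_by[OF fs(2,1)] K'
  proof eventually_elim
    case (elim b)
    from elim(1) show ?case
    proof
      assume "spec b K = carrier T"
      then show ?thesis using T.linked_to_unit.unit[of "Suc c"] by simp
    next
      assume "T.linked_by (map (e b) fs) (spec b K) (spec b K')"
      then show ?thesis using elim(2) by (rule T.linked_to_unit.link)
    qed
  qed
qed

lemma eventually_linked_to_unit:
  "\<iota>.S.linked_to_unit c K \<Longrightarrow> eventually (\<lambda>b. T.linked_to_unit c (spec b K)) generic"
proof (induction rule: \<iota>.S.linked_to_unit.induct)
  case (unit c)
  show ?case using eventually_in_B
    by eventually_elim (simp add: spec_carrier T.linked_to_unit.unit)
next
  case (link xs K K' c)
  show ?case using link.hyps(1) link.IH by (rule eventually_linked_to_unit_link)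
qed

end

section \<open>Heights of prime ideals\<close>

context cring
begin

lemma primeideal_ideal: "primeideal P R \<Longrightarrow> ideal P R"
  by (rule primeideal.axioms(1))

lemma prime_one_notin: "primeideal P R \<Longrightarrow> \<one> \<notin> P"
  using primeideal.I_notcarr ideal_eq_carrier_iff primeideal_ideal by metis

lemma prime_mult_iff:
  assumes "primeideal P R" "a \<in> carrier R" "b \<in> carrier R"
  shows "a \<otimes> b \<in> P \<longleftrightarrow> a \<in> P \<or> b \<in> P"
  using primeideal.I_prime[OF assms(1), of a b] ideal_mult[OF primeideal_ideal[OF assms(1)], of b a]
    ideal_mult_right[OF primeideal_ideal[OF assms(1)], of a b] assms by blast

lemma prime_pow_memD:
  assumes "primeideal P R" "a \<in> carrier R" "a [^] (n::nat) \<in> P" shows "a \<in> P"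
  using assms(3) prime_one_notin[OF assms(1)] prime_mult_iff[OF assms(1)] assms(2)
  by (induction n) auto

lemma prime_idealI:
  assumes "ideal P R" "\<one> \<notin> P"
    and "\<And>a b. \<lbrakk>a \<in> carrier R; b \<in> carrier R; a \<otimes> b \<in> P; a \<notin> P\<rbrakk> \<Longrightarrow> b \<in> P"
  shows "primeideal P R"
  using assms by (intro primeidealI is_cring) blast+

text \<open>The contraction of the extension of \<open>N\<close> to the localization at \<open>P\<close>.\<close>

definition sat_at :: "'a set \<Rightarrow> 'a set \<Rightarrow> 'a set" where
  "sat_at P N = {f \<in> carrier R. \<exists>w\<in>carrier R - P. w \<otimes> f \<in> N}"

lemma prime_compl_mult:
  "\<lbrakk>primeideal P R; v \<in> carrier R - P; w \<in> carrier R - P\<rbrakk> \<Longrightarrow> v \<otimes> w \<in> carrier R - P"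
  by (auto simp: prime_mult_iff)

lemma prime_compl_one: "primeideal P R \<Longrightarrow> \<one> \<in> carrier R - P"
  by (auto simp: prime_one_notin)

lemma ideal_sat_at: assumes P: "primeideal P R" and N: "ideal N R" shows "ideal (sat_at P N) R"
proof (rule ideal_closedI)
  show "\<zero> \<in> sat_at P N"
    using prime_compl_one[OF P] ideal_zero[OF N] by (force simp: sat_at_def)
next
  fix x y assume "x \<in> sat_at P N" "y \<in> sat_at P N"
  then obtain v w where 1: "x \<in> carrier R" "y \<in> carrier R" "v \<in> carrier R - P" "w \<in> carrier R - P"
    "v \<otimes> x \<in> N" "w \<otimes> y \<in> N" by (auto simp: sat_at_def)
  have vw: "v \<in> carrier R" "w \<in> carrier R" using 1 by auto
  have "(v \<otimes> w) \<otimes> (x \<oplus> y) = w \<otimes> (v \<otimes> x) \<oplus> v \<otimes> (w \<otimes> y)"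
    by (rule ring_identity, (rule ring_split | simp add: ring_norm 1(1,2) vw)+)
  also have "\<dots> \<in> N" using 1 by (simp add: ideal_add[OF N] ideal_mult[OF N])
  finally show "x \<oplus> y \<in> sat_at P N" using prime_compl_mult[OF P 1(3,4)] 1 by (auto simp: sat_at_def)
next
  fix r x assume r: "r \<in> carrier R" and "x \<in> sat_at P N"
  then obtain v where 1: "x \<in> carrier R" "v \<in> carrier R - P" "v \<otimes> x \<in> N" by (auto simp: sat_at_def)
  have "v \<otimes> (r \<otimes> x) = r \<otimes> (v \<otimes> x)" using 1 r by (simp add: m_lcomm)
  also have "\<dots> \<in> N" using 1 r by (simp add: ideal_mult[OF N])
  finally show "r \<otimes> x \<in> sat_at P N" using 1 r by (auto simp: sat_at_def)
qed (auto simp: sat_at_def)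

lemma sat_at_incl: "\<lbrakk>primeideal P R; ideal N R\<rbrakk> \<Longrightarrow> N \<subseteq> sat_at P N"
  using prime_compl_one[of P] ideal_carrier[of N] by (force simp: sat_at_def)

lemma sat_at_cancel:
  assumes P: "primeideal P R" and "w \<in> carrier R" "w \<notin> P" "f \<in> carrier R" "w \<otimes> f \<in> sat_at P N"
  shows "f \<in> sat_at P N"
proof -
  obtain v where v: "v \<in> carrier R - P" "v \<otimes> (w \<otimes> f) \<in> N" using assms by (auto simp: sat_at_def)
  then have "(v \<otimes> w) \<otimes> f \<in> N" using assms by (simp add: m_assoc)
  moreover have "v \<otimes> w \<in> carrier R - P" using prime_compl_mult[OF P v(1)] assms by blast
  ultimately show ?thesis using assms(4) unfolding sat_at_def by blast
qed

lemma one_notin_sat_at: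
  assumes "primeideal P R" "N \<subseteq> P" shows "\<one> \<notin> sat_at P N"
  using assms by (auto simp: sat_at_def)

text \<open>The chains counted by \<open>prime_height\<close>, with their length as a natural
  number, so that inductions on heights involve no suprema.\<close>

definition prime_chain :: "nat \<Rightarrow> 'a set \<Rightarrow> bool" where
  "prime_chain n P \<longleftrightarrow> (\<exists>C :: nat \<Rightarrow> 'a set.
     (\<forall>i\<le>n. primeideal (C i) R) \<and> (\<forall>i<n. C i \<subset> C (Suc i)) \<and> C n = P)"

lemma prime_chain_prime: "prime_chain n P \<Longrightarrow> primeideal P R"
  by (auto simp: prime_chain_def)

lemma prime_chain_0: "primeideal P R \<Longrightarrow> prime_chain 0 P"
  by (auto simp: prime_chain_def)

lemma prime_chain_Suc:
  assumes "prime_chain n P" "primeideal Q R" "P \<subset> Q" shows "prime_chain (Suc n) Q"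
proof -
  obtain C where C: "\<forall>i\<le>n. primeideal (C i) R" "\<forall>i<n. C i \<subset> C (Suc i)" "C n = P"
    using assms(1) by (auto simp: prime_chain_def)
  show ?thesis unfolding prime_chain_def
    using C assms(2,3) by (intro exI[of _ "C(Suc n := Q)"]) (auto simp: less_Suc_eq le_Suc_eq)
qed

lemma prime_chain_SucD: "prime_chain (Suc n) Q \<Longrightarrow> \<exists>P. prime_chain n P \<and> P \<subset> Q"
  by (auto simp: prime_chain_def) (metis le_SucI lessI less_Suc_eq)

lemma prime_chain_antimono:
  assumes "prime_chain n P" "k \<le> n" shows "prime_chain k P"
proof -
  obtain C where C: "\<forall>i\<le>n. primeideal (C i) R" "\<forall>i<n. C i \<subset> C (Suc i)" "C n = P"
    using assms(1) by (auto simp: prime_chain_def)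
  show ?thesis unfolding prime_chain_def
    using C assms(2) by (intro exI[of _ "\<lambda>i. C (i + (n - k))"]) auto
qed

lemma prime_height_eq: "prime_height R P = Sup {enat n | n. prime_chain n P}"
  unfolding prime_height_def prime_chain_def ..

lemma prime_chain_le_height: "prime_chain n P \<Longrightarrow> enat n \<le> prime_height R P"
  unfolding prime_height_eq by (rule Sup_upper) blast

lemma height_le_prime_chain: assumes "\<not> prime_chain (Suc n) P" shows "prime_height R P \<le> enat n"
  unfolding prime_height_eq
proof (rule Sup_least, clarify)
  fix k assume "prime_chain k P"
  then show "enat k \<le> enat n" using assms prime_chain_antimono[of k P "Suc n"] by (cases "Suc n \<le> k") auto
qed

end

section \<open>Existence of primes and Krull's height theorem\<close>

context noetherian_cring
begin

text \<open>An annihilator that is maximal among those of the multiples of \<open>u\<close> outside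
  \<open>N\<close> is prime.\<close>

lemma exists_associated_prime:
  assumes N: "ideal N R" and u: "u \<in> carrier R" "u \<notin> N"
  obtains r where "r \<in> carrier R" "r \<otimes> u \<notin> N" "primeideal (colon_ideal R N {r \<otimes> u}) R"
proof -
  define S where "S = {colon_ideal R N {r \<otimes> u} | r. r \<in> carrier R \<and> r \<otimes> u \<notin> N}"
  have S: "ideal J R" if "J \<in> S" for J using that N u by (auto simp: S_def intro!: ideal_colon)
  have "colon_ideal R N {\<one> \<otimes> u} \<in> S"
    unfolding S_def using u by (intro CollectI exI[of _ \<one>]) auto
  then obtain M where M: "M \<in> S" "colon_ideal R N {\<one> \<otimes> u} \<subseteq> M" "\<And>J. \<lbrakk>J \<in> S; M \<subseteq> J\<rbrakk> \<Longrightarrow> J = M"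
    using maximal_ideal_in[of _ S] S by meson
  obtain r where r: "r \<in> carrier R" "r \<otimes> u \<notin> N" "M = colon_ideal R N {r \<otimes> u}"
    using M(1) by (auto simp: S_def)
  have "primeideal M R"
  proof (rule prime_idealI)
    show "ideal M R" using M S by blast
    show "\<one> \<notin> M" using r u by (simp add: colon_ideal_def)
    fix a b assume ab: "a \<in> carrier R" "b \<in> carrier R" "a \<otimes> b \<in> M" "a \<notin> M"
    have "(a \<otimes> r) \<otimes> u \<notin> N" using ab r u by (simp add: colon_ideal_def m_assoc)
    then have "colon_ideal R N {(a \<otimes> r) \<otimes> u} \<in> S" unfolding S_def using ab r by blast
    moreover have "M \<subseteq> colon_ideal R N {(a \<otimes> r) \<otimes> u}"
    proof
      fix f assume "f \<in> M"
      then have f: "f \<in> carrier R" "f \<otimes> (r \<otimes> u) \<in> N" by (auto simp: r(3) colon_ideal_def)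
      have "f \<otimes> ((a \<otimes> r) \<otimes> u) = a \<otimes> (f \<otimes> (r \<otimes> u))" using f ab r u by (simp add: m_ac)
      then show "f \<in> colon_ideal R N {(a \<otimes> r) \<otimes> u}"
        using f ab ideal_mult[OF N f(2) ab(1)] by (simp add: colon_ideal_def)
    qed
    ultimately have eq: "colon_ideal R N {(a \<otimes> r) \<otimes> u} = M" using M(3) by blast
    have "b \<otimes> ((a \<otimes> r) \<otimes> u) = (a \<otimes> b) \<otimes> (r \<otimes> u)" using ab r u by (simp add: m_ac)
    then have "b \<in> colon_ideal R N {(a \<otimes> r) \<otimes> u}" using ab(2,3) by (simp add: r(3) colon_ideal_def)
    then show "b \<in> M" using eq by simp
  qed
  then show ?thesis using that r by simp
qed

lemma exists_prime_disjoint: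
  assumes A: "ideal A R" and W: "W \<subseteq> carrier R" "\<one> \<in> W" "\<And>v w. \<lbrakk>v \<in> W; w \<in> W\<rbrakk> \<Longrightarrow> v \<otimes> w \<in> W"
    and AW: "A \<inter> W = {}"
  obtains P where "primeideal P R" "A \<subseteq> P" "P \<inter> W = {}"
proof -
  define S where "S = {J. ideal J R \<and> A \<subseteq> J \<and> J \<inter> W = {}}"
  have "A \<in> S" "\<And>J. J \<in> S \<Longrightarrow> ideal J R" using A AW by (auto simp: S_def)
  then obtain M where M: "M \<in> S" "A \<subseteq> M" "\<And>J. \<lbrakk>J \<in> S; M \<subseteq> J\<rbrakk> \<Longrightarrow> J = M"
    using maximal_ideal_in[of _ S] by meson
  have Mi: "ideal M R" "A \<subseteq> M" "M \<inter> W = {}" using M by (auto simp: S_def)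
  have meet: "\<exists>w\<in>W. w \<in> adj M a" if a: "a \<in> carrier R" "a \<notin> M" for a
  proof (rule ccontr)
    assume "\<not> (\<exists>w\<in>W. w \<in> adj M a)"
    then have "adj M a \<in> S" using Mi a adj_incl[OF Mi(1) a(1)] by (auto simp: S_def ideal_adj)
    then have "adj M a = M" using M(3) adj_incl[OF Mi(1) a(1)] by blast
    then show False using adj_self[OF Mi(1) a(1)] a by blast
  qed
  have "primeideal M R"
  proof (rule prime_idealI)
    show "\<one> \<notin> M" using Mi W by blast
    fix a b assume ab: "a \<in> carrier R" "b \<in> carrier R" "a \<otimes> b \<in> M" "a \<notin> M"
    show "b \<in> M"
    proof (rule ccontr)
      assume "b \<notin> M"
      then obtain v w where vw: "v \<in> W" "v \<in> adj M a" "w \<in> W" "w \<in> adj M b"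
        using meet ab by metis
      obtain n r where 1: "n \<in> M" "n \<in> carrier R" "r \<in> carrier R" "v = n \<oplus> r \<otimes> a"
        using vw(2) Mi(1) by (rule adjE)
      obtain l s where 2: "l \<in> M" "l \<in> carrier R" "s \<in> carrier R" "w = l \<oplus> s \<otimes> b"
        using vw(4) Mi(1) by (rule adjE)
      have "v \<otimes> w = w \<otimes> n \<oplus> (r \<otimes> a) \<otimes> l \<oplus> (r \<otimes> s) \<otimes> (a \<otimes> b)"
        unfolding 1(4) 2(4) by (rule ring_identity, (rule ring_split | simp add: ring_norm 1(2,3) 2(2,3) ab)+)
      also have "\<dots> \<in> M"
        using 1 2 ab vw W(1) by (simp add: ideal_add[OF Mi(1)] ideal_mult[OF Mi(1)] subset_iff)
      finally show False using W(3) vw Mi by blast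
    qed
  qed (use Mi in auto)
  then show ?thesis using that Mi by blast
qed

text \<open>The argument with symbolic powers, carried out modulo \<open>q0\<close> and locally at
  \<open>P\<close> inside the given ring. The ideals \<open>D n\<close> become stationary locally at
  \<open>P\<close>, Nakayama's lemma passes this to the symbolic powers \<open>J n\<close>, and
  cancelling a power of \<open>y\<close> modulo the prime \<open>q0\<close> contradicts y \<in>
  q.\<close>

theorem krull_principal_ideal:
  assumes q0: "primeideal q0 R" and q: "primeideal q R" and P: "primeideal P R"
    and chain: "q0 \<subset> q" "q \<subset> P" and x: "x \<in> P"
    and min: "\<And>Q. \<lbrakk>primeideal Q R; q0 \<subseteq> Q; x \<in> Q; Q \<subseteq> P\<rbrakk> \<Longrightarrow> Q = P"
  shows False
proof -
  note iq0 = primeideal_ideal[OF q0] and iq = primeideal_ideal[OF q] and iP = primeideal_ideal[OF P]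
  have xc: "x \<in> carrier R" using x iP ideal_carrier by blast
  have xq: "x \<notin> q" using min[OF q] chain by blast
  obtain y where y: "y \<in> q" "y \<notin> q0" using chain by blast
  have yc: "y \<in> carrier R" using y iq ideal_carrier by blast
  define W where "W = carrier R - P"
  have W: "W \<subseteq> carrier R" "\<one> \<in> W" "\<And>v w. \<lbrakk>v \<in> W; w \<in> W\<rbrakk> \<Longrightarrow> v \<otimes> w \<in> W"
    unfolding W_def using prime_compl_one[OF P] prime_compl_mult[OF P] by blast+
  define J where "J n = sat_at q (adj q0 (y [^] n))" for n :: nat
  have ia: "ideal (adj q0 (y [^] n)) R" for n :: nat using iq0 yc by (intro ideal_adj) auto
  have J: "ideal (J n) R" for n unfolding J_def using q ia by (rule ideal_sat_at)
  have aJ: "adj q0 (y [^] n) \<subseteq> J n" for n unfolding J_def using q ia by (rule sat_at_incl)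
  have q0J: "q0 \<subseteq> J n" for n using aJ adj_incl[OF iq0, of "y [^] n"] yc by fastforce
  have "adj q0 (y [^] Suc n) \<subseteq> adj q0 (y [^] n)" for n
    using adj_pow_antimono[OF iq0 yc, of _ n 1] by auto
  then have JS: "J (Suc n) \<subseteq> J n" for n unfolding J_def by (auto simp: sat_at_def)
  define D where "D n = adj (J n) x" for n
  have D: "ideal (D n) R" for n unfolding D_def using J xc by (intro ideal_adj)
  have DS: "D (Suc n) \<subseteq> D n" for n unfolding D_def by (rule adj_mono[OF JS])
  have Dmono: "D k \<subseteq> D n" if "n \<le> k" for n k using that by (induction rule: dec_induct) (use DS in auto)
  define A0 where "A0 = adj q0 x"
  have A0: "ideal A0 R" unfolding A0_def using iq0 xc by (intro ideal_adj)
  \<comment> \<open>Substitute for finite length of the localized quotient by q0 + (x):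
    \<open>good C\<close> says that \<open>D n\<close>, cut down to \<open>C\<close>, is eventually
    stationary up to factors outside \<open>P\<close>. A maximal good ideal will turn out to meet
    \<open>W\<close>, which removes the restriction to it.\<close>
  define good where "good C \<longleftrightarrow> ideal C R \<and> A0 \<subseteq> C \<and>
    (\<exists>n0. \<forall>n\<ge>n0. \<forall>f\<in>D n \<inter> C. \<exists>w\<in>W. w \<otimes> f \<in> D (Suc n))" for C
  have "good A0"
    unfolding good_def
  proof (intro conjI exI[of _ 0] allI impI ballI)
    fix n f assume "f \<in> D n \<inter> A0"
    moreover have "A0 \<subseteq> D (Suc n)" unfolding A0_def D_def by (rule adj_mono[OF q0J])
    ultimately show "\<exists>w\<in>W. w \<otimes> f \<in> D (Suc n)" using W(2) D ideal_carrier by (metis IntE l_one subsetD)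
  qed (use A0 in auto)
  then have "A0 \<in> Collect good" "\<And>J. J \<in> Collect good \<Longrightarrow> ideal J R" by (auto simp: good_def)
  then obtain M where M': "M \<in> Collect good" "A0 \<subseteq> M" "\<And>J. \<lbrakk>J \<in> Collect good; M \<subseteq> J\<rbrakk> \<Longrightarrow> J = M"
    using maximal_ideal_in[of A0 "Collect good"] by meson
  then have M: "good M" "\<And>C. \<lbrakk>good C; M \<subseteq> C\<rbrakk> \<Longrightarrow> C = M" by auto
  have iM: "ideal M R" "A0 \<subseteq> M" using M by (auto simp: good_def)
  obtain n0 where n0: "\<And>n f. \<lbrakk>n0 \<le> n; f \<in> D n; f \<in> M\<rbrakk> \<Longrightarrow> \<exists>w\<in>W. w \<otimes> f \<in> D (Suc n)"
    using M(1) unfolding good_def by blast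
  have "\<exists>w\<in>W. w \<in> M"
  proof (rule ccontr)
    assume no: "\<not> (\<exists>w\<in>W. w \<in> M)"
    then have MP: "M \<subseteq> P" using iM ideal_carrier by (auto simp: W_def)
    define N where "N = sat_at P M"
    have N: "ideal N R" "M \<subseteq> N" "\<one> \<notin> N"
      unfolding N_def using P iM MP by (auto intro: ideal_sat_at simp: one_notin_sat_at dest: sat_at_incl)
    obtain r where r: "r \<in> carrier R" "r \<otimes> \<one> \<notin> N" "primeideal (colon_ideal R N {r \<otimes> \<one>}) R"
      using exists_associated_prime[OF N(1) _ N(3)] by blast
    define v where "v = r \<otimes> \<one>"
    have vc: "v \<in> carrier R" using r by (simp add: v_def)
    define Q where "Q = colon_ideal R N {v}"
    have Q: "primeideal Q R" using r by (simp add: Q_def v_def)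
    have "Q \<subseteq> P"
    proof
      fix f assume "f \<in> Q"
      then have f: "f \<in> carrier R" "f \<otimes> v \<in> N" by (auto simp: Q_def colon_ideal_def)
      show "f \<in> P"
      proof (rule ccontr)
        assume "f \<notin> P"
        then have "v \<in> N" using sat_at_cancel[OF P f(1) _ vc] f(2) by (simp add: N_def)
        then show False using r by (simp add: v_def)
      qed
    qed
    moreover have "A0 \<subseteq> Q"
      using iM N vc A0 ideal_carrier[OF A0] by (auto simp: Q_def colon_ideal_def intro!: ideal_mult_right[OF N(1)])
    moreover have "q0 \<subseteq> A0" "x \<in> A0"
      unfolding A0_def using iq0 xc by (auto intro: adj_incl adj_self)
    ultimately have QP: "Q = P" using min[OF Q] by blast
    \<comment> \<open>As the associated prime is \<open>P\<close>, the quotient of M + (v) by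
      \<open>M\<close> is simple locally at \<open>P\<close>. So either every \<open>D n\<close>
      contains, modulo \<open>M\<close>, a multiple of \<open>v\<close> by an element of
      \<open>W\<close>, or from some \<open>n\<close> on none does; in both cases stationarity
      extends from \<open>M\<close>.\<close>
    have "good (adj M v)"
      unfolding good_def
    proof (intro conjI)
      show "ideal (adj M v) R" using iM vc by (intro ideal_adj)
      show "A0 \<subseteq> adj M v" using iM adj_incl[OF iM(1) vc] by blast
      define hit where "hit n \<longleftrightarrow> (\<exists>g\<in>D n. \<exists>r\<in>W. \<exists>c\<in>M. g = c \<oplus> r \<otimes> v)" for n
      have hit_mono: "hit k \<Longrightarrow> n \<le> k \<Longrightarrow> hit n" for n k using Dmono unfolding hit_def by blast
      show "\<exists>n0. \<forall>n\<ge>n0. \<forall>f\<in>D n \<inter> adj M v. \<exists>w\<in>W. w \<otimes> f \<in> D (Suc n)"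
      proof (cases "\<forall>n. hit n")
        case True
        show ?thesis
        proof (intro exI[of _ n0] allI impI ballI)
          fix n f assume n: "n0 \<le> n" and f: "f \<in> D n \<inter> adj M v"
          then obtain c s where 1: "c \<in> M" "c \<in> carrier R" "s \<in> carrier R" "f = c \<oplus> s \<otimes> v"
            using iM(1) adjE by (metis IntE)
          obtain g s' c' where 2: "g \<in> D (Suc n)" "s' \<in> W" "c' \<in> M" "g = c' \<oplus> s' \<otimes> v"
            using True unfolding hit_def by blast
          have c: "c' \<in> carrier R" "s' \<in> carrier R" using 2 iM ideal_carrier W by auto
          have "s' \<otimes> f \<ominus> s \<otimes> g \<in> D n"
            using f 2 DS[of n] c 1(3) by (auto intro!: ideal_minus[OF D] ideal_mult[OF D])
          moreover have "s' \<otimes> f \<ominus> s \<otimes> g = s' \<otimes> c \<ominus> s \<otimes> c'"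
            unfolding 1(4) 2(4) by (rule ring_identity, (rule ring_split | simp add: ring_norm 1(2,3) c vc)+)
          moreover have "s' \<otimes> c \<ominus> s \<otimes> c' \<in> M"
            using 1 2 c by (simp add: ideal_minus[OF iM(1)] ideal_mult[OF iM(1)])
          ultimately obtain w where w: "w \<in> W" "w \<otimes> (s' \<otimes> f \<ominus> s \<otimes> g) \<in> D (Suc n)"
            using n0[OF n] by metis
          have wc: "w \<in> carrier R" "g \<in> carrier R" "f \<in> carrier R"
            using w(1) W(1) ideal_carrier[OF D 2(1)] ideal_carrier[OF D, of f n] f by blast+
          have "(w \<otimes> s') \<otimes> f = w \<otimes> (s' \<otimes> f \<ominus> s \<otimes> g) \<oplus> (w \<otimes> s) \<otimes> g"
            by (rule ring_identity, (rule ring_split | simp add: ring_norm 1(3) c wc)+)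
          also have "\<dots> \<in> D (Suc n)" using w 2 1(3) wc by (simp add: ideal_add[OF D] ideal_mult[OF D])
          finally show "\<exists>w\<in>W. w \<otimes> f \<in> D (Suc n)" using W(3)[OF w(1) 2(2)] by blast
        qed
      next
        case False
        then obtain n1 where n1: "\<not> hit n1" by blast
        show ?thesis
        proof (intro exI[of _ "max n0 n1"] allI impI ballI)
          fix n f assume n: "max n0 n1 \<le> n" and f: "f \<in> D n \<inter> adj M v"
          then obtain c s where 1: "c \<in> M" "c \<in> carrier R" "s \<in> carrier R" "f = c \<oplus> s \<otimes> v"
            using iM(1) adjE by (metis IntE)
          have "\<not> hit n" using n1 hit_mono n by auto
          then have "s \<in> P" using f 1 unfolding hit_def W_def by blast
          then have "s \<otimes> v \<in> N" using QP by (auto simp: Q_def colon_ideal_def)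
          then obtain w where w: "w \<in> W" "w \<otimes> (s \<otimes> v) \<in> M" by (auto simp: N_def sat_at_def W_def)
          have wc: "w \<in> carrier R" "f \<in> carrier R" using w(1) W(1) ideal_carrier[OF D, of f n] f by blast+
          have "w \<otimes> f = w \<otimes> c \<oplus> w \<otimes> (s \<otimes> v)"
            unfolding 1(4) by (rule ring_identity, (rule ring_split | simp add: ring_norm 1(2,3) wc vc)+)
          also have "\<dots> \<in> M" using w 1 wc by (simp add: ideal_add[OF iM(1)] ideal_mult[OF iM(1)])
          finally have "w \<otimes> f \<in> M" .
          moreover have "w \<otimes> f \<in> D n" using f wc by (simp add: ideal_mult[OF D])
          ultimately obtain w' where w': "w' \<in> W" "w' \<otimes> (w \<otimes> f) \<in> D (Suc n)"
            using n0[of n] n by auto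
          then have "(w' \<otimes> w) \<otimes> f \<in> D (Suc n)" using W(1) wc by (simp add: m_assoc subset_iff)
          then show "\<exists>w\<in>W. w \<otimes> f \<in> D (Suc n)" using W(3)[OF w'(1) w(1)] by blast
        qed
      qed
    qed
    then have "adj M v = M" using M(2) adj_incl[OF iM(1) vc] by blast
    then have "v \<in> N" using adj_self[OF iM(1) vc] N by blast
    then show False using r by (simp add: v_def)
  qed
  then obtain w where w: "w \<in> W" "w \<in> M" by blast
  have wc: "w \<in> carrier R" using w W by blast
  \<comment> \<open>Up to a factor from \<open>W\<close>, an element of \<open>J n0\<close> is j +
    hx with \<open>j\<close> in the next ideal, and \<open>h\<close> lies in \<open>J n0\<close>
    because \<open>x\<close> is outside \<open>q\<close>. This is the hypothesis of Nakayama's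
    lemma.\<close>
  have "J n0 \<subseteq> J (Suc n0)"
  proof (rule nakayama_mult_subset[OF J J xc W])
    fix v r assume v: "v \<in> W" and r: "r \<in> carrier R"
    have "x \<otimes> r \<in> P" using x r by (simp add: ideal_mult_right[OF iP])
    then show "v \<ominus> x \<otimes> r \<in> W" using ideal_diff_iff[OF iP, of v "x \<otimes> r"] v r xc
      by (auto simp: W_def)
  next
    fix v f assume v: "v \<in> W" and f: "f \<in> carrier R" "v \<otimes> f \<in> J (Suc n0)"
    show "f \<in> J (Suc n0)"
      using sat_at_cancel[OF q _ _ f(1), of v] v f(2) chain unfolding J_def W_def by blast
  next
    fix f assume f: "f \<in> J n0"
    then have fc: "f \<in> carrier R" using J ideal_carrier by blast
    have "f \<in> D n0" unfolding D_def using J xc f by (auto intro: adj_incl)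
    then have "w \<otimes> f \<in> D n0" "w \<otimes> f \<in> M"
      using w wc fc by (auto intro: ideal_mult[OF D] ideal_mult_right[OF iM(1)])
    then obtain w' where w': "w' \<in> W" "w' \<otimes> (w \<otimes> f) \<in> D (Suc n0)" using n0 by blast
    obtain j h where 1: "j \<in> J (Suc n0)" "j \<in> carrier R" "h \<in> carrier R" "w' \<otimes> (w \<otimes> f) = j \<oplus> h \<otimes> x"
      using w'(2) J unfolding D_def by (rule adjE)
    have w'c: "w' \<in> carrier R" using w' W by blast
    have "h \<otimes> x = w' \<otimes> (w \<otimes> f) \<ominus> j" unfolding 1(4) using 1(2,3) xc by algebra
    also have "\<dots> \<in> J n0"
      using f 1(1) JS w'c wc by (auto intro!: ideal_minus[OF J] ideal_mult[OF J])
    finally have "x \<otimes> h \<in> J n0" using 1 xc by (simp add: m_comm)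
    then have "h \<in> J n0" unfolding J_def using sat_at_cancel[OF q xc xq 1(3)] by blast
    moreover have "(w' \<otimes> w) \<otimes> f = j \<oplus> x \<otimes> h"
      using 1(4) m_assoc[OF w'c wc fc] m_comm[OF 1(3) xc] by simp
    ultimately show "\<exists>w\<in>W. \<exists>a\<in>J (Suc n0). \<exists>e\<in>J n0. w \<otimes> f = a \<oplus> x \<otimes> e"
      using W(3)[OF w'(1) w(1)] 1(1) by blast
  qed
  define p where "p = y [^] n0"
  have pc: "p \<in> carrier R" using yc by (simp add: p_def)
  have "p \<in> J n0" using aJ[of n0] adj_self[OF iq0, of p] pc by (auto simp: p_def)
  then have "p \<in> J (Suc n0)" using \<open>J n0 \<subseteq> J (Suc n0)\<close> by blast
  then obtain s where s: "s \<in> carrier R" "s \<notin> q" "s \<otimes> p \<in> adj q0 (p \<otimes> y)"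
    by (auto simp: J_def sat_at_def p_def)
  obtain c a where 1: "c \<in> q0" "c \<in> carrier R" "a \<in> carrier R" "s \<otimes> p = c \<oplus> a \<otimes> (p \<otimes> y)"
    using s(3) iq0 by (rule adjE)
  have "p \<otimes> (s \<ominus> a \<otimes> y) = s \<otimes> p \<ominus> a \<otimes> (p \<otimes> y)" by (rule ring_identity, (rule ring_split | simp add: ring_norm 1(3) s(1) pc yc)+)
  also have "\<dots> = c" unfolding 1(4) using 1(2,3) pc yc by algebra
  finally have "p \<in> q0 \<or> s \<ominus> a \<otimes> y \<in> q0"
    using prime_mult_iff[OF q0 pc, of "s \<ominus> a \<otimes> y"] 1 s yc by simp
  then have "s \<ominus> a \<otimes> y \<in> q" using prime_pow_memD[OF q0 yc] y(2) chain unfolding p_def by blast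
  moreover have "a \<otimes> y \<in> q" using y 1 by (simp add: ideal_mult[OF iq])
  ultimately show False using ideal_diff_iff[OF iq, of s "a \<otimes> y"] s 1 yc by simp
qed

text \<open>Otherwise some prime contains \<open>A\<close> and avoids all products w y^n with
  \<open>w\<close> outside \<open>Q\<close>. It lies in \<open>Q\<close> and omits \<open>y\<close>,
  against minimality.\<close>

lemma minimal_prime_radical:
  assumes Q: "primeideal Q R" and A: "ideal A R"
    and min: "\<And>Q'. \<lbrakk>primeideal Q' R; A \<subseteq> Q'; Q' \<subseteq> Q\<rbrakk> \<Longrightarrow> Q' = Q" and y: "y \<in> Q"
  shows "\<exists>w\<in>carrier R - Q. \<exists>n::nat. w \<otimes> y [^] n \<in> A"
proof (rule ccontr)
  assume no: "\<not> ?thesis"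
  have yc: "y \<in> carrier R" using y Q primeideal_ideal ideal_carrier by blast
  define W where "W = {w \<otimes> y [^] (n::nat) | w n. w \<in> carrier R - Q}"
  have WI: "w \<otimes> y [^] (n::nat) \<in> W" if "w \<in> carrier R - Q" for w n using that unfolding W_def by blast
  have incl: "w \<in> W" if "w \<in> carrier R - Q" for w using WI[OF that, of 0] that by simp
  have "v \<otimes> w \<in> W" if vw: "v \<in> W" "w \<in> W" for v w
  proof -
    obtain a b and i j :: nat where 1: "a \<in> carrier R - Q" "b \<in> carrier R - Q" "v = a \<otimes> y [^] i" "w = b \<otimes> y [^] j"
      using vw unfolding W_def by blast
    then have "v \<otimes> w = (a \<otimes> b) \<otimes> y [^] (i + j)" using yc by (simp add: nat_pow_mult[symmetric] m_ac)
    then show ?thesis using WI[OF prime_compl_mult[OF Q 1(1,2)]] by simp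
  qed
  moreover have "W \<subseteq> carrier R" using yc by (auto simp: W_def)
  moreover have "\<one> \<in> W" using incl[OF prime_compl_one[OF Q]] .
  moreover have "A \<inter> W = {}" using no by (auto simp: W_def)
  ultimately obtain P where P: "primeideal P R" "A \<subseteq> P" "P \<inter> W = {}"
    using exists_prime_disjoint[OF A, of W] by blast
  have "P \<subseteq> Q" using P(1,3) incl ideal_carrier[OF primeideal_ideal] by blast
  then have "P = Q" using min P by blast
  moreover have "y \<in> W" using WI[OF prime_compl_one[OF Q], of 1] yc by (simp add: nat_pow_eone)
  ultimately show False using y P by blast
qed

text \<open>A prime \<open>Q1\<close> maximal among those strictly below \<open>Q\<close> omits some
  generator \<open>x\<close>. Locally at \<open>Q\<close>, powers of the other generators are
  elements \<open>z y\<close> of \<open>Q1\<close> plus multiples of \<open>x\<close>. A prime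
  strictly below \<open>Q1\<close> containing all \<open>z y\<close> would contradict
  \<open>krull_principal_ideal\<close> for \<open>x\<close>, so \<open>Q1\<close> is minimal over
  one element fewer.\<close>

theorem krull_height:
  assumes "set xs \<subseteq> Q" "primeideal Q R"
    and "\<And>Q'. \<lbrakk>primeideal Q' R; set xs \<subseteq> Q'; Q' \<subseteq> Q\<rbrakk> \<Longrightarrow> Q' = Q"
  shows "\<not> prime_chain (Suc (length xs)) Q"
  using assms
proof (induction "length xs" arbitrary: xs Q)
  case 0
  show ?case
  proof
    assume "prime_chain (Suc (length xs)) Q"
    then obtain P where P: "prime_chain (length xs) P" "P \<subset> Q" using prime_chain_SucD by blast
    have "P = Q" using 0(1) P prime_chain_prime[OF P(1)] by (intro 0(4)) auto
    then show False using P(2) by blast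
  qed
next
  case (Suc g)
  note Q = Suc.prems(2) and min = Suc.prems(3)
  note iQ = primeideal_ideal[OF Q]
  show ?case
  proof
    assume "prime_chain (Suc (length xs)) Q"
    then obtain P1 where P1: "prime_chain (Suc g) P1" "P1 \<subset> Q"
      using prime_chain_SucD Suc.hyps(2) by metis
    define S where "S = {P. primeideal P R \<and> P \<subset> Q}"
    have "P1 \<in> S" "\<And>J. J \<in> S \<Longrightarrow> ideal J R"
      using P1 prime_chain_prime[OF P1(1)] primeideal_ideal by (auto simp: S_def)
    then obtain Q1 where Q1: "Q1 \<in> S" "P1 \<subseteq> Q1" "\<And>J. \<lbrakk>J \<in> S; Q1 \<subseteq> J\<rbrakk> \<Longrightarrow> J = Q1"
      using maximal_ideal_in[of _ S] by meson
    have pQ1: "primeideal Q1 R" "Q1 \<subset> Q" using Q1 by (auto simp: S_def)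
    note iQ1 = primeideal_ideal[OF pQ1(1)]
    have chain: "prime_chain (Suc g) Q1"
    proof (cases "P1 = Q1")
      case False
      then have "prime_chain (Suc (Suc g)) Q1" using P1 Q1(2) pQ1(1) prime_chain_Suc by blast
      then show ?thesis by (rule prime_chain_antimono) simp
    qed (use P1 in auto)
    obtain x where x: "x \<in> set xs" "x \<notin> Q1" using min[OF pQ1(1)] pQ1(2) by blast
    then obtain as bs where xs: "xs = as @ x # bs" by (meson split_list)
    define ys where "ys = as @ bs"
    have ys: "length ys = g" "set xs = insert x (set ys)" using Suc.hyps(2) by (auto simp: ys_def xs)
    have xQ: "x \<in> Q" using x Suc.prems(1) by blast
    have xc: "x \<in> carrier R" using xQ iQ ideal_carrier by blast
    have "\<exists>w\<in>carrier R - Q. \<exists>n::nat. w \<otimes> y [^] n \<in> adj Q1 x" if "y \<in> Q" for y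
    proof (rule minimal_prime_radical[OF Q _ _ that])
      show "ideal (adj Q1 x) R" using iQ1 xc by (rule ideal_adj)
      fix Q' assume Q': "primeideal Q' R" "adj Q1 x \<subseteq> Q'" "Q' \<subseteq> Q"
      then have sub: "Q1 \<subseteq> Q'" "x \<in> Q'" using adj_incl[OF iQ1 xc] adj_self[OF iQ1 xc] by blast+
      show "Q' = Q"
      proof (rule ccontr)
        assume "Q' \<noteq> Q"
        then have "Q' \<in> S" using Q' by (auto simp: S_def)
        then have "Q' = Q1" using Q1(3) sub by blast
        then show False using sub x by blast
      qed
    qed
    note rad = this
    have "\<exists>z. z \<in> Q1 \<and> (\<exists>w\<in>carrier R - Q. \<exists>a\<in>carrier R. \<exists>n::nat. w \<otimes> y [^] n = z \<oplus> a \<otimes> x)"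
      if y: "y \<in> set ys" for y
    proof -
      obtain w n where w: "w \<in> carrier R - Q" "w \<otimes> y [^] (n::nat) \<in> adj Q1 x"
        using rad[of y] y Suc.prems(1) ys(2) by blast
      obtain c a where "c \<in> Q1" "c \<in> carrier R" "a \<in> carrier R" "w \<otimes> y [^] n = c \<oplus> a \<otimes> x"
        using w(2) iQ1 by (rule adjE)
      then show ?thesis using w(1) by blast
    qed
    then obtain z where z: "\<And>y. y \<in> set ys \<Longrightarrow> z y \<in> Q1"
      "\<And>y. y \<in> set ys \<Longrightarrow> \<exists>w\<in>carrier R - Q. \<exists>a\<in>carrier R. \<exists>n::nat. w \<otimes> y [^] n = z y \<oplus> a \<otimes> x"
      by metis
    have "\<not> prime_chain (Suc (length (map z ys))) Q1"
    proof (rule Suc.hyps(1))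
      show "g = length (map z ys)" using ys by simp
      show "set (map z ys) \<subseteq> Q1" using z by auto
      fix Q' assume Q': "primeideal Q' R" "set (map z ys) \<subseteq> Q'" "Q' \<subseteq> Q1"
      show "Q' = Q1"
      proof (rule ccontr)
        assume "Q' \<noteq> Q1"
        then have "Q' \<subset> Q1" using Q' by blast
        then show False
        proof (rule krull_principal_ideal[OF Q'(1) pQ1(1) Q _ pQ1(2) xQ])
          fix Q'' assume Q'': "primeideal Q'' R" "Q' \<subseteq> Q''" "x \<in> Q''" "Q'' \<subseteq> Q"
          note iQ'' = primeideal_ideal[OF Q''(1)]
          have "y \<in> Q''" if y: "y \<in> set ys" for y
          proof -
            have yc: "y \<in> carrier R" using y Suc.prems(1) ys(2) iQ ideal_carrier by blast
            obtain w a n where 1: "w \<in> carrier R - Q" "a \<in> carrier R" "w \<otimes> y [^] (n::nat) = z y \<oplus> a \<otimes> x"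
              using z(2)[OF y] by blast
            have "z y \<in> Q''" using Q'(2) Q''(2) y by auto
            then have "w \<otimes> y [^] n \<in> Q''"
              unfolding 1(3) using 1(2) Q''(3) by (intro ideal_add[OF iQ''] ideal_mult[OF iQ''])
            then have "w \<in> Q'' \<or> y [^] n \<in> Q''" using prime_mult_iff[OF Q''(1)] 1(1) yc by simp
            then show ?thesis using 1(1) Q''(4) prime_pow_memD[OF Q''(1) yc] by blast
          qed
          then have "set xs \<subseteq> Q''" using Q''(3) ys(2) by auto
          then show "Q'' = Q" using Q''(1,4) by (intro min)
        qed
      qed
    qed (rule pQ1(1))
    then show False using chain ys by simp
  qed
qed

text \<open>An associated prime of the ideal of \<open>xs\<close>, taken locally at
  \<open>Q\<close>, consists of zero divisors and so misses the regular element \<open>x\<close>. It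
  lies strictly below \<open>Q\<close> and contains \<open>xs\<close>, so induction applies to
  it.\<close>

lemma regular_prime_chain:
  assumes "regm {\<zero>} xs" "primeideal Q R" "set xs \<subseteq> Q"
  shows "prime_chain (length xs) Q"
  using assms
proof (induction xs arbitrary: Q rule: rev_induct)
  case Nil then show ?case by (simp add: prime_chain_0)
next
  case (snoc x xs)
  note Q = snoc.prems(2)
  note iQ = primeideal_ideal[OF Q]
  have xs: "set xs \<subseteq> Q" "x \<in> Q" using snoc.prems by auto
  have xsc: "set xs \<subseteq> carrier R" "x \<in> carrier R" using xs ideal_carrier[OF iQ] by auto
  define N where "N = adjl {\<zero>} xs"
  have N: "ideal N R" "N \<subseteq> Q" "set xs \<subseteq> N"
    unfolding N_def using xs xsc ideal_zero[OF iQ]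
    by (simp_all add: ideal_adjl zeroideal adjl_subset[OF iQ] adjl_set[OF zeroideal])
  have rx: "reg N x" using snoc.prems by (simp add: N_def)
  define N' where "N' = sat_at Q N"
  have N': "ideal N' R" "N \<subseteq> N'" "\<one> \<notin> N'"
    unfolding N'_def
    using Q N by (auto intro: ideal_sat_at simp: one_notin_sat_at dest: sat_at_incl)
  obtain r where r: "r \<in> carrier R" "r \<otimes> \<one> \<notin> N'" "primeideal (colon_ideal R N' {r \<otimes> \<one>}) R"
    using exists_associated_prime[OF N'(1) _ N'(3)] by blast
  define P where "P = colon_ideal R N' {r}"
  have P: "primeideal P R" "r \<notin> N'" using r by (auto simp: P_def)
  have NP: "set xs \<subseteq> P"
    using N N' r(1) xsc by (auto simp: P_def colon_ideal_def intro!: ideal_mult_right[OF N'(1)])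
  have "P \<subseteq> Q"
    using sat_at_cancel[OF Q _ _ r(1)] P(2) by (auto simp: P_def colon_ideal_def N'_def)
  moreover have "x \<notin> P"
  proof
    assume "x \<in> P"
    then obtain w where w: "w \<in> carrier R - Q" "w \<otimes> (x \<otimes> r) \<in> N"
      by (auto simp: P_def colon_ideal_def N'_def sat_at_def)
    have "(w \<otimes> r) \<otimes> x \<in> N" using w r xsc by (simp add: m_ac)
    then have "w \<otimes> r \<in> N" using w r by (simp add: regD[OF rx])
    then show False using P(2) r(1) w(1) by (auto simp: N'_def sat_at_def)
  qed
  ultimately have "P \<subset> Q" using xs by blast
  moreover have "prime_chain (length xs) P" using snoc.IH[OF _ P(1) NP] snoc.prems by simp
  ultimately show ?case using prime_chain_Suc[OF _ Q] by simp
qed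

lemma prime_contains_finite_Int:
  assumes P: "primeideal P R" and "\<And>k. k \<in> set ks \<Longrightarrow> ideal (I k) R"
    and "\<And>k. k \<in> set ks \<Longrightarrow> \<not> I k \<subseteq> P"
  shows "\<exists>f\<in>carrier R - P. \<forall>k\<in>set ks. f \<in> I k"
  using assms(2,3)
proof (induction ks)
  case Nil then show ?case using prime_compl_one[OF P] by auto
next
  case (Cons k ks)
  then obtain f where f: "f \<in> carrier R - P" "\<forall>k\<in>set ks. f \<in> I k" by auto
  obtain g where g: "g \<in> I k" "g \<notin> P" using Cons.prems(2)[of k] by auto
  have gc: "g \<in> carrier R" using g Cons.prems(1)[of k] ideal_carrier by auto
  have "g \<otimes> f \<in> carrier R - P" using prime_compl_mult[OF P] f g gc by blast
  moreover have "\<forall>l\<in>set (k # ks). g \<otimes> f \<in> I l"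
    using f g gc Cons.prems(1) by (auto intro: ideal_mult ideal_mult_right)
  ultimately show ?case by blast
qed

text \<open>With finitely many generators of \<open>K\<close>, an annihilator modulo A : K is a
  finite intersection of annihilators modulo \<open>A\<close>; a prime that is a finite intersection
  of ideals equals one of them.\<close>

lemma associated_primes_colon:
  assumes A: "ideal A R" and K: "ideal K R"
  shows "associated_primes R (colon_ideal R A K) \<subseteq> associated_primes R A"
proof
  fix P assume "P \<in> associated_primes R (colon_ideal R A K)"
  then obtain a where P: "primeideal P R" and a: "a \<in> carrier R" "P = colon_ideal R (colon_ideal R A K) {a}"
    by (auto simp: associated_primes_def)
  obtain ks where ks: "set ks \<subseteq> carrier R" "K = Idl (set ks)" using K by (rule ideal_list_generators)
  have eq: "colon_ideal R A K = colon_ideal R A (set ks)" using colon_genideal[OF A ks(1)] ks(2) by simp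
  have mem: "f \<in> P \<longleftrightarrow> f \<in> carrier R \<and> (\<forall>k\<in>set ks. f \<otimes> (a \<otimes> k) \<in> A)" for f
    using a ks(1) unfolding a(2) eq by (auto simp: colon_ideal_def m_assoc subset_iff)
  have iI: "ideal (colon_ideal R A {a \<otimes> k}) R" if "k \<in> set ks" for k
    using A a ks(1) that by (intro ideal_colon) auto
  have "\<exists>k\<in>set ks. colon_ideal R A {a \<otimes> k} \<subseteq> P"
  proof (rule ccontr)
    assume no: "\<not> ?thesis"
    have "\<exists>f\<in>carrier R - P. \<forall>k\<in>set ks. f \<in> colon_ideal R A {a \<otimes> k}"
      using iI no by (intro prime_contains_finite_Int[OF P]) auto
    then show False using mem by (auto simp: colon_ideal_def)
  qed
  then obtain k where k: "k \<in> set ks" "colon_ideal R A {a \<otimes> k} \<subseteq> P" by blast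
  moreover have "P \<subseteq> colon_ideal R A {a \<otimes> k}" using mem k(1) by (auto simp: colon_ideal_def)
  ultimately have "P = colon_ideal R A {a \<otimes> k}" by blast
  then show "P \<in> associated_primes R A"
    using P a(1) k(1) ks(1) by (auto simp: associated_primes_def)
qed

end

section \<open>Associated primes along regular sequences in a local ring\<close>

context local_noetherian
begin

lemma m_prime: "primeideal m R"
proof (rule prime_idealI[OF m_ideal one_notin_m])
  fix a b assume "a \<in> carrier R" "b \<in> carrier R" "a \<otimes> b \<in> m" "a \<notin> m"
  then show "b \<in> m" using ideal_unit_mult_iff[OF m_ideal Units_if_notin_m] by blast
qed

lemma prime_subset_m: "primeideal P R \<Longrightarrow> P \<subseteq> m"
  using proper_ideal_subset_m primeideal_ideal prime_one_notin one_closed by metis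

text \<open>Let \<open>C\<close> consist of the elements that the given prime multiplies into
  \<open>N\<close>. If \<open>C\<close> were inside N + yR, regularity of \<open>y\<close> would
  give C \<subseteq> N + yC, so C \<subseteq> N by Nakayama's lemma. Hence some element of
  \<open>C\<close> survives modulo N + yR, and an associated prime arising from it contains the
  given prime and \<open>y\<close>.\<close>

lemma associated_prime_step:
  assumes N: "ideal N R" and a: "a \<in> carrier R" and P: "primeideal (colon_ideal R N {a}) R"
    and y: "y \<in> m" "reg N y"
  shows "\<exists>b\<in>carrier R. primeideal (colon_ideal R (adj N y) {b}) R \<and>
    colon_ideal R N {a} \<subset> colon_ideal R (adj N y) {b}"
proof -
  define Q where "Q = colon_ideal R N {a}"
  have yc: "y \<in> carrier R" using y m_carrier by blast
  have Qc: "Q \<subseteq> carrier R" by (auto simp: Q_def colon_ideal_def)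
  have aN: "a \<notin> N" using prime_one_notin[OF P] a by (auto simp: colon_ideal_def)
  have Ny: "ideal (adj N y) R" using N yc by (rule ideal_adj)
  define C where "C = colon_ideal R N Q"
  have C: "ideal C R" unfolding C_def using N Qc by (rule ideal_colon)
  have aC: "a \<in> C" using a by (auto simp: C_def Q_def colon_ideal_def m_comm)
  have "\<not> C \<subseteq> adj N y"
  proof
    assume sub: "C \<subseteq> adj N y"
    have "C \<subseteq> N"
    proof (rule nakayama_m[OF C N y(1)])
      fix d assume d: "d \<in> C"
      then obtain n g where 1: "n \<in> N" "n \<in> carrier R" "g \<in> carrier R" "d = n \<oplus> g \<otimes> y"
        using sub N adjE by (metis subsetD)
      have "g \<otimes> p \<in> N" if p: "p \<in> Q" for p
      proof -
        have pc: "p \<in> carrier R" using p Qc by blast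
        have "(g \<otimes> p) \<otimes> y = d \<otimes> p \<ominus> p \<otimes> n"
          unfolding 1(4) by (rule ring_identity, (rule ring_split | simp add: ring_norm 1(2,3) pc yc)+)
        also have "\<dots> \<in> N" using d p 1(1) pc
          by (simp add: C_def colon_ideal_def ideal_minus[OF N] ideal_mult[OF N])
        finally show ?thesis using 1(3) pc by (simp add: regD[OF y(2)])
      qed
      then have "g \<in> C" using 1(3) by (simp add: C_def colon_ideal_def)
      then show "\<exists>n\<in>N. \<exists>e\<in>C. d = n \<oplus> y \<otimes> e" using 1 yc by (metis m_comm)
    qed
    then show False using aC aN by blast
  qed
  then obtain u where u: "u \<in> C" "u \<notin> adj N y" by blast
  have uc: "u \<in> carrier R" using u C ideal_carrier by blast
  obtain r where r: "r \<in> carrier R" "r \<otimes> u \<notin> adj N y" "primeideal (colon_ideal R (adj N y) {r \<otimes> u}) R"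
    using exists_associated_prime[OF Ny uc u(2)] by blast
  have "Q \<subseteq> colon_ideal R (adj N y) {r \<otimes> u}"
  proof
    fix p assume p: "p \<in> Q"
    then have pc: "p \<in> carrier R" using Qc by blast
    have "p \<otimes> (r \<otimes> u) = r \<otimes> (u \<otimes> p)" using pc r uc by (simp add: m_ac)
    also have "\<dots> \<in> N" using u p r by (simp add: C_def colon_ideal_def ideal_mult[OF N])
    finally have "p \<otimes> (r \<otimes> u) \<in> N" .
    then show "p \<in> colon_ideal R (adj N y) {r \<otimes> u}"
      using pc adj_incl[OF N yc] by (simp add: colon_ideal_def)
  qed
  moreover have "y \<in> colon_ideal R (adj N y) {r \<otimes> u}"
    using adj_mult_self[OF N yc, of "r \<otimes> u"] r uc yc by (simp add: colon_ideal_def m_comm)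
  moreover have "y \<notin> Q" using regD'[OF y(2) a] aN by (auto simp: Q_def colon_ideal_def)
  ultimately show ?thesis using r uc unfolding Q_def by blast
qed

lemma associated_prime_chain:
  assumes "ideal N R" "a \<in> carrier R" "prime_chain k (colon_ideal R N {a})" "set ys \<subseteq> m" "regm N ys"
  shows "\<exists>b\<in>carrier R. prime_chain (k + length ys) (colon_ideal R (adjl N ys) {b})"
  using assms
proof (induction ys arbitrary: N a k)
  case (Cons y ys)
  have yc: "y \<in> carrier R" using Cons.prems m_carrier by auto
  obtain b where b: "b \<in> carrier R" "primeideal (colon_ideal R (adj N y) {b}) R"
    "colon_ideal R N {a} \<subset> colon_ideal R (adj N y) {b}"
    using associated_prime_step[OF Cons.prems(1,2) prime_chain_prime[OF Cons.prems(3)], of y] Cons.prems by auto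
  have "prime_chain (Suc k) (colon_ideal R (adj N y) {b})"
    using prime_chain_Suc[OF Cons.prems(3) b(2,3)] .
  from Cons.IH[OF ideal_adj[OF Cons.prems(1) yc] b(1) this] show ?case using Cons.prems by simp
qed auto

end

text \<open>The Cohen--Macaulay property enters only through a regular sequence whose length is at least
  the dimension.\<close>

locale cohen_macaulay_infinite = local_noetherian_infinite +
  fixes ys
  assumes ys: "set ys \<subseteq> m" "regm {\<zero>} ys" and dim: "\<not> prime_chain (Suc (length ys)) m"
begin

lemma prime_chain_le_dim: assumes "prime_chain k P" shows "k \<le> length ys"
proof (rule ccontr)
  assume "\<not> k \<le> length ys"
  then have "Suc (length ys) \<le> k" by simp
  then have "prime_chain (Suc (length ys)) P" using prime_chain_antimono[OF assms] by blast
  then show False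
    using dim prime_subset_m[OF prime_chain_prime[OF assms]] prime_chain_Suc[OF _ m_prime]
      prime_chain_antimono[of "Suc (Suc (length ys))" m] by (metis Suc_n_not_le_n nat_le_linear psubsetI)
qed

lemma extend_to_full_length:
  assumes "set xs \<subseteq> m" "regm {\<zero>} xs" "length xs \<le> length ys"
  shows "\<exists>zs. set zs \<subseteq> m \<and> regm {\<zero>} (xs @ zs) \<and> length (xs @ zs) = length ys"
  using assms
proof (induction "length ys - length xs" arbitrary: xs)
  case 0
  then show ?case by (intro exI[of _ "[]"]) auto
next
  case (Suc k)
  then have "length xs < length ys" by linarith
  then obtain z where z: "z \<in> m" "reg (adjl {\<zero>} xs) z"
    using regm_extend[OF zeroideal Suc.prems(1) ys(1) Suc.prems(2) ys(2)] by auto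
  have "\<exists>zs. set zs \<subseteq> m \<and> regm {\<zero>} ((xs @ [z]) @ zs) \<and> length ((xs @ [z]) @ zs) = length ys"
    using Suc.hyps(2) Suc.prems z by (intro Suc.hyps(1)) auto
  then obtain zs where "set zs \<subseteq> m" "regm {\<zero>} ((xs @ [z]) @ zs)" "length ((xs @ [z]) @ zs) = length ys"
    by blast
  then show ?case using z by (intro exI[of _ "z # zs"]) auto
qed

text \<open>\<open>regular_prime_chain\<close> gives the lower bound. For the upper bound the
  sequence is completed to full length: \<open>associated_prime_chain\<close> would prolong a longer
  chain below \<open>P\<close> beyond the dimension.\<close>

lemma height_associated_prime:
  assumes xs: "regm {\<zero>} xs" "adjl {\<zero>} xs \<noteq> carrier R" and P: "P \<in> associated_primes R (adjl {\<zero>} xs)"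
  shows "prime_height R P = enat (length xs)"
proof -
  obtain a where a: "a \<in> carrier R" "P = colon_ideal R (adjl {\<zero>} xs) {a}" and p: "primeideal P R"
    using P by (auto simp: associated_primes_def)
  have c: "set xs \<subseteq> carrier R" using xs by (intro regm_closed)
  have N: "ideal (adjl {\<zero>} xs) R" using c by (intro ideal_adjl zeroideal)
  have sm: "set xs \<subseteq> m" using proper_ideal_subset_m[OF N xs(2)] adjl_set[OF zeroideal c] by blast
  have "set xs \<subseteq> P"
    using adjl_set[OF zeroideal c] colon_incl[OF N, of "{a}"] a by auto
  then have ch: "prime_chain (length xs) P" using regular_prime_chain[OF xs(1) p] by blast
  have "\<not> prime_chain (Suc (length xs)) P"
  proof
    assume "prime_chain (Suc (length xs)) P"
    moreover obtain zs where zs: "set zs \<subseteq> m" "regm {\<zero>} (xs @ zs)" "length (xs @ zs) = length ys"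
      using extend_to_full_length[OF sm xs(1) prime_chain_le_dim[OF ch]] by blast
    ultimately obtain b where "prime_chain (Suc (length xs) + length zs) (colon_ideal R (adjl (adjl {\<zero>} xs) zs) {b})"
      using associated_prime_chain[OF N a(1), of "Suc (length xs)" zs] a(2) by auto
    from prime_chain_le_dim[OF this] show False using zs(3) by simp
  qed
  from height_le_prime_chain[OF this] prime_chain_le_height[OF ch] show ?thesis by simp
qed

text \<open>The associated primes of a linked ideal are among those of the complete intersection,
  which all have the same height. Thus proper ideals in links produced by lifting or extension are
  unmixed automatically.\<close>

lemma unmixed_linked:
  assumes l: "linked_by xs K K'" and K: "K \<noteq> carrier R" shows "unmixed_ideal R K"
proof -
  have "associated_primes R K \<subseteq> associated_primes R (adjl {\<zero>} xs)"
    using associated_primes_colon[OF linked_by_ideal_adjl[OF l] linked_byD(4)[OF l]] linked_by_colon(1)[OF l] by simp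
  then have "prime_height R P = enat (length xs)" if "P \<in> associated_primes R K" for P
    using height_associated_prime[OF linked_byD(1,2)[OF l]] that by blast
  then show ?thesis using linked_byD(3)[OF l] K by (simp add: unmixed_ideal_def)
qed

end

section \<open>Localizations\<close>

locale localization_hom = fractional_hom P Q h "{\<zero>}" for P (structure) and Q (structure) and h
begin

lemma h_mem_ext_iff:
  assumes A: "ideal A P" and f: "f \<in> carrier P"
  shows "h f \<in> ext A \<longleftrightarrow> (\<exists>w\<in>carrier P. h w \<in> Units Q \<and> w \<otimes> f \<in> A)"
proof
  assume "h f \<in> ext A"
  then show "\<exists>w\<in>carrier P. h w \<in> Units Q \<and> w \<otimes> f \<in> A"
    using h_mem_extD[OF A f] f by (auto simp: R.minus_eq)
next
  assume "\<exists>w\<in>carrier P. h w \<in> Units Q \<and> w \<otimes> f \<in> A"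
  then obtain w where w: "w \<in> carrier P" "h w \<in> Units Q" "w \<otimes> f \<in> A" by blast
  show "h f \<in> ext A" by (rule ext_memI[of _ "w \<otimes> f" _ w]) (use w f in \<open>auto simp: S.m_comm\<close>)
qed

lemma ext_reg: assumes N: "ideal N P" and r: "R.reg N f" shows "S.reg (ext N) (h f)"
proof (rule S.regI)
  have f: "f \<in> carrier P" using r by (rule R.reg_closed)
  then show "h f \<in> carrier Q" by simp
  fix s assume s: "s \<in> carrier Q" "s \<otimes>\<^bsub>Q\<^esub> h f \<in> ext N"
  obtain g w where 1: "g \<in> carrier P" "w \<in> carrier P" "h w \<in> Units Q" "s \<otimes>\<^bsub>Q\<^esub> h w = h g"
    using fraction[OF s(1)] by blast
  have "h (g \<otimes> f) = h w \<otimes>\<^bsub>Q\<^esub> (s \<otimes>\<^bsub>Q\<^esub> h f)"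
    using 1(1,2) f s(1) by (simp add: 1(4)[symmetric] S.m_ac)
  also have "\<dots> \<in> ext N" using s(2) 1(2) by (simp add: S.ideal_mult[OF ideal_ext[OF N]])
  finally obtain v where v: "v \<in> carrier P" "h v \<in> Units Q" "v \<otimes> (g \<otimes> f) \<in> N"
    using h_mem_ext_iff[OF N, of "g \<otimes> f"] 1(1) f by auto
  then have "v \<otimes> g \<in> N" using R.regD[OF r, of "v \<otimes> g"] 1(1) f by (simp add: R.m_assoc)
  moreover have "s \<otimes>\<^bsub>Q\<^esub> h (w \<otimes> v) = h (v \<otimes> g)"
  proof -
    have "s \<otimes>\<^bsub>Q\<^esub> h (w \<otimes> v) = h v \<otimes>\<^bsub>Q\<^esub> (s \<otimes>\<^bsub>Q\<^esub> h w)" using s(1) 1(2) v(1) by (simp add: S.m_ac)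
    then show ?thesis using 1 v by simp
  qed
  ultimately show "s \<in> ext N"
    using 1 v s(1) by (intro ext_memI[of _ "v \<otimes> g" _ "w \<otimes> v"] Units_h_mult) auto
qed

lemma ext_regm: "\<lbrakk>ideal N P; R.regm N fs\<rbrakk> \<Longrightarrow> S.regm (ext N) (map h fs)"
proof (induction fs arbitrary: N)
  case (Cons f fs)
  then have f: "f \<in> carrier P" by (auto simp: R.reg_def)
  then show ?case using Cons.prems Cons.IH[of "R.adj N f"] ext_reg[of N f] ext_adj[of N f] R.ideal_adj[of N f] by auto
qed simp

lemma noetherian_ext: assumes "noetherian_cring P" shows "noetherian_cring Q"
proof -
  interpret N: noetherian_cring P by (rule assms)
  have "noetherian_ring Q"
  proof (rule S.noetherian_ringI)
    fix K assume K: "ideal K Q"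
    obtain F where F: "set F \<subseteq> carrier P" "contr K = Idl (set F)"
      using ideal_contr[OF K] by (rule N.ideal_list_generators)
    have sub: "h ` set F \<subseteq> carrier Q" using F(1) by auto
    have iG: "ideal (Idl\<^bsub>Q\<^esub> (h ` set F)) Q" using sub by (rule S.genideal_ideal)
    have "set F \<subseteq> contr (Idl\<^bsub>Q\<^esub> (h ` set F))"
      using F(1) S.genideal_self[OF sub] by (auto simp: contr_def)
    then have "contr K \<subseteq> contr (Idl\<^bsub>Q\<^esub> (h ` set F))"
      unfolding F(2) by (rule R.genideal_minimal[OF ideal_contr[OF iG]])
    then have "K \<subseteq> Idl\<^bsub>Q\<^esub> (h ` set F)" using ext_mono ext_contr[OF K] ext_contr[OF iG] by metis
    moreover have "h ` set F \<subseteq> K"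
      using R.genideal_self[OF F(1)] F(2) by (auto simp: contr_def)
    then have "Idl\<^bsub>Q\<^esub> (h ` set F) \<subseteq> K" by (rule S.genideal_minimal[OF K])
    ultimately show "\<exists>A\<subseteq>carrier Q. finite A \<and> K = Idl\<^bsub>Q\<^esub> A" using sub by (intro exI[of _ "h ` set F"]) auto
  qed
  then show ?thesis by (simp add: noetherian_cring_def S.is_cring)
qed

text \<open>A single denominator has to serve all of \<open>K\<close>; finite generation supplies it
  as a product.\<close>

lemma ext_colon:
  assumes "noetherian_cring P" and N: "ideal N P" and K: "ideal K P"
  shows "ext (colon_ideal P N K) = colon_ideal Q (ext N) (ext K)"
proof
  show "ext (colon_ideal P N K) \<subseteq> colon_ideal Q (ext N) (ext K)"
    using N R.ideal_subset_carrier[OF K] by (rule ext_colon_subset)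
  interpret N: noetherian_cring P by (rule assms)
  obtain ks where ks: "set ks \<subseteq> carrier P" "K = Idl (set ks)" using K by (rule N.ideal_list_generators)
  have ksK: "set ks \<subseteq> K" using ks R.genideal_self by blast
  show "colon_ideal Q (ext N) (ext K) \<subseteq> ext (colon_ideal P N K)"
  proof
    fix s assume "s \<in> colon_ideal Q (ext N) (ext K)"
    then have s: "s \<in> carrier Q" "\<And>k. k \<in> ext K \<Longrightarrow> s \<otimes>\<^bsub>Q\<^esub> k \<in> ext N" by (auto simp: colon_ideal_def)
    obtain g w where 1: "g \<in> carrier P" "w \<in> carrier P" "h w \<in> Units Q" "s \<otimes>\<^bsub>Q\<^esub> h w = h g"
      using fraction[OF s(1)] by blast
    have step: "\<exists>v\<in>carrier P. h v \<in> Units Q \<and> v \<otimes> (g \<otimes> k) \<in> N" if k: "k \<in> set ks" for k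
    proof -
      have kc: "k \<in> carrier P" using k ks by blast
      have "h (g \<otimes> k) = h w \<otimes>\<^bsub>Q\<^esub> (s \<otimes>\<^bsub>Q\<^esub> h k)"
        using 1(1,2) kc s(1) by (simp add: 1(4)[symmetric] S.m_ac)
      also have "\<dots> \<in> ext N"
        using s(2)[OF h_mem_ext[OF subsetD[OF ksK k] kc]] 1(2) by (simp add: S.ideal_mult[OF ideal_ext[OF N]])
      finally show ?thesis using h_mem_ext_iff[OF N, of "g \<otimes> k"] 1(1) kc by auto
    qed
    have "\<exists>v\<in>carrier P. h v \<in> Units Q \<and> (\<forall>k\<in>set ls. v \<otimes> (g \<otimes> k) \<in> N)" if "set ls \<subseteq> set ks" for ls
      using that
    proof (induction ls)
      case Nil then show ?case by (intro bexI[of _ \<one>]) auto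
    next
      case (Cons k ls)
      then obtain v where v: "v \<in> carrier P" "h v \<in> Units Q" "\<forall>k\<in>set ls. v \<otimes> (g \<otimes> k) \<in> N" by auto
      obtain u where u: "u \<in> carrier P" "h u \<in> Units Q" "u \<otimes> (g \<otimes> k) \<in> N" using step[of k] Cons by auto
      have "(u \<otimes> v) \<otimes> (g \<otimes> l) \<in> N" if l: "l \<in> set (k # ls)" for l
      proof -
        have lc: "l \<in> carrier P" using l Cons.prems ks by auto
        have e: "(u \<otimes> v) \<otimes> (g \<otimes> l) = v \<otimes> (u \<otimes> (g \<otimes> l))" "v \<otimes> (u \<otimes> (g \<otimes> l)) = u \<otimes> (v \<otimes> (g \<otimes> l))"
          using u v 1 lc by (simp_all add: R.m_ac)
        from l consider "l = k" | "l \<in> set ls" by auto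
        then show ?thesis
        proof cases
          case 1
          then show ?thesis unfolding e(1) using u v R.ideal_mult[OF N] by simp
        next
          case 2
          then show ?thesis unfolding e using u v R.ideal_mult[OF N] by simp
        qed
      qed
      then show ?case using u v Units_h_mult by (intro bexI[of _ "u \<otimes> v"]) auto
    qed
    from this[OF order_refl] obtain v where v: "v \<in> carrier P" "h v \<in> Units Q" "\<And>k. k \<in> set ks \<Longrightarrow> v \<otimes> (g \<otimes> k) \<in> N"
      by blast
    have "v \<otimes> g \<in> colon_ideal P N (set ks)"
      using v 1 ks(1) by (auto simp: colon_ideal_def R.m_assoc subset_iff)
    then have "v \<otimes> g \<in> colon_ideal P N K" using R.colon_genideal[OF N ks(1)] ks(2) by simp
    moreover have "s \<otimes>\<^bsub>Q\<^esub> h (w \<otimes> v) = h (v \<otimes> g)"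
    proof -
      have "s \<otimes>\<^bsub>Q\<^esub> h (w \<otimes> v) = h v \<otimes>\<^bsub>Q\<^esub> (s \<otimes>\<^bsub>Q\<^esub> h w)" using s(1) 1(2) v(1) by (simp add: S.m_ac)
      then show ?thesis using 1 v by simp
    qed
    ultimately show "s \<in> ext (colon_ideal P N K)"
      using 1 v s(1) by (intro ext_memI[of _ "v \<otimes> g" _ "w \<otimes> v"] Units_h_mult) auto
  qed
qed

lemma universal_property:
  assumes T: "ring_hom_cring P T g" and unit: "\<And>w. \<lbrakk>w \<in> carrier P; h w \<in> Units Q\<rbrakk> \<Longrightarrow> g w \<in> Units T"
  obtains \<psi> where "ring_hom_cring Q T \<psi>" "\<And>f. f \<in> carrier P \<Longrightarrow> \<psi> (h f) = g f"
proof -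
  interpret g: ring_hom_cring P T g by (rule T)
  have uniq: "g f \<otimes>\<^bsub>T\<^esub> g w' = g f' \<otimes>\<^bsub>T\<^esub> g w"
    if "s \<in> carrier Q" "f \<in> carrier P" "f' \<in> carrier P" "w \<in> carrier P" "w' \<in> carrier P"
      "h w \<in> Units Q" "h w' \<in> Units Q" "s \<otimes>\<^bsub>Q\<^esub> h w = h f" "s \<otimes>\<^bsub>Q\<^esub> h w' = h f'" for s f f' w w'
  proof -
    note fw = that(1-5)
    have "h (f \<otimes> w') = h (f' \<otimes> w)"
      using that(1-5) by (simp add: that(8,9)[symmetric] S.m_ac)
    then have "h (f \<otimes> w' \<ominus> f' \<otimes> w) = \<zero>\<^bsub>Q\<^esub>" using that(1-5) by (simp add: S.minus_eq S.r_neg)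
    then obtain u where u: "u \<in> carrier P" "h u \<in> Units Q" "u \<otimes> (f \<otimes> w' \<ominus> f' \<otimes> w) = \<zero>"
      using h_eq_zero[of "f \<otimes> w' \<ominus> f' \<otimes> w"] fw by auto
    then have "g u \<otimes>\<^bsub>T\<^esub> g (f \<otimes> w' \<ominus> f' \<otimes> w) = \<zero>\<^bsub>T\<^esub>"
      using that(1-5) g.hom_mult[of u "f \<otimes> w' \<ominus> f' \<otimes> w"] by simp
    then have "g (f \<otimes> w' \<ominus> f' \<otimes> w) = \<zero>\<^bsub>T\<^esub>"
      using g.S.ideal_unit_mult_iff[OF g.S.zeroideal unit[OF u(1,2)], of "g (f \<otimes> w' \<ominus> f' \<otimes> w)"] that(1-5) by simp
    then show ?thesis using that(1-5) by (simp add: g.S.r_right_minus_eq)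
  qed
  \<comment> \<open>A numerator and a denominator are chosen for every \<open>s\<close>;
    \<open>uniq\<close> makes the quotient independent of the choice.\<close>
  define p where "p s = (SOME fw. fst fw \<in> carrier P \<and> snd fw \<in> carrier P \<and> h (snd fw) \<in> Units Q \<and>
    s \<otimes>\<^bsub>Q\<^esub> h (snd fw) = h (fst fw))" for s
  have p: "fst (p s) \<in> carrier P \<and> snd (p s) \<in> carrier P \<and> h (snd (p s)) \<in> Units Q \<and>
    s \<otimes>\<^bsub>Q\<^esub> h (snd (p s)) = h (fst (p s))" if s: "s \<in> carrier Q" for s
  proof -
    obtain f w where "f \<in> carrier P" "w \<in> carrier P" "h w \<in> Units Q" "s \<otimes>\<^bsub>Q\<^esub> h w = h f"
      using fraction[OF s] by blast
    then have "\<exists>fw. fst fw \<in> carrier P \<and> snd fw \<in> carrier P \<and> h (snd fw) \<in> Units Q \<and>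
      s \<otimes>\<^bsub>Q\<^esub> h (snd fw) = h (fst fw)" by (intro exI[of _ "(f, w)"]) simp
    then show ?thesis unfolding p_def by (rule someI_ex)
  qed
  define \<psi> where "\<psi> s = g (fst (p s)) \<otimes>\<^bsub>T\<^esub> inv\<^bsub>T\<^esub> g (snd (p s))" for s
  have \<psi>: "\<psi> s \<in> carrier T \<and> \<psi> s \<otimes>\<^bsub>T\<^esub> g w = g f"
    if s: "s \<in> carrier Q" and fw: "f \<in> carrier P" "w \<in> carrier P" "h w \<in> Units Q" "s \<otimes>\<^bsub>Q\<^esub> h w = h f" for s f w
  proof -
    define a b where "a = g (fst (p s))" and "b = g (snd (p s))"
    have b: "b \<in> Units T" "a \<in> carrier T" using p[OF s] unit by (auto simp: a_def b_def)
    have eq: "a \<otimes>\<^bsub>T\<^esub> g w = g f \<otimes>\<^bsub>T\<^esub> b" unfolding a_def b_def using uniq[OF s] p[OF s] fw by blast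
    have "(a \<otimes>\<^bsub>T\<^esub> inv\<^bsub>T\<^esub> b) \<otimes>\<^bsub>T\<^esub> g w = inv\<^bsub>T\<^esub> b \<otimes>\<^bsub>T\<^esub> (a \<otimes>\<^bsub>T\<^esub> g w)"
      using b fw by (simp add: g.S.m_ac)
    also have "\<dots> = g f" unfolding eq using b fw by (simp add: g.S.m_lcomm[of _ "g f"] g.S.Units_closed)
    finally show ?thesis using b by (simp add: \<psi>_def a_def b_def)
  qed
  have h\<psi>: "\<psi> (h f) = g f" if f: "f \<in> carrier P" for f
    using \<psi>[of "h f" f \<one>] f by auto
  have "\<psi> \<in> ring_hom Q T"
  proof (rule ring_hom_memI)
    fix x assume "x \<in> carrier Q" then show "\<psi> x \<in> carrier T" using \<psi> p by blast
  next
    fix x y assume xy: "x \<in> carrier Q" "y \<in> carrier Q"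
    obtain f v where 1: "f \<in> carrier P" "v \<in> carrier P" "h v \<in> Units Q" "x \<otimes>\<^bsub>Q\<^esub> h v = h f" using fraction[OF xy(1)] by blast
    obtain k w where 2: "k \<in> carrier P" "w \<in> carrier P" "h w \<in> Units Q" "y \<otimes>\<^bsub>Q\<^esub> h w = h k" using fraction[OF xy(2)] by blast
    define a where "a = \<psi> x" define b where "b = \<psi> y" define v' where "v' = g v" define w' where "w' = g w"
    have ab: "a \<in> carrier T" "b \<in> carrier T" "v' \<in> carrier T" "w' \<in> carrier T"
      "a \<otimes>\<^bsub>T\<^esub> v' = g f" "b \<otimes>\<^bsub>T\<^esub> w' = g k"
      using \<psi>[OF xy(1) 1] \<psi>[OF xy(2) 2] 1 2 by (auto simp: a_def b_def v'_def w'_def)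
    have vw: "v \<otimes> w \<in> carrier P" "h (v \<otimes> w) \<in> Units Q" "g (v \<otimes> w) = v' \<otimes>\<^bsub>T\<^esub> w'" using 1 2 by (auto simp: v'_def w'_def)
    have u: "v' \<otimes>\<^bsub>T\<^esub> w' \<in> Units T" using unit[OF vw(1,2)] vw(3) by simp
    define V where "V = h v" define U where "U = h w"
    have VU: "V \<in> carrier Q" "U \<in> carrier Q" using 1 2 by (auto simp: V_def U_def)
    have "(x \<otimes>\<^bsub>Q\<^esub> y) \<otimes>\<^bsub>Q\<^esub> (V \<otimes>\<^bsub>Q\<^esub> U) = (x \<otimes>\<^bsub>Q\<^esub> V) \<otimes>\<^bsub>Q\<^esub> (y \<otimes>\<^bsub>Q\<^esub> U)" using xy VU by (simp add: S.m_ac)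
    then have "(x \<otimes>\<^bsub>Q\<^esub> y) \<otimes>\<^bsub>Q\<^esub> h (v \<otimes> w) = h (f \<otimes> k)" using 1 2 by (simp add: V_def U_def)
    then have m: "\<psi> (x \<otimes>\<^bsub>Q\<^esub> y) \<in> carrier T" "\<psi> (x \<otimes>\<^bsub>Q\<^esub> y) \<otimes>\<^bsub>T\<^esub> (v' \<otimes>\<^bsub>T\<^esub> w') = g f \<otimes>\<^bsub>T\<^esub> g k"
      using \<psi>[of "x \<otimes>\<^bsub>Q\<^esub> y" "f \<otimes> k" "v \<otimes> w"] xy vw 1 2 by auto
    have "(a \<otimes>\<^bsub>T\<^esub> b) \<otimes>\<^bsub>T\<^esub> (v' \<otimes>\<^bsub>T\<^esub> w') = (a \<otimes>\<^bsub>T\<^esub> v') \<otimes>\<^bsub>T\<^esub> (b \<otimes>\<^bsub>T\<^esub> w')" using ab(1-4) by (simp add: g.S.m_ac)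
    note e = this
    show "\<psi> (x \<otimes>\<^bsub>Q\<^esub> y) = \<psi> x \<otimes>\<^bsub>T\<^esub> \<psi> y"
    proof (rule g.S.Units_right_cancel[OF _ u m(1)])
      show "\<psi> (x \<otimes>\<^bsub>Q\<^esub> y) \<otimes>\<^bsub>T\<^esub> (v' \<otimes>\<^bsub>T\<^esub> w') = (\<psi> x \<otimes>\<^bsub>T\<^esub> \<psi> y) \<otimes>\<^bsub>T\<^esub> (v' \<otimes>\<^bsub>T\<^esub> w')"
        by (simp only: m(2) e ab(5,6) flip: a_def b_def)
      show "\<psi> x \<otimes>\<^bsub>T\<^esub> \<psi> y \<in> carrier T" using ab(1,2) by (simp flip: a_def b_def)
    qed
    have "(x \<oplus>\<^bsub>Q\<^esub> y) \<otimes>\<^bsub>Q\<^esub> (V \<otimes>\<^bsub>Q\<^esub> U) = U \<otimes>\<^bsub>Q\<^esub> (x \<otimes>\<^bsub>Q\<^esub> V) \<oplus>\<^bsub>Q\<^esub> V \<otimes>\<^bsub>Q\<^esub> (y \<otimes>\<^bsub>Q\<^esub> U)"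
      by (rule S.ring_identity, (rule S.ring_split | simp add: S.ring_norm xy VU)+)
    then have "(x \<oplus>\<^bsub>Q\<^esub> y) \<otimes>\<^bsub>Q\<^esub> h (v \<otimes> w) = h (w \<otimes> f \<oplus> v \<otimes> k)" using 1 2 by (simp add: V_def U_def)
    then have m: "\<psi> (x \<oplus>\<^bsub>Q\<^esub> y) \<in> carrier T"
      "\<psi> (x \<oplus>\<^bsub>Q\<^esub> y) \<otimes>\<^bsub>T\<^esub> (v' \<otimes>\<^bsub>T\<^esub> w') = w' \<otimes>\<^bsub>T\<^esub> g f \<oplus>\<^bsub>T\<^esub> v' \<otimes>\<^bsub>T\<^esub> g k"
      using \<psi>[of "x \<oplus>\<^bsub>Q\<^esub> y" "w \<otimes> f \<oplus> v \<otimes> k" "v \<otimes> w"] xy vw 1 2 by (auto simp: v'_def w'_def)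
    have "(a \<oplus>\<^bsub>T\<^esub> b) \<otimes>\<^bsub>T\<^esub> (v' \<otimes>\<^bsub>T\<^esub> w') = w' \<otimes>\<^bsub>T\<^esub> (a \<otimes>\<^bsub>T\<^esub> v') \<oplus>\<^bsub>T\<^esub> v' \<otimes>\<^bsub>T\<^esub> (b \<otimes>\<^bsub>T\<^esub> w')"
      by (rule g.S.ring_identity, (rule g.S.ring_split | simp add: g.S.ring_norm ab(1-4))+)
    note e = this
    show "\<psi> (x \<oplus>\<^bsub>Q\<^esub> y) = \<psi> x \<oplus>\<^bsub>T\<^esub> \<psi> y"
    proof (rule g.S.Units_right_cancel[OF _ u m(1)])
      show "\<psi> (x \<oplus>\<^bsub>Q\<^esub> y) \<otimes>\<^bsub>T\<^esub> (v' \<otimes>\<^bsub>T\<^esub> w') = (\<psi> x \<oplus>\<^bsub>T\<^esub> \<psi> y) \<otimes>\<^bsub>T\<^esub> (v' \<otimes>\<^bsub>T\<^esub> w')"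
        by (simp only: m(2) e ab(5,6) flip: a_def b_def)
      show "\<psi> x \<oplus>\<^bsub>T\<^esub> \<psi> y \<in> carrier T" using ab(1,2) by (simp flip: a_def b_def)
    qed
  next
    show "\<psi> \<one>\<^bsub>Q\<^esub> = \<one>\<^bsub>T\<^esub>" using h\<psi>[of \<one>] by simp
  qed
  then have "ring_hom_cring Q T \<psi>"
    by (simp add: ring_hom_cring_def ring_hom_cring_axioms_def S.is_cring g.S.is_cring)
  then show ?thesis using that h\<psi> by blast
qed

end

text \<open>The ideal \<open>Z\<close> of the composite is the kernel of \<open>ev\<close>;
  numerators and denominators are lifted by surjectivity.\<close>

lemma (in surjective_hom) fractional_hom_compose:
  assumes "localization_hom T Q \<iota>"
  shows "fractional_hom S Q (\<lambda>x. \<iota> (ev x)) {f \<in> carrier S. ev f = \<zero>\<^bsub>T\<^esub>}"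
proof -
  interpret \<iota>: localization_hom T Q \<iota> by (rule assms)
  have "(\<lambda>x. \<iota> (ev x)) \<in> ring_hom S Q" by (rule ring_hom_memI) auto
  then interpret c: ring_hom_cring S Q "\<lambda>x. \<iota> (ev x)"
    by (simp add: ring_hom_cring_def ring_hom_cring_axioms_def R.is_cring \<iota>.S.is_cring)
  show ?thesis
  proof (intro fractional_hom.intro fractional_hom_axioms.intro c.ring_hom_cring_axioms)
    show "ideal {f \<in> carrier S. ev f = \<zero>\<^bsub>T\<^esub>} S"
      by (rule R.ideal_closedI) auto
  next
    fix s assume s: "s \<in> carrier Q"
    obtain f w where 1: "f \<in> carrier T" "w \<in> carrier T" "\<iota> w \<in> Units Q" "s \<otimes>\<^bsub>Q\<^esub> \<iota> w = \<iota> f"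
      using \<iota>.fraction[OF s] by blast
    obtain f' w' where "f' \<in> carrier S" "w' \<in> carrier S" "f = ev f'" "w = ev w'"
      using 1(1,2) surj by blast
    then show "\<exists>f\<in>carrier S. \<exists>w\<in>carrier S. \<iota> (ev w) \<in> Units Q \<and> s \<otimes>\<^bsub>Q\<^esub> \<iota> (ev w) = \<iota> (ev f)"
      using 1 by (intro bexI[of _ f'] bexI[of _ w']) simp_all
  next
    fix f assume f: "f \<in> carrier S" "\<iota> (ev f) = \<zero>\<^bsub>Q\<^esub>"
    obtain w where w: "w \<in> carrier T" "\<iota> w \<in> Units Q" "w \<otimes>\<^bsub>T\<^esub> ev f \<in> {\<zero>\<^bsub>T\<^esub>}"
      using \<iota>.h_eq_zero[of "ev f"] f by auto
    obtain w' where "w' \<in> carrier S" "w = ev w'" using w(1) surj by blast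
    then show "\<exists>w\<in>carrier S. \<iota> (ev w) \<in> Units Q \<and> w \<otimes> f \<in> {f \<in> carrier S. ev f = \<zero>\<^bsub>T\<^esub>}"
      using w f by (intro bexI[of _ w']) auto
  qed auto
qed

section \<open>The ring of fractions as an instance of the abstract localization\<close>

context mult_subset
begin

lemma localization_hom_fraction:
  "localization_hom A (localization A W) (\<lambda>a. fraction A W a \<one>)"
proof -
  let ?L = "localization A W" and ?h = "\<lambda>a. fraction A W a \<one>"
  have one: "\<one>\<^bsub>?L\<^esub> = fraction A W \<one> \<one>" and zero: "\<zero>\<^bsub>?L\<^esub> = fraction A W \<zero> \<one>"
    by (simp_all add: localization_def)
  have car: "fraction A W a s \<in> carrier ?L" if "a \<in> carrier A" "s \<in> W" for a s
    unfolding carrier_localization using that by blast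
  have "?h \<in> ring_hom A ?L"
    by (rule ring_hom_memI) (simp_all add: car W_one localization_mult localization_add one)
  then interpret h: ring_hom_cring A ?L ?h
    by (simp add: ring_hom_cring_def ring_hom_cring_axioms_def is_cring cring_localization)
  have inverse: "fraction A W \<one> w \<otimes>\<^bsub>?L\<^esub> fraction A W w \<one> = \<one>\<^bsub>?L\<^esub>" if w: "w \<in> W" for w
    using w W_one unfolding one by (subst localization_mult) (auto simp: fraction_eq_iff W_one simp del: h.hom_one)
  have Units_h: "?h w \<in> Units ?L" if w: "w \<in> W" for w
    using inverse[OF w] car[OF one_closed w] car[OF W_closed[OF w] W_one]
    by (metis h.S.Units_one_closed h.S.m_comm h.S.unit_factor)
  show ?thesis
  proof (intro localization_hom.intro fractional_hom.intro fractional_hom_axioms.intro h.ring_hom_cring_axioms)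
    show "ideal {\<zero>} A" by (rule zeroideal)
    show "?h z = \<zero>\<^bsub>?L\<^esub>" if "z \<in> {\<zero>}" for z using that h.hom_zero by simp
    fix s assume "s \<in> carrier ?L"
    then obtain a w where s: "s = fraction A W a w" "a \<in> carrier A" "w \<in> W" by (auto simp: carrier_localization)
    have "s \<otimes>\<^bsub>?L\<^esub> ?h w = ?h a"
      unfolding s(1) using s(2,3) W_one W_mult by (auto simp: localization_mult fraction_eq_iff m_comm)
    then show "\<exists>f\<in>carrier A. \<exists>w\<in>carrier A. ?h w \<in> Units ?L \<and> s \<otimes>\<^bsub>?L\<^esub> ?h w = ?h f"
      using s Units_h by blast
  next
    fix f assume f: "f \<in> carrier A" "?h f = \<zero>\<^bsub>?L\<^esub>"
    then obtain u where "u \<in> W" "u \<otimes> (\<one> \<otimes> f) = u \<otimes> (\<one> \<otimes> \<zero>)"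
      unfolding zero using fraction_eq_iff[of f \<one> \<zero> \<one>] W_one by auto
    then show "\<exists>w\<in>carrier A. ?h w \<in> Units ?L \<and> w \<otimes> f \<in> {\<zero>}" using f Units_h by auto
  qed
qed

lemma Units_fraction_iff:
  assumes W: "W = carrier A - p" and p: "primeideal p A" and w: "w \<in> carrier A"
  shows "fraction A W w \<one> \<in> Units (localization A W) \<longleftrightarrow> w \<notin> p"
proof -
  let ?L = "localization A W"
  have one: "\<one>\<^bsub>?L\<^esub> = fraction A W \<one> \<one>" by (simp add: localization_def)
  show ?thesis
proof
  let ?L = "localization A W"
  assume "fraction A W w \<one> \<in> Units ?L"
  then obtain s where s: "s \<in> carrier ?L" "s \<otimes>\<^bsub>?L\<^esub> fraction A W w \<one> = \<one>\<^bsub>?L\<^esub>" by (auto simp: Units_def)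
  then obtain a v where v: "s = fraction A W a v" "a \<in> carrier A" "v \<in> W" by (auto simp: carrier_localization)
  have "fraction A W (a \<otimes> w) (v \<otimes> \<one>) = fraction A W \<one> \<one>"
    using s(2) v w W_one unfolding one v(1) by (simp add: localization_mult)
  then obtain u where u: "u \<in> W" "u \<otimes> (\<one> \<otimes> (a \<otimes> w)) = u \<otimes> ((v \<otimes> \<one>) \<otimes> \<one>)"
    using fraction_eq_iff[of "a \<otimes> w" "v \<otimes> \<one>" \<one> \<one>] v w W_one W_mult by auto
  show "w \<notin> p"
  proof
    assume "w \<in> p"
    moreover have e: "u \<otimes> v = (u \<otimes> a) \<otimes> w" using u v w by (simp add: m_assoc)
    ultimately have "u \<otimes> v \<in> p"
      using u v unfolding e by (intro ideal_mult[OF primeideal_ideal[OF p]]) auto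
    moreover have "u \<otimes> v \<in> W" using u v W_mult by blast
    ultimately show False by (simp add: W)
  qed
next
  interpret h: localization_hom A "localization A W" "\<lambda>a. fraction A W a \<one>"
    by (rule localization_hom_fraction)
  assume "w \<notin> p"
  then have wW: "w \<in> W" using w by (simp add: W)
  have "fraction A W w \<one> \<otimes>\<^bsub>localization A W\<^esub> fraction A W \<one> w = \<one>\<^bsub>localization A W\<^esub>"
    unfolding one using wW W_one by (simp add: localization_mult fraction_eq_iff del: h.hom_one) (use W_one in blast)
  moreover have "fraction A W \<one> w \<in> carrier (localization A W)" using wW by (auto simp: carrier_localization)
  ultimately show "fraction A W w \<one> \<in> Units (localization A W)"
    by (rule h.S.unit_factor[OF eq_mem_trans[OF _ h.S.Units_one_closed] h.hom_closed[OF w]])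
qed
qed

end

section \<open>Polynomial rings\<close>

context cring
begin

lemma ideal_finsum:
  assumes "ideal N R" "finite A" "\<And>i. i \<in> A \<Longrightarrow> f i \<in> N" shows "finsum R f A \<in> N"
  using assms(2,3)
proof (induction A rule: finite_induct)
  case (insert i A)
  then have "f \<in> insert i A \<rightarrow> carrier R" using ideal_carrier[OF assms(1)] by blast
  then show ?case using insert by (auto simp: finsum_insert Pi_def ideal_add[OF assms(1)])
qed (simp add: ideal_zero[OF assms(1)])

end

context UP_cring
begin

text \<open>Ideals homogeneous in the variable, given by their coefficient ideals \<open>F j\<close>
  in degree \<open>j\<close>, which have to increase with \<open>j\<close>. A constant
  \<open>F\<close> gives the extension of an ideal of \<open>R\<close>; taking the whole ring in
  positive degrees adjoins the variable. Both cases are thus treated together.\<close>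

definition coeffs_in :: "(nat \<Rightarrow> 'a set) \<Rightarrow> (nat \<Rightarrow> 'a) set" where
  "coeffs_in F = {p \<in> carrier P. \<forall>j. coeff P p j \<in> F j}"

lemma coeffs_inD: "p \<in> coeffs_in F \<Longrightarrow> p \<in> carrier P \<and> coeff P p j \<in> F j"
  by (simp add: coeffs_in_def)

lemma ideal_coeffs_in:
  assumes F: "\<And>j. ideal (F j) R" and mono: "\<And>j. F j \<subseteq> F (Suc j)"
  shows "ideal (coeffs_in F) P"
proof (rule P.ideal_closedI)
  have inc: "F i \<subseteq> F j" if "i \<le> j" for i j using mono that by (rule lift_Suc_mono_le)
  fix r p assume r: "r \<in> carrier P" and p: "p \<in> coeffs_in F"
  have "coeff P r i \<otimes> coeff P p (n - i) \<in> F n" if "i \<le> n" for n i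
    using coeffs_inD[OF p, of "n - i"] inc[of "n - i" n] r by (intro R.ideal_mult[OF F]) auto
  then show "r \<otimes>\<^bsub>P\<^esub> p \<in> coeffs_in F"
    using r coeffs_inD[OF p] by (auto simp: coeffs_in_def intro!: R.ideal_finsum[OF F])
qed (use R.ideal_zero[OF F] R.ideal_add[OF F] in \<open>auto simp: coeffs_in_def\<close>)

lemma coeffs_in_subset:
  assumes I: "ideal I P" and "\<And>j c. c \<in> F j \<Longrightarrow> monom P c j \<in> I"
  shows "coeffs_in F \<subseteq> I"
proof
  fix p assume p: "p \<in> coeffs_in F"
  then have "(\<Oplus>\<^bsub>P\<^esub> i \<in> {..deg R p}. monom P (coeff P p i) i) \<in> I"
    using assms(2) coeffs_inD[OF p] by (intro P.ideal_finsum[OF I]) auto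
  then show "p \<in> I" using up_repr coeffs_inD[OF p] by simp
qed

text \<open>In degree \<open>n\<close> of the product all terms except the one with the constant
  term of \<open>w\<close> lie in \<open>F n\<close> by induction, because \<open>F\<close>
  increases.\<close>

lemma reg_coeffs_in:
  assumes F: "\<And>j. ideal (F j) R" and mono: "\<And>j. F j \<subseteq> F (Suc j)"
    and w: "w \<in> carrier P" and reg: "\<And>j. R.reg (F j) (coeff P w 0)"
  shows "P.reg (coeffs_in F) w"
proof (rule P.regI[OF w])
  have inc: "F i \<subseteq> F j" if "i \<le> j" for i j using mono that by (rule lift_Suc_mono_le)
  fix f assume f: "f \<in> carrier P" "f \<otimes>\<^bsub>P\<^esub> w \<in> coeffs_in F"
  have "coeff P f n \<in> F n" for n
  proof (induction n rule: less_induct)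
    case (less n)
    have s: "(\<Oplus>i\<in>{..<n}. coeff P f i \<otimes> coeff P w (n - i)) \<in> F n"
    proof (rule R.ideal_finsum[OF F])
      fix i assume "i \<in> {..<n}"
      then have "coeff P f i \<in> F n" using less.IH[of i] inc[of i n] by auto
      then show "coeff P f i \<otimes> coeff P w (n - i) \<in> F n" using w by (intro R.ideal_mult_right[OF F]) auto
    qed simp
    have "coeff P (f \<otimes>\<^bsub>P\<^esub> w) n = (\<Oplus>i\<in>insert n {..<n}. coeff P f i \<otimes> coeff P w (n - i))"
      using f w by (simp add: lessThan_Suc_atMost[symmetric] lessThan_Suc)
    also have "\<dots> = coeff P f n \<otimes> coeff P w 0 \<oplus> (\<Oplus>i\<in>{..<n}. coeff P f i \<otimes> coeff P w (n - i))"
      using f w by (subst R.finsum_insert) auto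
    finally have "(\<Oplus>i\<in>{..<n}. coeff P f i \<otimes> coeff P w (n - i)) \<oplus> coeff P f n \<otimes> coeff P w 0 \<in> F n"
      using coeffs_inD[OF f(2), of n] f w R.ideal_carrier[OF F s] by (simp add: R.a_comm)
    then have "coeff P f n \<otimes> coeff P w 0 \<in> F n"
      using R.ideal_add_cancel[OF F _ s] f w by simp
    then show ?case using R.regD[OF reg] f by simp
  qed
  then show "f \<in> coeffs_in F" using f by (simp add: coeffs_in_def)
qed

abbreviation const :: "'a \<Rightarrow> nat \<Rightarrow> 'a" where
  "const a \<equiv> monom P a 0"

abbreviation var :: "nat \<Rightarrow> 'a" where
  "var \<equiv> monom P \<one> 1"

lemma coeff_const_mult:
  "\<lbrakk>a \<in> carrier R; p \<in> carrier P\<rbrakk> \<Longrightarrow> coeff P (const a \<otimes>\<^bsub>P\<^esub> p) n = a \<otimes> coeff P p n"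
  by (simp add: monom_mult_is_smult del: coeff_mult)

lemma coeff_mult_const:
  "\<lbrakk>a \<in> carrier R; p \<in> carrier P\<rbrakk> \<Longrightarrow> coeff P (p \<otimes>\<^bsub>P\<^esub> const a) n = coeff P p n \<otimes> a"
  using coeff_const_mult[of a p n] P.m_comm[of p "const a"] R.m_comm[of "coeff P p n" a] by (simp del: coeff_mult)

lemma coeff_mult_var_Suc: "p \<in> carrier P \<Longrightarrow> coeff P (p \<otimes>\<^bsub>P\<^esub> var) (Suc n) = coeff P p n"
  using coeff_monom_mult[of \<one> p 1 n] P.m_comm[of p var] by (simp del: coeff_mult)

lemma coeff_mult_0: "\<lbrakk>p \<in> carrier P; q \<in> carrier P\<rbrakk> \<Longrightarrow> coeff P (p \<otimes>\<^bsub>P\<^esub> q) 0 = coeff P p 0 \<otimes> coeff P q 0"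
  by simp

lemma coeff_mult_var_0: "p \<in> carrier P \<Longrightarrow> coeff P (p \<otimes>\<^bsub>P\<^esub> var) 0 = \<zero>"
  by (simp add: coeff_mult_0)

lemma mult_var_mem_coeffs_in:
  assumes F: "\<And>j. ideal (F j) R" and p: "p \<in> carrier P"
  shows "p \<otimes>\<^bsub>P\<^esub> var \<in> coeffs_in F \<longleftrightarrow> p \<in> coeffs_in (\<lambda>j. F (Suc j))"
proof -
  have "(\<forall>j. coeff P (p \<otimes>\<^bsub>P\<^esub> var) j \<in> F j) \<longleftrightarrow> (\<forall>j. coeff P p j \<in> F (Suc j))"
  proof (intro iffI allI)
    show "coeff P p j \<in> F (Suc j)" if "\<forall>j. coeff P (p \<otimes>\<^bsub>P\<^esub> var) j \<in> F j" for j
      using spec[OF that, of "Suc j"] coeff_mult_var_Suc[OF p] by simp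
    show "coeff P (p \<otimes>\<^bsub>P\<^esub> var) j \<in> F j" if "\<forall>j. coeff P p j \<in> F (Suc j)" for j
      using that p R.ideal_zero[OF F] coeff_mult_var_0 coeff_mult_var_Suc by (cases j) (simp_all del: coeff_mult)
  qed
  then show ?thesis using p by (simp add: coeffs_in_def del: coeff_mult)
qed

lemma colon_coeffs_in:
  assumes "K \<subseteq> carrier R"
  shows "colon_ideal P (coeffs_in F) (const ` K) = coeffs_in (\<lambda>j. colon_ideal R (F j) K)"
  using assms coeff_mult_const
  by (auto simp: colon_ideal_def coeffs_in_def subset_iff simp del: coeff_mult)

lemma coeffs_in_adj:
  assumes F: "\<And>j. ideal (F j) R" and mono: "\<And>j. F j \<subseteq> F (Suc j)" and a: "a \<in> carrier R"
  shows "coeffs_in (\<lambda>j. R.adj (F j) a) = P.adj (coeffs_in F) (const a)"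
proof
  have I: "ideal (coeffs_in F) P" using F mono by (rule ideal_coeffs_in)
  have J: "ideal (coeffs_in (\<lambda>j. R.adj (F j) a)) P"
    using F mono a by (intro ideal_coeffs_in R.ideal_adj R.adj_mono)
  show "coeffs_in (\<lambda>j. R.adj (F j) a) \<subseteq> P.adj (coeffs_in F) (const a)"
  proof (rule coeffs_in_subset)
    show "ideal (P.adj (coeffs_in F) (const a)) P" using I a by (intro P.ideal_adj) auto
    fix j c assume "c \<in> R.adj (F j) a"
    then obtain n r where 1: "n \<in> F j" "n \<in> carrier R" "r \<in> carrier R" "c = n \<oplus> r \<otimes> a"
      using F by (rule R.adjE)
    have "monom P c j = monom P n j \<oplus>\<^bsub>P\<^esub> monom P r j \<otimes>\<^bsub>P\<^esub> const a"
      using 1 a by (simp flip: monom_mult)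
    moreover have "monom P n j \<in> coeffs_in F" using 1 R.ideal_zero[OF F] by (simp add: coeffs_in_def)
    ultimately show "monom P c j \<in> P.adj (coeffs_in F) (const a)"
      using 1 by (intro P.adjI) auto
  qed
  show "P.adj (coeffs_in F) (const a) \<subseteq> coeffs_in (\<lambda>j. R.adj (F j) a)"
    using a R.adj_incl[OF F a] R.adj_self[OF F a] R.ideal_zero[OF R.ideal_adj[OF F a]]
    by (intro P.adj_subset[OF J]) (auto simp: coeffs_in_def)
qed

section \<open>Evaluation and the Hilbert basis theorem\<close>

lemma surjective_hom_eval:
  assumes a: "a \<in> carrier R" shows "surjective_hom P R (eval R R id a)"
proof -
  interpret u: UP_pre_univ_prop R R id P by unfold_locales simp
  have h: "eval R R id a \<in> ring_hom P R" using u.eval_ring_hom[OF a] .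
  interpret h: ring_hom_cring P R "eval R R id a" by unfold_locales (rule h)
  show ?thesis
  proof
    have "eval R R id a (const r) = r" if "r \<in> carrier R" for r using u.eval_const[OF a that] by simp
    then have "r \<in> eval R R id a ` carrier P" if "r \<in> carrier R" for r
      using that by (intro image_eqI[of _ _ "const r"]) (simp_all del: id_apply)
    then show "eval R R id a ` carrier P = carrier R" using h.hom_closed by blast
  qed
qed

lemma eval_const_id: "\<lbrakk>a \<in> carrier R; r \<in> carrier R\<rbrakk> \<Longrightarrow> eval R R id a (const r) = r"
proof -
  interpret u: UP_pre_univ_prop R R id P by unfold_locales simp
  show "\<lbrakk>a \<in> carrier R; r \<in> carrier R\<rbrakk> \<Longrightarrow> eval R R id a (const r) = r" using u.eval_const[of a r] by (simp only: id_apply)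
qed

lemma eval_var: "a \<in> carrier R \<Longrightarrow> eval R R id a var = a"
proof -
  interpret u: UP_pre_univ_prop R R id P by unfold_locales simp
  show "a \<in> carrier R \<Longrightarrow> eval R R id a var = a" by (rule u.eval_monom1)
qed

lemma remainder:
  assumes "f \<in> carrier P" "a \<in> carrier R" "\<one> \<noteq> \<zero>"
  obtains q where "q \<in> carrier P" "f = (var \<ominus>\<^bsub>P\<^esub> const a) \<otimes>\<^bsub>P\<^esub> q \<oplus>\<^bsub>P\<^esub> const (eval R R id a f)"
  using remainder_theorem[OF assms(1,2)] assms(3) R.carrier_one_not_zero by blast

lemma eval_0: assumes f: "f \<in> carrier P" and "\<one> \<noteq> \<zero>" shows "eval R R id \<zero> f = coeff P f 0"
proof -
  interpret e: surjective_hom P R "eval R R id \<zero>" by (rule surjective_hom_eval) simp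
  define c where "c = eval R R id \<zero> f"
  have c: "c \<in> carrier R" unfolding c_def using f by simp
  obtain q where q: "q \<in> carrier P" "f = (var \<ominus>\<^bsub>P\<^esub> const \<zero>) \<otimes>\<^bsub>P\<^esub> q \<oplus>\<^bsub>P\<^esub> const c"
    unfolding c_def by (rule remainder[OF f R.zero_closed assms(2)])
  have "var \<ominus>\<^bsub>P\<^esub> const \<zero> = var" by (simp add: P.minus_eq)
  then have "coeff P f 0 = coeff P (var \<otimes>\<^bsub>P\<^esub> q \<oplus>\<^bsub>P\<^esub> const c) 0" using q(2) by simp
  also have "\<dots> = c" using q(1) c by (simp add: coeff_mult_0)
  finally show ?thesis by (simp add: c_def)
qed

lemma kernel_eval:
  assumes f: "f \<in> carrier P" and a: "a \<in> carrier R" and "\<one> \<noteq> \<zero>"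
  shows "eval R R id a f = \<zero> \<longleftrightarrow> (\<exists>q\<in>carrier P. f = q \<otimes>\<^bsub>P\<^esub> (var \<ominus>\<^bsub>P\<^esub> const a))"
proof
  interpret e: surjective_hom P R "eval R R id a" using a by (rule surjective_hom_eval)
  obtain q where q: "q \<in> carrier P" "f = (var \<ominus>\<^bsub>P\<^esub> const a) \<otimes>\<^bsub>P\<^esub> q \<oplus>\<^bsub>P\<^esub> const (eval R R id a f)"
    by (rule remainder[OF f a assms(3)])
  assume "eval R R id a f = \<zero>"
  then show "\<exists>q\<in>carrier P. f = q \<otimes>\<^bsub>P\<^esub> (var \<ominus>\<^bsub>P\<^esub> const a)" using q a by (auto simp: P.m_comm)
next
  interpret e: surjective_hom P R "eval R R id a" using a by (rule surjective_hom_eval)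
  assume "\<exists>q\<in>carrier P. f = q \<otimes>\<^bsub>P\<^esub> (var \<ominus>\<^bsub>P\<^esub> const a)"
  then obtain q where q: "q \<in> carrier P" "f = q \<otimes>\<^bsub>P\<^esub> (var \<ominus>\<^bsub>P\<^esub> const a)" by blast
  have "eval R R id a (var \<ominus>\<^bsub>P\<^esub> const a) = \<zero>" by (rule eval_monom_expr[OF a])
  then show "eval R R id a f = \<zero>" using q a by (simp add: R.minus_eq R.r_neg)
qed

text \<open>Hilbert's argument with leading coefficients: \<open>lead J n\<close> takes the
  coefficient in degree \<open>n\<close> of the elements of \<open>J\<close> of degree at most
  \<open>n\<close>, zero included, which makes it an ideal that increases with
  \<open>n\<close>.\<close>

lemma noetherian_UP: assumes "noetherian_cring R" shows "noetherian_cring P"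
proof -
  interpret N: noetherian_cring R by (rule assms)
  have "noetherian_ring P"
  proof (rule P.noetherian_ringI)
    fix I assume I: "ideal I P"
    define lead where "lead J n = {coeff P p n | p. p \<in> J \<and> (\<forall>i>n. coeff P p i = \<zero>)}" for J and n :: nat
    have ideal_lead: "ideal (lead J n) R" if J: "ideal J P" for J n
    proof (rule R.ideal_closedI)
      note Jc = P.ideal_carrier[OF J]
      show "lead J n \<subseteq> carrier R" using Jc by (auto simp: lead_def)
      show "\<zero> \<in> lead J n" using P.ideal_zero[OF J] unfolding lead_def
        by (intro CollectI exI[of _ "\<zero>\<^bsub>P\<^esub>"]) auto
      show "x \<oplus> y \<in> lead J n" if "x \<in> lead J n" "y \<in> lead J n" for x y
      proof -
        obtain p q where pq: "p \<in> J" "q \<in> J" "x = coeff P p n" "y = coeff P q n"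
          "\<forall>i>n. coeff P p i = \<zero>" "\<forall>i>n. coeff P q i = \<zero>" using \<open>x \<in> lead J n\<close> \<open>y \<in> lead J n\<close> unfolding lead_def by blast
        then show ?thesis using P.ideal_add[OF J] Jc unfolding lead_def
          by (intro CollectI exI[of _ "p \<oplus>\<^bsub>P\<^esub> q"]) auto
      qed
      show "r \<otimes> x \<in> lead J n" if r: "r \<in> carrier R" and "x \<in> lead J n" for r x
      proof -
        obtain p where p: "p \<in> J" "x = coeff P p n" "\<forall>i>n. coeff P p i = \<zero>" using \<open>x \<in> lead J n\<close> unfolding lead_def by blast
        then show ?thesis using P.ideal_mult[OF J, of p "const r"] Jc r coeff_const_mult unfolding lead_def
          by (intro CollectI exI[of _ "const r \<otimes>\<^bsub>P\<^esub> p"]) (auto simp del: coeff_mult)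
      qed
    qed
    have lead_Suc: "lead J n \<subseteq> lead J (Suc n)" if J: "ideal J P" for J n
    proof
      fix x assume "x \<in> lead J n"
      then obtain p where p: "p \<in> J" "x = coeff P p n" "\<forall>i>n. coeff P p i = \<zero>" unfolding lead_def by blast
      have pc: "p \<in> carrier P" using p J P.ideal_carrier by blast
      have "p \<otimes>\<^bsub>P\<^esub> var \<in> J" using p by (intro P.ideal_mult_right[OF J]) auto
      moreover have "coeff P (p \<otimes>\<^bsub>P\<^esub> var) i = \<zero>" if "i > Suc n" for i
        using that p coeff_mult_var_Suc[OF pc, of "i - 1"] by (cases i) (auto simp del: coeff_mult)
      ultimately show "x \<in> lead J (Suc n)" unfolding lead_def
        using coeff_mult_var_Suc[OF pc] p(2) by (intro CollectI exI[of _ "p \<otimes>\<^bsub>P\<^esub> var"]) (auto simp del: coeff_mult)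
    qed
    obtain N where N: "\<And>k. N \<le> k \<Longrightarrow> lead I k = lead I N"
      using N.ideal_ascending_chain[of "lead I"] ideal_lead[OF I] lead_Suc[OF I] by blast
    have "\<exists>F. finite F \<and> F \<subseteq> carrier R \<and> lead I n = Idl F" for n
      using N.finetely_gen[OF ideal_lead[OF I]] by blast
    then obtain F where F: "\<And>n. finite (F n)" "\<And>n. F n \<subseteq> carrier R" "\<And>n. lead I n = Idl (F n)" by metis
    have FL: "F n \<subseteq> lead I n" for n using F(2,3) R.genideal_self by blast
    define lift where "lift n c = (SOME p. p \<in> I \<and> (\<forall>i>n. coeff P p i = \<zero>) \<and> coeff P p n = c)" for n :: nat and c
    have lift: "lift n c \<in> I \<and> (\<forall>i>n. coeff P (lift n c) i = \<zero>) \<and> coeff P (lift n c) n = c" if "c \<in> lead I n" for n c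
    proof -
      have "\<exists>p. p \<in> I \<and> (\<forall>i>n. coeff P p i = \<zero>) \<and> coeff P p n = c" using that by (auto simp: lead_def)
      then show ?thesis unfolding lift_def by (rule someI_ex)
    qed
    \<comment> \<open>Lifts of generators are needed only up to degree \<open>N\<close>; above it,
      multiplication by the variable carries them along.\<close>
    define G where "G = (\<Union>n\<le>N. lift n ` F n)"
    have G: "finite G" "G \<subseteq> I" unfolding G_def using F(1) FL lift by (auto, blast)
    have Gc: "G \<subseteq> carrier P" using G I P.ideal_subset_carrier by blast
    have J: "ideal (Idl\<^bsub>P\<^esub> G) P" using Gc by (rule P.genideal_ideal)
    have GJ: "G \<subseteq> Idl\<^bsub>P\<^esub> G" using Gc by (rule P.genideal_self)
    have small: "lead I n \<subseteq> lead (Idl\<^bsub>P\<^esub> G) n" if n: "n \<le> N" for n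
      unfolding F(3)
    proof (rule R.genideal_minimal[OF ideal_lead[OF J]])
      show "F n \<subseteq> lead (Idl\<^bsub>P\<^esub> G) n"
      proof
        fix c assume c: "c \<in> F n"
        then have "lift n c \<in> Idl\<^bsub>P\<^esub> G" using GJ n by (auto simp: G_def)
        then show "c \<in> lead (Idl\<^bsub>P\<^esub> G) n"
          using lift[OF subsetD[OF FL c]] unfolding lead_def by (intro CollectI exI[of _ "lift n c"]) simp
      qed
    qed
    have lead_le: "lead I n \<subseteq> lead (Idl\<^bsub>P\<^esub> G) n" for n
    proof (cases "n \<le> N")
      case False
      have "lead (Idl\<^bsub>P\<^esub> G) N \<subseteq> lead (Idl\<^bsub>P\<^esub> G) n"
        by (rule lift_Suc_mono_le[of "lead (Idl\<^bsub>P\<^esub> G)"]) (use lead_Suc[OF J] False in simp_all)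
      then show ?thesis using N[of n] small[of N] False by auto
    qed (rule small)
    have "p \<in> Idl\<^bsub>P\<^esub> G" if "p \<in> I" "\<forall>i\<ge>k. coeff P p i = \<zero>" for p k
      using that
    proof (induction k arbitrary: p)
      case 0
      then have "p = \<zero>\<^bsub>P\<^esub>" using P.ideal_carrier[OF I] by (intro up_eqI) auto
      then show ?case using P.ideal_zero[OF J] by simp
    next
      case (Suc k)
      have pc: "p \<in> carrier P" using Suc.prems I P.ideal_carrier by blast
      have "coeff P p k \<in> lead I k" unfolding lead_def using Suc.prems by (intro CollectI exI[of _ p]) auto
      then obtain q where q: "q \<in> Idl\<^bsub>P\<^esub> G" "coeff P p k = coeff P q k" "\<forall>i>k. coeff P q i = \<zero>"
        using lead_le[of k] unfolding lead_def by blast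
      have "Idl\<^bsub>P\<^esub> G \<subseteq> I" using P.genideal_minimal[OF I G(2)] .
      then have qI: "q \<in> I" "q \<in> carrier P" using q I P.ideal_carrier by auto
      have "p \<ominus>\<^bsub>P\<^esub> q \<in> Idl\<^bsub>P\<^esub> G"
      proof (rule Suc.IH)
        show "p \<ominus>\<^bsub>P\<^esub> q \<in> I" using Suc.prems qI by (intro P.ideal_minus[OF I])
        show "\<forall>i\<ge>k. coeff P (p \<ominus>\<^bsub>P\<^esub> q) i = \<zero>"
        proof (intro allI impI)
          fix i assume "i \<ge> k"
          then have "coeff P p i = coeff P q i" using Suc.prems(2) q(2,3) by (cases "i = k") auto
          then show "coeff P (p \<ominus>\<^bsub>P\<^esub> q) i = \<zero>" using pc qI(2) by (simp add: coeff_minus R.minus_eq R.r_neg)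
        qed
      qed
      moreover have "(p \<ominus>\<^bsub>P\<^esub> q) \<oplus>\<^bsub>P\<^esub> q = p" using pc qI(2) by algebra
      ultimately show ?case using P.ideal_add[OF J _ q(1), of "p \<ominus>\<^bsub>P\<^esub> q"] by simp
    qed
    moreover have "\<exists>k. \<forall>i\<ge>k. coeff P p i = \<zero>" if "p \<in> I" for p
      using deg_aboveD[of p] P.ideal_carrier[OF I that] by (intro exI[of _ "Suc (deg R p)"]) auto
    ultimately have "I \<subseteq> Idl\<^bsub>P\<^esub> G" by blast
    then have "I = Idl\<^bsub>P\<^esub> G" using P.genideal_minimal[OF I G(2)] by blast
    then show "\<exists>A\<subseteq>carrier P. finite A \<and> I = Idl\<^bsub>P\<^esub> A" using G Gc by blast
  qed
  then show ?thesis by (simp add: noetherian_cring_def P.is_cring)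
qed

end

section \<open>Links by a product, and links under localization and reduction\<close>

context cring
begin

text \<open>Cancelling the regular element \<open>b\<close> identifies the colon of N + abR by N +
  bR with N + aR, and symmetrically.\<close>

lemma linked_by_product:
  assumes xs: "regm {\<zero>} xs" and a: "reg (adjl {\<zero>} xs) a" and b: "reg (adjl {\<zero>} xs) b"
    and proper: "adj (adjl {\<zero>} xs) (a \<otimes> b) \<noteq> carrier R"
  shows "linked_by (xs @ [a \<otimes> b]) (adj (adjl {\<zero>} xs) a) (adj (adjl {\<zero>} xs) b)"
proof -
  define N where "N = adjl {\<zero>} xs"
  have xsc: "set xs \<subseteq> carrier R" using xs by (rule regm_closed)
  have N: "ideal N R" unfolding N_def using zeroideal xsc by (rule ideal_adjl)
  have xsN: "set xs \<subseteq> N" unfolding N_def using zeroideal xsc by (rule adjl_set)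
  have ab: "a \<in> carrier R" "b \<in> carrier R" using a b reg_closed by auto
  have "reg N (a \<otimes> b)"
  proof (rule regI)
    fix r assume r: "r \<in> carrier R" "r \<otimes> (a \<otimes> b) \<in> N"
    then have "(r \<otimes> a) \<otimes> b \<in> N" using ab by (simp add: m_assoc)
    then have "r \<otimes> a \<in> N" using regD[OF b, of "r \<otimes> a"] r(1) ab by (simp add: N_def)
    then show "r \<in> N" using regD[OF a r(1)] by (simp add: N_def)
  qed (use ab in simp)
  moreover have colon: "colon_ideal R (adj N (x \<otimes> y)) (adj N y) = adj N x"
    if "x \<in> carrier R" and y: "reg N y" for x y
  proof -
    have yc: "y \<in> carrier R" using y by (rule reg_closed)
    have xy: "ideal (adj N (x \<otimes> y)) R" using N that(1) yc by (simp add: ideal_adj)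
    show ?thesis
    proof (intro equalityI subsetI)
      fix z assume "z \<in> colon_ideal R (adj N (x \<otimes> y)) (adj N y)"
      then have z: "z \<in> carrier R" "z \<otimes> y \<in> adj N (x \<otimes> y)"
        using adj_self[OF N yc] by (auto simp: colon_ideal_def)
      then show "z \<in> adj N x" using reg_mult_mem_adj_iff[OF N y that(1) z(1)] yc by (simp add: m_comm)
    next
      fix z assume zx: "z \<in> adj N x"
      then have z: "z \<in> carrier R" using ideal_adj[OF N that(1)] ideal_carrier by blast
      have zy: "y \<otimes> z \<in> adj N (x \<otimes> y)" using reg_mult_mem_adj_iff[OF N y that(1) z] zx by simp
      have "z \<otimes> v \<in> adj N (x \<otimes> y)" if "v \<in> adj N y" for v
      proof -
        obtain n r where v: "n \<in> N" "n \<in> carrier R" "r \<in> carrier R" "v = n \<oplus> r \<otimes> y"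
          using \<open>v \<in> adj N y\<close> N by (rule adjE)
        have "z \<otimes> n \<in> adj N (x \<otimes> y)"
          using adj_incl[OF N _ ideal_mult[OF N v(1) z]] \<open>x \<in> carrier R\<close> yc by simp
        moreover have "r \<otimes> (y \<otimes> z) \<in> adj N (x \<otimes> y)" using zy v(3) by (simp add: ideal_mult[OF xy])
        ultimately have "z \<otimes> n \<oplus> r \<otimes> (y \<otimes> z) \<in> adj N (x \<otimes> y)" by (rule ideal_add[OF xy])
        moreover have "z \<otimes> v = z \<otimes> n \<oplus> r \<otimes> (y \<otimes> z)"
          unfolding v(4) using v(2,3) z yc by (simp add: r_distr m_ac)
        ultimately show ?thesis by simp
      qed
      then show "z \<in> colon_ideal R (adj N (x \<otimes> y)) (adj N y)" using z by (simp add: colon_ideal_def)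
    qed
  qed
  moreover have "set xs \<subseteq> adj N a" "a \<otimes> b \<in> adj N a"
    using adj_incl[OF N ab(1)] xsN adj_mult_self[OF N ab] m_comm[OF ab] by auto
  moreover have "colon_ideal R (adj N (a \<otimes> b)) (adj N b) = adj N a" using b by (intro colon ab(1)) (simp add: N_def)
  moreover have "colon_ideal R (adj N (a \<otimes> b)) (adj N a) = adj N b"
    unfolding m_comm[OF ab] using a by (intro colon ab(2)) (simp add: N_def)
  ultimately show ?thesis
    using xs proper ideal_adj[OF N ab(1)] ideal_adj[OF N ab(2)]
    by (simp add: linked_by_def N_def[symmetric])
qed

end

lemma (in localization_hom) linked_by_ext:
  assumes N: "noetherian_cring P" and l: "R.linked_by xs K K'" and "ext (R.adjl {\<zero>} xs) \<noteq> carrier Q"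
  shows "S.linked_by (map h xs) (ext K) (ext K')"
proof -
  note d = R.linked_byD[OF l]
  have xsc: "set xs \<subseteq> carrier P" using d(1) by (rule R.regm_closed)
  have e: "ext (R.adjl {\<zero>} xs) = S.adjl {\<zero>\<^bsub>Q\<^esub>} (map h xs)"
    using ext_adjl[OF R.zeroideal xsc] ext_zero by simp
  have "S.regm {\<zero>\<^bsub>Q\<^esub>} (map h xs)" using ext_regm[OF R.zeroideal d(1)] ext_zero by simp
  moreover have "set (map h xs) \<subseteq> ext K" using d(5) xsc h_mem_ext by auto
  moreover have "ext K = colon_ideal Q (ext (R.adjl {\<zero>} xs)) (ext K')"
    "ext K' = colon_ideal Q (ext (R.adjl {\<zero>} xs)) (ext K)"
    using ext_colon[OF N R.linked_by_ideal_adjl[OF l]] d(3,4) R.linked_by_colon[OF l] by metis+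
  ultimately show ?thesis using assms(3) ideal_ext d(3,4) unfolding S.linked_by_def e by blast
qed

text \<open>Reduction modulo the first element of the sequence. The ideals involved contain the
  kernel, so membership in their images can be tested before reduction, and colons and regularity
  carry over.\<close>

lemma (in surjective_hom) linked_by_image:
  assumes l: "R.linked_by (x # xs) K K'" and ker: "{s \<in> carrier S. ev s = \<zero>\<^bsub>T\<^esub>} = R.adj {\<zero>} x"
    and proper: "ev ` K \<noteq> carrier T"
  shows "S.linked_by (map ev xs) (ev ` K) (ev ` K')"
proof -
  note d = R.linked_byD[OF l]
  define N where "N = R.adj {\<zero>} x"
  define A where "A = R.adjl N xs"
  have xc: "x \<in> carrier S" "set xs \<subseteq> carrier S" using R.regm_closed[OF d(1)] by auto
  have N: "ideal N S" unfolding N_def using R.zeroideal xc(1) by (rule R.ideal_adj)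
  have evN: "ev ` N = {\<zero>\<^bsub>T\<^esub>}" using ker R.ideal_zero[OF N] unfolding N_def by force
  have mem: "ev s \<in> ev ` I \<longleftrightarrow> s \<in> I" if I: "ideal I S" "N \<subseteq> I" and s: "s \<in> carrier S" for I s
  proof
    assume "ev s \<in> ev ` I"
    then obtain i where i: "i \<in> I" "ev s = ev i" by blast
    have ic: "i \<in> carrier S" using I(1) i(1) R.ideal_carrier by blast
    have "ev (s \<ominus> i) = \<zero>\<^bsub>T\<^esub>" using i(2) s ic by (simp add: S.r_neg S.minus_eq)
    then have "s \<ominus> i \<in> I" using ker I(2) s ic unfolding N_def by blast
    then show "s \<in> I" using R.ideal_diff_iff[OF I(1) _ s ic] i(1) by simp
  qed simp
  have A: "ideal A S" "N \<subseteq> A" unfolding A_def using N xc by (simp_all add: R.ideal_adjl R.adjl_incl)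
  have AK: "A \<subseteq> K" "A \<subseteq> K'" using R.linked_by_adjl_subset[OF l] by (simp_all add: A_def N_def)
  have eA: "ev ` A = S.adjl {\<zero>\<^bsub>T\<^esub>} (map ev xs)" unfolding A_def using image_adjl[OF N xc(2)] evN by simp
  have colon: "colon_ideal T (ev ` A) (ev ` J) = ev ` colon_ideal S A J" if J: "J \<subseteq> carrier S" for J
  proof -
    have "ev s \<otimes>\<^bsub>T\<^esub> ev j \<in> ev ` A \<longleftrightarrow> s \<otimes> j \<in> A" if "s \<in> carrier S" "j \<in> J" for s j
      using mem[OF A, of "s \<otimes> j"] that J by auto
    then have "ev s \<in> colon_ideal T (ev ` A) (ev ` J) \<longleftrightarrow> s \<in> colon_ideal S A J" if "s \<in> carrier S" for s
      using that by (simp add: colon_ideal_def)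
    moreover have "\<exists>s\<in>carrier S. z = ev s" if "z \<in> colon_ideal T (ev ` A) (ev ` J)" for z
      using that surj by (auto simp: colon_ideal_def)
    moreover have "colon_ideal S A J \<subseteq> carrier S" by (auto simp: colon_ideal_def)
    ultimately show ?thesis by blast
  qed
  have regm: "R.regm M ys \<Longrightarrow> ideal M S \<Longrightarrow> N \<subseteq> M \<Longrightarrow> S.regm (ev ` M) (map ev ys)" for M ys
  proof (induction ys arbitrary: M)
    case (Cons y ys)
    then have y: "R.reg M y" "y \<in> carrier S" using R.reg_closed by auto
    have "S.reg (ev ` M) (ev y)"
    proof (rule S.regI)
      fix r assume r: "r \<in> carrier T" "r \<otimes>\<^bsub>T\<^esub> ev y \<in> ev ` M"
      then obtain s where s: "s \<in> carrier S" "r = ev s" using surj by blast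
      then have "s \<otimes> y \<in> M" using r(2) mem[OF Cons.prems(2,3), of "s \<otimes> y"] y(2) by simp
      then show "r \<in> ev ` M" using R.regD[OF y(1) s(1)] s(2) by simp
    qed (use y in simp)
    moreover have "S.regm (ev ` R.adj M y) (map ev ys)"
      using Cons.prems y(2) R.adj_incl[OF Cons.prems(2) y(2)] by (intro Cons.IH R.ideal_adj) auto
    ultimately show ?case using image_adj[OF Cons.prems(2) y(2)] by simp
  qed simp
  have "S.regm {\<zero>\<^bsub>T\<^esub>} (map ev xs)" using regm[of N xs] d(1) N evN by (simp add: N_def)
  moreover have "ev ` A \<noteq> carrier T"
  proof
    assume eq: "ev ` A = carrier T"
    have "ev ` A \<subseteq> ev ` K" using AK by blast
    moreover have "ev ` K \<subseteq> carrier T" using d(3) R.ideal_carrier by auto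
    ultimately show False using proper eq by blast
  qed
  moreover note lc = R.linked_by_colon[OF l, unfolded R.adjl_Cons, folded N_def, folded A_def]
  have "ev ` K = colon_ideal T (ev ` A) (ev ` K')"
    unfolding colon[OF R.ideal_subset_carrier[OF d(4)]] by (rule arg_cong[OF lc(1)])
  moreover have "ev ` K' = colon_ideal T (ev ` A) (ev ` K)"
    unfolding colon[OF R.ideal_subset_carrier[OF d(3)]] by (rule arg_cong[OF lc(2)])
  moreover have "set (map ev xs) \<subseteq> ev ` K" using d(5) by auto
  ultimately show ?thesis using ideal_image[OF d(3)] ideal_image[OF d(4)] unfolding S.linked_by_def eA by blast
qed

lemma (in localization_hom) local_noetherian_ext:
  assumes p: "primeideal p P" and N: "noetherian_cring P"
    and unit: "\<And>w. w \<in> carrier P \<Longrightarrow> h w \<in> Units Q \<longleftrightarrow> w \<notin> p"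
  shows "local_noetherian Q (ext p)"
proof -
  interpret Q: noetherian_cring Q using N by (rule noetherian_ext)
  note ip = R.primeideal_ideal[OF p]
  show ?thesis
  proof (intro local_noetherian.intro local_noetherian_axioms.intro Q.noetherian_cring_axioms)
    show "ideal (ext p) Q" using ip by (rule ideal_ext)
    show "\<one>\<^bsub>Q\<^esub> \<notin> ext p"
    proof
      assume "\<one>\<^bsub>Q\<^esub> \<in> ext p"
      then obtain w where "w \<in> carrier P" "w \<otimes> \<one> \<in> p" "h w \<in> Units Q"
        using h_mem_ext_iff[OF ip R.one_closed] hom_one by auto
      then show False using unit by simp
    qed
    fix x assume x: "x \<in> carrier Q" "x \<notin> ext p"
    obtain f w where 1: "f \<in> carrier P" "w \<in> carrier P" "h w \<in> Units Q" "x \<otimes>\<^bsub>Q\<^esub> h w = h f"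
      using fraction[OF x(1)] by blast
    have "f \<notin> p" using x 1 ext_memI[of x f p w] by blast
    then have "x \<otimes>\<^bsub>Q\<^esub> h w \<in> Units Q" using unit[OF 1(1)] 1(4) by simp
    then show "x \<in> Units Q" using x(1) hom_closed[OF 1(2)] by (rule S.unit_factor)
  qed
qed

section \<open>The ideals J R[X] and (J, X), and links between them\<close>

context UP_cring
begin

abbreviation const_ext :: "'a set \<Rightarrow> (nat \<Rightarrow> 'a) set" where
  "const_ext J \<equiv> coeffs_in (\<lambda>_. J)"

abbreviation with_var :: "'a set \<Rightarrow> (nat \<Rightarrow> 'a) set" where
  "with_var J \<equiv> coeffs_in (\<lambda>j. if j = 0 then J else carrier R)"

lemma ideal_const_ext: "ideal J R \<Longrightarrow> ideal (const_ext J) P"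
  by (rule ideal_coeffs_in) auto

lemma ideal_with_var: "ideal J R \<Longrightarrow> ideal (with_var J) P"
  by (rule ideal_coeffs_in) (auto intro: R.ideal_carrier R.oneideal)

lemma mem_with_var_iff: "f \<in> with_var J \<longleftrightarrow> f \<in> carrier P \<and> coeff P f 0 \<in> J"
  by (auto simp: coeffs_in_def)

lemma const_ext_subset:
  assumes I: "ideal I P" and J: "J \<subseteq> carrier R" "const ` J \<subseteq> I"
  shows "const_ext J \<subseteq> I"
proof (rule coeffs_in_subset[OF I])
  fix j c assume c: "c \<in> J"
  have "monom P c j = const c \<otimes>\<^bsub>P\<^esub> monom P \<one> j" using monom_mult[of c \<one> 0 j] c J(1) by auto
  then show "monom P c j \<in> I" using P.ideal_mult_right[OF I, of "const c" "monom P \<one> j"] c J(2) by auto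
qed

lemma with_var_subset:
  assumes I: "ideal I P" and J: "J \<subseteq> carrier R" "const ` J \<subseteq> I" and var: "var \<in> I"
  shows "with_var J \<subseteq> I"
proof (rule coeffs_in_subset[OF I])
  fix j :: nat and c assume c: "c \<in> (if j = 0 then J else carrier R)"
  show "monom P c j \<in> I"
  proof (cases j)
    case (Suc i)
    then have "monom P c j = monom P c i \<otimes>\<^bsub>P\<^esub> var" using monom_mult[of c \<one> i 1] c by auto
    then show ?thesis using P.ideal_mult[OF I var] c Suc by auto
  qed (use c J in auto)
qed

lemma const_mem_coeffs_in: "\<lbrakk>\<And>j. ideal (F j) R; c \<in> F 0\<rbrakk> \<Longrightarrow> const c \<in> coeffs_in F"
  using R.ideal_zero[of "F _"] R.ideal_carrier[of "F 0" c] by (auto simp: coeffs_in_def)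

lemma var_mem_with_var: "ideal J R \<Longrightarrow> var \<in> with_var J"
  using R.ideal_zero by (auto simp: coeffs_in_def)

lemma with_var_eq_adj:
  assumes J: "ideal J R" shows "with_var J = P.adj (const_ext J) var"
proof
  have K: "ideal (P.adj (const_ext J) var) P" using ideal_const_ext[OF J] by (intro P.ideal_adj) auto
  have "const ` J \<subseteq> const_ext J" using J const_mem_coeffs_in[of "\<lambda>_. J"] by auto
  then show "with_var J \<subseteq> P.adj (const_ext J) var"
    using P.adj_incl[OF ideal_const_ext[OF J], of var] P.adj_self[OF ideal_const_ext[OF J], of var]
    by (intro with_var_subset[OF K R.ideal_subset_carrier[OF J]]) auto
  have "const_ext J \<subseteq> with_var J" using J R.ideal_carrier by (auto simp: coeffs_in_def)
  then show "P.adj (const_ext J) var \<subseteq> with_var J"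
    by (rule P.adj_subset[OF ideal_with_var[OF J] _ var_mem_with_var[OF J]])
qed

lemma const_ext_zero: "const_ext {\<zero>} = {\<zero>\<^bsub>P\<^esub>}"
  by (auto simp: coeffs_in_def intro: up_eqI)

lemma adjl_coeffs_in:
  "\<lbrakk>\<And>j. ideal (F j) R; \<And>j. F j \<subseteq> F (Suc j); set xs \<subseteq> carrier R\<rbrakk> \<Longrightarrow>
    P.adjl (coeffs_in F) (map const xs) = coeffs_in (\<lambda>j. R.adjl (F j) xs)"
proof (induction xs arbitrary: F)
  case (Cons x xs)
  have "P.adjl (coeffs_in (\<lambda>j. R.adj (F j) x)) (map const xs) = coeffs_in (\<lambda>j. R.adjl (R.adj (F j) x) xs)"
    using Cons.prems by (intro Cons.IH R.ideal_adj R.adj_mono) auto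
  then show ?case using coeffs_in_adj[of F x] Cons.prems by simp
qed simp

lemma regm_coeffs_in:
  "\<lbrakk>\<And>j. ideal (F j) R; \<And>j. F j \<subseteq> F (Suc j); \<And>j. R.regm (F j) xs\<rbrakk> \<Longrightarrow>
    P.regm (coeffs_in F) (map const xs)"
proof (induction xs arbitrary: F)
  case (Cons x xs)
  have x: "\<And>j. R.reg (F j) x" "x \<in> carrier R" using Cons.prems(3) R.reg_closed by auto
  have "P.regm (coeffs_in (\<lambda>j. R.adj (F j) x)) (map const xs)"
    using Cons.prems x by (intro Cons.IH R.ideal_adj R.adj_mono) auto
  moreover have "P.reg (coeffs_in F) (const x)"
    using Cons.prems(1,2) x by (intro reg_coeffs_in) simp_all
  ultimately show ?case using coeffs_in_adj[of F x] Cons.prems x(2) by simp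
qed simp

lemma reg_var: assumes J: "ideal J R" shows "P.reg (const_ext J) var"
  using mult_var_mem_coeffs_in[of "\<lambda>_. J"] J by (intro P.regI) auto

lemma colon_const_ext:
  assumes A: "ideal A R" and K: "ideal K R"
  shows "colon_ideal P (const_ext A) (const_ext K) = const_ext (colon_ideal R A K)"
proof -
  note Kc = R.ideal_subset_carrier[OF K]
  have "const ` K \<subseteq> const_ext K" using K const_mem_coeffs_in[of "\<lambda>_. K"] by auto
  moreover have "const_ext K \<subseteq> colon_ideal P (const_ext A) {f}"
    if "f \<in> colon_ideal P (const_ext A) (const ` K)" for f
  proof (rule const_ext_subset[OF P.ideal_colon[OF ideal_const_ext[OF A]] Kc])
    show "{f} \<subseteq> carrier P" using that by (simp add: colon_ideal_def)
    show "const ` K \<subseteq> colon_ideal P (const_ext A) {f}"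
      using that Kc by (auto simp: colon_ideal_def P.m_comm subset_iff)
  qed
  ultimately have "colon_ideal P (const_ext A) (const_ext K) = colon_ideal P (const_ext A) (const ` K)"
    using P.ideal_carrier[OF ideal_const_ext[OF K]]
    by (auto simp: colon_ideal_def P.m_comm subset_iff)
  then show ?thesis using colon_coeffs_in[OF Kc] by simp
qed

text \<open>The coefficient ideals in positive degrees are the whole ring and remain so under the
  colon; only degree 0 carries information.\<close>

lemma colon_with_var:
  assumes A: "ideal A R" and K: "ideal K R"
  shows "colon_ideal P (with_var A) (with_var K) = with_var (colon_ideal R A K)"
proof -
  note Kc = R.ideal_subset_carrier[OF K]
  have "const ` K \<subseteq> with_var K" using Kc by (auto simp: mem_with_var_iff)
  moreover have "with_var K \<subseteq> colon_ideal P (with_var A) {f}"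
    if "f \<in> colon_ideal P (with_var A) (const ` K)" for f
  proof (rule with_var_subset[OF P.ideal_colon[OF ideal_with_var[OF A]] Kc])
    show f: "{f} \<subseteq> carrier P" using that by (simp add: colon_ideal_def)
    show "const ` K \<subseteq> colon_ideal P (with_var A) {f}"
      using that Kc by (auto simp: colon_ideal_def P.m_comm subset_iff)
    show "var \<in> colon_ideal P (with_var A) {f}"
      using P.ideal_mult_right[OF ideal_with_var[OF A] var_mem_with_var[OF A], of f] f by (simp add: colon_ideal_def)
  qed
  ultimately have "colon_ideal P (with_var A) (with_var K) = colon_ideal P (with_var A) (const ` K)"
    using P.ideal_carrier[OF ideal_with_var[OF K]]
    by (auto simp: colon_ideal_def P.m_comm subset_iff)
  moreover have "(\<lambda>j. colon_ideal R (if j = 0 then A else carrier R) K) = (\<lambda>j::nat. if j = 0 then colon_ideal R A K else carrier R)"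
    using Kc by (auto simp: colon_ideal_def fun_eq_iff)
  ultimately show ?thesis using colon_coeffs_in[OF Kc, of "\<lambda>j. if j = 0 then A else carrier R"] by simp
qed

lemma const_ext_proper: "J \<noteq> carrier R \<Longrightarrow> ideal J R \<Longrightarrow> const_ext J \<noteq> carrier P"
  and with_var_proper: "J \<noteq> carrier R \<Longrightarrow> ideal J R \<Longrightarrow> with_var J \<noteq> carrier P"
proof -
  have "const \<one> \<in> carrier P" "coeff P (const \<one>) 0 = \<one>" by simp_all
  then show "J \<noteq> carrier R \<Longrightarrow> ideal J R \<Longrightarrow> const_ext J \<noteq> carrier P"
    and "J \<noteq> carrier R \<Longrightarrow> ideal J R \<Longrightarrow> with_var J \<noteq> carrier P"
    using R.ideal_eq_carrier_iff coeffs_inD[of "const \<one>" "\<lambda>_. J" 0] coeffs_inD[of "const \<one>" "\<lambda>j. if j = 0 then J else carrier R" 0]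
    by auto
qed

lemma linked_by_const_ext:
  assumes l: "R.linked_by xs K K'"
  shows "P.linked_by (map const xs) (const_ext K) (const_ext K')"
    and "P.adjl {\<zero>\<^bsub>P\<^esub>} (map const xs) = const_ext (R.adjl {\<zero>} xs)"
proof -
  note d = R.linked_byD[OF l]
  have xs: "set xs \<subseteq> carrier R" using d(1) by (rule R.regm_closed)
  show e: "P.adjl {\<zero>\<^bsub>P\<^esub>} (map const xs) = const_ext (R.adjl {\<zero>} xs)"
    using adjl_coeffs_in[of "\<lambda>_. {\<zero>}" xs] R.zeroideal xs const_ext_zero by simp
  have "P.regm {\<zero>\<^bsub>P\<^esub>} (map const xs)"
    using regm_coeffs_in[of "\<lambda>_. {\<zero>}" xs] R.zeroideal d(1) const_ext_zero by simp
  moreover have "set (map const xs) \<subseteq> const_ext K" using d(3,5) const_mem_coeffs_in[of "\<lambda>_. K"] by auto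
  moreover have "const_ext (R.adjl {\<zero>} xs) \<noteq> carrier P"
    using d(2) R.linked_by_ideal_adjl[OF l] by (rule const_ext_proper)
  moreover note A = R.linked_by_ideal_adjl[OF l]
  have "const_ext K = colon_ideal P (const_ext (R.adjl {\<zero>} xs)) (const_ext K')"
    unfolding colon_const_ext[OF A d(4)] by (rule arg_cong[OF R.linked_by_colon(1)[OF l]])
  moreover have "const_ext K' = colon_ideal P (const_ext (R.adjl {\<zero>} xs)) (const_ext K)"
    unfolding colon_const_ext[OF A d(3)] by (rule arg_cong[OF R.linked_by_colon(2)[OF l]])
  ultimately show "P.linked_by (map const xs) (const_ext K) (const_ext K')"
    using ideal_const_ext[OF d(3)] ideal_const_ext[OF d(4)] unfolding P.linked_by_def e by blast
qed

text \<open>Once the variable is divided out, constants act degree by degree: in degree 0 as on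
  \<open>R\<close>, in positive degrees on the zero module, where everything is regular.\<close>

lemma regm_var_const:
  assumes "R.regm {\<zero>} xs"
  shows "P.regm {\<zero>\<^bsub>P\<^esub>} (var # map const xs)"
    and "P.adjl {\<zero>\<^bsub>P\<^esub>} (var # map const xs) = with_var (R.adjl {\<zero>} xs)"
proof -
  have xs: "set xs \<subseteq> carrier R" using assms by (rule R.regm_closed)
  have N: "P.adj {\<zero>\<^bsub>P\<^esub>} var = with_var {\<zero>}" using with_var_eq_adj[OF R.zeroideal] const_ext_zero by simp
  define F where "F = (\<lambda>j::nat. if j = 0 then {\<zero>} else carrier R)"
  have F: "ideal (F j) R" "F j \<subseteq> F (Suc j)" for j using R.zeroideal R.oneideal by (auto simp: F_def)
  have c: "R.adjl (carrier R) xs = carrier R"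
    using R.adjl_incl[OF R.oneideal xs] R.ideal_subset_carrier[OF R.ideal_adjl[OF R.oneideal xs]] by blast
  then have "(\<lambda>j. R.adjl (F j) xs) = (\<lambda>j. if j = 0 then R.adjl {\<zero>} xs else carrier R)"
    by (intro ext) (simp add: F_def if_distrib[of "\<lambda>N. R.adjl N xs"])
  then show "P.adjl {\<zero>\<^bsub>P\<^esub>} (var # map const xs) = with_var (R.adjl {\<zero>} xs)"
    using adjl_coeffs_in[of F xs] F xs N by (simp add: F_def)
  have "R.regm (carrier R) ys" if "set ys \<subseteq> carrier R" for ys
    using that
  proof (induction ys)
    case (Cons y ys)
    have "R.adj (carrier R) y = carrier R" using Cons.prems R.oneideal by (intro R.adj_absorb) auto
    then show ?case using Cons by (simp add: R.reg_def)
  qed simp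
  then have "R.regm (F j) xs" for j using assms xs by (simp add: F_def)
  then have "P.regm (with_var {\<zero>}) (map const xs)" using regm_coeffs_in[of F xs] F by (simp add: F_def)
  then show "P.regm {\<zero>\<^bsub>P\<^esub>} (var # map const xs)"
    using reg_var[OF R.zeroideal] N const_ext_zero by simp
qed

lemma linked_by_with_var:
  assumes l: "R.linked_by xs K K'"
  shows "P.linked_by (var # map const xs) (with_var K) (with_var K')"
proof -
  note d = R.linked_byD[OF l]
  note r = regm_var_const[OF d(1)]
  have xs: "set xs \<subseteq> carrier R" using d(1) by (rule R.regm_closed)
  have "set (var # map const xs) \<subseteq> with_var K" using d(3,5) xs var_mem_with_var by (auto simp: mem_with_var_iff subset_iff)
  moreover have "with_var (R.adjl {\<zero>} xs) \<noteq> carrier P"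
    using d(2) R.linked_by_ideal_adjl[OF l] by (rule with_var_proper)
  moreover note A = R.linked_by_ideal_adjl[OF l]
  have "with_var K = colon_ideal P (with_var (R.adjl {\<zero>} xs)) (with_var K')"
    unfolding colon_with_var[OF A d(4)]
    by (rule arg_cong[of _ _ "\<lambda>J. with_var J", OF R.linked_by_colon(1)[OF l]])
  moreover have "with_var K' = colon_ideal P (with_var (R.adjl {\<zero>} xs)) (with_var K)"
    unfolding colon_with_var[OF A d(3)]
    by (rule arg_cong[of _ _ "\<lambda>J. with_var J", OF R.linked_by_colon(2)[OF l]])
  ultimately show ?thesis
    using r(1) ideal_with_var[OF d(3)] ideal_with_var[OF d(4)] unfolding P.linked_by_def r(2) by blast
qed

lemma primeideal_with_var:
  assumes p: "primeideal p R" shows "primeideal (with_var p) P"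
proof (rule P.prime_idealI)
  show "ideal (with_var p) P" using R.primeideal_ideal[OF p] by (rule ideal_with_var)
  show "\<one>\<^bsub>P\<^esub> \<notin> with_var p" using R.prime_one_notin[OF p] by (auto simp: mem_with_var_iff)
  show "b \<in> with_var p" if "a \<in> carrier P" "b \<in> carrier P" "a \<otimes>\<^bsub>P\<^esub> b \<in> with_var p" "a \<notin> with_var p" for a b
    using that R.prime_mult_iff[OF p] coeff_mult_0[OF that(1,2)] by (auto simp: mem_with_var_iff simp del: coeff_mult)
qed

end

section \<open>Linear factors and roots modulo a prime\<close>

context UP_cring
begin

text \<open>Modulo \<open>p\<close>, evaluation at \<rho> agrees with evaluation at zero.\<close>

lemma eval_mem_iff:
  assumes p: "ideal p R" and \<rho>: "\<rho> \<in> p" and f: "f \<in> carrier P" and nz: "\<one> \<noteq> \<zero>"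
  shows "eval R R id \<rho> f \<in> p \<longleftrightarrow> coeff P f 0 \<in> p"
proof -
  have r: "\<rho> \<in> carrier R" using R.ideal_carrier[OF p \<rho>] .
  interpret e: surjective_hom P R "eval R R id \<rho>" using r by (rule surjective_hom_eval)
  define c where "c = eval R R id \<rho> f"
  have c: "c \<in> carrier R" unfolding c_def using f by simp
  obtain q where q: "q \<in> carrier P" "f = (var \<ominus>\<^bsub>P\<^esub> const \<rho>) \<otimes>\<^bsub>P\<^esub> q \<oplus>\<^bsub>P\<^esub> const c"
    unfolding c_def by (rule remainder[OF f r nz])
  have "coeff P (var \<ominus>\<^bsub>P\<^esub> const \<rho>) 0 = \<ominus> \<rho>" using r by (simp add: coeff_minus R.minus_eq)
  then have f0: "coeff P f 0 = \<ominus> \<rho> \<otimes> coeff P q 0 \<oplus> c"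
    unfolding q(2) using q(1) r c by (simp add: coeff_mult_0 del: coeff_mult)
  have q0: "coeff P q 0 \<in> carrier R" using q(1) by simp
  have "\<ominus> \<rho> \<otimes> coeff P q 0 \<in> p"
    using R.ideal_mult_right[OF p _ q0, of "\<ominus> \<rho>"] additive_subgroup.a_inv_closed[OF ideal.axioms(1)[OF p] \<rho>] by simp
  then show ?thesis
    unfolding c_def[symmetric] f0 using R.ideal_add[OF p] R.ideal_add_cancel[OF p _ _ c] by blast
qed

text \<open>Each coefficient of an annihilated \<open>f\<close> is \<rho> times the next one, so
  vanishing above the degree descends to all coefficients.\<close>

lemma reg_var_minus_const:
  assumes \<rho>: "\<rho> \<in> carrier R" shows "P.reg {\<zero>\<^bsub>P\<^esub>} (var \<ominus>\<^bsub>P\<^esub> const \<rho>)"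
proof (rule P.regI)
  fix f assume f: "f \<in> carrier P" "f \<otimes>\<^bsub>P\<^esub> (var \<ominus>\<^bsub>P\<^esub> const \<rho>) \<in> {\<zero>\<^bsub>P\<^esub>}"
  have step: "coeff P f n = \<rho> \<otimes> coeff P f (Suc n)" for n
  proof -
    have "f \<otimes>\<^bsub>P\<^esub> (var \<ominus>\<^bsub>P\<^esub> const \<rho>) = f \<otimes>\<^bsub>P\<^esub> var \<ominus>\<^bsub>P\<^esub> f \<otimes>\<^bsub>P\<^esub> const \<rho>"
      using f(1) \<rho> by (simp add: P.minus_eq P.r_distr P.r_minus)
    then have "\<zero> = coeff P (f \<otimes>\<^bsub>P\<^esub> var \<ominus>\<^bsub>P\<^esub> f \<otimes>\<^bsub>P\<^esub> const \<rho>) (Suc n)" using f(2) by simp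
    also have "\<dots> = coeff P f n \<ominus> coeff P f (Suc n) \<otimes> \<rho>"
      using f(1) \<rho> coeff_mult_var_Suc[OF f(1), of n] by (simp add: coeff_minus coeff_mult_const del: coeff_mult)
    finally have "coeff P f n \<ominus> coeff P f (Suc n) \<otimes> \<rho> = \<zero>" by (rule sym)
    then have "coeff P f n = coeff P f (Suc n) \<otimes> \<rho>" by (rule R.eq_diffI) (use f(1) \<rho> in simp_all)
    also have "\<dots> = \<rho> \<otimes> coeff P f (Suc n)" by (rule R.m_comm) (use f(1) \<rho> in simp_all)
    finally show ?thesis .
  qed
  have "coeff P f (Suc (deg R f) - k) = \<zero>" for k
  proof (induction k)
    case 0 then show ?case using f(1) deg_aboveD by simp
  next
    case (Suc k)
    show ?case
    proof (cases "k \<le> deg R f")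
      case True
      then have "Suc (deg R f) - k = Suc (Suc (deg R f) - Suc k)" by simp
      then show ?thesis using step[of "Suc (deg R f) - Suc k"] Suc \<rho> by simp
    qed (use Suc in simp)
  qed
  then have "coeff P f n = \<zero>" for n
  proof (cases "n \<le> deg R f")
    case True
    then have "n = Suc (deg R f) - (Suc (deg R f) - n)" by simp
    then show ?thesis using \<open>\<And>k. coeff P f (Suc (deg R f) - k) = \<zero>\<close> by metis
  qed (use f(1) deg_aboveD in simp)
  then show "f \<in> {\<zero>\<^bsub>P\<^esub>}" using f(1) by (auto intro: up_eqI)
qed (use \<rho> in simp)

text \<open>If \<open>c\<close> is a root of \<open>v\<close> modulo \<open>p\<close>, the cofactor
  of X - c is killed by X - c modulo p[X] + (v) without being zero there. So \<open>c\<close> is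
  exceptional for the pencil X - c, and \<open>finite_pencil_exceptions\<close> bounds the
  roots.\<close>

lemma finite_roots_mod_prime:
  assumes N: "noetherian_cring R" and p: "primeideal p R"
    and B: "B \<subseteq> carrier R" "\<And>c d. \<lbrakk>c \<in> B; d \<in> B; c \<noteq> d\<rbrakk> \<Longrightarrow> c \<ominus> d \<in> Units R"
    and v: "v \<in> carrier P" "coeff P v 0 \<notin> p"
  shows "finite {c \<in> B. eval R R id c v \<in> p}"
proof -
  interpret N: noetherian_cring P using N by (rule noetherian_UP)
  note ip = R.primeideal_ideal[OF p]
  have nz: "\<one> \<noteq> \<zero>" using R.prime_one_notin[OF p] R.ideal_zero[OF ip] by metis
  note iM = ideal_const_ext[OF ip]
  define M where "M = P.adj (const_ext p) v"
  have M: "ideal M P" unfolding M_def using iM v(1) by (rule P.ideal_adj)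
  have c0: "const c \<ominus>\<^bsub>P\<^esub> const d \<in> Units P" if "c \<in> B" "d \<in> B" "c \<noteq> d" for c d
  proof -
    have cd: "c \<in> carrier R" "d \<in> carrier R" "c \<ominus> d \<in> Units R" using that B by auto
    have "const (c \<ominus> d) \<in> Units P"
    proof (rule P.unit_factor)
      have "const (c \<ominus> d) \<otimes>\<^bsub>P\<^esub> const (inv (c \<ominus> d)) = \<one>\<^bsub>P\<^esub>"
        using cd(3) by (simp add: R.Units_closed flip: monom_mult)
      then show "const (c \<ominus> d) \<otimes>\<^bsub>P\<^esub> const (inv (c \<ominus> d)) \<in> Units P" by simp
    qed (use cd in \<open>simp_all add: R.Units_closed\<close>)
    then show ?thesis using cd by (simp add: P.minus_eq R.minus_eq)
  qed
  have "finite {c \<in> const ` B. \<exists>u\<in>carrier P. (var \<oplus>\<^bsub>P\<^esub> c \<otimes>\<^bsub>P\<^esub> \<ominus>\<^bsub>P\<^esub> \<one>\<^bsub>P\<^esub>) \<otimes>\<^bsub>P\<^esub> u \<in> M \<and>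
      (\<forall>n::nat. (\<ominus>\<^bsub>P\<^esub> \<one>\<^bsub>P\<^esub>) [^]\<^bsub>P\<^esub> n \<otimes>\<^bsub>P\<^esub> u \<notin> M)}" (is "finite ?X")
  proof (rule N.finite_pencil_exceptions[OF M])
    fix x y assume "x \<in> const ` B" "y \<in> const ` B" and xy: "x \<noteq> y"
    then obtain c d where "x = const c" "y = const d" "c \<in> B" "d \<in> B" by blast
    then show "x \<ominus>\<^bsub>P\<^esub> y \<in> Units P" using c0[of c d] xy by metis
  qed (use B in auto)
  moreover have "const ` {c \<in> B. eval R R id c v \<in> p} \<subseteq> ?X"
  proof safe
    fix c assume c: "c \<in> B" "eval R R id c v \<in> p"
    define d where "d = eval R R id c v"
    have cc: "c \<in> carrier R" using c B by blast
    have dc: "d \<in> carrier R" "d \<in> p" using R.ideal_carrier[OF ip] c(2) by (auto simp: d_def)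
    obtain q where q: "q \<in> carrier P" "v = (var \<ominus>\<^bsub>P\<^esub> const c) \<otimes>\<^bsub>P\<^esub> q \<oplus>\<^bsub>P\<^esub> const d"
      unfolding d_def by (rule remainder[OF v(1) cc nz])
    define x where "x = var \<ominus>\<^bsub>P\<^esub> const c"
    have x: "x \<in> carrier P" using cc by (simp add: x_def)
    have D: "const d \<in> const_ext p" using dc ip by (intro const_mem_coeffs_in) auto
    have Dc: "const d \<in> carrier P" using dc by simp
    have "x \<otimes>\<^bsub>P\<^esub> q = v \<ominus>\<^bsub>P\<^esub> const d"
      unfolding q(2) x_def[symmetric] using x q(1) Dc by algebra
    then have xq: "x \<otimes>\<^bsub>P\<^esub> q \<in> M"
      using P.ideal_minus[OF M P.adj_self[OF iM v(1), folded M_def] P.adj_incl[OF iM v(1) D, folded M_def]] by simp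
    \<comment> \<open>If q = n + rv, cancelling \<open>v\<close> modulo p[X] leaves 1 - (X - c)r in
      p[X]; evaluation at \<open>c\<close> would put \<open>\<one>\<close> into
      \<open>p\<close>.\<close>
    have "q \<notin> M"
    proof
      assume "q \<in> M"
      then obtain n r where nr: "n \<in> const_ext p" "n \<in> carrier P" "r \<in> carrier P" "q = n \<oplus>\<^bsub>P\<^esub> r \<otimes>\<^bsub>P\<^esub> v"
        unfolding M_def using iM by (rule P.adjE)
      have "v = x \<otimes>\<^bsub>P\<^esub> q \<oplus>\<^bsub>P\<^esub> const d" using q(2) unfolding x_def .
      define D y z where "D = const d" and "y = x \<otimes>\<^bsub>P\<^esub> n \<oplus>\<^bsub>P\<^esub> D" and "z = x \<otimes>\<^bsub>P\<^esub> (r \<otimes>\<^bsub>P\<^esub> v)"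
      have Dc': "D \<in> carrier P" using Dc by (simp add: D_def)
      have yz: "y \<in> carrier P" "z \<in> carrier P" using nr(2,3) x Dc' v(1) by (auto simp: y_def z_def)
      have "v = x \<otimes>\<^bsub>P\<^esub> (n \<oplus>\<^bsub>P\<^esub> r \<otimes>\<^bsub>P\<^esub> v) \<oplus>\<^bsub>P\<^esub> D"
        using \<open>v = x \<otimes>\<^bsub>P\<^esub> q \<oplus>\<^bsub>P\<^esub> const d\<close> unfolding nr(4) D_def .
      also have "\<dots> = y \<oplus>\<^bsub>P\<^esub> z" unfolding y_def z_def using nr(2,3) x Dc' v(1) by algebra
      finally have vyz: "v = y \<oplus>\<^bsub>P\<^esub> z" .
      have "v \<otimes>\<^bsub>P\<^esub> (\<one>\<^bsub>P\<^esub> \<ominus>\<^bsub>P\<^esub> x \<otimes>\<^bsub>P\<^esub> r) = v \<ominus>\<^bsub>P\<^esub> z"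
        unfolding z_def using nr(3) x v(1) by algebra
      also have "v \<ominus>\<^bsub>P\<^esub> z = (y \<oplus>\<^bsub>P\<^esub> z) \<ominus>\<^bsub>P\<^esub> z" by (rule arg_cong[OF vyz])
      also have "\<dots> = y" using yz by algebra
      finally have "v \<otimes>\<^bsub>P\<^esub> (\<one>\<^bsub>P\<^esub> \<ominus>\<^bsub>P\<^esub> x \<otimes>\<^bsub>P\<^esub> r) = x \<otimes>\<^bsub>P\<^esub> n \<oplus>\<^bsub>P\<^esub> const d"
        by (simp only: y_def D_def)
      moreover have "x \<otimes>\<^bsub>P\<^esub> n \<oplus>\<^bsub>P\<^esub> const d \<in> const_ext p"
        using P.ideal_add[OF iM P.ideal_mult[OF iM nr(1) x] D] .
      ultimately have e: "(\<one>\<^bsub>P\<^esub> \<ominus>\<^bsub>P\<^esub> x \<otimes>\<^bsub>P\<^esub> r) \<otimes>\<^bsub>P\<^esub> v \<in> const_ext p"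
        using v(1) x nr(3) by (simp add: P.m_comm)
      have "P.reg (const_ext p) v"
      proof (rule reg_coeffs_in)
        show "R.reg p (coeff P v 0)"
          using R.prime_mult_iff[OF p] v by (intro R.regI) auto
      qed (use ip v in auto)
      then have m: "\<one>\<^bsub>P\<^esub> \<ominus>\<^bsub>P\<^esub> x \<otimes>\<^bsub>P\<^esub> r \<in> const_ext p"
        by (rule P.regD[OF _ _ e]) (use x nr(3) in simp)
      interpret e: surjective_hom P R "eval R R id c" using cc by (rule surjective_hom_eval)
      have "const_ext p \<subseteq> {r \<in> carrier P. eval R R id c r \<in> p}"
        using ip cc R.ideal_carrier[OF ip] eval_const_id
        by (intro const_ext_subset P.ideal_closedI)
          (auto simp: R.ideal_zero[OF ip] R.ideal_add[OF ip] R.ideal_mult[OF ip])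
      then have "eval R R id c (\<one>\<^bsub>P\<^esub> \<ominus>\<^bsub>P\<^esub> x \<otimes>\<^bsub>P\<^esub> r) \<in> p" using m by blast
      moreover have "eval R R id c x = \<zero>" unfolding x_def by (rule eval_monom_expr[OF cc])
      ultimately have "\<one> \<in> p" using x nr(3) by (simp add: R.minus_eq)
      then show False using R.prime_one_notin[OF p] by blast
    qed
    then have "\<exists>u\<in>carrier P. (var \<oplus>\<^bsub>P\<^esub> const c \<otimes>\<^bsub>P\<^esub> \<ominus>\<^bsub>P\<^esub> \<one>\<^bsub>P\<^esub>) \<otimes>\<^bsub>P\<^esub> u \<in> M \<and>
      (\<forall>n::nat. (\<ominus>\<^bsub>P\<^esub> \<one>\<^bsub>P\<^esub>) [^]\<^bsub>P\<^esub> n \<otimes>\<^bsub>P\<^esub> u \<notin> M)"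
    proof (intro bexI[of _ q] conjI allI)
      show "(var \<oplus>\<^bsub>P\<^esub> const c \<otimes>\<^bsub>P\<^esub> \<ominus>\<^bsub>P\<^esub> \<one>\<^bsub>P\<^esub>) \<otimes>\<^bsub>P\<^esub> q \<in> M"
        using xq cc by (simp add: x_def P.minus_eq P.r_minus)
      fix n :: nat
      have "(\<ominus>\<^bsub>P\<^esub> \<one>\<^bsub>P\<^esub>) \<in> Units P" by (rule P.unit_factor[of _ "\<ominus>\<^bsub>P\<^esub> \<one>\<^bsub>P\<^esub>"]) (simp_all add: P.l_minus)
      then have "(\<ominus>\<^bsub>P\<^esub> \<one>\<^bsub>P\<^esub>) [^]\<^bsub>P\<^esub> n \<in> Units P" by (rule P.Units_pow_closed)
      then show "(\<ominus>\<^bsub>P\<^esub> \<one>\<^bsub>P\<^esub>) [^]\<^bsub>P\<^esub> n \<otimes>\<^bsub>P\<^esub> q \<notin> M" using P.ideal_unit_mult_iff[OF M _ q(1)] \<open>q \<notin> M\<close> by blast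
    qed (rule q(1))
    then show "\<exists>u\<in>carrier P. (var \<oplus>\<^bsub>P\<^esub> const c \<otimes>\<^bsub>P\<^esub> \<ominus>\<^bsub>P\<^esub> \<one>\<^bsub>P\<^esub>) \<otimes>\<^bsub>P\<^esub> u \<in> M \<and>
      (\<forall>n::nat. (\<ominus>\<^bsub>P\<^esub> \<one>\<^bsub>P\<^esub>) [^]\<^bsub>P\<^esub> n \<otimes>\<^bsub>P\<^esub> u \<notin> M)" .
  qed (rule imageI)
  ultimately have "finite (const ` {c \<in> B. eval R R id c v \<in> p})" by (rule finite_subset[rotated])
  moreover have "inj_on const {c \<in> B. eval R R id c v \<in> p}"
  proof (rule inj_onI)
    fix c d assume "c \<in> {c \<in> B. eval R R id c v \<in> p}" "d \<in> {c \<in> B. eval R R id c v \<in> p}" "const c = const d"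
    then show "c = d" using inj_onD[OF monom_inj[of 0], of c d] B by auto
  qed
  ultimately show ?thesis by (rule finite_imageD)
qed

end

section \<open>Localized polynomial rings\<close>

text \<open>\<open>T\<close> is the localization $A_p$ and \<open>Q\<close> is the localization of $A[X]$ at $(p, X)$.\<close>

locale local_variable = UP_cring A P + N: noetherian_cring A +
    L: localization_hom A T \<iota> + M: localization_hom P Q \<kappa>
  for A (structure) and P (structure) and T (structure) and \<iota> and Q (structure) and \<kappa> +
  fixes p
  assumes p: "primeideal p A"
    and Units_\<iota>: "a \<in> carrier A \<Longrightarrow> \<iota> a \<in> Units T \<longleftrightarrow> a \<notin> p"
    and Units_\<kappa>: "f \<in> carrier P \<Longrightarrow> \<kappa> f \<in> Units Q \<longleftrightarrow> coeff P f 0 \<notin> p"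
begin

sublocale M: noetherian_cring P
  using N.noetherian_cring_axioms by (rule noetherian_UP)

lemma ideal_p: "ideal p A"
  using p by (rule R.primeideal_ideal)

lemma p_carrier: "\<rho> \<in> p \<Longrightarrow> \<rho> \<in> carrier A"
  using ideal_p by (rule R.ideal_carrier)

lemma nontrivial: "\<one> \<noteq> \<zero>"
  using R.prime_one_notin[OF p] R.ideal_zero[OF ideal_p] by metis

sublocale T: local_noetherian T "L.ext p"
  using p N.noetherian_cring_axioms Units_\<iota> by (rule L.local_noetherian_ext)

sublocale Q: local_noetherian Q "M.ext (with_var p)"
  using primeideal_with_var[OF p] M.noetherian_cring_axioms
  by (rule M.local_noetherian_ext) (simp add: Units_\<kappa> mem_with_var_iff)

text \<open>What lets evaluation at \<rho> in \<open>p\<close> extend from the polynomial ring to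
  its localization.\<close>

lemma Units_eval_iff:
  assumes \<rho>: "\<rho> \<in> p" and f: "f \<in> carrier P"
  shows "\<iota> (eval A A id \<rho> f) \<in> Units T \<longleftrightarrow> \<kappa> f \<in> Units Q"
proof -
  interpret e: surjective_hom P A "eval A A id \<rho>" using p_carrier[OF \<rho>] by (rule surjective_hom_eval)
  show ?thesis
    unfolding Units_\<iota>[OF e.hom_closed[OF f]] Units_\<kappa>[OF f] eval_mem_iff[OF ideal_p \<rho> f nontrivial] ..
qed

text \<open>The homomorphism $A[X]_{(p,X)} \to A_p$ with $X \mapsto \rho$, for \<open>\<rho> \<in> p\<close>.\<close>

definition
  "eval_at \<rho> = (SOME \<psi>. ring_hom_cring Q T \<psi> \<and> (\<forall>f\<in>carrier P. \<psi> (\<kappa> f) = \<iota> (eval A A id \<rho> f)))"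

lemma eval_at:
  assumes \<rho>: "\<rho> \<in> p"
  shows "ring_hom_cring Q T (eval_at \<rho>)" and "f \<in> carrier P \<Longrightarrow> eval_at \<rho> (\<kappa> f) = \<iota> (eval A A id \<rho> f)"
proof -
  interpret e: surjective_hom P A "eval A A id \<rho>" using p_carrier[OF \<rho>] by (rule surjective_hom_eval)
  interpret c: fractional_hom P T "\<lambda>f. \<iota> (eval A A id \<rho> f)" "{f \<in> carrier P. eval A A id \<rho> f = \<zero>}"
    using L.localization_hom_axioms by (rule e.fractional_hom_compose)
  obtain \<psi> where "ring_hom_cring Q T \<psi>" "\<And>f. f \<in> carrier P \<Longrightarrow> \<psi> (\<kappa> f) = \<iota> (eval A A id \<rho> f)"
    by (rule M.universal_property[OF c.ring_hom_cring_axioms]) (use Units_eval_iff[OF \<rho>] in auto)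
  then have "\<exists>\<psi>. ring_hom_cring Q T \<psi> \<and> (\<forall>f\<in>carrier P. \<psi> (\<kappa> f) = \<iota> (eval A A id \<rho> f))" by blast
  from someI_ex[OF this] show "ring_hom_cring Q T (eval_at \<rho>)" "f \<in> carrier P \<Longrightarrow> eval_at \<rho> (\<kappa> f) = \<iota> (eval A A id \<rho> f)"
    unfolding eval_at_def by blast+
qed

end

lemma (in ring_hom_cring) hom_Units_mem: assumes u: "u \<in> Units R" shows "h u \<in> Units S"
proof (rule S.unit_factor)
  have "h u \<otimes>\<^bsub>S\<^esub> h (inv\<^bsub>R\<^esub> u) = h (u \<otimes>\<^bsub>R\<^esub> inv\<^bsub>R\<^esub> u)"
    using u by (simp add: R.Units_closed flip: hom_mult)
  also have "\<dots> = \<one>\<^bsub>S\<^esub>" using u by simp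
  finally show "h u \<otimes>\<^bsub>S\<^esub> h (inv\<^bsub>R\<^esub> u) \<in> Units S" by simp
qed (use u in \<open>simp_all add: R.Units_closed\<close>)

lemma (in local_noetherian) local_noetherian_infinite_image:
  assumes h: "ring_hom_cring A R h" and B: "infinite B" "B \<subseteq> carrier A"
    "\<And>c d. \<lbrakk>c \<in> B; d \<in> B; c \<noteq> d\<rbrakk> \<Longrightarrow> c \<ominus>\<^bsub>A\<^esub> d \<in> Units A"
  shows "local_noetherian_infinite R m (h ` B)"
proof -
  interpret h: ring_hom_cring A R h by (rule h)
  have unit: "h c \<ominus> h d \<in> Units R" if "c \<in> B" "d \<in> B" "c \<noteq> d" for c d
    using h.hom_Units_mem[OF B(3)[OF that]] subsetD[OF B(2) that(1)] subsetD[OF B(2) that(2)] by simp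
  have "inj_on h B"
  proof (rule inj_onI, rule ccontr)
    fix c d assume cd: "c \<in> B" "d \<in> B" "h c = h d" "c \<noteq> d"
    then have "\<zero> \<in> Units R" using unit[of c d] B(2) by (auto simp: minus_eq r_neg subset_iff)
    then show False using Units_iff_notin_m[of \<zero>] ideal_zero[OF m_ideal] by simp
  qed
  then have "infinite (h ` B)" using B(1) finite_imageD by blast
  moreover have "x \<ominus> y \<in> Units R" if "x \<in> h ` B" "y \<in> h ` B" "x \<noteq> y" for x y
    using that unit by blast
  ultimately show ?thesis
    using B(2) by (intro local_noetherian_infinite.intro local_noetherian_infinite_axioms.intro local_noetherian_axioms) auto
qed

context UP_cring
begin

lemma ring_hom_const: "ring_hom_cring R P const"
proof -
  have "const \<in> ring_hom R P" by (rule ring_hom_memI) (simp_all flip: monom_mult)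
  then show ?thesis by (simp add: ring_hom_cring_def ring_hom_cring_axioms_def R.is_cring P.is_cring)
qed

end

context local_variable
begin

lemma eval_at_const: assumes "\<rho> \<in> p" "a \<in> carrier A" shows "eval_at \<rho> (\<kappa> (const a)) = \<iota> a"
  using eval_at(2)[OF assms(1), of "const a"] eval_const_id[OF p_carrier[OF assms(1)] assms(2)] assms(2) by simp

lemma eval_at_root: "\<rho> \<in> p \<Longrightarrow> eval_at \<rho> (\<kappa> (var \<ominus>\<^bsub>P\<^esub> const \<rho>)) = \<zero>\<^bsub>T\<^esub>"
  using eval_at(2)[of \<rho> "var \<ominus>\<^bsub>P\<^esub> const \<rho>"] eval_monom_expr[of \<rho>] p_carrier by simp

lemma Units_const: "a \<in> carrier A \<Longrightarrow> \<kappa> (const a) \<in> Units Q \<longleftrightarrow> \<iota> a \<in> Units T"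
  using Units_\<kappa>[of "const a"] Units_\<iota>[of a] by simp

lemma surjective_hom_eval_at: assumes \<rho>: "\<rho> \<in> p" shows "surjective_hom Q T (eval_at \<rho>)"
proof -
  interpret v: ring_hom_cring Q T "eval_at \<rho>" using \<rho> by (rule eval_at)
  have "t \<in> eval_at \<rho> ` carrier Q" if t: "t \<in> carrier T" for t
  proof -
    obtain a w where aw: "a \<in> carrier A" "w \<in> carrier A" "\<iota> w \<in> Units T" "t \<otimes>\<^bsub>T\<^esub> \<iota> w = \<iota> a"
      using L.fraction[OF t] by blast
    define u where "u = \<kappa> (const w)"
    define s where "s = \<kappa> (const a) \<otimes>\<^bsub>Q\<^esub> inv\<^bsub>Q\<^esub> u"
    have u: "u \<in> Units Q" unfolding u_def using Units_const[OF aw(2)] aw(3) by simp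
    have s: "s \<in> carrier Q" unfolding s_def using u aw(1) by simp
    have "s \<otimes>\<^bsub>Q\<^esub> u = \<kappa> (const a)" unfolding s_def using u aw(1) by (simp add: M.S.m_assoc M.S.Units_closed)
    then have "eval_at \<rho> (s \<otimes>\<^bsub>Q\<^esub> u) = \<iota> a" using eval_at_const[OF \<rho> aw(1)] by simp
    moreover have "eval_at \<rho> (s \<otimes>\<^bsub>Q\<^esub> u) = eval_at \<rho> s \<otimes>\<^bsub>T\<^esub> \<iota> w"
      using s u eval_at_const[OF \<rho> aw(2)] by (simp add: M.S.Units_closed flip: u_def)
    ultimately have "eval_at \<rho> s \<otimes>\<^bsub>T\<^esub> \<iota> w = t \<otimes>\<^bsub>T\<^esub> \<iota> w" using aw(4) by simp
    then have "eval_at \<rho> s = t" by (rule L.S.Units_right_cancel[OF _ aw(3) v.hom_closed[OF s] t])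
    then show ?thesis using s by blast
  qed
  then show ?thesis using v.hom_closed
    by (intro surjective_hom.intro surjective_hom_axioms.intro v.ring_hom_cring_axioms) blast
qed

text \<open>Denominators are cleared in \<open>Q\<close> and then in \<open>T\<close>, after which
  the remainder theorem applies to the numerator.\<close>

lemma eval_at_eq_zeroD:
  assumes \<rho>: "\<rho> \<in> p" and s: "s \<in> carrier Q" "eval_at \<rho> s = \<zero>\<^bsub>T\<^esub>"
  shows "\<exists>r\<in>carrier Q. s = \<kappa> (var \<ominus>\<^bsub>P\<^esub> const \<rho>) \<otimes>\<^bsub>Q\<^esub> r"
proof -
  note rc = p_carrier[OF \<rho>]
  interpret v: surjective_hom Q T "eval_at \<rho>" using \<rho> by (rule surjective_hom_eval_at)
  interpret e: surjective_hom P A "eval A A id \<rho>" using rc by (rule surjective_hom_eval)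
  obtain f w where fw: "f \<in> carrier P" "w \<in> carrier P" "\<kappa> w \<in> Units Q" "s \<otimes>\<^bsub>Q\<^esub> \<kappa> w = \<kappa> f"
    using M.fraction[OF s(1)] by blast
  have "\<iota> (eval A A id \<rho> f) = eval_at \<rho> (s \<otimes>\<^bsub>Q\<^esub> \<kappa> w)" unfolding fw(4) using eval_at(2)[OF \<rho> fw(1)] ..
  also have "\<dots> = \<zero>\<^bsub>T\<^esub>" using s fw(2) by simp
  finally obtain u where u: "u \<in> carrier A" "\<iota> u \<in> Units T" "u \<otimes> eval A A id \<rho> f = \<zero>"
    using L.h_eq_zero[of "eval A A id \<rho> f"] fw(1) by auto
  have "eval A A id \<rho> (const u \<otimes>\<^bsub>P\<^esub> f) = \<zero>" using u fw(1) eval_const_id[OF rc u(1)] by simp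
  then obtain q where q: "q \<in> carrier P" "const u \<otimes>\<^bsub>P\<^esub> f = q \<otimes>\<^bsub>P\<^esub> (var \<ominus>\<^bsub>P\<^esub> const \<rho>)"
    using kernel_eval[OF _ rc nontrivial, of "const u \<otimes>\<^bsub>P\<^esub> f"] u(1) fw(1) by auto
  define t where "t = \<kappa> (var \<ominus>\<^bsub>P\<^esub> const \<rho>)"
  have t: "t \<in> carrier Q" unfolding t_def using rc by simp
  define U where "U = \<kappa> (const u) \<otimes>\<^bsub>Q\<^esub> \<kappa> w"
  have U: "U \<in> Units Q" unfolding U_def using Units_const[OF u(1)] u(2) fw(3) by simp
  have "s \<otimes>\<^bsub>Q\<^esub> U = \<kappa> (const u) \<otimes>\<^bsub>Q\<^esub> (s \<otimes>\<^bsub>Q\<^esub> \<kappa> w)"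
    unfolding U_def using s(1) u(1) fw(2) by (simp add: M.S.m_ac)
  also have "\<dots> = \<kappa> (q \<otimes>\<^bsub>P\<^esub> (var \<ominus>\<^bsub>P\<^esub> const \<rho>))"
    unfolding fw(4) q(2)[symmetric] using u(1) fw(1) by simp
  also have "\<dots> = \<kappa> q \<otimes>\<^bsub>Q\<^esub> t" unfolding t_def using q(1) rc by simp
  also have "\<dots> = (t \<otimes>\<^bsub>Q\<^esub> (\<kappa> q \<otimes>\<^bsub>Q\<^esub> inv\<^bsub>Q\<^esub> U)) \<otimes>\<^bsub>Q\<^esub> U"
  proof -
    have "(t \<otimes>\<^bsub>Q\<^esub> (\<kappa> q \<otimes>\<^bsub>Q\<^esub> inv\<^bsub>Q\<^esub> U)) \<otimes>\<^bsub>Q\<^esub> U = (t \<otimes>\<^bsub>Q\<^esub> \<kappa> q) \<otimes>\<^bsub>Q\<^esub> (inv\<^bsub>Q\<^esub> U \<otimes>\<^bsub>Q\<^esub> U)"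
      using t q(1) U by (simp add: M.S.m_assoc M.S.Units_closed)
    then show ?thesis using t q(1) U by (simp add: M.S.m_comm)
  qed
  finally have "s = t \<otimes>\<^bsub>Q\<^esub> (\<kappa> q \<otimes>\<^bsub>Q\<^esub> inv\<^bsub>Q\<^esub> U)"
    by (rule M.S.Units_right_cancel[OF _ U s(1)]) (use t q(1) U in simp)
  moreover have "\<kappa> q \<otimes>\<^bsub>Q\<^esub> inv\<^bsub>Q\<^esub> U \<in> carrier Q" using q(1) U by simp
  ultimately show ?thesis unfolding t_def by blast
qed

lemma kernel_eval_at:
  assumes \<rho>: "\<rho> \<in> p"
  shows "{s \<in> carrier Q. eval_at \<rho> s = \<zero>\<^bsub>T\<^esub>} = M.S.adj {\<zero>\<^bsub>Q\<^esub>} (\<kappa> (var \<ominus>\<^bsub>P\<^esub> const \<rho>))"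
proof -
  interpret v: surjective_hom Q T "eval_at \<rho>" using \<rho> by (rule surjective_hom_eval_at)
  define t where "t = \<kappa> (var \<ominus>\<^bsub>P\<^esub> const \<rho>)"
  have t: "t \<in> carrier Q" unfolding t_def using p_carrier[OF \<rho>] by simp
  have "eval_at \<rho> t = \<zero>\<^bsub>T\<^esub>" unfolding t_def using \<rho> by (rule eval_at_root)
  moreover have "\<exists>r. s = \<zero>\<^bsub>Q\<^esub> \<oplus>\<^bsub>Q\<^esub> r \<otimes>\<^bsub>Q\<^esub> t \<and> r \<in> carrier Q" if s: "s \<in> carrier Q" "eval_at \<rho> s = \<zero>\<^bsub>T\<^esub>" for s
    proof -
    obtain r where "r \<in> carrier Q" "s = t \<otimes>\<^bsub>Q\<^esub> r" using eval_at_eq_zeroD[OF \<rho> s] unfolding t_def by blast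
    then show ?thesis using t M.S.m_comm[of t r] by (intro exI[of _ r]) simp
  qed
  ultimately show ?thesis unfolding t_def[symmetric] M.S.adj_def using t by auto
qed

lemma lifting_eval_at:
  assumes \<rho>: "\<rho> \<in> p" and T: "local_noetherian_infinite T m B"
  shows "lifting Q (M.ext (with_var p)) T m B (eval_at \<rho>) (\<kappa> (var \<ominus>\<^bsub>P\<^esub> const \<rho>))"
proof -
  have "ideal (with_var p) P" using ideal_p by (rule ideal_with_var)
  moreover have "var \<ominus>\<^bsub>P\<^esub> const \<rho> \<in> with_var p"
    using additive_subgroup.a_inv_closed[OF ideal.axioms(1)[OF ideal_p] \<rho>] p_carrier[OF \<rho>]
    by (simp add: mem_with_var_iff coeff_minus R.minus_eq)
  ultimately have n: "\<kappa> (var \<ominus>\<^bsub>P\<^esub> const \<rho>) \<in> M.ext (with_var p)"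
    using p_carrier[OF \<rho>] by (intro M.h_mem_ext) simp_all
  have r: "M.S.reg {\<zero>\<^bsub>Q\<^esub>} (\<kappa> (var \<ominus>\<^bsub>P\<^esub> const \<rho>))"
    using M.ext_reg[OF P.zeroideal reg_var_minus_const[OF p_carrier[OF \<rho>]]] unfolding M.ext_zero .
  show ?thesis
    by (intro lifting.intro lifting_axioms.intro Q.local_noetherian_axioms T surjective_hom_eval_at[OF \<rho>]
        n r eval_at_root[OF \<rho>] eval_at_eq_zeroD[OF \<rho>])
qed

lemma eval_at_ext:
  assumes \<rho>: "\<rho> \<in> p" and F: "ideal F A"
  shows "eval_at \<rho> ` M.ext (const_ext F) = L.ext F"
proof
  interpret v: surjective_hom Q T "eval_at \<rho>" using \<rho> by (rule surjective_hom_eval_at)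
  interpret e: surjective_hom P A "eval A A id \<rho>" using p_carrier[OF \<rho>] by (rule surjective_hom_eval)
  note iF = ideal_const_ext[OF F]
  note iE = M.ideal_ext[OF iF]
  have "const_ext F \<subseteq> {f \<in> carrier P. eval A A id \<rho> f \<in> F}"
    using R.ideal_subset_carrier[OF F] eval_const_id[OF p_carrier[OF \<rho>]]
    by (intro const_ext_subset P.ideal_closedI)
      (auto simp: R.ideal_zero[OF F] R.ideal_add[OF F] R.ideal_mult[OF F] subset_iff)
  then have sub: "\<iota> (eval A A id \<rho> f) \<in> L.ext F" "f \<in> carrier P" if "f \<in> const_ext F" for f
    using that L.h_mem_ext by auto
  note iL = L.ideal_ext[OF F]
  have "ideal {s \<in> carrier Q. eval_at \<rho> s \<in> L.ext F} Q"
    by (rule M.S.ideal_closedI) (auto simp: L.S.ideal_zero[OF iL] L.S.ideal_add[OF iL] L.S.ideal_mult[OF iL])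
  then have "M.ext (const_ext F) \<subseteq> {s \<in> carrier Q. eval_at \<rho> s \<in> L.ext F}"
    by (rule M.ext_minimal) (use sub eval_at(2)[OF \<rho>] in simp)
  then show "eval_at \<rho> ` M.ext (const_ext F) \<subseteq> L.ext F" by blast
  show "L.ext F \<subseteq> eval_at \<rho> ` M.ext (const_ext F)"
  proof (rule L.ext_minimal[OF v.ideal_image[OF iE]])
    fix f assume f: "f \<in> F"
    then have fc: "f \<in> carrier A" using F by (rule R.ideal_carrier[rotated])
    have "const f \<in> const_ext F" using f F by (intro const_mem_coeffs_in)
    then have "\<kappa> (const f) \<in> M.ext (const_ext F)" using fc by (intro M.h_mem_ext) auto
    then show "\<iota> f \<in> eval_at \<rho> ` M.ext (const_ext F)" using eval_at_const[OF \<rho> fc] by (metis imageI)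
  qed
qed

lemma reg_\<kappa>_var: "ideal F A \<Longrightarrow> M.S.reg (M.ext (const_ext F)) (\<kappa> var)"
  by (intro M.ext_reg reg_var ideal_const_ext)

text \<open>Unlike \<open>eval_at\<close>, evaluation at an arbitrary \<beta> starts from the
  polynomial ring: for \<beta> outside \<open>p\<close>, denominators of \<open>Q\<close> may go to
  nonunits.\<close>

lemma fractional_hom_eval:
  assumes \<beta>: "\<beta> \<in> carrier A"
  shows "fractional_hom P T (\<lambda>f. \<iota> (eval A A id \<beta> f)) {r \<otimes>\<^bsub>P\<^esub> (var \<ominus>\<^bsub>P\<^esub> const \<beta>) | r. r \<in> carrier P}"
proof -
  interpret e: surjective_hom P A "eval A A id \<beta>" using \<beta> by (rule surjective_hom_eval)
  have "{f \<in> carrier P. eval A A id \<beta> f = \<zero>} = {f \<in> carrier P. \<exists>q\<in>carrier P. f = q \<otimes>\<^bsub>P\<^esub> (var \<ominus>\<^bsub>P\<^esub> const \<beta>)}"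
    using kernel_eval[OF _ \<beta> nontrivial] by blast
  also have "\<dots> = {r \<otimes>\<^bsub>P\<^esub> (var \<ominus>\<^bsub>P\<^esub> const \<beta>) | r. r \<in> carrier P}" using \<beta> by auto
  finally have "{r \<otimes>\<^bsub>P\<^esub> (var \<ominus>\<^bsub>P\<^esub> const \<beta>) | r. r \<in> carrier P} = {f \<in> carrier P. eval A A id \<beta> f = \<zero>}" ..
  then show ?thesis using e.fractional_hom_compose[OF L.localization_hom_axioms] by simp
qed

lemma ext_eval:
  assumes \<beta>: "\<beta> \<in> carrier A" and F: "ideal F A"
  shows "fractional_hom.ext P T (\<lambda>f. \<iota> (eval A A id \<beta> f)) (const_ext F) = L.ext F"
proof -
  interpret c: fractional_hom P T "\<lambda>f. \<iota> (eval A A id \<beta> f)" "{r \<otimes>\<^bsub>P\<^esub> (var \<ominus>\<^bsub>P\<^esub> const \<beta>) | r. r \<in> carrier P}"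
    using \<beta> by (rule fractional_hom_eval)
  interpret e: surjective_hom P A "eval A A id \<beta>" using \<beta> by (rule surjective_hom_eval)
  note iF = ideal_const_ext[OF F]
  have "const_ext F \<subseteq> {f \<in> carrier P. eval A A id \<beta> f \<in> F}"
    using R.ideal_subset_carrier[OF F] eval_const_id[OF \<beta>]
    by (intro const_ext_subset P.ideal_closedI)
      (auto simp: R.ideal_zero[OF F] R.ideal_add[OF F] R.ideal_mult[OF F] subset_iff)
  then have "c.ext (const_ext F) \<subseteq> L.ext F"
    by (intro c.ext_minimal L.ideal_ext F L.h_mem_ext) auto
  moreover have "\<iota> f \<in> c.ext (const_ext F)" if f: "f \<in> F" for f
  proof -
    have fc: "f \<in> carrier A" using F f by (rule R.ideal_carrier)
    have "const f \<in> const_ext F" using f F by (intro const_mem_coeffs_in)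
    then show ?thesis using c.h_mem_ext[of "const f" "const_ext F"] fc eval_const_id[OF \<beta> fc] by simp
  qed
  then have "L.ext F \<subseteq> c.ext (const_ext F)" by (intro L.ext_minimal c.ideal_ext iF)
  ultimately show ?thesis by blast
qed

text \<open>The exceptional points of a denominator are its roots modulo \<open>p\<close>. Points
  are stored as constant polynomials, from which \<open>coeff P b 0\<close> recovers the element of
  \<open>A\<close>.\<close>

lemma specialization_eval:
  assumes B: "infinite B" "B \<subseteq> carrier A" "\<And>c d. \<lbrakk>c \<in> B; d \<in> B; c \<noteq> d\<rbrakk> \<Longrightarrow> c \<ominus> d \<in> Units A"
  shows "specialization P Q \<kappa> T (\<lambda>b f. \<iota> (eval A A id (coeff P b 0) f)) var (const ` B)"
proof (intro specialization.intro specialization_axioms.intro M.noetherian_cring_axioms M.fractional_hom_axioms L.S.is_cring)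
  have inj: "inj_on const (carrier A)" by (rule monom_inj)
  then show "infinite (const ` B)" using B(1,2) by (metis finite_imageD inj_on_subset)
  show "var \<in> carrier P" "const ` B \<subseteq> carrier P" using B(2) by auto
  interpret k: ring_hom_cring A P const by (rule ring_hom_const)
  show "c \<ominus>\<^bsub>P\<^esub> d \<in> Units P" if cd: "c \<in> const ` B" "d \<in> const ` B" "c \<noteq> d" for c d
  proof -
    obtain a b where ab: "c = const a" "d = const b" "a \<in> B" "b \<in> B" using cd by blast
    then have "const (a \<ominus> b) \<in> Units P" using k.hom_Units_mem[OF B(3)[of a b]] cd(3) by auto
    then show ?thesis using ab subsetD[OF B(2) ab(3)] subsetD[OF B(2) ab(4)] by simp
  qed
  show "fractional_hom P T (\<lambda>f. \<iota> (eval A A id (coeff P b 0) f)) {r \<otimes>\<^bsub>P\<^esub> (var \<ominus>\<^bsub>P\<^esub> b) | r. r \<in> carrier P}"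
    if b: "b \<in> const ` B" for b
  proof -
    obtain a where "b = const a" "a \<in> carrier A" using b B(2) by blast
    then show ?thesis using fractional_hom_eval[of a] by simp
  qed
  show "finite {b \<in> const ` B. \<iota> (eval A A id (coeff P b 0) w) \<notin> Units T}"
    if w: "w \<in> carrier P" "\<kappa> w \<in> Units Q" for w
  proof -
    have "finite {c \<in> B. eval A A id c w \<in> p}"
      using w Units_\<kappa> by (intro finite_roots_mod_prime[OF N.noetherian_cring_axioms p B(2,3)]) auto
    moreover have "{b \<in> const ` B. \<iota> (eval A A id (coeff P b 0) w) \<notin> Units T} \<subseteq> const ` {c \<in> B. eval A A id c w \<in> p}"
    proof safe
      fix c assume c: "c \<in> B" "\<iota> (eval A A id (coeff P (const c) 0) w) \<notin> Units T"
      then have cc: "c \<in> carrier A" using B(2) by blast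
      interpret e: surjective_hom P A "eval A A id c" using cc by (rule surjective_hom_eval)
      show "const c \<in> const ` {c \<in> B. eval A A id c w \<in> p}"
        using c Units_\<iota>[OF e.hom_closed[OF w(1)]] cc by auto
    qed
    ultimately show ?thesis using finite_surj by blast
  qed
qed

end

section \<open>Links over the localized polynomial ring in two variables\<close>

text \<open>\<open>T\<close> is $R[X]_{(m,X)}$ and \<open>S\<close> is $R[X,Y]_{(m,X,Y)}$.\<close>

locale two_local_variables = local_noetherian_infinite R m B +
    X: local_variable R P\<^sub>1 R id T \<iota> m +
    Y: local_variable P\<^sub>1 P\<^sub>2 T \<iota> S \<kappa> "{f \<in> carrier P\<^sub>1. coeff P\<^sub>1 f 0 \<in> m}"
  for R (structure) and m and B and P\<^sub>1 (structure) and P\<^sub>2 (structure)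
    and T (structure) and \<iota> and S (structure) and \<kappa>
begin

text \<open>The ideal $(J, X - \rho)$ of \<open>T\<close>.\<close>

definition fiber where
  "fiber \<rho> J = {z \<in> carrier T. X.eval_at \<rho> z \<in> J}"

abbreviation line where
  "line \<rho> \<equiv> X.var \<ominus>\<^bsub>P\<^sub>1\<^esub> X.const \<rho>"

text \<open>Presents the fiber as the extension of an ideal of the polynomial ring; in this form it
  can be extended to \<open>S\<close> and specialized again.\<close>

lemma fiber_eq_ext:
  assumes \<rho>: "\<rho> \<in> m" and J: "ideal J R"
  shows "ideal (fiber \<rho> J) T" and "ideal {f \<in> carrier P\<^sub>1. eval R R id \<rho> f \<in> J} P\<^sub>1"
    and "X.M.ext {f \<in> carrier P\<^sub>1. eval R R id \<rho> f \<in> J} = fiber \<rho> J"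
proof -
  interpret v: surjective_hom T R "X.eval_at \<rho>" using \<rho> by (rule X.surjective_hom_eval_at)
  show F: "ideal (fiber \<rho> J) T"
    unfolding fiber_def by (rule X.M.S.ideal_closedI) (auto simp: ideal_zero[OF J] ideal_add[OF J] ideal_mult[OF J])
  have c: "X.M.contr (fiber \<rho> J) = {f \<in> carrier P\<^sub>1. eval R R id \<rho> f \<in> J}"
    using X.eval_at(2)[OF \<rho>] by (auto simp: X.M.contr_def fiber_def)
  show "ideal {f \<in> carrier P\<^sub>1. eval R R id \<rho> f \<in> J} P\<^sub>1" using X.M.ideal_contr[OF F] c by simp
  show "X.M.ext {f \<in> carrier P\<^sub>1. eval R R id \<rho> f \<in> J} = fiber \<rho> J" using X.M.ext_contr[OF F] c by simp
qed

lemma eval_line: "\<lbrakk>\<rho> \<in> carrier R; \<sigma> \<in> carrier R\<rbrakk> \<Longrightarrow> eval R R id \<rho> (line \<sigma>) = \<rho> \<ominus> \<sigma>"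
proof -
  assume r: "\<rho> \<in> carrier R" "\<sigma> \<in> carrier R"
  interpret e: surjective_hom P\<^sub>1 R "eval R R id \<rho>" using r(1) by (rule X.surjective_hom_eval)
  show ?thesis using r X.eval_var[OF r(1)] X.eval_const_id[OF r] by simp
qed

text \<open>Moving the point of evaluation from \<rho> to \<sigma> changes values by multiples of
  \<sigma> - \<rho>.\<close>

lemma fiber_subset:
  assumes \<rho>: "\<rho> \<in> m" and \<sigma>: "\<sigma> \<in> m" and J: "ideal J R" and "\<sigma> \<ominus> \<rho> \<in> J"
  shows "fiber \<rho> J \<subseteq> fiber \<sigma> J"
proof -
  note rc = m_carrier[OF \<rho>] m_carrier[OF \<sigma>]
  interpret e: surjective_hom P\<^sub>1 R "eval R R id \<rho>" using rc(1) by (rule X.surjective_hom_eval)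
  interpret s: surjective_hom P\<^sub>1 R "eval R R id \<sigma>" using rc(2) by (rule X.surjective_hom_eval)
  have "eval R R id \<sigma> f \<in> J" if f: "f \<in> carrier P\<^sub>1" "eval R R id \<rho> f \<in> J" for f
  proof -
    define c where "c = eval R R id \<rho> f"
    have c: "c \<in> carrier R" "c \<in> J" using f by (auto simp: c_def)
    obtain q where q: "q \<in> carrier P\<^sub>1" "f = line \<rho> \<otimes>\<^bsub>P\<^sub>1\<^esub> q \<oplus>\<^bsub>P\<^sub>1\<^esub> X.const c"
      unfolding c_def by (rule X.remainder[OF f(1) rc(1) X.nontrivial])
    have l: "line \<rho> \<in> carrier P\<^sub>1" using rc by simp
    have "eval R R id \<sigma> f = eval R R id \<sigma> (line \<rho>) \<otimes> eval R R id \<sigma> q \<oplus> c"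
      unfolding q(2) using q(1) l c(1) X.eval_const_id[OF rc(2) c(1)]
      by (simp only: s.hom_mult s.hom_add X.P.m_closed X.monom_closed)
    also have "\<dots> = (\<sigma> \<ominus> \<rho>) \<otimes> eval R R id \<sigma> q \<oplus> c" using eval_line[OF rc(2,1)] by simp
    also have "\<dots> \<in> J" using assms(4) c q(1) by (simp add: ideal_add[OF J] ideal_mult_right[OF J])
    finally show ?thesis .
  qed
  then have "X.M.ext {f \<in> carrier P\<^sub>1. eval R R id \<rho> f \<in> J} \<subseteq> X.M.ext {f \<in> carrier P\<^sub>1. eval R R id \<sigma> f \<in> J}"
    by (intro X.M.ext_mono) blast
  then show ?thesis using fiber_eq_ext(3) \<rho> \<sigma> J by simp
qed

lemma image_fiber:
  assumes \<rho>: "\<rho> \<in> m" and J: "ideal J R" shows "X.eval_at \<rho> ` fiber \<rho> J = J"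
proof -
  interpret v: surjective_hom T R "X.eval_at \<rho>" using \<rho> by (rule X.surjective_hom_eval_at)
  show ?thesis
  proof
    show "J \<subseteq> X.eval_at \<rho> ` fiber \<rho> J"
    proof
      fix j assume j: "j \<in> J"
      then have "j \<in> X.eval_at \<rho> ` carrier T" using ideal_carrier[OF J] v.surj by simp
      then show "j \<in> X.eval_at \<rho> ` fiber \<rho> J" using j by (auto simp: fiber_def)
    qed
  qed (auto simp: fiber_def)
qed

lemma fiber_image:
  assumes \<rho>: "\<rho> \<in> m" and K: "ideal K T" and x: "\<iota> (line \<rho>) \<in> K"
  shows "K = fiber \<rho> (X.eval_at \<rho> ` K)"
proof
  interpret v: surjective_hom T R "X.eval_at \<rho>" using \<rho> by (rule X.surjective_hom_eval_at)
  show "K \<subseteq> fiber \<rho> (X.eval_at \<rho> ` K)" using X.M.S.ideal_carrier[OF K] by (auto simp: fiber_def)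
  show "fiber \<rho> (X.eval_at \<rho> ` K) \<subseteq> K"
  proof
    fix z assume "z \<in> fiber \<rho> (X.eval_at \<rho> ` K)"
    then obtain k where k: "z \<in> carrier T" "k \<in> K" "X.eval_at \<rho> z = X.eval_at \<rho> k" by (auto simp: fiber_def)
    have kc: "k \<in> carrier T" using K k(2) by (rule X.M.S.ideal_carrier)
    have "X.eval_at \<rho> (z \<ominus>\<^bsub>T\<^esub> k) = \<zero>" using k kc by (simp add: minus_eq r_neg)
    then have "z \<ominus>\<^bsub>T\<^esub> k \<in> {s \<in> carrier T. X.eval_at \<rho> s = \<zero>}" using k(1) kc by simp
    then have "z \<ominus>\<^bsub>T\<^esub> k \<in> X.M.S.adj {\<zero>\<^bsub>T\<^esub>} (\<iota> (line \<rho>))" unfolding X.kernel_eval_at[OF \<rho>] .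
    then have "z \<ominus>\<^bsub>T\<^esub> k \<in> K" using X.M.S.adj_subset[OF K _ x] X.M.S.ideal_zero[OF K] by blast
    then show "z \<in> K" using X.M.S.ideal_diff_iff[OF K _ k(1) kc] k(2) by simp
  qed
qed

text \<open>Two elements of \<open>B\<close> in \<open>m\<close> would differ by a nonunit, so at
  most one is lost.\<close>

lemma infinite_units_B: "infinite {c \<in> B. c \<notin> m}"
proof -
  have "c = d" if "c \<in> B" "d \<in> B" "c \<in> m" "d \<in> m" for c d
  proof (rule ccontr)
    assume "c \<noteq> d"
    then have "c \<ominus> d \<in> Units R" "c \<ominus> d \<in> m" using B_diff that ideal_minus[OF m_ideal] by auto
    then show False using Units_iff_notin_m[of "c \<ominus> d"] that B_carrier by auto
  qed
  then have "{c \<in> B. c \<in> m} \<subseteq> {SOME c. c \<in> B \<and> c \<in> m}"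
    using someI_ex[of "\<lambda>c. c \<in> B \<and> c \<in> m"] by blast
  then have "finite {c \<in> B. c \<in> m}" by (rule finite_subset) simp
  moreover have "B = {c \<in> B. c \<in> m} \<union> {c \<in> B. c \<notin> m}" by blast
  ultimately show ?thesis using infinite_B by (metis finite_UnI)
qed

text \<open>The link is moved until its sequence starts with an associate of the equation of a line.
  The number of remaining links is unchanged; \<rho> becomes \<sigma> because the deformed first
  element cuts out another line, with \<sigma> congruent to \<rho> modulo \<open>J\<close>, so that
  both lines give the same fiber of \<open>J\<close>.\<close>

lemma deform_link:
  assumes \<rho>: "\<rho> \<in> m" and J: "ideal J R" and proper: "J \<noteq> carrier R"
    and link: "X.M.S.linked_by xs (fiber \<rho> J) K'" and K': "X.M.S.linked_to_unit n K'"
  shows "\<exists>\<sigma>\<in>m. \<exists>J' ys. linked_by ys J J' \<and> X.M.S.linked_to_unit n (fiber \<sigma> J')"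
proof -
  note rc = m_carrier[OF \<rho>]
  define K where "K = fiber \<rho> J"
  define F where "F = {f \<in> carrier P\<^sub>1. eval R R id \<rho> f \<in> J}"
  note fib = fiber_eq_ext[OF \<rho> J, folded F_def K_def]
  note iF = fib(2)
  have Jm: "J \<subseteq> m" using J proper by (rule proper_ideal_subset_m)
  interpret e: surjective_hom P\<^sub>1 R "eval R R id \<rho>" using rc by (rule X.surjective_hom_eval)
  have Kproper: "K \<noteq> carrier T"
    using image_fiber[OF \<rho> J] proper surjective_hom.surj[OF X.surjective_hom_eval_at[OF \<rho>]] unfolding K_def by metis
  have x: "line \<rho> \<in> carrier P\<^sub>1" using rc by simp
  have xF: "line \<rho> \<in> F" using x eval_line[OF rc rc] ideal_zero[OF J] rc by (simp add: F_def minus_eq r_neg)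
  obtain fs where fs: "set fs \<subseteq> carrier P\<^sub>1" "X.M.S.linked_by (map \<iota> fs) K K'"
    by (rule X.M.linked_by_clear_denominators[OF link, folded K_def])
  note l = X.M.S.linked_byD[OF fs(2)]
  \<comment> \<open>A link over the zero ideal would make \<open>K'\<close> zero, since
    \<open>K\<close> contains the regular element X - \<rho>, and hence \<open>K\<close> the unit
    ideal.\<close>
  have "fs \<noteq> []"
  proof
    assume "fs = []"
    have r: "X.M.S.reg {\<zero>\<^bsub>T\<^esub>} (\<iota> (line \<rho>))"
      using X.M.ext_reg[OF X.P.zeroideal X.reg_var_minus_const[OF rc]] unfolding X.M.ext_zero .
    have "\<iota> (line \<rho>) \<in> K" using X.M.h_mem_ext[OF xF x] fib(3) by simp
    then have "K' \<subseteq> {\<zero>\<^bsub>T\<^esub>}"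
      using X.M.S.linked_by_colon(2)[OF fs(2)] X.M.S.regD[OF r] \<open>fs = []\<close>
      by (auto simp: colon_ideal_def)
    then have "K = carrier T"
      using X.M.S.linked_by_colon(1)[OF fs(2)] X.M.S.colon_subset[OF X.M.S.zeroideal] \<open>fs = []\<close> by (metis map_is_Nil_conv X.M.S.adjl_Nil)
    then show False using Kproper by blast
  qed
  then obtain g gs where fs_eq: "fs = g # gs" by (cases fs) auto
  have gc: "g \<in> carrier P\<^sub>1" "set gs \<subseteq> carrier P\<^sub>1" using fs(1) by (auto simp: fs_eq)
  have mem_F: "f \<in> F" if "f \<in> carrier P\<^sub>1" "\<iota> f \<in> K" for f
    using that X.eval_at(2)[OF \<rho>] by (simp add: F_def K_def fiber_def)
  have gF: "g \<in> F" "set gs \<subseteq> F" using l(5) gc by (auto simp: fs_eq intro!: mem_F)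
  define j where "j = eval R R id \<rho> g"
  have j: "j \<in> J" "j \<in> carrier R" using gF(1) ideal_carrier[OF J] by (auto simp: F_def j_def)
  obtain \<zeta> where \<zeta>: "\<zeta> \<in> carrier P\<^sub>1" "g = line \<rho> \<otimes>\<^bsub>P\<^sub>1\<^esub> \<zeta> \<oplus>\<^bsub>P\<^sub>1\<^esub> X.const j"
    unfolding j_def by (rule X.remainder[OF gc(1) rc X.nontrivial])

  text \<open>The first element \<open>g\<close> of the sequence is replaced by \<open>g + Y (X - \<rho>)\<close> when the
    link is lifted to \<open>S\<close>.\<close>
  have T: "local_noetherian_infinite T (X.M.ext (X.with_var m)) (\<iota> ` X.const ` B)"
  proof -
    interpret k: ring_hom_cring R P\<^sub>1 X.const by (rule X.ring_hom_const)
    have "(\<lambda>c. \<iota> (X.const c)) \<in> ring_hom R T" by (rule ring_hom_memI) simp_all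
    then have "ring_hom_cring R T (\<lambda>c. \<iota> (X.const c))"
      by (simp add: ring_hom_cring_def ring_hom_cring_axioms_def is_cring X.M.S.is_cring)
    from X.Q.local_noetherian_infinite_image[OF this infinite_B B_carrier B_diff]
    show ?thesis by (simp add: image_image)
  qed
  have z: "\<zero>\<^bsub>P\<^sub>1\<^esub> \<in> {f \<in> carrier P\<^sub>1. coeff P\<^sub>1 f 0 \<in> m}" using ideal_zero[OF m_ideal] by simp
  have var0: "Y.var \<ominus>\<^bsub>P\<^sub>2\<^esub> Y.const \<zero>\<^bsub>P\<^sub>1\<^esub> = Y.var" by (simp add: Y.P.minus_eq)
  interpret lift: lifting S "Y.M.ext (Y.with_var {f \<in> carrier P\<^sub>1. coeff P\<^sub>1 f 0 \<in> m})" T "X.M.ext (X.with_var m)"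
    "\<iota> ` X.const ` B" "Y.eval_at \<zero>\<^bsub>P\<^sub>1\<^esub>" "\<kappa> Y.var"
    using Y.lifting_eval_at[OF z T] unfolding var0 .
  define E where "E = Y.M.ext (Y.const_ext F)"
  have iE: "ideal E S" unfolding E_def using iF by (intro Y.M.ideal_ext Y.ideal_const_ext)
  have evE: "Y.eval_at \<zero>\<^bsub>P\<^sub>1\<^esub> ` E = K" unfolding E_def using Y.eval_at_ext[OF z iF] fib(3) by simp
  have regE: "Y.M.S.reg E (\<kappa> Y.var)" unfolding E_def using iF by (rule Y.reg_\<kappa>_var)
  have constE: "\<kappa> (Y.const f) \<in> E" if "f \<in> F" for f
    unfolding E_def using that iF X.P.ideal_carrier[OF iF that]
    by (intro Y.M.h_mem_ext Y.const_mem_coeffs_in) auto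
  define G where "G = Y.const g \<oplus>\<^bsub>P\<^sub>2\<^esub> Y.var \<otimes>\<^bsub>P\<^sub>2\<^esub> Y.const (line \<rho>)"
  define hs where "hs = G # map Y.const gs"
  have Gc: "G \<in> carrier P\<^sub>2" unfolding G_def using gc(1) x by simp
  have hc: "set hs \<subseteq> carrier P\<^sub>2" unfolding hs_def using Gc gc(2) by auto
  have "\<kappa> G \<in> E"
  proof -
    have "\<kappa> G = \<kappa> (Y.const g) \<oplus>\<^bsub>S\<^esub> \<kappa> Y.var \<otimes>\<^bsub>S\<^esub> \<kappa> (Y.const (line \<rho>))"
      unfolding G_def using gc(1) x by (simp only: Y.M.hom_add Y.M.hom_mult Y.P.m_closed Y.monom_closed X.P.one_closed)
    moreover have "\<kappa> Y.var \<in> carrier S" by simp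
    ultimately show ?thesis using Y.M.S.ideal_add[OF iE constE[OF gF(1)] Y.M.S.ideal_mult[OF iE constE[OF xF]]] by simp
  qed
  then have hsE: "set (map \<kappa> hs) \<subseteq> E" using constE gF(2) by (auto simp: hs_def)
  have eG: "eval P\<^sub>1 P\<^sub>1 id \<beta> G = g \<oplus>\<^bsub>P\<^sub>1\<^esub> \<beta> \<otimes>\<^bsub>P\<^sub>1\<^esub> line \<rho>" if b: "\<beta> \<in> carrier P\<^sub>1" for \<beta>
  proof -
    interpret d: surjective_hom P\<^sub>2 P\<^sub>1 "eval P\<^sub>1 P\<^sub>1 id \<beta>" using b by (rule Y.surjective_hom_eval)
    show ?thesis unfolding G_def
      using gc(1) x Y.eval_var[OF b] Y.eval_const_id[OF b gc(1)] Y.eval_const_id[OF b x]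
      by (simp only: d.hom_add d.hom_mult Y.P.m_closed Y.monom_closed X.P.one_closed)
  qed
  \<comment> \<open>At Y = 0 the deformed sequence becomes the given one, which together with
    membership in \<open>E\<close> is what \<open>lift_link\<close> asks of it.\<close>
  have "eval P\<^sub>1 P\<^sub>1 id \<zero>\<^bsub>P\<^sub>1\<^esub> G = g" using eG[OF X.P.zero_closed] gc(1) x by simp
  then have map_ev: "map (Y.eval_at \<zero>\<^bsub>P\<^sub>1\<^esub>) (map \<kappa> hs) = map \<iota> fs"
    using Y.eval_at(2)[OF z Gc] Y.eval_at_const[OF z] gc(2) by (auto simp: hs_def fs_eq)
  obtain K'' where K'': "Y.M.S.linked_by (map \<kappa> hs) E K''" "Y.M.S.reg K'' (\<kappa> Y.var)" "Y.eval_at \<zero>\<^bsub>P\<^sub>1\<^esub> ` K'' = K'"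
    by (rule lift.lift_link[of "map \<kappa> hs" E, unfolded map_ev evE, OF fs(2) K' Kproper iE regE hsE])
  have unit: "Y.M.S.linked_to_unit n K''"
    by (rule lift.lift_linked_to_unit[OF K' Y.M.S.linked_byD(4)[OF K''(1)] K''(2,3)])

  text \<open>At \<open>Y = c - \<zeta>\<close> the deformed element becomes \<open>c (X - \<rho>) + j\<close>, a unit multiple of
    some \<open>X - \<sigma>\<close>.\<close>
  define U where "U = {c \<in> B. c \<notin> m}"
  define B' where "B' = (\<lambda>c. X.const c \<ominus>\<^bsub>P\<^sub>1\<^esub> \<zeta>) ` U"
  have Uc: "c \<in> carrier R" if "c \<in> U" for c using that B_carrier by (auto simp: U_def)
  have diff: "(X.const c \<ominus>\<^bsub>P\<^sub>1\<^esub> \<zeta>) \<ominus>\<^bsub>P\<^sub>1\<^esub> (X.const d \<ominus>\<^bsub>P\<^sub>1\<^esub> \<zeta>) = X.const (c \<ominus> d)" if "c \<in> U" "d \<in> U" for c d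
  proof -
    define p q where "p = X.const c" and "q = X.const d"
    have pq: "p \<in> carrier P\<^sub>1" "q \<in> carrier P\<^sub>1" using that Uc by (auto simp: p_def q_def)
    have "(p \<ominus>\<^bsub>P\<^sub>1\<^esub> \<zeta>) \<ominus>\<^bsub>P\<^sub>1\<^esub> (q \<ominus>\<^bsub>P\<^sub>1\<^esub> \<zeta>) = p \<ominus>\<^bsub>P\<^sub>1\<^esub> q"
      by (rule X.P.ring_identity, (rule X.P.ring_split | simp add: X.P.ring_norm pq \<zeta>(1))+)
    then show ?thesis using ring_hom_cring.hom_minus[OF X.ring_hom_const, of c d] that Uc by (simp add: p_def q_def)
  qed
  have B': "infinite B'"
  proof -
    have "inj_on (\<lambda>c. X.const c \<ominus>\<^bsub>P\<^sub>1\<^esub> \<zeta>) U"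
    proof (rule inj_onI, rule ccontr)
      fix c d assume cd: "c \<in> U" "d \<in> U" "X.const c \<ominus>\<^bsub>P\<^sub>1\<^esub> \<zeta> = X.const d \<ominus>\<^bsub>P\<^sub>1\<^esub> \<zeta>" "c \<noteq> d"
      have "X.const (c \<ominus> d) = \<zero>\<^bsub>P\<^sub>1\<^esub>" using diff[OF cd(1,2)] cd(3) \<zeta>(1) Uc[OF cd(2)] by (simp add: X.P.minus_eq X.P.r_neg)
      then have "coeff P\<^sub>1 (X.const (c \<ominus> d)) 0 = \<zero>" by simp
      then have "c \<ominus> d = \<zero>" using Uc cd(1,2) by simp
      then have "c = d" by (rule eq_diffI[OF _ Uc[OF cd(1)] Uc[OF cd(2)]])
      then show False using cd(4) by blast
    qed
    then show ?thesis using infinite_units_B finite_imageD unfolding B'_def U_def by blast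
  qed
  have B'c: "B' \<subseteq> carrier P\<^sub>1" using Uc \<zeta>(1) by (auto simp: B'_def)
  have B'd: "b \<ominus>\<^bsub>P\<^sub>1\<^esub> b' \<in> Units P\<^sub>1" if bb: "b \<in> B'" "b' \<in> B'" "b \<noteq> b'" for b b'
  proof -
    obtain c d where cd: "b = X.const c \<ominus>\<^bsub>P\<^sub>1\<^esub> \<zeta>" "b' = X.const d \<ominus>\<^bsub>P\<^sub>1\<^esub> \<zeta>" "c \<in> U" "d \<in> U"
      using bb by (auto simp: B'_def)
    then have "c \<ominus> d \<in> Units R" using bb(3) by (intro B_diff) (auto simp: U_def)
    then show ?thesis unfolding cd(1,2) diff[OF cd(3,4)]
      by (rule ring_hom_cring.hom_Units_mem[OF X.ring_hom_const])
  qed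
  interpret sp: specialization P\<^sub>2 S \<kappa> T "\<lambda>b f. \<iota> (eval P\<^sub>1 P\<^sub>1 id (coeff P\<^sub>2 b 0) f)" Y.var "Y.const ` B'"
    using B' B'c B'd by (rule Y.specialization_eval)
  \<comment> \<open>All generic conditions are collected so that one point satisfies them
    simultaneously; the last one identifies the specialization of \<open>E\<close> with
    \<open>K\<close> again.\<close>
  have "eventually (\<lambda>b. b \<in> Y.const ` B' \<and>
      (sp.spec b E = carrier T \<or> X.M.S.linked_by (map (\<lambda>f. \<iota> (eval P\<^sub>1 P\<^sub>1 id (coeff P\<^sub>2 b 0) f)) hs) (sp.spec b E) (sp.spec b K'')) \<and>
      X.M.S.linked_to_unit n (sp.spec b K'') \<and> sp.spec b E = sp.exte b (Y.const_ext F)) sp.generic"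
    unfolding E_def
    by (intro eventually_conj sp.eventually_in_B sp.eventually_linked_by[OF K''(1)[unfolded E_def] hc]
        sp.eventually_linked_to_unit[OF unit] sp.eventually_spec_ext Y.ideal_const_ext iF)
  from eventually_happens'[OF sp.generic_neq_bot this] obtain b where b: "b \<in> Y.const ` B'"
    "sp.spec b E = carrier T \<or> X.M.S.linked_by (map (\<lambda>f. \<iota> (eval P\<^sub>1 P\<^sub>1 id (coeff P\<^sub>2 b 0) f)) hs) (sp.spec b E) (sp.spec b K'')"
    "X.M.S.linked_to_unit n (sp.spec b K'')" "sp.spec b E = sp.exte b (Y.const_ext F)" by (elim exE conjE)
  obtain c where c: "c \<in> U" "b = Y.const (X.const c \<ominus>\<^bsub>P\<^sub>1\<^esub> \<zeta>)" using b(1) unfolding B'_def by blast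
  define \<beta> where "\<beta> = X.const c \<ominus>\<^bsub>P\<^sub>1\<^esub> \<zeta>"
  have \<beta>: "\<beta> \<in> carrier P\<^sub>1" "coeff P\<^sub>2 b 0 = \<beta>" using c Uc \<zeta>(1) by (auto simp: \<beta>_def)
  define K2 where "K2 = sp.spec b K''"
  have "sp.spec b E = K" using b(4) Y.ext_eval[OF \<beta>(1) iF] fib(3) by (simp add: \<beta>(2))
  then have link2: "X.M.S.linked_by (map (\<lambda>f. \<iota> (eval P\<^sub>1 P\<^sub>1 id \<beta> f)) hs) K K2"
    using b(2) Kproper by (simp add: \<beta>(2) K2_def)
  \<comment> \<open>The solution of c(X - \<rho>) + j = c(X - \<sigma>); it lies in \<open>m\<close>
    because \<open>j\<close> does.\<close>
  define \<sigma> where "\<sigma> = \<rho> \<ominus> inv c \<otimes> j"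
  have cu: "c \<in> Units R" "c \<in> carrier R" using c(1) Uc Units_if_notin_m by (auto simp: U_def)
  have \<sigma>: "\<sigma> \<in> m" unfolding \<sigma>_def using \<rho> j Jm cu by (intro ideal_minus[OF m_ideal] ideal_mult[OF m_ideal]) auto
  have sc: "\<sigma> \<in> carrier R" using \<sigma> by (rule m_carrier)
  have "c \<otimes> \<sigma> = c \<otimes> \<rho> \<ominus> j"
  proof -
    have "c \<otimes> (inv c \<otimes> j) = j" using cu j(2) by (simp flip: m_assoc)
    moreover have "c \<otimes> \<sigma> = c \<otimes> \<rho> \<ominus> c \<otimes> (inv c \<otimes> j)"
      unfolding \<sigma>_def using cu rc j(2) by (simp add: minus_eq r_distr r_minus)
    ultimately show ?thesis by simp
  qed
  then have cs: "X.const c \<otimes>\<^bsub>P\<^sub>1\<^esub> X.const \<sigma> = X.const c \<otimes>\<^bsub>P\<^sub>1\<^esub> X.const \<rho> \<ominus>\<^bsub>P\<^sub>1\<^esub> X.const j"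
  proof -
    interpret k: ring_hom_cring R P\<^sub>1 X.const by (rule X.ring_hom_const)
    have "X.const (c \<otimes> \<sigma>) = X.const (c \<otimes> \<rho> \<ominus> j)" by (rule arg_cong) fact
    then show ?thesis using cu(2) sc rc j(2) by simp
  qed
  have head: "g \<oplus>\<^bsub>P\<^sub>1\<^esub> \<beta> \<otimes>\<^bsub>P\<^sub>1\<^esub> line \<rho> = X.const c \<otimes>\<^bsub>P\<^sub>1\<^esub> line \<sigma>"
  proof -
    define v C D r j' where "v = X.var" and "C = X.const c" and "D = X.const \<sigma>" and "r = X.const \<rho>" and "j' = X.const j"
    have mem: "v \<in> carrier P\<^sub>1" "C \<in> carrier P\<^sub>1" "D \<in> carrier P\<^sub>1" "r \<in> carrier P\<^sub>1" "j' \<in> carrier P\<^sub>1"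
      using cu(2) sc rc j(2) by (simp_all add: v_def C_def D_def r_def j'_def)
    have e: "C \<otimes>\<^bsub>P\<^sub>1\<^esub> D = C \<otimes>\<^bsub>P\<^sub>1\<^esub> r \<ominus>\<^bsub>P\<^sub>1\<^esub> j'" using cs by (simp only: C_def D_def r_def j'_def)
    have "((v \<ominus>\<^bsub>P\<^sub>1\<^esub> r) \<otimes>\<^bsub>P\<^sub>1\<^esub> \<zeta> \<oplus>\<^bsub>P\<^sub>1\<^esub> j') \<oplus>\<^bsub>P\<^sub>1\<^esub> (C \<ominus>\<^bsub>P\<^sub>1\<^esub> \<zeta>) \<otimes>\<^bsub>P\<^sub>1\<^esub> (v \<ominus>\<^bsub>P\<^sub>1\<^esub> r)
        = C \<otimes>\<^bsub>P\<^sub>1\<^esub> v \<ominus>\<^bsub>P\<^sub>1\<^esub> (C \<otimes>\<^bsub>P\<^sub>1\<^esub> r \<ominus>\<^bsub>P\<^sub>1\<^esub> j')"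
      by (rule X.P.ring_identity, (rule X.P.ring_split | simp add: X.P.ring_norm mem \<zeta>(1))+)
    also have "\<dots> = C \<otimes>\<^bsub>P\<^sub>1\<^esub> (v \<ominus>\<^bsub>P\<^sub>1\<^esub> D)"
      unfolding e[symmetric] by (rule X.P.ring_identity, (rule X.P.ring_split | simp add: X.P.ring_norm mem)+)
    finally show ?thesis unfolding \<zeta>(2) \<beta>_def v_def C_def D_def r_def j'_def .
  qed
  define y where "y = \<iota> (line \<sigma>)"
  have yc: "y \<in> carrier T" unfolding y_def using sc by simp
  have lc: "\<iota> (X.const c) \<in> Units T" using X.Units_const[OF cu(2)] cu(1) by simp
  have hs_eq: "map (\<lambda>f. \<iota> (eval P\<^sub>1 P\<^sub>1 id \<beta> f)) hs = (\<iota> (X.const c) \<otimes>\<^bsub>T\<^esub> y) # map \<iota> gs"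
    unfolding hs_def y_def using eG[OF \<beta>(1)] head Y.eval_const_id[OF \<beta>(1)] gc(2) cu(2) sc by (auto simp del: X.M.hom_minus)
  note link3 = link2[unfolded hs_eq]
  note l3 = X.M.S.linked_byD[OF link3]
  have ker: "{s \<in> carrier T. X.eval_at \<sigma> s = \<zero>} = X.M.S.adj {\<zero>\<^bsub>T\<^esub>} (\<iota> (X.const c) \<otimes>\<^bsub>T\<^esub> y)"
    unfolding X.kernel_eval_at[OF \<sigma>] y_def[symmetric] X.M.S.adj_unit_mult[OF X.M.S.zeroideal lc yc] ..
  have d: "\<rho> \<ominus> \<sigma> \<in> J" "\<sigma> \<ominus> \<rho> \<in> J"
  proof -
    have "\<rho> \<ominus> \<sigma> = inv c \<otimes> j" "\<sigma> \<ominus> \<rho> = (\<ominus> (inv c)) \<otimes> j"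
      unfolding \<sigma>_def using rc cu j(2) by (simp_all add: minus_eq l_minus minus_add r_neg1 r_neg2 a_ac)
    then show "\<rho> \<ominus> \<sigma> \<in> J" "\<sigma> \<ominus> \<rho> \<in> J" using ideal_mult[OF J j(1)] cu by simp_all
  qed
  have K\<sigma>: "K = fiber \<sigma> J"
    unfolding K_def using fiber_subset[OF \<rho> \<sigma> J d(2)] fiber_subset[OF \<sigma> \<rho> J d(1)] by blast
  interpret v: surjective_hom T R "X.eval_at \<sigma>" using \<sigma> by (rule X.surjective_hom_eval_at)
  have vK: "X.eval_at \<sigma> ` K = J" unfolding K\<sigma> using \<sigma> J by (rule image_fiber)
  define J' where "J' = X.eval_at \<sigma> ` K2"
  have "linked_by (map (X.eval_at \<sigma>) (map \<iota> gs)) J J'"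
    using v.linked_by_image[OF link3 ker] proper unfolding vK J'_def by blast
  \<comment> \<open>The linked ideal contains the sequence and hence X - \<sigma>, so it is itself a
    fiber. This restores the shape needed for the next link.\<close>
  moreover have "y \<in> K2"
  proof -
    have "\<iota> (X.const c) \<otimes>\<^bsub>T\<^esub> y \<in> K2"
      using X.M.S.linked_by_adjl_subset[OF link3] X.M.S.adjl_set[OF X.M.S.zeroideal X.M.S.regm_closed[OF l3(1)]] by auto
    then show ?thesis using X.M.S.ideal_unit_mult_iff[OF l3(4) lc yc] by simp
  qed
  then have "K2 = fiber \<sigma> J'" unfolding J'_def y_def by (rule fiber_image[OF \<sigma> l3(4)])
  then have "X.M.S.linked_to_unit n (fiber \<sigma> J')" using b(3) by (simp flip: K2_def)
  ultimately show ?thesis using \<sigma> by blast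
qed

text \<open>\<rho> has to vary in the induction, since every application of
  \<open>deform_link\<close> replaces it.\<close>

lemma linked_to_unit_fiber:
  "\<lbrakk>\<rho> \<in> m; ideal J R; X.M.S.linked_to_unit n (fiber \<rho> J)\<rbrakk> \<Longrightarrow> linked_to_unit n J"
proof (induction n arbitrary: \<rho> J)
  case (0 \<rho> J)
  from 0(3) have "fiber \<rho> J = carrier T" by (rule X.M.S.linked_to_unit.cases) auto
  then have "J = carrier R"
    using image_fiber[OF 0(1,2)] surjective_hom.surj[OF X.surjective_hom_eval_at[OF 0(1)]] by simp
  then show ?case using linked_to_unit.unit[of 0] by simp
next
  case (Suc n \<rho> J)
  show ?case
  proof (cases "J = carrier R")
    case True then show ?thesis using linked_to_unit.unit[of "Suc n"] by simp
  next
    case False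
    from Suc.prems(3) obtain xs K' where "X.M.S.linked_by xs (fiber \<rho> J) K'" "X.M.S.linked_to_unit n K'"
    proof (rule X.M.S.linked_to_unit.cases)
      fix c assume "fiber \<rho> J = carrier T"
      then have "J = carrier R"
        using image_fiber[OF Suc.prems(1,2)] surjective_hom.surj[OF X.surjective_hom_eval_at[OF Suc.prems(1)]] by simp
      then show thesis using False by blast
    qed auto
    from deform_link[OF Suc.prems(1,2) False this] obtain \<sigma> J' ys
      where 1: "\<sigma> \<in> m" "linked_by ys J J'" "X.M.S.linked_to_unit n (fiber \<sigma> J')" by blast
    have "linked_to_unit n J'" using 1(1) linked_byD(4)[OF 1(2)] 1(3) by (rule Suc.IH)
    with 1(2) show ?thesis by (rule linked_to_unit.link)
  qed
qed


end

section \<open>The linkage relation in terms of explicit sequences\<close>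

context cring
begin

lemma genideal_ideal_eq: "ideal I R \<Longrightarrow> Idl I = I"
  using genideal_minimal[of I I] genideal_self[of I] ideal_subset_carrier by blast

lemma linked_by_sym: assumes "linked_by xs K K'" shows "linked_by xs K' K"
  using assms linked_by_adjl_subset[OF assms] adjl_set[OF zeroideal regm_closed[OF linked_byD(1)[OF assms]]]
  unfolding linked_by_def by blast

lemma directly_linked_iff:
  "directly_linked R I J \<longleftrightarrow> I \<noteq> carrier R \<and> J \<noteq> carrier R \<and> (\<exists>xs. linked_by xs I J)"
proof
  assume "directly_linked R I J"
  then obtain xs where 1: "ideal I R" "I \<noteq> carrier R" "ideal J R" "J \<noteq> carrier R" "regular_sequence R xs"
    "Idl (set xs) \<subseteq> I" "I = colon_ideal R (Idl (set xs)) J" "J = colon_ideal R (Idl (set xs)) I"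
    unfolding directly_linked_def complete_intersection_def by blast
  have xs: "regm {\<zero>} xs" "adjl {\<zero>} xs \<noteq> carrier R" using 1(5) by (simp_all add: regular_sequence_iff)
  have e: "adjl {\<zero>} xs = Idl (set xs)" using regm_closed[OF xs(1)] by (rule adjl_zero_eq_genideal)
  have "set xs \<subseteq> I" using genideal_self[OF regm_closed[OF xs(1)]] 1(6) by blast
  then have "linked_by xs I J" using xs 1 unfolding linked_by_def e by blast
  then show "I \<noteq> carrier R \<and> J \<noteq> carrier R \<and> (\<exists>xs. linked_by xs I J)" using 1 by blast
next
  assume "I \<noteq> carrier R \<and> J \<noteq> carrier R \<and> (\<exists>xs. linked_by xs I J)"
  then obtain xs where 1: "I \<noteq> carrier R" "J \<noteq> carrier R" "linked_by xs I J" by blast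
  note l = linked_byD[OF 1(3)]
  have "regular_sequence R xs" using l by (simp add: regular_sequence_iff)
  moreover have "adjl {\<zero>} xs = Idl (set xs)" using regm_closed[OF l(1)] by (rule adjl_zero_eq_genideal)
  ultimately have "complete_intersection R (adjl {\<zero>} xs)" unfolding complete_intersection_def by blast
  then show "directly_linked R I J"
    using 1(1,2) l linked_by_colon[OF 1(3)] linked_by_adjl_subset[OF 1(3)]
    unfolding directly_linked_def by blast
qed

lemma same_linkage_class_iff: "same_linkage_class R I J \<longleftrightarrow> (I, J) \<in> linkage R"
proof
  assume "same_linkage_class R I J"
  then show "(I, J) \<in> linkage R"
    unfolding same_linkage_class_def linkage_classes_def
    using in_quotient_imp_in_rel[OF equiv_linkage] by blast
next
  assume IJ: "(I, J) \<in> linkage R"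
  then have "I \<in> {I. unmixed_ideal R I}" by (simp add: linkage_def)
  moreover from this have "I \<in> linkage R `` {I}" using equiv_class_self[OF equiv_linkage] by blast
  ultimately show "same_linkage_class R I J"
    unfolding same_linkage_class_def linkage_classes_def
    by (intro bexI[of _ "linkage R `` {I}"] quotientI) (simp_all add: IJ)
qed

abbreviation link_rel :: "'a set \<Rightarrow> 'a set \<Rightarrow> bool" where
  "link_rel \<equiv> \<lambda>I J. unmixed_ideal R I \<and> unmixed_ideal R J \<and> directly_linked R I J"

end

context cohen_macaulay_infinite
begin

lemma link_rel_if_linked_by:
  assumes l: "linked_by xs K K'" and K: "K \<noteq> carrier R" "K' \<noteq> carrier R" shows "link_rel K K'"
  using unmixed_linked[OF l K(1)] unmixed_linked[OF linked_by_sym[OF l] K(2)] l K directly_linked_iff by blast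

text \<open>The last proper ideal of the chain is linked to the unit ideal and therefore equals the
  ideal of the sequence.\<close>

lemma linked_to_unit_complete_intersection:
  "\<lbrakk>linked_to_unit n K; K \<noteq> carrier R\<rbrakk> \<Longrightarrow> \<exists>A. complete_intersection R A \<and> (K, A) \<in> linkage R"
proof (induction rule: linked_to_unit.induct)
  case (link xs K K' n)
  note l = linked_byD[OF link.hyps(1)]
  have U: "unmixed_ideal R K" using link.hyps(1) link.prems by (rule unmixed_linked)
  show ?case
  proof (cases "K' = carrier R")
    case True
    have "K = adjl {\<zero>} xs"
      using linked_by_colon(1)[OF link.hyps(1)] colon_carrier[OF linked_by_ideal_adjl[OF link.hyps(1)]] True by metis
    moreover have "regular_sequence R xs" using l by (simp add: regular_sequence_iff)
    ultimately have "complete_intersection R K"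
      unfolding complete_intersection_def using adjl_zero_eq_genideal[OF regm_closed[OF l(1)]] by blast
    moreover have "(K, K) \<in> linkage R" using U by (simp add: linkage_def)
    ultimately show ?thesis by blast
  next
    case False
    then obtain A where A: "complete_intersection R A" "(K', A) \<in> linkage R" using link.IH by blast
    have "link_rel K K'" using link.hyps(1) link.prems False by (rule link_rel_if_linked_by)
    then have "(K, K') \<in> linkage R" unfolding linkage_def using r_into_equivclp[of link_rel K K'] by blast
    then show ?thesis using A equiv_linkage[of R] unfolding equiv_def by (meson transD)
  qed
qed simp

end

lemma (in localization_hom) ext_genideal:
  assumes G: "G \<subseteq> carrier P" shows "ext (Idl G) = Idl\<^bsub>Q\<^esub> (h ` G)"
proof
  have hG: "h ` G \<subseteq> carrier Q" using G by auto
  have I: "ideal (Idl\<^bsub>Q\<^esub> (h ` G)) Q" using hG by (rule S.genideal_ideal)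
  have "Idl G \<subseteq> contr (Idl\<^bsub>Q\<^esub> (h ` G))"
    using G S.genideal_self[OF hG] by (intro R.genideal_minimal ideal_contr I) (auto simp: contr_def)
  then show "ext (Idl G) \<subseteq> Idl\<^bsub>Q\<^esub> (h ` G)" using ext_mono ext_contr[OF I] by metis
  show "Idl\<^bsub>Q\<^esub> (h ` G) \<subseteq> ext (Idl G)"
    using R.genideal_self[OF G] G h_mem_ext by (intro S.genideal_minimal ideal_ext R.genideal_ideal G) auto
qed

section \<open>Generators of the extended ideals\<close>

context UP_cring
begin

lemma ideal_const_preimage: assumes I: "ideal I P" shows "ideal {c \<in> carrier R. const c \<in> I} R"
proof -
  interpret k: ring_hom_cring R P const by (rule ring_hom_const)
  show ?thesis
    by (rule R.ideal_closedI) (auto simp: P.ideal_zero[OF I] P.ideal_add[OF I] P.ideal_mult[OF I])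
qed

lemma const_image_genideal:
  assumes I: "ideal I P" and G: "G \<subseteq> carrier R" "const ` G \<subseteq> I" shows "const ` (Idl G) \<subseteq> I"
  using R.genideal_minimal[OF ideal_const_preimage[OF I], of G] G by blast

lemma const_ext_genideal:
  assumes G: "G \<subseteq> carrier R" shows "const_ext (Idl G) = Idl\<^bsub>P\<^esub> (const ` G)"
proof
  have c: "const ` G \<subseteq> carrier P" using G by auto
  note I = P.genideal_ideal[OF c] and J = R.genideal_ideal[OF G]
  show "const_ext (Idl G) \<subseteq> Idl\<^bsub>P\<^esub> (const ` G)"
    using const_image_genideal[OF I G P.genideal_self[OF c]] R.ideal_subset_carrier[OF J] by (intro const_ext_subset I)
  show "Idl\<^bsub>P\<^esub> (const ` G) \<subseteq> const_ext (Idl G)"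
    using R.genideal_self[OF G] const_mem_coeffs_in[of "\<lambda>_. Idl G"] J
    by (intro P.genideal_minimal ideal_const_ext J) auto
qed

lemma with_var_genideal:
  assumes G: "G \<subseteq> carrier R" shows "with_var (Idl G) = Idl\<^bsub>P\<^esub> (const ` G \<union> {var})"
proof
  have c: "const ` G \<union> {var} \<subseteq> carrier P" using G by auto
  note I = P.genideal_ideal[OF c] and J = R.genideal_ideal[OF G]
  have s: "const ` G \<subseteq> Idl\<^bsub>P\<^esub> (const ` G \<union> {var})" "var \<in> Idl\<^bsub>P\<^esub> (const ` G \<union> {var})"
    using P.genideal_self[OF c] by auto
  show "with_var (Idl G) \<subseteq> Idl\<^bsub>P\<^esub> (const ` G \<union> {var})"
    using const_image_genideal[OF I G s(1)] R.ideal_subset_carrier[OF J] s(2) by (intro with_var_subset I)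
  have "const ` G \<union> {var} \<subseteq> with_var (Idl G)"
    using R.genideal_self[OF G] var_mem_with_var[OF J] G by (auto simp: mem_with_var_iff subset_iff)
  then show "Idl\<^bsub>P\<^esub> (const ` G \<union> {var}) \<subseteq> with_var (Idl G)"
    by (rule P.genideal_minimal[OF ideal_with_var[OF J]])
qed

end

context two_local_variables
begin

abbreviation with_X where
  "with_X J \<equiv> Y.M.ext (Y.const_ext (X.with_var J))"

abbreviation with_Y where
  "with_Y J \<equiv> Y.M.ext (Y.with_var (X.const_ext J))"

lemma with_X_eq: "ideal J R \<Longrightarrow> with_X J = Idl\<^bsub>S\<^esub> (\<kappa> ` ((\<lambda>r. Y.const (X.const r)) ` J \<union> {Y.const X.var}))"
proof -
  assume J: "ideal J R"
  have c: "X.const ` J \<union> {X.var} \<subseteq> carrier P\<^sub>1" using ideal_carrier[OF J] by auto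
  have c': "Y.const ` (X.const ` J \<union> {X.var}) \<subseteq> carrier P\<^sub>2" using c by auto
  have "X.with_var J = Idl\<^bsub>P\<^sub>1\<^esub> (X.const ` J \<union> {X.var})"
    using X.with_var_genideal[OF ideal_subset_carrier[OF J]] unfolding genideal_ideal_eq[OF J] .
  then show ?thesis using Y.const_ext_genideal[OF c] Y.M.ext_genideal[OF c'] by (simp add: image_Un image_image)
qed

lemma with_Y_eq: "ideal J R \<Longrightarrow> with_Y J = Idl\<^bsub>S\<^esub> (\<kappa> ` ((\<lambda>r. Y.const (X.const r)) ` J \<union> {Y.var}))"
proof -
  assume J: "ideal J R"
  have c: "X.const ` J \<subseteq> carrier P\<^sub>1" using ideal_carrier[OF J] by auto
  have c': "Y.const ` X.const ` J \<union> {Y.var} \<subseteq> carrier P\<^sub>2" using c by auto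
  have "X.const_ext J = Idl\<^bsub>P\<^sub>1\<^esub> (X.const ` J)"
    using X.const_ext_genideal[OF ideal_subset_carrier[OF J]] unfolding genideal_ideal_eq[OF J] .
  note e = this
  show ?thesis unfolding e Y.with_var_genideal[OF c] Y.M.ext_genideal[OF c'] by (simp add: image_Un image_image)
qed

text \<open>If the extension were the unit ideal, \<open>A\<close> would contain an invertible
  denominator, whose constant term lies outside \<open>m\<close>.\<close>

lemma ext_proper:
  assumes A: "ideal A P\<^sub>2" and m: "\<And>f. f \<in> A \<Longrightarrow> coeff P\<^sub>1 (coeff P\<^sub>2 f 0) 0 \<in> m"
  shows "Y.M.ext A \<noteq> carrier S"
proof
  assume "Y.M.ext A = carrier S"
  then have "\<kappa> \<one>\<^bsub>P\<^sub>2\<^esub> \<in> Y.M.ext A" by simp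
  then obtain w where w: "w \<in> carrier P\<^sub>2" "\<kappa> w \<in> Units S" "w \<otimes>\<^bsub>P\<^sub>2\<^esub> \<one>\<^bsub>P\<^sub>2\<^esub> \<in> A"
    using Y.M.h_mem_ext_iff[OF A Y.P.one_closed] by blast
  then show False using m[of w] Y.Units_\<kappa>[of w] by simp
qed

lemma with_X_proper: "ideal J R \<Longrightarrow> J \<noteq> carrier R \<Longrightarrow> with_X J \<noteq> carrier S"
  using proper_ideal_subset_m[of J] Y.coeffs_inD[of _ "\<lambda>_. X.with_var J" 0]
  by (intro ext_proper Y.ideal_const_ext X.ideal_with_var) (auto simp: X.mem_with_var_iff)

lemma with_Y_proper: "ideal J R \<Longrightarrow> J \<noteq> carrier R \<Longrightarrow> with_Y J \<noteq> carrier S"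
  using proper_ideal_subset_m[of J] X.coeffs_inD[of _ "\<lambda>_. J" 0]
  by (intro ext_proper Y.ideal_with_var X.ideal_const_ext) (auto simp: Y.mem_with_var_iff)

lemma linked_by_with_X:
  assumes l: "linked_by xs K K'" shows "\<exists>ys. Y.M.S.linked_by ys (with_X K) (with_X K')"
proof -
  note A = linked_by_ideal_adjl[OF l] linked_byD(2)[OF l]
  note l1 = X.linked_by_with_var[OF l]
  note l2 = Y.linked_by_const_ext[OF l1]
  have "Y.M.ext (Y.P.adjl {\<zero>\<^bsub>P\<^sub>2\<^esub>} (map Y.const (X.var # map X.const xs))) \<noteq> carrier S"
    unfolding l2(2) X.regm_var_const(2)[OF linked_byD(1)[OF l]] using A by (rule with_X_proper)
  from Y.M.linked_by_ext[OF Y.M.noetherian_cring_axioms l2(1) this] show ?thesis by blast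
qed

lemma linked_by_with_Y:
  assumes l: "linked_by xs K K'" shows "\<exists>ys. Y.M.S.linked_by ys (with_Y K) (with_Y K')"
proof -
  note A = linked_by_ideal_adjl[OF l] linked_byD(2)[OF l]
  note l1 = X.linked_by_const_ext[OF l]
  note l2 = Y.linked_by_with_var[OF l1(1)]
  have "Y.M.ext (Y.P.adjl {\<zero>\<^bsub>P\<^sub>2\<^esub>} (Y.var # map Y.const (map X.const xs))) \<noteq> carrier S"
    unfolding Y.regm_var_const(2)[OF X.P.linked_byD(1)[OF l1(1)]] l1(2) using A by (rule with_Y_proper)
  from Y.M.linked_by_ext[OF Y.M.noetherian_cring_axioms l2 this] show ?thesis by blast
qed

text \<open>The link is given by the product of the two variables.\<close>

lemma linked_by_with_X_with_Y:
  assumes xs: "regm {\<zero>} xs" "adjl {\<zero>} xs \<noteq> carrier R"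
  shows "\<exists>ys. Y.M.S.linked_by ys (with_X (adjl {\<zero>} xs)) (with_Y (adjl {\<zero>} xs))"
proof -
  define A where "A = adjl {\<zero>} xs"
  have xsc: "set xs \<subseteq> carrier R" using xs(1) by (rule regm_closed)
  have A: "ideal A R" unfolding A_def using zeroideal xsc by (rule ideal_adjl)
  note A1 = X.ideal_const_ext[OF A]
  define as where "as = map Y.const (map X.const xs)"
  define N where "N = Y.const_ext (X.const_ext A)"
  have r1: "X.P.regm {\<zero>\<^bsub>P\<^sub>1\<^esub>} (map X.const xs)" "X.P.adjl {\<zero>\<^bsub>P\<^sub>1\<^esub>} (map X.const xs) = X.const_ext A"
    using X.regm_coeffs_in[of "\<lambda>_. {\<zero>}" xs] X.adjl_coeffs_in[of "\<lambda>_. {\<zero>}" xs] xs xsc zeroideal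
    by (simp_all add: X.const_ext_zero A_def)
  have r2: "Y.P.regm {\<zero>\<^bsub>P\<^sub>2\<^esub>} as" "Y.P.adjl {\<zero>\<^bsub>P\<^sub>2\<^esub>} as = N"
    using Y.regm_coeffs_in[of "\<lambda>_. {\<zero>\<^bsub>P\<^sub>1\<^esub>}" "map X.const xs"] Y.adjl_coeffs_in[of "\<lambda>_. {\<zero>\<^bsub>P\<^sub>1\<^esub>}" "map X.const xs"]
      r1 X.P.regm_closed[OF r1(1)] X.P.zeroideal
    by (simp_all only: Y.const_ext_zero as_def N_def)
  have N: "ideal N P\<^sub>2" unfolding N_def using A1 by (rule Y.ideal_const_ext)
  define x where "x = Y.const X.var"
  have x: "Y.P.adj N x = Y.const_ext (X.with_var A)"
    unfolding N_def x_def X.with_var_eq_adj[OF A] using Y.coeffs_in_adj[of "\<lambda>_. X.const_ext A" X.var] A1 by simp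
  have y: "Y.P.adj N Y.var = Y.with_var (X.const_ext A)"
    unfolding N_def using Y.with_var_eq_adj[OF A1] ..
  have regx: "Y.P.reg N x"
    unfolding N_def x_def using X.reg_var[OF A] A1 by (intro Y.reg_coeffs_in) simp_all
  have regy: "Y.P.reg N Y.var" unfolding N_def using A1 by (rule Y.reg_var)
  have xc: "x \<in> carrier P\<^sub>2" unfolding x_def by simp
  have "Y.P.adj N (x \<otimes>\<^bsub>P\<^sub>2\<^esub> Y.var) \<subseteq> Y.P.adj N x"
    using Y.P.adj_incl[OF N xc] Y.P.ideal_mult_right[OF Y.P.ideal_adj[OF N xc] Y.P.adj_self[OF N xc], of Y.var]
    by (intro Y.P.adj_subset Y.P.ideal_adj N xc) auto
  then have "Y.M.ext (Y.P.adj N (x \<otimes>\<^bsub>P\<^sub>2\<^esub> Y.var)) \<subseteq> with_X A" unfolding x by (rule Y.M.ext_mono)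
  moreover have "with_X A \<noteq> carrier S" using A xs(2) by (intro with_X_proper) (simp_all add: A_def)
  moreover have "with_X A \<subseteq> carrier S"
    using A by (intro Y.M.S.ideal_subset_carrier Y.M.ideal_ext Y.ideal_const_ext X.ideal_with_var)
  ultimately have pr: "Y.M.ext (Y.P.adj N (x \<otimes>\<^bsub>P\<^sub>2\<^esub> Y.var)) \<noteq> carrier S" by blast
  then have "Y.P.adj N (x \<otimes>\<^bsub>P\<^sub>2\<^esub> Y.var) \<noteq> carrier P\<^sub>2" using Y.M.ext_carrier by metis
  then have "Y.P.linked_by (as @ [x \<otimes>\<^bsub>P\<^sub>2\<^esub> Y.var]) (Y.P.adj N x) (Y.P.adj N Y.var)"
    using Y.P.linked_by_product[OF r2(1), of x Y.var] regx regy unfolding r2(2) by blast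
  from Y.M.linked_by_ext[OF Y.M.noetherian_cring_axioms this] pr show ?thesis
    unfolding x y A_def[symmetric] by (auto simp: r2(2))
qed

end

lemma (in cring) linked_by_if_link_rel:
  assumes "link_rel J K \<or> link_rel K J"
  shows "J \<noteq> carrier R \<and> K \<noteq> carrier R \<and> (\<exists>xs. linked_by xs J K)"
  using assms
proof
  assume "link_rel J K"
  then show ?thesis using directly_linked_iff[of J K] by simp
next
  assume "link_rel K J"
  then show ?thesis using directly_linked_iff[of K J] linked_by_sym[of _ K J] by auto
qed

section \<open>From the hypotheses of the theorem to the locales\<close>

lemma local_ring_local_noetherian:
  fixes R (structure) assumes l: "local_ring R m" shows "local_noetherian R m"
proof -
  interpret noetherian_cring R using l by (simp add: local_ring_def noetherian_cring_def)
  interpret m: maximalideal m R using l by (auto simp: local_ring_def)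
  show ?thesis
  proof (intro local_noetherian.intro local_noetherian_axioms.intro noetherian_cring_axioms)
    show m: "ideal m R" by (rule m.ideal_axioms)
    show "\<one> \<notin> m" using m.I_notcarr ideal_eq_carrier_iff[OF m] by auto
    fix x assume x: "x \<in> carrier R" "x \<notin> m"
    show "x \<in> Units R"
    proof (rule ccontr)
      assume nu: "x \<notin> Units R"
      \<comment> \<open>A nonunit lies in a maximal ideal, found by the maximal condition;
        uniqueness identifies it with \<open>m\<close>.\<close>
      define S where "S = {J. ideal J R \<and> \<one> \<notin> J}"
      have I: "ideal (Idl {x}) R" using x(1) by (intro genideal_ideal) simp
      have "\<one> \<notin> Idl {x}"
      proof
        assume "\<one> \<in> Idl {x}"
        then obtain r where "r \<in> carrier R" "\<one> = r \<otimes> x"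
          using cgenideal_eq_genideal[OF x(1)] by (auto simp: cgenideal_def)
        then show False using nu x(1) m_comm[of r x] by (auto simp: Units_def)
      qed
      then have "Idl {x} \<in> S" using I by (simp add: S_def)
      then have "\<exists>M\<in>S. Idl {x} \<subseteq> M \<and> (\<forall>J\<in>S. M \<subseteq> J \<longrightarrow> J = M)"
        by (rule maximal_ideal_in) (simp add: S_def)
      then obtain M where M: "M \<in> S" "Idl {x} \<subseteq> M" "\<forall>J\<in>S. M \<subseteq> J \<longrightarrow> J = M" by (elim bexE conjE)
      have iM: "ideal M R" "\<one> \<notin> M" using M(1) by (auto simp: S_def)
      have "maximalideal M R"
      proof (rule maximalidealI[OF iM(1)])
        show "carrier R \<noteq> M" using iM by auto
        show "J = M \<or> J = carrier R" if "ideal J R" "M \<subseteq> J" "J \<subseteq> carrier R" for J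
          using that M(3) ideal_eq_carrier_iff[OF that(1)] by (auto simp: S_def)
      qed
      then have "M = m" using l by (auto simp: local_ring_def)
      then show False using x M(2) genideal_self'[OF x(1)] by blast
    qed
  qed
qed

context local_noetherian
begin

lemma infinite_residue_field:
  assumes "infinite (carrier (R Quot m))" obtains B where "local_noetherian_infinite R m B"
proof -
  interpret m: ideal m R by (rule m_ideal)
  define rep where "rep c = (SOME x. x \<in> carrier R \<and> c = m +> x)" for c
  have rep: "rep c \<in> carrier R \<and> c = m +> rep c" if "c \<in> carrier (R Quot m)" for c
    unfolding rep_def by (rule someI_ex) (use that in \<open>auto simp: FactRing_def A_RCOSETS_def'\<close>)
  define B where "B = rep ` carrier (R Quot m)"
  have "inj_on rep (carrier (R Quot m))" using rep by (metis inj_onI)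
  then have "infinite B" unfolding B_def using assms finite_imageD by blast
  moreover have "B \<subseteq> carrier R" unfolding B_def using rep by blast
  moreover have "x \<ominus> y \<in> Units R" if "x \<in> B" "y \<in> B" "x \<noteq> y" for x y
  proof -
    obtain c d where cd: "c \<in> carrier (R Quot m)" "d \<in> carrier (R Quot m)" "x = rep c" "y = rep d"
      using \<open>x \<in> B\<close> \<open>y \<in> B\<close> by (auto simp: B_def)
    have xy: "x \<in> carrier R" "y \<in> carrier R" using rep cd by auto
    have "x \<ominus> y \<notin> m"
    proof
      assume "x \<ominus> y \<in> m"
      then have "m +> x = m +> y" using quotient_eq_iff_same_a_r_cos[OF m_ideal xy] by blast
      then show False using rep[OF cd(1)] rep[OF cd(2)] cd(3,4) \<open>x \<noteq> y\<close> by metis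
    qed
    then show ?thesis using Units_iff_notin_m[of "x \<ominus> y"] xy by simp
  qed
  ultimately have "local_noetherian_infinite R m B"
    unfolding local_noetherian_infinite_def local_noetherian_infinite_axioms_def
    using local_noetherian_axioms by blast
  then show ?thesis by (rule that)
qed

text \<open>Krull's height theorem bounds the length of regular sequences in \<open>m\<close> by the
  number of generators of \<open>m\<close>, so the supremum in \<open>depth\<close> is attained.
  Equality with the dimension then bounds the chains of primes below \<open>m\<close>.\<close>

lemma cohen_macaulay_regular_sequence:
  assumes "depth R m = krull_dim R"
  obtains ys where "set ys \<subseteq> m" "regm {\<zero>} ys" "\<not> prime_chain (Suc (length ys)) m"
proof -
  obtain gs where gs: "set gs \<subseteq> carrier R" "m = Idl (set gs)" using m_ideal by (rule ideal_list_generators)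
  have gm: "set gs \<subseteq> m" using gs genideal_self by blast
  have chain: "\<not> prime_chain (Suc (length gs)) m"
  proof (rule krull_height[OF gm m_prime])
    fix Q assume Q: "primeideal Q R" "set gs \<subseteq> Q" "Q \<subseteq> m"
    show "Q = m" using genideal_minimal[OF primeideal_ideal[OF Q(1)] Q(2)] Q(3) gs(2) by blast
  qed
  have le: "length xs \<le> length gs" if "regular_sequence R xs" "set xs \<subseteq> m" for xs
  proof (rule ccontr)
    assume "\<not> length xs \<le> length gs"
    moreover have "prime_chain (length xs) m"
      using that m_prime by (intro regular_prime_chain) (simp_all add: regular_sequence_iff)
    ultimately show False using chain prime_chain_antimono[of "length xs" m "Suc (length gs)"] by simp
  qed
  define L where "L = {length xs | xs. regular_sequence R xs \<and> set xs \<subseteq> m}"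
  have "L \<subseteq> {..length gs}" using le by (auto simp: L_def)
  then have fin: "finite L" using finite_subset by blast
  have "{\<zero>} \<noteq> carrier R" using one_notin_m ideal_zero[OF m_ideal] one_closed by (metis singletonD)
  then have "regular_sequence R []" by (simp add: regular_sequence_iff)
  then have "0 \<in> L" unfolding L_def by force
  then have "Max L \<in> L" using fin by (intro Max_in) auto
  then obtain ys where ys: "Max L = length ys" "regular_sequence R ys" "set ys \<subseteq> m" unfolding L_def by blast
  have "depth R m \<le> enat (length ys)"
    unfolding depth_def
  proof (rule Sup_least)
    fix k assume "k \<in> {enat (length xs) | xs. regular_sequence R xs \<and> set xs \<subseteq> m}"
    then obtain xs where xs: "k = enat (length xs)" "regular_sequence R xs" "set xs \<subseteq> m" by blast
    then have "length xs \<in> L" unfolding L_def by blast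
    then show "k \<le> enat (length ys)" using Max_ge[OF fin] ys(1) xs(1) by simp
  qed
  moreover have "prime_height R m \<le> krull_dim R"
    unfolding krull_dim_def using m_prime by (intro Sup_upper) blast
  ultimately have "\<not> prime_chain (Suc (length ys)) m"
    using prime_chain_le_height[of "Suc (length ys)" m] assms by (metis Suc_n_not_le_n enat_ord_simps(1) order_trans)
  then show ?thesis using that ys by (simp add: regular_sequence_iff)
qed

end

section \<open>The two directions of the equivalence\<close>

context two_local_variables
begin

text \<open>\<open>ys\<close> with both variables adjoined is a regular sequence in the maximal
  ideal \<open>n\<close> of \<open>S\<close>. By \<open>krull_height\<close> its length bounds
  chains below \<open>n\<close>, once \<open>n\<close> is minimal over it: a prime containing it
  contracts to a prime of \<open>R\<close> containing \<open>ys\<close>, whose height forces it to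
  be \<open>m\<close>.\<close>

lemma cohen_macaulay_infinite_S:
  assumes CM: "cohen_macaulay_infinite R m B ys"
  shows "\<exists>n B' zs. cohen_macaulay_infinite S n B' zs"
proof -
  interpret C: cohen_macaulay_infinite R m B ys by (rule CM)
  interpret k1: ring_hom_cring R P\<^sub>1 X.const by (rule X.ring_hom_const)
  interpret k2: ring_hom_cring P\<^sub>1 P\<^sub>2 Y.const by (rule Y.ring_hom_const)
  define h where "h = (\<lambda>r. \<kappa> (Y.const (X.const r)))"
  have "h \<in> ring_hom R S" unfolding h_def by (rule ring_hom_memI) simp_all
  then interpret h: ring_hom_cring R S h
    by (simp add: ring_hom_cring_def ring_hom_cring_axioms_def is_cring Y.M.S.is_cring)
  define p where "p = {f \<in> carrier P\<^sub>1. coeff P\<^sub>1 f 0 \<in> m}"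
  have p: "p = X.with_var m" by (auto simp: p_def X.mem_with_var_iff)
  have ip: "ideal p P\<^sub>1" unfolding p using m_ideal by (rule X.ideal_with_var)
  define n where "n = Y.M.ext (Y.with_var p)"
  note Qm = Y.Q.local_noetherian_axioms[folded p_def n_def]
  interpret S: local_noetherian_infinite S n "h ` B"
    by (rule local_noetherian.local_noetherian_infinite_image[OF Qm h.ring_hom_cring_axioms infinite_B B_carrier B_diff])
  define zs where "zs = Y.var # map Y.const (X.var # map X.const ys)"
  have r1: "X.P.regm {\<zero>\<^bsub>P\<^sub>1\<^esub>} (X.var # map X.const ys)" using C.ys(2) by (rule X.regm_var_const)
  have r2: "Y.P.regm {\<zero>\<^bsub>P\<^sub>2\<^esub>} zs" unfolding zs_def using r1 by (rule Y.regm_var_const)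
  have r3: "Y.M.S.regm {\<zero>\<^bsub>S\<^esub>} (map \<kappa> zs)" using Y.M.ext_regm[OF Y.P.zeroideal r2] unfolding Y.M.ext_zero .
  have yc: "set ys \<subseteq> carrier R" using C.ys(2) by (rule regm_closed)
  have zc: "set zs \<subseteq> carrier P\<^sub>2" using r2 by (rule Y.P.regm_closed)
  have "set zs \<subseteq> Y.with_var p"
    using yc C.ys(1) ideal_zero[OF m_ideal]
    by (auto simp: zs_def Y.mem_with_var_iff p_def subset_iff)
  then have zn: "set (map \<kappa> zs) \<subseteq> n" using zc Y.M.h_mem_ext unfolding n_def by (auto simp: subset_iff)
  have "\<not> Y.M.S.prime_chain (Suc (length (map \<kappa> zs))) n"
  proof (rule Y.Q.krull_height[OF zn S.m_prime])
    fix Q assume Q: "primeideal Q S" "set (map \<kappa> zs) \<subseteq> Q" "Q \<subseteq> n"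
    note iQ = Y.M.S.primeideal_ideal[OF Q(1)]
    have "primeideal {r \<in> carrier R. h r \<in> Q} R"
    proof (rule prime_idealI)
      show "ideal {r \<in> carrier R. h r \<in> Q} R"
        by (rule ideal_closedI) (auto simp: Y.M.S.ideal_zero[OF iQ] Y.M.S.ideal_add[OF iQ] Y.M.S.ideal_mult[OF iQ])
      show "\<one> \<notin> {r \<in> carrier R. h r \<in> Q}" using Y.M.S.prime_one_notin[OF Q(1)] by simp
      show "b \<in> {r \<in> carrier R. h r \<in> Q}"
        if "a \<in> carrier R" "b \<in> carrier R" "a \<otimes> b \<in> {r \<in> carrier R. h r \<in> Q}" "a \<notin> {r \<in> carrier R. h r \<in> Q}" for a b
        using that Y.M.S.prime_mult_iff[OF Q(1), of "h a" "h b"] by simp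
    qed
    note q = this
    have "set ys \<subseteq> {r \<in> carrier R. h r \<in> Q}" using yc Q(2) by (auto simp: zs_def h_def)
    then have "prime_chain (length ys) {r \<in> carrier R. h r \<in> Q}" by (rule regular_prime_chain[OF C.ys(2) q])
    then have qm: "{r \<in> carrier R. h r \<in> Q} = m"
      using prime_chain_Suc[OF _ m_prime] C.dim prime_subset_m[OF q] by blast
    have cQ: "ideal (Y.M.contr Q) P\<^sub>2" using iQ by (rule Y.M.ideal_contr)
    have "X.with_var m \<subseteq> {c \<in> carrier P\<^sub>1. Y.const c \<in> Y.M.contr Q}"
      using qm Q(2) m_carrier
      by (intro X.with_var_subset Y.ideal_const_preimage[OF cQ])
        (auto simp: Y.M.contr_def h_def zs_def)
    then have "Y.with_var p \<subseteq> Y.M.contr Q"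
      using X.P.ideal_subset_carrier[OF ip] Q(2) unfolding p
      by (intro Y.with_var_subset[OF cQ]) (auto simp: Y.M.contr_def zs_def)
    then have "n \<subseteq> Q" unfolding n_def using Y.M.ext_mono Y.M.ext_contr[OF iQ] by metis
    then show "Q = n" using Q(3) by blast
  qed
  then have "cohen_macaulay_infinite S n (h ` B) (map \<kappa> zs)"
    using zn r3 by (intro cohen_macaulay_infinite.intro cohen_macaulay_infinite_axioms.intro S.local_noetherian_infinite_axioms)
  then show ?thesis by blast
qed

text \<open>The chain is followed from its end (I, Y). At a unit value of Y this ideal becomes the
  unit ideal, so the specialized chain joins the image of (I, X) to the unit ideal of
  \<open>T\<close>, with one length valid for all but finitely many points.\<close>

lemma linked_to_unit_if_equivclp:
  assumes I: "ideal I R" and eq: "equivclp Y.M.S.link_rel (with_X I) (with_Y I)"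
  shows "\<exists>n. linked_to_unit n I"
proof -
  define U where "U = {c \<in> B. c \<notin> m}"
  have Uc: "U \<subseteq> carrier R" using B_carrier by (auto simp: U_def)
  have Uu: "c \<in> Units R" if "c \<in> U" for c using that Uc Units_if_notin_m by (auto simp: U_def)
  interpret k: ring_hom_cring R P\<^sub>1 X.const by (rule X.ring_hom_const)
  have B': "infinite (X.const ` U)" "X.const ` U \<subseteq> carrier P\<^sub>1"
  proof -
    have "inj_on X.const U" using X.monom_inj Uc by (rule inj_on_subset)
    then show "infinite (X.const ` U)" using infinite_units_B finite_imageD unfolding U_def by blast
  qed (use Uc in auto)
  have B'd: "b \<ominus>\<^bsub>P\<^sub>1\<^esub> b' \<in> Units P\<^sub>1" if bb: "b \<in> X.const ` U" "b' \<in> X.const ` U" "b \<noteq> b'" for b b'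
  proof -
    obtain c d where cd: "b = X.const c" "b' = X.const d" "c \<in> U" "d \<in> U" using bb by blast
    then have "c \<ominus> d \<in> Units R" using bb(3) by (intro B_diff) (auto simp: U_def)
    then have "X.const (c \<ominus> d) \<in> Units P\<^sub>1" by (rule k.hom_Units_mem)
    then show ?thesis using cd subsetD[OF Uc cd(3)] subsetD[OF Uc cd(4)] by simp
  qed
  interpret sp: specialization P\<^sub>2 S \<kappa> T "\<lambda>b f. \<iota> (eval P\<^sub>1 P\<^sub>1 id (coeff P\<^sub>2 b 0) f)" Y.var "Y.const ` X.const ` U"
    using B' B'd by (rule Y.specialization_eval)
  have "\<exists>n. eventually (\<lambda>b. X.M.S.linked_to_unit n (sp.spec b (with_X I))) sp.generic"
    using equivclp_sym[OF eq]
  proof (induction rule: equivclp_induct)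
    case base
    have iY: "ideal (with_Y I) S" using I by (intro Y.M.ideal_ext Y.ideal_with_var X.ideal_const_ext)
    have "\<kappa> Y.var \<in> with_Y I" using Y.var_mem_with_var[OF X.ideal_const_ext[OF I]] by (intro Y.M.h_mem_ext) auto
    then have v: "Y.var \<in> Y.M.contr (with_Y I)" by (simp add: Y.M.contr_def)
    have "X.M.S.linked_to_unit 0 (sp.spec b (with_Y I))" if b: "b \<in> Y.const ` X.const ` U" for b
    proof -
      obtain c where c: "c \<in> U" "b = Y.const (X.const c)" using b by blast
      have cc: "X.const c \<in> carrier P\<^sub>1" "c \<in> carrier R" using c(1) Uc by auto
      interpret e: fractional_hom P\<^sub>2 T "\<lambda>f. \<iota> (eval P\<^sub>1 P\<^sub>1 id (coeff P\<^sub>2 b 0) f)" "{r \<otimes>\<^bsub>P\<^sub>2\<^esub> (Y.var \<ominus>\<^bsub>P\<^sub>2\<^esub> b) | r. r \<in> carrier P\<^sub>2}"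
        using b by (rule sp.e)
      have "\<iota> (eval P\<^sub>1 P\<^sub>1 id (coeff P\<^sub>2 b 0) Y.var) \<in> sp.spec b (with_Y I)"
        unfolding sp.spec_def using v by (rule e.h_mem_ext) simp
      moreover have "\<iota> (eval P\<^sub>1 P\<^sub>1 id (coeff P\<^sub>2 b 0) Y.var) = \<iota> (X.const c)"
        using Y.eval_var[OF cc(1)] cc(1) by (simp add: c(2))
      moreover have "\<iota> (X.const c) \<in> Units T" using X.Units_const[OF cc(2)] Uu[OF c(1)] by simp
      ultimately have "sp.spec b (with_Y I) = carrier T"
        using X.M.S.ideal_unit[OF sp.ideal_spec[OF b iY]] by metis
      then show ?thesis by (simp add: X.M.S.linked_to_unit.unit)
    qed
    then have "eventually (\<lambda>b. X.M.S.linked_to_unit 0 (sp.spec b (with_Y I))) sp.generic"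
      using sp.eventually_in_B by (rule eventually_mono[rotated])
    then show ?case by blast
  next
    case (step K' K)
    obtain n where n: "eventually (\<lambda>b. X.M.S.linked_to_unit n (sp.spec b K')) sp.generic" using step.IH by blast
    obtain xs where l: "Y.M.S.linked_by xs K' K" using Y.M.S.linked_by_if_link_rel[OF step.hyps(2)] by blast
    show ?case using sp.eventually_linked_to_unit_link[OF Y.M.S.linked_by_sym[OF l] n] by blast
  qed
  then obtain n where n: "eventually (\<lambda>b. X.M.S.linked_to_unit n (sp.spec b (with_X I))) sp.generic" by blast
  note iX = X.ideal_with_var[OF I]
  have "eventually (\<lambda>b. b \<in> Y.const ` X.const ` U \<and> X.M.S.linked_to_unit n (sp.spec b (with_X I)) \<and>
      sp.spec b (with_X I) = sp.exte b (Y.const_ext (X.with_var I))) sp.generic"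
    by (intro eventually_conj sp.eventually_in_B n sp.eventually_spec_ext Y.ideal_const_ext iX)
  from eventually_happens'[OF sp.generic_neq_bot this] obtain b where b: "b \<in> Y.const ` X.const ` U"
    "X.M.S.linked_to_unit n (sp.spec b (with_X I))" "sp.spec b (with_X I) = sp.exte b (Y.const_ext (X.with_var I))"
    by (elim exE conjE)
  obtain c where c: "c \<in> U" "b = Y.const (X.const c)" using b(1) by blast
  have cc: "X.const c \<in> carrier P\<^sub>1" using c(1) Uc by auto
  have z: "\<zero> \<in> m" using m_ideal by (rule ideal_zero)
  \<comment> \<open>(I, X) is the fiber of \<open>I\<close> over \<rho> = 0, where the descent to
    \<open>R\<close> starts.\<close>
  have w: "X.with_var I = {f \<in> carrier P\<^sub>1. eval R R id \<zero> f \<in> I}"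
    using X.eval_0[OF _ X.nontrivial] by (auto simp: X.mem_with_var_iff)
  have "sp.spec b (with_X I) = X.M.ext (X.with_var I)"
    using b(3) Y.ext_eval[OF cc iX] cc by (simp add: c(2))
  also have "\<dots> = fiber \<zero> I" unfolding w using z I by (rule fiber_eq_ext)
  finally have e: "sp.spec b (with_X I) = fiber \<zero> I" .
  have "linked_to_unit n I" using b(2) unfolding e by (rule linked_to_unit_fiber[OF z I])
  then show ?thesis ..
qed

text \<open>The chain from \<open>A\<close> to \<open>I\<close> is extended by either variable, and
  the two extended chains are joined at (A, X) and (A, Y). The invariant also carries the
  unmixedness that \<open>linkage\<close> demands of its members; at the start it comes from that
  joining link.\<close>

lemma equivclp_if_licci:
  assumes CM: "cohen_macaulay_infinite S n B' zs" and eq: "equivclp link_rel I A" and A: "complete_intersection R A"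
  shows "(with_X I, with_Y I) \<in> linkage S"
proof -
  interpret S: cohen_macaulay_infinite S n B' zs by (rule CM)
  obtain xs where xs: "regm {\<zero>} xs" "adjl {\<zero>} xs \<noteq> carrier R" "A = Idl (set xs)"
    using A by (auto simp: complete_intersection_def regular_sequence_iff)
  have e: "A = adjl {\<zero>} xs" using adjl_zero_eq_genideal[OF regm_closed[OF xs(1)]] xs(3) by simp
  have iA: "ideal A R" unfolding e using zeroideal regm_closed[OF xs(1)] by (rule ideal_adjl)
  have rel: "Y.M.S.link_rel (with_X A) (with_Y A)"
    using linked_by_with_X_with_Y[OF xs(1,2)] with_X_proper[OF iA] with_Y_proper[OF iA] S.link_rel_if_linked_by xs(2)
    unfolding e by blast
  have "Y.M.S.link_rel (with_X A) (with_Y A) \<and> equivclp Y.M.S.link_rel (with_X A) (with_X I) \<and>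
    equivclp Y.M.S.link_rel (with_Y A) (with_Y I) \<and> unmixed_ideal S (with_X I) \<and> unmixed_ideal S (with_Y I)"
    using equivclp_sym[OF eq]
  proof (induction rule: equivclp_induct)
    case base
    show ?case using rel by simp
  next
    case (step J K)
    obtain xs where l: "linked_by xs J K" "J \<noteq> carrier R" "K \<noteq> carrier R"
      using linked_by_if_link_rel[OF step.hyps(2)] by blast
    have X: "Y.M.S.link_rel (with_X J) (with_X K)"
    proof -
      obtain ys where ys: "Y.M.S.linked_by ys (with_X J) (with_X K)" using linked_by_with_X[OF l(1)] by (elim exE)
      show ?thesis
        by (rule S.link_rel_if_linked_by[OF ys with_X_proper[OF linked_byD(3)[OF l(1)] l(2)]
          with_X_proper[OF linked_byD(4)[OF l(1)] l(3)]])
    qed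
    have Y: "Y.M.S.link_rel (with_Y J) (with_Y K)"
    proof -
      obtain ys where ys: "Y.M.S.linked_by ys (with_Y J) (with_Y K)" using linked_by_with_Y[OF l(1)] by (elim exE)
      show ?thesis
        by (rule S.link_rel_if_linked_by[OF ys with_Y_proper[OF linked_byD(3)[OF l(1)] l(2)]
          with_Y_proper[OF linked_byD(4)[OF l(1)] l(3)]])
    qed
    note IH = step.IH[THEN conjunct2, THEN conjunct1] step.IH[THEN conjunct2, THEN conjunct2, THEN conjunct1]
    show ?case
      using rel X Y equivclp_trans[OF IH(1) r_into_equivclp[of Y.M.S.link_rel, OF X]]
        equivclp_trans[OF IH(2) r_into_equivclp[of Y.M.S.link_rel, OF Y]] by simp
  qed
  then have 1: "equivclp Y.M.S.link_rel (with_X A) (with_X I)" "equivclp Y.M.S.link_rel (with_Y A) (with_Y I)"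
    "unmixed_ideal S (with_X I)" "unmixed_ideal S (with_Y I)" by blast+
  have "equivclp Y.M.S.link_rel (with_X I) (with_Y I)"
    using equivclp_trans[OF equivclp_trans[OF equivclp_sym[OF 1(1)] r_into_equivclp[of Y.M.S.link_rel, OF rel]] 1(2)] .
  then show ?thesis using 1(3,4) unfolding linkage_def by blast
qed

theorem licci_iff_same_linkage_class:
  assumes CM: "cohen_macaulay_infinite R m B ys" and I: "unmixed_ideal R I"
  shows "licci R I \<longleftrightarrow> same_linkage_class S (with_X I) (with_Y I)"
proof
  obtain n B' zs where S: "cohen_macaulay_infinite S n B' zs" using cohen_macaulay_infinite_S[OF CM] by blast
  assume "licci R I"
  then obtain A where "complete_intersection R A" "(I, A) \<in> linkage R" unfolding licci_def same_linkage_class_iff by blast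
  then show "same_linkage_class S (with_X I) (with_Y I)"
    using equivclp_if_licci[OF S, of I A] unfolding Y.M.S.same_linkage_class_iff by (simp add: linkage_def)
next
  interpret C: cohen_macaulay_infinite R m B ys by (rule CM)
  assume "same_linkage_class S (with_X I) (with_Y I)"
  then have "equivclp Y.M.S.link_rel (with_X I) (with_Y I)"
    unfolding Y.M.S.same_linkage_class_iff by (simp add: linkage_def)
  moreover have "ideal I R" "I \<noteq> carrier R" using I by (simp_all add: unmixed_ideal_def)
  ultimately show "licci R I"
    using linked_to_unit_if_equivclp C.linked_to_unit_complete_intersection
    unfolding licci_def same_linkage_class_iff by blast
qed

end

section \<open>Instantiation with the concrete rings\<close>

lemma (in cring) localization_hom_id: "localization_hom R R id"
proof -
  interpret h: ring_hom_cring R R id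
    by (simp add: ring_hom_cring_def ring_hom_cring_axioms_def is_cring)
  show ?thesis
  proof (intro localization_hom.intro fractional_hom.intro fractional_hom_axioms.intro h.ring_hom_cring_axioms zeroideal)
    show "\<exists>f\<in>carrier R. \<exists>w\<in>carrier R. id w \<in> Units R \<and> s \<otimes> id w = id f" if "s \<in> carrier R" for s
      using that by (intro bexI[of _ s] bexI[of _ \<one>]) auto
    show "\<exists>w\<in>carrier R. id w \<in> Units R \<and> w \<otimes> f \<in> {\<zero>}" if "f \<in> carrier R" "id f = \<zero>" for f
      using that by (intro bexI[of _ \<one>]) auto
  qed auto
qed

theorem theorem3p4:
  fixes R :: "('a, 'b) ring_scheme" and m I :: "'a set"
  assumes "gorenstein_local R m"
    and "infinite (carrier (R Quot m))"
    and "unmixed_ideal R I"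
    and "ideal_height R I > 0"
  shows "licci R I \<longleftrightarrow>
    same_linkage_class (local_poly2 R m)
      (extend_by R m I (poly2_X R)) (extend_by R m I (poly2_Y R))"
proof -
  have R: "local_ring R m" "depth R m = krull_dim R"
    using assms(1) by (simp_all add: gorenstein_local_def cohen_macaulay_local_def)
  interpret local_noetherian R m using R(1) by (rule local_ring_local_noetherian)
  obtain B where B: "local_noetherian_infinite R m B" using assms(2) by (rule infinite_residue_field)
  interpret local_noetherian_infinite R m B by (rule B)
  obtain ys where ys: "set ys \<subseteq> m" "regm {\<zero>\<^bsub>R\<^esub>} ys" "\<not> prime_chain (Suc (length ys)) m"
    using R(2) by (rule cohen_macaulay_regular_sequence)
  have CM: "cohen_macaulay_infinite R m B ys"
    by (intro cohen_macaulay_infinite.intro cohen_macaulay_infinite_axioms.intro B ys)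
  interpret X: UP_cring R "UP R" by (rule UP_cring.intro) (rule is_cring)
  interpret Y: UP_cring "UP R" "UP (UP R)" by (rule UP_cring.intro) (rule X.P.is_cring)
  \<comment> \<open>The intermediate ring is the localization of R[X] at (m, X), which the statement
    does not mention; its prime is described by constant terms, as the locale expects.\<close>
  define p where "p = {f \<in> carrier (UP R). coeff (UP R) f 0 \<in> m}"
  have p_eq: "p = X.with_var m" by (auto simp: p_def X.mem_with_var_iff)
  have p: "primeideal p (UP R)" unfolding p_eq using m_prime by (rule X.primeideal_with_var)
  define W where "W = carrier (UP R) - p"
  interpret W: mult_subset "UP R" W
    using X.P.prime_compl_mult[OF p] X.P.prime_compl_one[OF p]
    by (intro mult_subset.intro mult_subset_axioms.intro X.P.is_cring) (auto simp: W_def)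
  \<comment> \<open>Matches the prime of the statement, given by generators, with its description by
    constant terms.\<close>
  have p2: "poly2_ideal R m = Y.with_var p"
  proof -
    have c: "m \<subseteq> carrier R" "X.const ` m \<union> {X.var} \<subseteq> carrier (UP R)" using m_carrier by auto
    have "p = Idl\<^bsub>UP R\<^esub> (X.const ` m \<union> {X.var})"
      unfolding p_eq using X.with_var_genideal[OF c(1)] unfolding genideal_ideal_eq[OF m_ideal] .
    note e = this
    show ?thesis
      unfolding e Y.with_var_genideal[OF c(2)]
      by (simp add: poly2_ideal_def poly2_def poly2_const_def[abs_def] poly2_X_def poly2_Y_def
          image_Un image_image insert_commute)
  qed
  have q: "primeideal (poly2_ideal R m) (UP (UP R))" unfolding p2 using p by (rule Y.primeideal_with_var)
  define V where "V = poly2_denoms R m"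
  have V: "V = carrier (UP (UP R)) - poly2_ideal R m" by (simp add: V_def poly2_denoms_def poly2_def)
  interpret V: mult_subset "UP (UP R)" V
    using Y.P.prime_compl_mult[OF q] Y.P.prime_compl_one[OF q]
    by (intro mult_subset.intro mult_subset_axioms.intro Y.P.is_cring) (auto simp: V)
  define T \<iota> where "T = localization (UP R) W" and "\<iota> = (\<lambda>a. fraction (UP R) W a \<one>\<^bsub>UP R\<^esub>)"
  define S \<kappa> where "S = localization (UP (UP R)) V" and "\<kappa> = (\<lambda>a. fraction (UP (UP R)) V a \<one>\<^bsub>UP (UP R)\<^esub>)"
  have \<iota>: "localization_hom (UP R) T \<iota>" unfolding T_def \<iota>_def by (rule W.localization_hom_fraction)
  have \<kappa>: "localization_hom (UP (UP R)) S \<kappa>" unfolding S_def \<kappa>_def by (rule V.localization_hom_fraction)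
  have U1: "\<iota> f \<in> Units T \<longleftrightarrow> f \<notin> p" if "f \<in> carrier (UP R)" for f
    unfolding T_def \<iota>_def using W_def p that by (rule W.Units_fraction_iff)
  have U2: "\<kappa> f \<in> Units S \<longleftrightarrow> coeff (UP (UP R)) f 0 \<notin> p" if "f \<in> carrier (UP (UP R))" for f
    using V.Units_fraction_iff[OF V q that] that unfolding p2 Y.mem_with_var_iff S_def \<kappa>_def by simp
  \<comment> \<open>\<open>R\<close> is already local, so the identity serves as its localization at
    \<open>m\<close> in the inner instance.\<close>
  have "two_local_variables R m B T \<iota> S \<kappa>"
  proof (intro two_local_variables.intro B local_variable.intro local_variable_axioms.intro
      X.UP_cring_axioms Y.UP_cring_axioms localization_hom_id \<iota> \<kappa> m_prime noetherian_cring_axioms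
      X.noetherian_UP p[unfolded p_def])
    show "id a \<in> Units R \<longleftrightarrow> a \<notin> m" if "a \<in> carrier R" for a
      using Units_iff_notin_m[OF that] by simp
  qed (use U1 U2 in \<open>auto simp: p_def\<close>)
  then interpret two_local_variables R m B "UP R" "UP (UP R)" T \<iota> S \<kappa> .
  have I: "ideal I R" using assms(3) by (simp add: unmixed_ideal_def)
  have "local_poly2 R m = S" by (simp add: local_poly2_def S_def V_def poly2_def)
  moreover have "to_local_poly2 R m = \<kappa>" by (auto simp: to_local_poly2_def \<kappa>_def V_def poly2_def)
  moreover have "poly2_const R = (\<lambda>r. Y.const (X.const r))" "poly2_X R = Y.const X.var" "poly2_Y R = Y.var"
    by (auto simp: poly2_const_def poly2_X_def poly2_Y_def)
  ultimately show ?thesis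
    using licci_iff_same_linkage_class[OF CM assms(3)] unfolding with_X_eq[OF I] with_Y_eq[OF I]
    by (simp add: extend_by_def)
qed

end
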